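(* Let $d \geq 2$, let $0 < r_1 < r_2$, let $A_{r_1,r_2} := \{x \in \mathbb{R}^d : r_1 < |x| < r_2\}$ be the corresponding spherical shell, and let $B \subset \mathbb{R}^d$ be an open ball with the same volume, $|B| = |A_{r_1,r_2}|$. Then the inequality $\lambda_1^\alpha(A_{r_1,r_2}) \leq \lambda_1^\alpha(B)$ is violated for all sufficiently large negative $\alpha$; that is, there exists a number $\alpha_0 < 0$ such that $$\lambda_1^\alpha(A_{r_1,r_2}) > \lambda_1^\alpha(B) \qquad \text{for all } \alpha < \alpha_0 .$$ In particular, for every $d\ge 2$ it is not true that $\lambda_1^\alpha(\Omega) \leq \lambda_1^\alpha(B)$ holds for every $\alpha \leq 0$ and every bounded smooth domain $\Omega \subset \mathbb{R}^d$, where $B$ denotes a ball of the same volume as $\Omega$.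
   Context: A domain is an open connected set. For a bounded Lipschitz domain $\Omega \subset \mathbb{R}^d$ and $\alpha \in \mathbb{R}$, the first Robin eigenvalue of the Laplacian is $$\lambda_1^\alpha(\Omega) := \inf_{u \in W^{1,2}(\Omega),\ u \neq 0} \frac{\|\nabla u\|_{L^2(\Omega)}^2 + \alpha \|u\|_{L^2(\partial\Omega)}^2}{\|u\|_{L^2(\Omega)}^2},$$ where boundary values of $u$ are understood in the sense of traces. It is the lowest eigenvalue of the problem $-\Delta u = \lambda u$ in $\Omega$, $\frac{\partial u}{\partial n} + \alpha u = 0$ on $\partial\Omega$, with $n$ the outer unit normal. $|\cdot|$ applied to a set denotes the $d$-dimensional Lebesgue measure. *)

theory Defs
  imports "HOL-Analysis.Analysis"
begin

subsection \<open>Smooth functions and domains with smooth boundary\<close>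

text \<open>For open \<open>S\<close>, \<open>Ck_on k S f\<close> says that \<open>f\<close> is \<open>k\<close> times continuously differentiable on \<open>S\<close>.\<close>

primrec Ck_on :: "nat \<Rightarrow> 'a::euclidean_space set \<Rightarrow> ('a \<Rightarrow> real) \<Rightarrow> bool" where
  "Ck_on 0 S f \<longleftrightarrow> continuous_on S f"
| "Ck_on (Suc k) S f \<longleftrightarrow>
     (\<forall>x\<in>S. f differentiable (at x)) \<and>
     (\<forall>v. Ck_on k S (\<lambda>x. frechet_derivative f (at x) v))"

definition smooth_on :: "'a::euclidean_space set \<Rightarrow> ('a \<Rightarrow> real) \<Rightarrow> bool" where
  "smooth_on S f \<longleftrightarrow> (\<forall>k. Ck_on k S f)"

text \<open>Near every boundary point, \<open>\<Omega>\<close> is the set above the graph of a smooth function, in the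
  orthogonal coordinates \<open>y = (y - (y \<bullet> e) e) + (y \<bullet> e) e\<close> determined by a unit vector \<open>e\<close>.
  The graph function \<open>\<gamma>\<close> is evaluated only on the hyperplane orthogonal to \<open>e\<close>.\<close>

definition bounded_smooth_domain :: "'a::euclidean_space set \<Rightarrow> bool" where
  "bounded_smooth_domain \<Omega> \<longleftrightarrow>
     open \<Omega> \<and> connected \<Omega> \<and> \<Omega> \<noteq> {} \<and> bounded \<Omega> \<and>
     (\<forall>x\<in>frontier \<Omega>. \<exists>r>0. \<exists>e \<gamma>. norm e = 1 \<and>
        smooth_on (ball (x - (x \<bullet> e) *\<^sub>R e) r) \<gamma> \<and>
        \<Omega> \<inter> ball x r = {y \<in> ball x r. \<gamma> (y - (y \<bullet> e) *\<^sub>R e) < y \<bullet> e})"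

definition spherical_shell :: "real \<Rightarrow> real \<Rightarrow> 'a::euclidean_space set" where
  "spherical_shell r1 r2 = {x. r1 < norm x \<and> norm x < r2}"

subsection \<open>Hausdorff measure and boundary measure\<close>

text \<open>The normalisation makes the \<open>k\<close>-dimensional Hausdorff measure agree with the
  \<open>k\<close>-dimensional area of smooth (or Lipschitz) surfaces. Boundedness is required because
  \<^const>\<open>diameter\<close> is meaningless on unbounded sets. The definition is intended for \<open>k \<ge> 1\<close>; for
  \<open>k = 0\<close> the convention \<open>0 ^ 0 = 1\<close> would also charge empty sets of a cover.\<close>

definition hausdorff_premeasure :: "nat \<Rightarrow> real \<Rightarrow> 'a::euclidean_space set \<Rightarrow> ennreal" where
  "hausdorff_premeasure k \<delta> E =
     (INF C\<in>{C :: nat \<Rightarrow> 'a set. E \<subseteq> (\<Union>n. C n) \<and> (\<forall>n. bounded (C n) \<and> diameter (C n) \<le> \<delta>)}.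
        (\<Sum>n. ennreal (unit_ball_vol (real k) * (diameter (C n) / 2) ^ k)))"

definition hausdorff_outer_measure :: "nat \<Rightarrow> 'a::euclidean_space set \<Rightarrow> ennreal" where
  "hausdorff_outer_measure k E = (SUP \<delta>\<in>{0<..}. hausdorff_premeasure k \<delta> E)"

definition hausdorff_measure :: "nat \<Rightarrow> 'a::euclidean_space measure" where
  "hausdorff_measure k = measure_of UNIV (sets borel) (hausdorff_outer_measure k)"

definition boundary_measure :: "'a::euclidean_space set \<Rightarrow> 'a measure" where
  "boundary_measure \<Omega> = restrict_space (hausdorff_measure (DIM('a) - 1)) (frontier \<Omega>)"

subsection \<open>The Sobolev space of order one\<close>

definition square_integrable :: "'a measure \<Rightarrow> ('a \<Rightarrow> 'b::euclidean_space) \<Rightarrow> bool" where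
  "square_integrable M f \<longleftrightarrow> f \<in> borel_measurable M \<and> integrable M (\<lambda>x. (norm (f x))\<^sup>2)"

definition L2_norm_sq :: "'a measure \<Rightarrow> ('a \<Rightarrow> 'b::euclidean_space) \<Rightarrow> real" where
  "L2_norm_sq M f = (\<integral>x. (norm (f x))\<^sup>2 \<partial>M)"

definition test_function :: "'a::euclidean_space set \<Rightarrow> ('a \<Rightarrow> real) \<Rightarrow> bool" where
  "test_function \<Omega> \<phi> \<longleftrightarrow>
     smooth_on UNIV \<phi> \<and> compact (closure {x. \<phi> x \<noteq> 0}) \<and> closure {x. \<phi> x \<noteq> 0} \<subseteq> \<Omega>"

definition has_weak_gradient ::
  "'a::euclidean_space set \<Rightarrow> ('a \<Rightarrow> real) \<Rightarrow> ('a \<Rightarrow> 'a) \<Rightarrow> bool" where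
  "has_weak_gradient \<Omega> u G \<longleftrightarrow>
     (\<forall>\<phi>. test_function \<Omega> \<phi> \<longrightarrow> (\<forall>b\<in>Basis.
        (\<integral>x. u x * frechet_derivative \<phi> (at x) b \<partial>lebesgue_on \<Omega>) =
        - (\<integral>x. (G x \<bullet> b) * \<phi> x \<partial>lebesgue_on \<Omega>)))"

text \<open>Elements of \<open>W\<^sup>1\<^sup>,\<^sup>2(\<Omega>)\<close> are represented by functions on the whole space, of which only the
  values on \<open>\<Omega>\<close> matter. Weak gradients and traces are unique up to null sets, and only their
  \<open>L\<^sup>2\<close> norms are used below.\<close>

definition W12 :: "'a::euclidean_space set \<Rightarrow> ('a \<Rightarrow> real) set" where
  "W12 \<Omega> = {u. square_integrable (lebesgue_on \<Omega>) u \<and>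
     (\<exists>G. square_integrable (lebesgue_on \<Omega>) G \<and> has_weak_gradient \<Omega> u G)}"

definition weak_gradient :: "'a::euclidean_space set \<Rightarrow> ('a \<Rightarrow> real) \<Rightarrow> 'a \<Rightarrow> 'a" where
  "weak_gradient \<Omega> u =
     (SOME G. square_integrable (lebesgue_on \<Omega>) G \<and> has_weak_gradient \<Omega> u G)"

definition W12_norm_sq :: "'a::euclidean_space set \<Rightarrow> ('a \<Rightarrow> real) \<Rightarrow> real" where
  "W12_norm_sq \<Omega> u =
     L2_norm_sq (lebesgue_on \<Omega>) u + L2_norm_sq (lebesgue_on \<Omega>) (weak_gradient \<Omega> u)"

text \<open>The trace operator is the continuous extension to \<open>W\<^sup>1\<^sup>,\<^sup>2(\<Omega>)\<close> of the restriction map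
  \<open>v \<mapsto> v|\<partial>\<Omega>\<close> from functions smooth up to the boundary to \<open>L\<^sup>2(\<partial>\<Omega>)\<close>; for a bounded Lipschitz
  domain it is defined on all of \<open>W\<^sup>1\<^sup>,\<^sup>2(\<Omega>)\<close>.\<close>

definition has_trace :: "'a::euclidean_space set \<Rightarrow> ('a \<Rightarrow> real) \<Rightarrow> ('a \<Rightarrow> real) \<Rightarrow> bool" where
  "has_trace \<Omega> u g \<longleftrightarrow>
     square_integrable (boundary_measure \<Omega>) g \<and>
     (\<exists>v :: nat \<Rightarrow> 'a \<Rightarrow> real.
        (\<forall>n. smooth_on UNIV (v n) \<and> v n \<in> W12 \<Omega>) \<and>
        (\<lambda>n. W12_norm_sq \<Omega> (\<lambda>x. v n x - u x)) \<longlonglongrightarrow> 0 \<and>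
        (\<lambda>n. L2_norm_sq (boundary_measure \<Omega>) (\<lambda>x. v n x - g x)) \<longlonglongrightarrow> 0)"

definition sobolev_trace :: "'a::euclidean_space set \<Rightarrow> ('a \<Rightarrow> real) \<Rightarrow> 'a \<Rightarrow> real" where
  "sobolev_trace \<Omega> u = (SOME g. has_trace \<Omega> u g)"

subsection \<open>The first Robin eigenvalue\<close>

text \<open>Intended for bounded Lipschitz domains \<open>\<Omega>\<close>. The infimum is taken in the extended reals so that
  no a priori lower bound is presupposed.\<close>

definition robin_eigenvalue :: "real \<Rightarrow> 'a::euclidean_space set \<Rightarrow> ereal" where
  "robin_eigenvalue \<alpha> \<Omega> =
     (INF u\<in>{u \<in> W12 \<Omega>. \<not> (AE x in lebesgue_on \<Omega>. u x = 0)}.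
        ereal ((L2_norm_sq (lebesgue_on \<Omega>) (weak_gradient \<Omega> u)
                 + \<alpha> * L2_norm_sq (boundary_measure \<Omega>) (sobolev_trace \<Omega> u))
               / L2_norm_sq (lebesgue_on \<Omega>) u))"

end

theory Submission
  imports Defs "HOL-Computational_Algebra.Polynomial"
begin

text \<open>
  For a domain \<open>\<Omega>\<close> write \<open>b\<close> for \<open>-\<alpha>\<close> and consider
  \<open>Q(v) = \<integral>\<^sub>\<Omega> |\<nabla>v|\<^sup>2 - b \<integral>\<^sub>\<partial>\<^sub>\<Omega> v\<^sup>2\<close> for large \<open>b\<close>. A minimiser concentrates at the boundary and behaves
  like \<open>exp (- b t)\<close> in the distance \<open>t\<close> to the boundary, which gives
  \<open>\<lambda>\<^sub>1 = - b\<^sup>2 - (d - 1) H b + o(b)\<close>, where \<open>H\<close> is the largest mean curvature of \<open>\<partial>\<Omega>\<close>. For the ball of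
  radius \<open>R\<close> this is \<open>1 / R\<close>, for the shell it is \<open>1 / r2\<close>, since the inner sphere is curved the other
  way. Equal volume forces \<open>R < r2\<close>, so for large \<open>b\<close> the ball has the lower eigenvalue.

  Only one bound is required on each side.

  \<^item> Lower bound for the shell (\<open>shell_lower_bound\<close>). If \<open>V\<close> is a vector field with normal component
    \<open>b\<close> on the boundary, integrating \<open>div (v\<^sup>2 V)\<close> and using \<open>2 v V \<bullet> \<nabla>v \<le> |V|\<^sup>2 v\<^sup>2 + |\<nabla>v|\<^sup>2\<close> gives
    \<open>Q(v) \<ge> - \<integral> (div V + |V|\<^sup>2) v\<^sup>2\<close>. For the radial field \<open>V = b p(r) x / r\<close>, with a profile \<open>p\<close>
    passing from \<open>-1\<close> at the inner to \<open>1\<close> at the outer sphere, the expression \<open>div V + |V|\<^sup>2\<close> is at most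
    \<open>b\<^sup>2 + (d - 1) b / r2 + C\<close> with \<open>C\<close> independent of \<open>b\<close> (\<open>step_profile_riccati\<close>).

  \<^item> Upper bound for the ball (\<open>ball_test_function\<close>). The function \<open>u = exp (b \<rho>)\<close>, where
    \<open>\<rho> = sqrt (|x - c|\<^sup>2 + b\<^sup>-\<^sup>4)\<close> is a smooth substitute for the distance to the centre, satisfies
    \<open>\<Delta>u \<ge> (b\<^sup>2 + (d - 1 - 1 / b) b / \<rho>(R)) u\<close> and \<open>\<partial>u / \<partial>n \<le> b u\<close>, so Green's formula bounds its
    quotient.

  Both integral identities concern rotationally symmetric domains and follow from the fundamental
  theorem of calculus on rays together with polar coordinates. There the sphere carries the cone
  measure, whereas the boundary terms are defined by Hausdorff measure. The two are proportional
  because both are invariant under rotations and a uniformly distributed measure is unique up to a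
  factor (\<open>uniformly_distributed_eq\<close>, \<open>hausdorff_unit_sphere\<close>). One factor \<open>\<kappa>\<close> serves all spheres, so
  it is absorbed into the parameter by putting \<open>b = - \<kappa> \<alpha>\<close>.

  Passing from smooth functions to \<open>W\<^sup>1\<^sup>,\<^sup>2\<close> requires that weak gradients are unique
  (\<open>weak_gradient_unique\<close>) and that every function in \<open>W\<^sup>1\<^sup>,\<^sup>2\<close> of the shell has a trace
  (\<open>has_trace_exists\<close>); otherwise an arbitrarily chosen gradient or trace would carry no
  information. The trace is the limit of the boundary values of smooth approximations
  (\<open>smooth_dense_W12\<close>), and these boundary values converge by the trace inequality, which is the lower
  bound for \<open>b = 1\<close>.
\<close>

section \<open>Calculus of smooth functions\<close>

text \<open>The induction needs equality of the derivatives, which depend only on the values near a point;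
  hence \<open>S\<close> has to be open.\<close>

lemma Ck_on_cong:
  assumes "open S" and "\<And>x. x \<in> S \<Longrightarrow> f x = g x"
  shows "Ck_on k S f \<longleftrightarrow> Ck_on k S g"
  using assms(2)
proof (induction k arbitrary: f g)
  case 0
  then show ?case by (simp cong: continuous_on_cong)
next
  case (Suc k)
  have hd: "(f has_derivative D) (at x) \<longleftrightarrow> (g has_derivative D) (at x)" if "x \<in> S" for x D
    using has_derivative_transform_within_open[OF _ \<open>open S\<close> that] Suc.prems by metis
  then have "f differentiable at x \<longleftrightarrow> g differentiable at x" if "x \<in> S" for x
    using that by (simp add: differentiable_def)
  moreover have fr: "frechet_derivative f (at x) v = frechet_derivative g (at x) v" if "x \<in> S" for x v
    using that by (simp add: frechet_derivative_def hd)
  have "Ck_on k S (\<lambda>x. frechet_derivative f (at x) v) \<longleftrightarrow> Ck_on k S (\<lambda>x. frechet_derivative g (at x) v)" for v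
    by (rule Suc.IH) (simp add: fr)
  ultimately show ?case by simp
qed

lemma Ck_on_SucI:
  assumes "open S" and "\<And>x. x \<in> S \<Longrightarrow> (f has_derivative D x) (at x)"
    and "\<And>v. Ck_on k S (\<lambda>x. D x v)"
  shows "Ck_on (Suc k) S f"
proof -
  have "frechet_derivative f (at x) = D x" if "x \<in> S" for x
    using assms(2)[OF that] by (metis frechet_derivative_at)
  then have "Ck_on k S (\<lambda>x. frechet_derivative f (at x) v)" for v
    using Ck_on_cong[OF assms(1), of "\<lambda>x. frechet_derivative f (at x) v" "\<lambda>x. D x v" k] assms(3)
    by simp
  then show ?thesis using assms(2) by (auto simp: differentiable_def)
qed

lemma Ck_on_Suc_derivative:
  assumes "Ck_on (Suc k) S f" "x \<in> S"
  shows "(f has_derivative frechet_derivative f (at x)) (at x)"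
  using assms by (simp add: frechet_derivative_works)

lemma Ck_on_Suc_mono: "Ck_on (Suc k) S f \<Longrightarrow> Ck_on k S f"
proof (induction k arbitrary: f)
  case 0
  then show ?case
    by (auto simp: differentiable_imp_continuous_within intro!: continuous_at_imp_continuous_on)
next
  case (Suc k)
  then show ?case by simp
qed

lemma Ck_on_const: "open S \<Longrightarrow> Ck_on k S (\<lambda>x. c)"
proof (induction k arbitrary: c)
  case (Suc k)
  then show ?case by (intro Ck_on_SucI[where D="\<lambda>x v. 0"]) auto
qed simp

lemma Ck_on_inner: "open S \<Longrightarrow> Ck_on k S (\<lambda>x. x \<bullet> a)"
proof (cases k)
  case (Suc j)
  assume "open S"
  then show ?thesis
    unfolding Suc by (intro Ck_on_SucI[where D="\<lambda>x v. v \<bullet> a"] Ck_on_const) (auto intro!: derivative_eq_intros)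
qed (auto intro!: continuous_intros)

lemma Ck_on_add:
  "open S \<Longrightarrow> Ck_on k S f \<Longrightarrow> Ck_on k S g \<Longrightarrow> Ck_on k S (\<lambda>x. f x + g x)"
proof (induction k arbitrary: f g)
  case (Suc k)
  show ?case
  proof (rule Ck_on_SucI[OF Suc.prems(1)])
    show "((\<lambda>x. f x + g x) has_derivative
        (\<lambda>v. frechet_derivative f (at x) v + frechet_derivative g (at x) v)) (at x)" if "x \<in> S" for x
      using Suc.prems that by (intro has_derivative_add Ck_on_Suc_derivative)
  qed (use Suc in auto)
qed (auto intro: continuous_on_add)

lemma Ck_on_mult:
  "open S \<Longrightarrow> Ck_on k S f \<Longrightarrow> Ck_on k S g \<Longrightarrow> Ck_on k S (\<lambda>x. f x * g x)"
proof (induction k arbitrary: f g)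
  case (Suc k)
  show ?case
  proof (rule Ck_on_SucI[OF Suc.prems(1)])
    show "((\<lambda>x. f x * g x) has_derivative
        (\<lambda>v. f x * frechet_derivative g (at x) v + frechet_derivative f (at x) v * g x)) (at x)" if "x \<in> S" for x
      using Suc.prems that by (intro has_derivative_mult Ck_on_Suc_derivative)
    show "Ck_on k S (\<lambda>x. f x * frechet_derivative g (at x) v + frechet_derivative f (at x) v * g x)" for v
    proof (intro Ck_on_add Suc.IH Suc.prems(1))
      show "Ck_on k S f" "Ck_on k S g"
        using Suc.prems Ck_on_Suc_mono by blast+
      show "Ck_on k S (\<lambda>x. frechet_derivative g (at x) v)" "Ck_on k S (\<lambda>x. frechet_derivative f (at x) v)"
        using Suc.prems by simp_all
    qed
  qed
qed (auto intro: continuous_on_mult)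

lemma Ck_on_sum:
  "finite I \<Longrightarrow> open S \<Longrightarrow> (\<And>i. i \<in> I \<Longrightarrow> Ck_on k S (f i)) \<Longrightarrow> Ck_on k S (\<lambda>x. \<Sum>i\<in>I. f i x)"
proof (induction I rule: finite_induct)
  case empty
  then show ?case by (simp add: Ck_on_const)
next
  case (insert i I)
  then show ?case by (simp add: Ck_on_add)
qed

text \<open>The chain rule writes the derivative of \<open>f \<circ> \<Psi>\<close> as a sum of products
  \<open>(\<partial>\<^sub>b f \<circ> \<Psi>) \<cdot> \<partial>\<^sub>v \<Psi>\<^sub>b\<close>, whose factors are one degree less smooth and are covered by the
  induction hypothesis.\<close>

lemma Ck_on_compose:
  fixes \<Psi> :: "'a::euclidean_space \<Rightarrow> 'b::euclidean_space"
  assumes "open S" "open T" "\<Psi> ` S \<subseteq> T"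
  shows "Ck_on k T f \<Longrightarrow> (\<And>b. b \<in> Basis \<Longrightarrow> Ck_on k S (\<lambda>x. \<Psi> x \<bullet> b)) \<Longrightarrow> Ck_on k S (\<lambda>x. f (\<Psi> x))"
proof (induction k arbitrary: f)
  case 0
  have "continuous_on S \<Psi>"
    using 0(2) by (subst continuous_on_componentwise) auto
  then show ?case using 0 assms(3) by (auto intro: continuous_on_compose2)
next
  case (Suc k)
  define P where "P x v = (\<Sum>b\<in>Basis. frechet_derivative (\<lambda>x. \<Psi> x \<bullet> b) (at x) v *\<^sub>R b)" for x v
  have dP: "(\<Psi> has_derivative P x) (at x)" if "x \<in> S" for x
  proof (subst has_derivative_componentwise_within, intro ballI)
    fix b :: 'b assume b: "b \<in> Basis"
    have "P x v \<bullet> b = frechet_derivative (\<lambda>x. \<Psi> x \<bullet> b) (at x) v" for v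
      using b by (simp add: P_def inner_sum_left inner_Basis if_distrib cong: if_cong)
    then show "((\<lambda>x. \<Psi> x \<bullet> b) has_derivative (\<lambda>v. P x v \<bullet> b)) (at x)"
      using Ck_on_Suc_derivative[OF Suc.prems(2)[OF b] that] by (simp add: eta_contract_eq)
  qed
  have df: "(f has_derivative frechet_derivative f (at (\<Psi> x))) (at (\<Psi> x))" if "x \<in> S" for x
    using Ck_on_Suc_derivative[OF Suc.prems(1)] that assms(3) by blast
  show ?case
  proof (rule Ck_on_SucI[OF assms(1)])
    show "((\<lambda>x. f (\<Psi> x)) has_derivative (\<lambda>v. frechet_derivative f (at (\<Psi> x)) (P x v))) (at x)"
      if "x \<in> S" for x
      using has_derivative_compose[OF dP[OF that] df[OF that]] .
    fix v
    have "frechet_derivative f (at (\<Psi> x)) (P x v) =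
        (\<Sum>b\<in>Basis. frechet_derivative (\<lambda>x. \<Psi> x \<bullet> b) (at x) v * frechet_derivative f (at (\<Psi> x)) b)"
      if "x \<in> S" for x
    proof -
      interpret linear "frechet_derivative f (at (\<Psi> x))"
        using df[OF that] by (rule has_derivative_linear)
      show ?thesis by (simp add: P_def sum scaleR)
    qed
    moreover have "Ck_on k S (\<lambda>x. \<Sum>b\<in>Basis. frechet_derivative (\<lambda>x. \<Psi> x \<bullet> b) (at x) v *
        frechet_derivative f (at (\<Psi> x)) b)"
    proof (intro Ck_on_sum Ck_on_mult assms finite_Basis)
      fix b :: 'b assume b: "b \<in> Basis"
      show "Ck_on k S (\<lambda>x. frechet_derivative (\<lambda>x. \<Psi> x \<bullet> b) (at x) v)"
        using Suc.prems(2)[OF b] by simp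
      show "Ck_on k S (\<lambda>x. frechet_derivative f (at (\<Psi> x)) b)"
      proof (rule Suc.IH[of "\<lambda>y. frechet_derivative f (at y) b"])
        show "Ck_on k T (\<lambda>y. frechet_derivative f (at y) b)"
          using Suc.prems(1) by simp
        show "Ck_on k S (\<lambda>x. \<Psi> x \<bullet> b)" if "b \<in> Basis" for b
          using Suc.prems(2)[OF that] by (rule Ck_on_Suc_mono)
      qed
    qed
    ultimately show "Ck_on k S (\<lambda>x. frechet_derivative f (at (\<Psi> x)) (P x v))"
      by (subst Ck_on_cong[OF assms(1)])
  qed
qed

lemma smooth_on_cong:
  "open S \<Longrightarrow> (\<And>x. x \<in> S \<Longrightarrow> f x = g x) \<Longrightarrow> smooth_on S f \<longleftrightarrow> smooth_on S g"
  unfolding smooth_on_def by (simp add: Ck_on_cong[of S f g])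

lemma smooth_on_const: "open S \<Longrightarrow> smooth_on S (\<lambda>x. c)"
  and smooth_on_inner: "open S \<Longrightarrow> smooth_on S (\<lambda>x. x \<bullet> a)"
  and smooth_on_add: "open S \<Longrightarrow> smooth_on S f \<Longrightarrow> smooth_on S g \<Longrightarrow> smooth_on S (\<lambda>x. f x + g x)"
  and smooth_on_mult: "open S \<Longrightarrow> smooth_on S f \<Longrightarrow> smooth_on S g \<Longrightarrow> smooth_on S (\<lambda>x. f x * g x)"
  unfolding smooth_on_def by (simp_all add: Ck_on_const Ck_on_inner Ck_on_add Ck_on_mult)

lemma smooth_on_sum:
  "open S \<Longrightarrow> finite I \<Longrightarrow> (\<And>i. i \<in> I \<Longrightarrow> smooth_on S (f i)) \<Longrightarrow> smooth_on S (\<lambda>x. \<Sum>i\<in>I. f i x)"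
  unfolding smooth_on_def by (simp add: Ck_on_sum)

lemma smooth_on_diff: "open S \<Longrightarrow> smooth_on S f \<Longrightarrow> smooth_on S g \<Longrightarrow> smooth_on S (\<lambda>x. f x - g x)"
  using smooth_on_add[of S f "\<lambda>x. (-1) * g x"] smooth_on_mult[of S "\<lambda>x. -1" g] smooth_on_const[of S "-1"]
  by simp

lemma smooth_on_compose:
  fixes \<Psi> :: "'a::euclidean_space \<Rightarrow> 'b::euclidean_space"
  assumes "open S" "open T" "\<Psi> ` S \<subseteq> T" "smooth_on T f"
    and "\<And>b. b \<in> Basis \<Longrightarrow> smooth_on S (\<lambda>x. \<Psi> x \<bullet> b)"
  shows "smooth_on S (\<lambda>x. f (\<Psi> x))"
  unfolding smooth_on_def
proof
  fix k
  show "Ck_on k S (\<lambda>x. f (\<Psi> x))"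
    using assms(4,5) unfolding smooth_on_def by (rule_tac Ck_on_compose[OF assms(1-3)]) auto
qed

lemma smooth_on_compose_real:
  assumes "open S" "open T" "\<psi> ` S \<subseteq> T" "smooth_on T f" "smooth_on S \<psi>"
  shows "smooth_on S (\<lambda>x. f (\<psi> x :: real))"
  using assms by (rule_tac smooth_on_compose[where T=T and \<Psi>=\<psi>]) auto

lemma smooth_on_norm_sq: "open S \<Longrightarrow> smooth_on S (\<lambda>x. (norm (x - c))\<^sup>2)"
proof -
  assume S: "open S"
  have "(norm (x - c))\<^sup>2 = (\<Sum>b\<in>Basis. (x \<bullet> b - c \<bullet> b) * (x \<bullet> b - c \<bullet> b))" for x :: 'a
    unfolding power2_norm_eq_inner by (subst euclidean_inner) (simp add: inner_diff_left)
  with S show ?thesis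
    by (simp only:, intro smooth_on_sum smooth_on_mult smooth_on_diff smooth_on_const smooth_on_inner) auto
qed

text \<open>A function on the line is smooth as soon as it starts a sequence in which every function
  is the derivative of its predecessor.\<close>

lemma smooth_on_real_sequence:
  fixes g :: "nat \<Rightarrow> real \<Rightarrow> real"
  assumes "open T" and d: "\<And>n t. t \<in> T \<Longrightarrow> (g n has_real_derivative g (Suc n) t) (at t)"
  shows "smooth_on T (g 0)"
proof -
  have "Ck_on k T (g n)" for k n
  proof (induction k arbitrary: n)
    case 0
    then show ?case
      using d by (auto intro!: continuous_at_imp_continuous_on DERIV_isCont)
  next
    case (Suc k)
    show ?case
    proof (rule Ck_on_SucI[OF assms(1)])
      show "(g n has_derivative (*) (g (Suc n) t)) (at t)" if "t \<in> T" for t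
        using d[OF that] by (simp add: has_field_derivative_def)
      show "Ck_on k T (\<lambda>x. g (Suc n) x * v)" for v
        using Suc assms(1) by (intro Ck_on_mult Ck_on_const)
    qed
  qed
  then show ?thesis by (simp add: smooth_on_def)
qed

lemma smooth_on_exp: "smooth_on UNIV (exp :: real \<Rightarrow> real)"
  using smooth_on_real_sequence[of UNIV "\<lambda>n. exp"] by (auto intro: DERIV_exp)

text \<open>The derivatives of the square root are multiples of the powers \<open>t powr (1/2 - n)\<close>.\<close>

lemma smooth_on_sqrt: "smooth_on {0<..} sqrt"
proof -
  define g where "g n t = (\<Prod>i<n. 1/2 - real i) * t powr (1/2 - real n)" for n t
  have "smooth_on {0<..} (g 0)"
  proof (rule smooth_on_real_sequence)
    fix n and t :: real assume t: "t \<in> {0<..}"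
    have "1/2 - real n - 1 = 1/2 - real (Suc n)" by simp
    with t show "(g n has_real_derivative g (Suc n) t) (at t)"
      unfolding g_def by (auto intro!: derivative_eq_intros)
  qed auto
  moreover have "g 0 t = sqrt t" if "t \<in> {0<..}" for t
    using that by (simp add: g_def powr_half_sqrt)
  ultimately show ?thesis using smooth_on_cong[of "{0<..}" "g 0" sqrt] by auto
qed

text \<open>The derivatives of \<open>exp (-1/t)\<close> are \<open>P\<^sub>n(1/t) exp (-1/t)\<close> with the polynomials
  defined here, by the substitution \<open>s = 1/t\<close>, \<open>ds/dt = -s\<^sup>2\<close>.\<close>

primrec flat_poly :: "nat \<Rightarrow> real poly" where
  "flat_poly 0 = 1"
| "flat_poly (Suc n) = [:0, 0, 1:] * (flat_poly n - pderiv (flat_poly n))"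

definition flat_deriv :: "nat \<Rightarrow> real \<Rightarrow> real" where
  "flat_deriv n t = (if t > 0 then poly (flat_poly n) (1 / t) * exp (- (1 / t)) else 0)"

lemma poly_times_exp_minus_tendsto_0:
  "((\<lambda>s. poly p s * exp (- s)) \<longlongrightarrow> (0::real)) at_top"
proof -
  have "((\<lambda>s. \<Sum>i\<le>degree p. coeff p i * (s ^ i / exp s)) \<longlongrightarrow> (\<Sum>i\<le>degree p. coeff p i * 0)) at_top"
    by (intro tendsto_intros tendsto_power_div_exp_0)
  then show ?thesis
    by (simp add: poly_altdef sum_distrib_right sum_divide_distrib exp_minus field_simps)
qed

text \<open>At the origin the difference quotient \<open>P\<^sub>n(s) s exp (- s)\<close> with \<open>s = 1/t\<close> tends to \<open>0\<close>, because the
  exponential dominates every polynomial.\<close>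

lemma flat_deriv_has_derivative: "(flat_deriv n has_real_derivative flat_deriv (Suc n) t) (at t)"
proof -
  consider "t > 0" | "t < 0" | "t = 0" by linarith
  then show ?thesis
  proof cases
    case 1
    have "((\<lambda>t. poly (flat_poly n) (1 / t) * exp (- (1 / t))) has_real_derivative flat_deriv (Suc n) t) (at t)"
      using 1 unfolding flat_deriv_def
      by (auto intro!: derivative_eq_intros simp: field_simps power2_eq_square)
    then show ?thesis
      using 1 by (rule_tac has_field_derivative_transform_within_open[where S="{0<..}"])
        (auto simp: flat_deriv_def)
  next
    case 2
    have "((\<lambda>t. 0) has_real_derivative flat_deriv (Suc n) t) (at t)"
      using 2 by (auto simp: flat_deriv_def)
    then show ?thesis
      using 2 by (rule_tac has_field_derivative_transform_within_open[where S="{..<0}"])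
        (auto simp: flat_deriv_def)
  next
    case 3
    have "((\<lambda>h. flat_deriv n h / h) \<longlongrightarrow> 0) (at_right 0)"
    proof -
      have "filterlim (\<lambda>h::real. 1 / h) at_top (at_right 0)"
        using filterlim_inverse_at_top_right by (simp add: inverse_eq_divide)
      from filterlim_compose[OF poly_times_exp_minus_tendsto_0[of "pCons 0 (flat_poly n)"] this]
      show ?thesis
        by (rule Lim_transform_eventually)
          (auto simp: flat_deriv_def eventually_at_filter)
    qed
    moreover have "((\<lambda>h. flat_deriv n h / h) \<longlongrightarrow> 0) (at_left 0)"
      by (rule Lim_transform_eventually[OF tendsto_const])
        (auto simp: flat_deriv_def eventually_at_filter)
    ultimately have "((\<lambda>h. flat_deriv n h / h) \<longlongrightarrow> 0) (at 0)"
      by (simp add: filterlim_split_at)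
    then show ?thesis
      unfolding 3 by (simp add: DERIV_def flat_deriv_def)
  qed
qed

definition bump :: "'a::euclidean_space \<Rightarrow> real" where
  "bump x = flat_deriv 0 (1 - (norm x)\<^sup>2)"

lemma smooth_bump: "smooth_on UNIV (bump :: 'a::euclidean_space \<Rightarrow> real)"
proof -
  have "smooth_on UNIV (flat_deriv 0)"
    by (rule smooth_on_real_sequence) (auto intro: flat_deriv_has_derivative)
  moreover have "smooth_on UNIV (\<lambda>x::'a. 1 - (norm x)\<^sup>2)"
    using smooth_on_norm_sq[of UNIV "0::'a"] by (intro smooth_on_diff smooth_on_const) auto
  ultimately show ?thesis
    unfolding bump_def [abs_def] by (rule_tac smooth_on_compose_real[where T=UNIV]) auto
qed

lemma bump_nonneg: "0 \<le> bump x"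
  by (simp add: bump_def flat_deriv_def)

lemma bump_pos: "norm x < 1 \<Longrightarrow> 0 < bump x"
  by (simp add: bump_def flat_deriv_def power_less_one_iff)

lemma bump_eq_0: "1 \<le> norm x \<Longrightarrow> bump x = 0"
  by (simp add: bump_def flat_deriv_def not_less one_le_power)

lemma smooth_on_continuous: "smooth_on S f \<Longrightarrow> continuous_on S f"
  unfolding smooth_on_def by (metis Ck_on.simps(1))

lemma smooth_on_has_derivative:
  "smooth_on S f \<Longrightarrow> x \<in> S \<Longrightarrow> (f has_derivative frechet_derivative f (at x)) (at x)"
  unfolding smooth_on_def by (metis Ck_on_Suc_derivative)

lemma smooth_on_frechet_derivative:
  "smooth_on S f \<Longrightarrow> smooth_on S (\<lambda>x. frechet_derivative f (at x) v)"
  unfolding smooth_on_def by (metis Ck_on.simps(2))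

section \<open>Hausdorff measure as a Borel measure\<close>

definition covers :: "real \<Rightarrow> 'a::euclidean_space set \<Rightarrow> (nat \<Rightarrow> 'a set) set" where
  "covers \<delta> E = {C. E \<subseteq> (\<Union>n. C n) \<and> (\<forall>n. bounded (C n) \<and> diameter (C n) \<le> \<delta>)}"

definition hausdorff_gauge :: "nat \<Rightarrow> 'a::euclidean_space set \<Rightarrow> ennreal" where
  "hausdorff_gauge k C = ennreal (unit_ball_vol (real k) * (diameter C / 2) ^ k)"

lemma hausdorff_premeasure_alt: "hausdorff_premeasure k \<delta> E = (INF C\<in>covers \<delta> E. \<Sum>n. hausdorff_gauge k (C n))"
  by (simp add: hausdorff_premeasure_def covers_def hausdorff_gauge_def)

lemma hausdorff_gauge_empty: "k \<ge> 1 \<Longrightarrow> hausdorff_gauge k {} = 0"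
  by (simp add: hausdorff_gauge_def)

lemma hausdorff_premeasure_le: "C \<in> covers \<delta> E \<Longrightarrow> hausdorff_premeasure k \<delta> E \<le> (\<Sum>n. hausdorff_gauge k (C n))"
  unfolding hausdorff_premeasure_alt by (rule INF_lower)

lemma hausdorff_premeasure_mono:
  assumes "E \<subseteq> F" "\<delta>' \<le> \<delta>"
  shows "hausdorff_premeasure k \<delta> E \<le> hausdorff_premeasure k \<delta>' F"
proof -
  have "C \<in> covers \<delta> E" if "C \<in> covers \<delta>' F" for C
    using that assms(1) order_trans[OF _ assms(2)] unfolding covers_def by blast
  then show ?thesis
    unfolding hausdorff_premeasure_alt by (intro INF_superset_mono) auto
qed

lemma hausdorff_premeasure_le_outer:
  "\<delta> > 0 \<Longrightarrow> hausdorff_premeasure k \<delta> E \<le> hausdorff_outer_measure k E"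
  unfolding hausdorff_outer_measure_def by (rule SUP_upper) simp

lemma hausdorff_outer_measure_mono:
  "E \<subseteq> F \<Longrightarrow> hausdorff_outer_measure k E \<le> hausdorff_outer_measure k F"
  unfolding hausdorff_outer_measure_def by (rule SUP_mono) (use hausdorff_premeasure_mono in blast)

lemma hausdorff_outer_measure_empty:
  "k \<ge> 1 \<Longrightarrow> hausdorff_outer_measure k ({} :: 'a::euclidean_space set) = 0"
proof -
  assume k: "k \<ge> 1"
  have "hausdorff_premeasure k \<delta> ({} :: 'a set) \<le> 0" if "\<delta> > 0" for \<delta> :: real
    using hausdorff_premeasure_le[of "\<lambda>n. {} :: 'a set" \<delta> "{}" k] k that by (simp add: covers_def hausdorff_gauge_empty)
  then have "hausdorff_outer_measure k ({} :: 'a set) \<le> 0"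
    unfolding hausdorff_outer_measure_def by (intro SUP_least) simp
  then show ?thesis by simp
qed

lemma hausdorff_premeasure_countably_subadditive:
  "hausdorff_premeasure k \<delta> (\<Union>i. A i) \<le> (\<Sum>i. hausdorff_premeasure k \<delta> (A i))"
proof (rule ennreal_le_epsilon)
  fix e :: real assume fin: "(\<Sum>i. hausdorff_premeasure k \<delta> (A i)) < top" and e: "0 < e"
  have "\<exists>C\<in>covers \<delta> (A i). (\<Sum>n. hausdorff_gauge k (C n)) < hausdorff_premeasure k \<delta> (A i) + ennreal (e * (1/2) ^ Suc i)" for i
  proof -
    have "hausdorff_premeasure k \<delta> (A i) < top"
      using fin by (metis ennreal_suminf_lessD top.not_eq_extremum)
    moreover have "ennreal (e * (1/2) ^ Suc i) > 0"
      using e by simp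
    ultimately have "hausdorff_premeasure k \<delta> (A i) < hausdorff_premeasure k \<delta> (A i) + ennreal (e * (1/2) ^ Suc i)"
      using ennreal_add_left_cancel_less[of "hausdorff_premeasure k \<delta> (A i)" 0 "ennreal (e * (1/2) ^ Suc i)"]
      by simp
    then show ?thesis
      by (subst (asm) hausdorff_premeasure_alt) (simp add: INF_less_iff)
  qed
  then obtain C where C: "\<And>i. C i \<in> covers \<delta> (A i)"
    and less: "\<And>i. (\<Sum>n. hausdorff_gauge k (C i n)) < hausdorff_premeasure k \<delta> (A i) + ennreal (e * (1/2) ^ Suc i)"
    by metis
  define B where "B n = (case prod_decode n of (i, j) \<Rightarrow> C i j)" for n
  have "B \<in> covers \<delta> (\<Union>i. A i)"
  proof -
    have "(\<Union>i. A i) \<subseteq> (\<Union>n. B n)"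
    proof
      fix x assume "x \<in> (\<Union>i. A i)"
      then obtain i j where "x \<in> C i j"
        using C unfolding covers_def by blast
      then have "x \<in> B (prod_encode (i, j))" by (simp add: B_def)
      then show "x \<in> (\<Union>n. B n)" by blast
    qed
    then show ?thesis
      using C by (auto simp: covers_def B_def split: prod.split)
  qed
  then have "hausdorff_premeasure k \<delta> (\<Union>i. A i) \<le> (\<Sum>n. hausdorff_gauge k (B n))"
    by (rule hausdorff_premeasure_le)
  also have "\<dots> = (\<Sum>i. \<Sum>n. hausdorff_gauge k (C i n))"
  proof -
    have "(\<Sum>n. (case_prod (\<lambda>i j. hausdorff_gauge k (C i j))) (prod_decode n)) = (\<Sum>i. \<Sum>j. hausdorff_gauge k (C i j))"
      by (rule suminf_ennreal_2dimen) simp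
    then show ?thesis by (simp add: B_def split_def)
  qed
  also have "\<dots> \<le> (\<Sum>i. hausdorff_premeasure k \<delta> (A i) + ennreal (e * (1/2) ^ Suc i))"
    using less by (intro suminf_le) (auto intro: less_imp_le)
  also have "\<dots> = (\<Sum>i. hausdorff_premeasure k \<delta> (A i)) + (\<Sum>i. ennreal (e * (1/2) ^ Suc i))"
    by (simp add: suminf_add)
  also have "(\<Sum>i. ennreal (e * (1/2) ^ Suc i)) = ennreal e"
  proof (rule suminf_ennreal_eq)
    show "(\<lambda>i. e * (1/2) ^ Suc i) sums e"
      using sums_mult[OF power_half_series, of e] by simp
  qed (use e in simp)
  finally show "hausdorff_premeasure k \<delta> (\<Union>i. A i) \<le> (\<Sum>i. hausdorff_premeasure k \<delta> (A i)) + ennreal e" .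
qed

lemma hausdorff_outer_measure_countably_subadditive:
  "hausdorff_outer_measure k (\<Union>i. A i) \<le> (\<Sum>i. hausdorff_outer_measure k (A i))"
proof -
  have "hausdorff_premeasure k \<delta> (\<Union>i. A i) \<le> (\<Sum>i. hausdorff_outer_measure k (A i))"
    if "\<delta> > 0" for \<delta>
  proof -
    have "hausdorff_premeasure k \<delta> (\<Union>i. A i) \<le> (\<Sum>i. hausdorff_premeasure k \<delta> (A i))"
      by (rule hausdorff_premeasure_countably_subadditive)
    also have "\<dots> \<le> (\<Sum>i. hausdorff_outer_measure k (A i))"
      using that by (intro suminf_le hausdorff_premeasure_le_outer) auto
    finally show ?thesis .
  qed
  then show ?thesis
    unfolding hausdorff_outer_measure_def[of k "\<Union>i. A i"] by (intro SUP_least) simp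
qed

lemma hausdorff_outer_measure_space:
  "k \<ge> 1 \<Longrightarrow> outer_measure_space (Pow UNIV) (hausdorff_outer_measure k)"
  unfolding outer_measure_space_def positive_def increasing_def countably_subadditive_def
  by (simp add: hausdorff_outer_measure_empty hausdorff_outer_measure_mono
      hausdorff_outer_measure_countably_subadditive)

lemma hausdorff_outer_measure_Un_le:
  assumes "k \<ge> 1"
  shows "hausdorff_outer_measure k (A \<union> B) \<le> hausdorff_outer_measure k A + hausdorff_outer_measure k B"
proof -
  have "hausdorff_outer_measure k (A \<union> B) \<le> (\<Sum>i. hausdorff_outer_measure k (binaryset A B i))"
    using hausdorff_outer_measure_countably_subadditive[of k "binaryset A B"]
    by (simp add: UN_binaryset_eq)
  also have "\<dots> = hausdorff_outer_measure k A + hausdorff_outer_measure k B"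
    using binaryset_sums[of "hausdorff_outer_measure k" A B] assms
    by (intro sums_unique[symmetric]) (simp add: hausdorff_outer_measure_empty)
  finally show ?thesis .
qed

text \<open>A set of diameter smaller than the distance of \<open>A\<close> and \<open>B\<close> cannot meet both, so a fine
  cover of the union splits into a cover of \<open>A\<close> and one of \<open>B\<close>.\<close>

lemma hausdorff_outer_measure_separated:
  assumes k: "k \<ge> 1" and d: "d > 0" and sep: "\<And>x y. x \<in> A \<Longrightarrow> y \<in> B \<Longrightarrow> d \<le> dist x y"
  shows "hausdorff_outer_measure k A + hausdorff_outer_measure k B \<le> hausdorff_outer_measure k (A \<union> B)"
proof -
  have pre: "hausdorff_premeasure k \<delta> A + hausdorff_premeasure k \<delta> B \<le> hausdorff_premeasure k \<delta> (A \<union> B)"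
    if "\<delta> < d" for \<delta>
  proof -
    have "hausdorff_premeasure k \<delta> A + hausdorff_premeasure k \<delta> B \<le> (\<Sum>n. hausdorff_gauge k (C n))"
      if C: "C \<in> covers \<delta> (A \<union> B)" for C
    proof -
      define CA where "CA n = (if C n \<inter> A \<noteq> {} then C n else {})" for n
      define CB where "CB n = (if C n \<inter> A \<noteq> {} then {} else C n)" for n
      have "bounded (C 0)" "diameter (C 0) \<le> \<delta>" using C by (auto simp: covers_def)
      then have "0 \<le> \<delta>" using diameter_ge_0[of "C 0"] by linarith
      have CA: "CA \<in> covers \<delta> A"
      proof -
        have "A \<subseteq> (\<Union>n. CA n)"
        proof
          fix x assume x: "x \<in> A"
          then obtain n where "x \<in> C n" using C by (auto simp: covers_def)
          then have "x \<in> CA n" using x by (auto simp: CA_def)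
          then show "x \<in> (\<Union>n. CA n)" by blast
        qed
        then show ?thesis using C \<open>0 \<le> \<delta>\<close> by (simp add: covers_def CA_def)
      qed
      have "B \<subseteq> (\<Union>n. CB n)"
      proof
        fix y assume y: "y \<in> B"
        then obtain n where n: "y \<in> C n" using C by (auto simp: covers_def)
        have "C n \<inter> A = {}"
        proof (rule ccontr)
          assume "C n \<inter> A \<noteq> {}"
          then obtain x where x: "x \<in> C n" "x \<in> A" by blast
          then have "dist x y \<le> diameter (C n)"
            using C n by (auto simp: covers_def intro: diameter_bounded_bound)
          also have "\<dots> \<le> \<delta>" using C by (auto simp: covers_def)
          finally show False using sep[OF x(2) y] \<open>\<delta> < d\<close> by simp
        qed
        then show "y \<in> (\<Union>n. CB n)" using n by (auto simp: CB_def)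
      qed
      then have CB: "CB \<in> covers \<delta> B"
        using C \<open>0 \<le> \<delta>\<close> by (simp add: covers_def CB_def)
      have "hausdorff_premeasure k \<delta> A + hausdorff_premeasure k \<delta> B \<le> (\<Sum>n. hausdorff_gauge k (CA n)) + (\<Sum>n. hausdorff_gauge k (CB n))"
        by (intro add_mono hausdorff_premeasure_le CA CB)
      also have "\<dots> = (\<Sum>n. hausdorff_gauge k (CA n) + hausdorff_gauge k (CB n))"
        by (simp add: suminf_add)
      also have "\<dots> = (\<Sum>n. hausdorff_gauge k (C n))"
        using k by (intro suminf_cong) (simp add: CA_def CB_def hausdorff_gauge_empty)
      finally show ?thesis .
    qed
    then show ?thesis
      unfolding hausdorff_premeasure_alt[of k \<delta> "A \<union> B"] by (intro INF_greatest)
  qed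
  have "hausdorff_premeasure k \<delta> A + hausdorff_premeasure k \<delta>' B \<le> hausdorff_outer_measure k (A \<union> B)"
    if "\<delta> > 0" "\<delta>' > 0" for \<delta> \<delta>'
  proof -
    define m where "m = min (min \<delta> \<delta>') (d / 2)"
    have m: "0 < m" "m \<le> \<delta>" "m \<le> \<delta>'" "m < d" using that d by (auto simp: m_def min_def)
    have "hausdorff_premeasure k \<delta> A + hausdorff_premeasure k \<delta>' B \<le>
        hausdorff_premeasure k m A + hausdorff_premeasure k m B"
      using m by (intro add_mono hausdorff_premeasure_mono) auto
    also have "\<dots> \<le> hausdorff_premeasure k m (A \<union> B)" using m by (intro pre)
    also have "\<dots> \<le> hausdorff_outer_measure k (A \<union> B)" using m by (intro hausdorff_premeasure_le_outer)
    finally show ?thesis .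
  qed
  then have "(SUP \<delta>\<in>{0<..}. hausdorff_premeasure k \<delta> A + hausdorff_premeasure k \<delta>' B) \<le> hausdorff_outer_measure k (A \<union> B)"
    if "\<delta>' > 0" for \<delta>' using that by (intro SUP_least) auto
  moreover have "(SUP \<delta>\<in>{0<..}. hausdorff_premeasure k \<delta> A + c) = hausdorff_outer_measure k A + c" for c
    unfolding hausdorff_outer_measure_def by (rule ennreal_SUP_add_left) auto
  ultimately have "(SUP \<delta>\<in>{0<..}. hausdorff_outer_measure k A + hausdorff_premeasure k \<delta> B) \<le> hausdorff_outer_measure k (A \<union> B)"
    by (intro SUP_least) auto
  moreover have "(SUP \<delta>\<in>{0<..}. hausdorff_outer_measure k A + hausdorff_premeasure k \<delta> B) =
      hausdorff_outer_measure k A + hausdorff_outer_measure k B"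
    unfolding hausdorff_outer_measure_def[of k B] by (rule ennreal_SUP_add_right[symmetric]) auto
  ultimately show ?thesis by simp
qed

text \<open>Caratheodory's criterion. The points of \<open>T - F\<close> at distance at least \<open>1/(n+1)\<close> from \<open>F\<close> form
  sets \<open>S n\<close> separated from \<open>F\<close>; the shells \<open>S (n+1) - S n\<close> of the same parity are separated
  from each other, so their measures are summable and \<open>S n\<close> exhausts \<open>T - F\<close> in measure.\<close>

lemma hausdorff_outer_measure_closed:
  fixes F T :: "'a::euclidean_space set"
  assumes k: "k \<ge> 1" and F: "closed F"
  shows "hausdorff_outer_measure k (T \<inter> F) + hausdorff_outer_measure k (T - F) \<le> hausdorff_outer_measure k T"
proof (cases "F = {} \<or> hausdorff_outer_measure k T = top")
  case True
  then show ?thesis using k by (auto simp: hausdorff_outer_measure_empty)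
next
  case False
  let ?H = "hausdorff_outer_measure k"
  define S where "S n = {x \<in> T. inverse (real (Suc n)) \<le> infdist x F}" for n
  define R where "R n = S (Suc n) - S n" for n
  have Fne: "F \<noteq> {}" and fin: "?H T < top" using False by (auto simp: top.not_eq_extremum)
  have Smono: "S m \<subseteq> S n" if "m \<le> n" for m n
  proof
    fix x assume "x \<in> S m"
    moreover have "inverse (real (Suc n)) \<le> inverse (real (Suc m))" using that by (simp add: field_simps)
    ultimately show "x \<in> S n" unfolding S_def by (blast intro: order_trans)
  qed
  have TF: "T - F = (\<Union>n. S n)"
  proof (intro set_eqI iffI)
    fix x assume x: "x \<in> T - F"
    then have "0 < infdist x F"
      using in_closed_iff_infdist_zero[OF F Fne, of x] infdist_nonneg[of x F] by (auto simp: less_le)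
    then obtain n where "inverse (real (Suc n)) < infdist x F" using reals_Archimedean by blast
    then show "x \<in> (\<Union>n. S n)" using x by (auto simp: S_def intro!: exI[of _ n])
  next
    fix x assume "x \<in> (\<Union>n. S n)"
    then obtain n where n: "x \<in> T" "inverse (real (Suc n)) \<le> infdist x F" by (auto simp: S_def)
    moreover have "0 < inverse (real (Suc n))" by simp
    ultimately show "x \<in> T - F" using infdist_zero[of x F] by fastforce
  qed
  have step: "?H (T \<inter> F) + ?H (S n) \<le> ?H T" for n
  proof -
    have "?H (T \<inter> F) + ?H (S n) \<le> ?H (T \<inter> F \<union> S n)"
    proof (rule hausdorff_outer_measure_separated[OF k, of "inverse (real (Suc n))"])
      fix x y assume "x \<in> T \<inter> F" "y \<in> S n"
      then show "inverse (real (Suc n)) \<le> dist x y"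
        using infdist_le[of x F y] by (auto simp: S_def dist_commute)
    qed simp
    also have "\<dots> \<le> ?H T" by (rule hausdorff_outer_measure_mono) (auto simp: S_def)
    finally show ?thesis .
  qed
  have Rsep: "inverse (real (Suc m + 1)) - inverse (real (Suc m + 2)) \<le> dist x y"
    if "x \<in> S (Suc m)" "y \<in> T" "y \<notin> S (Suc (Suc m))" for m x y
  proof -
    have "infdist x F \<le> infdist y F + dist x y" by (rule infdist_triangle)
    then show ?thesis using that by (auto simp: S_def not_le)
  qed
  \<comment> \<open>Two shells of the same parity have a full shell of width \<open>1/n - 1/(n+1)\<close> between them.\<close>
  have evenodd: "(\<Sum>i<n. ?H (R (2 * i + p))) \<le> ?H T" for n p
  proof -
    have "(\<Sum>i<n. ?H (R (2 * i + p))) \<le> ?H (\<Union>i<n. R (2 * i + p))"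
    proof (induction n)
      case 0
      then show ?case using k by (simp add: hausdorff_outer_measure_empty)
    next
      case (Suc n)
      have "(\<Sum>i<Suc n. ?H (R (2 * i + p))) \<le> ?H (\<Union>i<n. R (2 * i + p)) + ?H (R (2 * n + p))"
        using Suc by (simp add: add_mono)
      also have "\<dots> \<le> ?H ((\<Union>i<n. R (2 * i + p)) \<union> R (2 * n + p))"
      proof (cases "n = 0")
        case True
        then show ?thesis using k by (simp add: hausdorff_outer_measure_empty)
      next
        case False
        define m where "m = 2 * n + p - 2"
        have m: "2 * n + p = Suc (Suc m)" using False by (simp add: m_def)
        show ?thesis
        proof (rule hausdorff_outer_measure_separated[OF k])
          show "0 < inverse (real (Suc m + 1)) - inverse (real (Suc m + 2))"
            using less_imp_inverse_less[of "real (Suc m + 1)" "real (Suc m + 2)"] by simp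
          fix x y assume xy: "x \<in> (\<Union>i<n. R (2 * i + p))" "y \<in> R (2 * n + p)"
          then obtain i where i: "i < n" "x \<in> S (Suc (2 * i + p))" by (auto simp: R_def)
          moreover have "Suc (2 * i + p) \<le> Suc m" using i m by linarith
          ultimately have "x \<in> S (Suc m)" using Smono by blast
          moreover have "y \<in> T" "y \<notin> S (Suc (Suc m))" using xy m by (auto simp: R_def S_def)
          ultimately show "inverse (real (Suc m + 1)) - inverse (real (Suc m + 2)) \<le> dist x y"
            by (rule Rsep)
        qed
      qed
      also have "(\<Union>i<n. R (2 * i + p)) \<union> R (2 * n + p) = (\<Union>i<Suc n. R (2 * i + p))"
        by (auto simp: lessThan_Suc)
      finally show ?case .
    qed
    also have "\<dots> \<le> ?H T" by (rule hausdorff_outer_measure_mono) (auto simp: R_def S_def)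
    finally show ?thesis .
  qed
  have Rsum: "(\<Sum>i. ?H (R i)) < top"
  proof -
    have "(\<Sum>i<n. ?H (R i)) \<le> ?H T + ?H T" for n
    proof -
      have "(\<Sum>i<n. ?H (R i)) \<le> (\<Sum>i<2 * n. ?H (R i))" by (rule sum_mono2) auto
      also have "\<dots> = (\<Sum>i<n. ?H (R (2 * i + 0))) + (\<Sum>i<n. ?H (R (2 * i + 1)))"
        by (induction n) (auto simp: ac_simps)
      also have "\<dots> \<le> ?H T + ?H T" using evenodd[of 0 n] evenodd[of 1 n] by (intro add_mono) auto
      finally show ?thesis .
    qed
    then have "(\<Sum>i. ?H (R i)) \<le> ?H T + ?H T"
      by (intro suminf_le_const) auto
    also have "\<dots> < top" using fin by simp
    finally show ?thesis .
  qed
  have tail: "?H (T - F) \<le> ?H (S n) + (\<Sum>i. ?H (R (i + n)))" for n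
  proof -
    have "T - F \<subseteq> S n \<union> (\<Union>i. R (i + n))"
    proof
      fix x assume x: "x \<in> T - F"
      show "x \<in> S n \<union> (\<Union>i. R (i + n))"
      proof (cases "x \<in> S n")
        case False
        obtain m where m: "x \<in> S m" "\<And>j. j < m \<Longrightarrow> x \<notin> S j"
          using x TF exists_least_iff[of "\<lambda>m. x \<in> S m"] by auto
        have "n < m" using False m Smono by (metis not_le subsetD)
        then obtain i where i: "m = Suc (i + n)" by (metis add.commute less_imp_Suc_add)
        then have "x \<in> R (i + n)" using m by (simp add: R_def)
        then show ?thesis by blast
      qed simp
    qed
    then have "?H (T - F) \<le> ?H (S n \<union> (\<Union>i. R (i + n)))" by (rule hausdorff_outer_measure_mono)
    also have "\<dots> \<le> ?H (S n) + ?H (\<Union>i. R (i + n))" by (rule hausdorff_outer_measure_Un_le[OF k])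
    also have "\<dots> \<le> ?H (S n) + (\<Sum>i. ?H (R (i + n)))"
      by (intro add_left_mono hausdorff_outer_measure_countably_subadditive)
    finally show ?thesis .
  qed
  have "(\<lambda>n. \<Sum>i. ?H (R (i + n))) \<longlonglongrightarrow> 0"
  proof -
    define a where "a i = enn2real (?H (R i))" for i
    have Ra: "?H (R i) = ennreal (a i)" for i
      using Rsum ennreal_suminf_lessD[OF Rsum] by (simp add: a_def)
    have a0: "a i \<ge> 0" for i by (simp add: a_def)
    have "(\<Sum>i. ennreal (a i)) \<noteq> top" using Rsum by (simp add: Ra)
    then have sa: "summable a" by (rule summable_suminf_not_top[OF a0])
    have "(\<lambda>n. \<Sum>i. a (i + n)) \<longlonglongrightarrow> 0"
      using suminf_exist_split2[OF sa] .
    then have "(\<lambda>n. ennreal (\<Sum>i. a (i + n))) \<longlonglongrightarrow> ennreal 0" by (rule tendsto_ennrealI)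
    moreover have "ennreal (\<Sum>i. a (i + n)) = (\<Sum>i. ?H (R (i + n)))" for n
      unfolding Ra by (rule suminf_ennreal2[symmetric]) (use a0 sa in \<open>auto simp: summable_iff_shift\<close>)
    ultimately show ?thesis by simp
  qed
  then have lim: "(\<lambda>n. ?H T + (\<Sum>i. ?H (R (i + n)))) \<longlonglongrightarrow> ?H T + 0"
    by (intro tendsto_intros)
  have "?H (T \<inter> F) + ?H (T - F) \<le> ?H T + (\<Sum>i. ?H (R (i + n)))" for n
  proof -
    have "?H (T \<inter> F) + ?H (T - F) \<le> (?H (T \<inter> F) + ?H (S n)) + (\<Sum>i. ?H (R (i + n)))"
      using tail[of n] by (simp add: add.assoc add_left_mono)
    also have "\<dots> \<le> ?H T + (\<Sum>i. ?H (R (i + n)))" using step by (rule add_right_mono)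
    finally show ?thesis .
  qed
  then have "?H (T \<inter> F) + ?H (T - F) \<le> ?H T + 0"
    by (intro LIMSEQ_le_const[OF lim]) auto
  then show ?thesis by simp
qed

text \<open>The Borel sets lie in the sigma-algebra of Caratheodory measurable sets, which contains the closed
  sets by the previous lemma. Without this, \<^const>\<open>measure_of\<close> would return the zero measure.\<close>

lemma emeasure_hausdorff_measure:
  fixes E :: "'a::euclidean_space set"
  assumes k: "k \<ge> 1" and E: "E \<in> sets borel"
  shows "emeasure (hausdorff_measure k) E = hausdorff_outer_measure k E"
proof -
  let ?H = "hausdorff_outer_measure k :: 'a set \<Rightarrow> ennreal"
  let ?L = "lambda_system UNIV (Pow UNIV) ?H"
  interpret P: sigma_algebra UNIV "Pow UNIV :: 'a set set" by (rule sigma_algebra_Pow)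
  have ms: "measure_space UNIV ?L ?H"
    by (rule P.caratheodory_lemma[OF hausdorff_outer_measure_space[OF k]])
  then have sa: "sigma_algebra UNIV ?L" by (simp add: measure_space_def)
  have sb: "sigma_algebra UNIV (sets (borel :: 'a measure))"
    using sets.sigma_algebra_axioms[of "borel :: 'a measure"] by simp
  have "F \<in> ?L" if "closed F" for F
  proof -
    have "?H (F \<inter> T) + ?H ((UNIV - F) \<inter> T) = ?H T" for T
    proof (rule antisym)
      show "?H (F \<inter> T) + ?H ((UNIV - F) \<inter> T) \<le> ?H T"
        using hausdorff_outer_measure_closed[OF k that, of T]
        by (simp add: Int_commute Diff_eq)
      show "?H T \<le> ?H (F \<inter> T) + ?H ((UNIV - F) \<inter> T)"
        using hausdorff_outer_measure_Un_le[OF k, of "F \<inter> T" "(UNIV - F) \<inter> T"]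
        by (simp add: Int_Un_distrib2[symmetric])
    qed
    then show ?thesis by (simp add: lambda_system_def)
  qed
  then have "sigma_sets UNIV {F. closed F} \<subseteq> ?L"
    by (intro sigma_algebra.sigma_sets_subset[OF sa]) auto
  then have "sets borel \<subseteq> ?L" by (simp add: borel_eq_closed)
  then have "measure_space UNIV (sets borel) ?H"
    by (rule measure_down[OF ms sb])
  then have "positive (sets borel) ?H" "countably_additive (sets borel) ?H"
    by (auto simp: measure_space_def)
  then show ?thesis
    unfolding hausdorff_measure_def by (intro emeasure_measure_of_sigma sb E)
qed

lemma sets_hausdorff_measure [simp, measurable_cong]: "sets (hausdorff_measure k) = sets borel"
  and space_hausdorff_measure [simp]: "space (hausdorff_measure k) = UNIV"
  by (auto simp: hausdorff_measure_def sets.sets_measure_of_eq[of "borel :: 'a measure", simplified])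

text \<open>A Lipschitz map sends a cover of \<open>E\<close> to a cover of the image whose diameters grow by at most \<open>L\<close>.
  Applied to isometries and to dilations in both directions, this yields invariance and scaling.\<close>

lemma hausdorff_outer_measure_Lipschitz_image:
  assumes L: "L > 0" and lip: "\<And>x y. x \<in> E \<Longrightarrow> y \<in> E \<Longrightarrow> dist (f x) (f y) \<le> L * dist x y"
  shows "hausdorff_outer_measure k (f ` E) \<le> ennreal (L ^ k) * hausdorff_outer_measure k E"
proof -
  have "hausdorff_premeasure k \<delta> (f ` E) \<le> ennreal (L ^ k) * hausdorff_outer_measure k E" if \<delta>: "\<delta> > 0" for \<delta>
  proof -
    have bound: "hausdorff_premeasure k \<delta> (f ` E) \<le> ennreal (L ^ k) * (\<Sum>n. hausdorff_gauge k (C n))"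
      if C: "C \<in> covers (\<delta> / L) E" for C
    proof -
      have diam: "bounded (f ` (C n \<inter> E)) \<and> diameter (f ` (C n \<inter> E)) \<le> L * diameter (C n)" for n
      proof -
        have b: "bounded (C n)" using C by (auto simp: covers_def)
        have *: "dist (f x) (f y) \<le> L * diameter (C n)" if "x \<in> C n \<inter> E" "y \<in> C n \<inter> E" for x y
        proof -
          have "dist (f x) (f y) \<le> L * dist x y" using lip that by auto
          also have "\<dots> \<le> L * diameter (C n)"
            using that b L by (intro mult_left_mono diameter_bounded_bound) auto
          finally show ?thesis .
        qed
        have "diameter (f ` (C n \<inter> E)) \<le> L * diameter (C n)"
          using * L diameter_ge_0[OF b] by (intro diameter_le) (auto simp: dist_norm)
        moreover have "bounded (f ` (C n \<inter> E))"
        proof (cases "C n \<inter> E = {}")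
          case False
          then obtain x where "x \<in> C n \<inter> E" by blast
          then show ?thesis unfolding bounded_def using * by (intro exI[of _ "f x"]) auto
        qed simp
        ultimately show ?thesis by simp
      qed
      have "(\<lambda>n. f ` (C n \<inter> E)) \<in> covers \<delta> (f ` E)"
      proof -
        have "L * diameter (C n) \<le> \<delta>" for n
          using C L by (auto simp: covers_def field_simps)
        then have "diameter (f ` (C n \<inter> E)) \<le> \<delta>" for n using diam order_trans by blast
        moreover have "f ` E \<subseteq> (\<Union>n. f ` (C n \<inter> E))"
          using C unfolding covers_def by blast
        ultimately show ?thesis using diam by (simp add: covers_def)
      qed
      then have "hausdorff_premeasure k \<delta> (f ` E) \<le> (\<Sum>n. hausdorff_gauge k (f ` (C n \<inter> E)))"
        by (rule hausdorff_premeasure_le)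
      also have "\<dots> \<le> (\<Sum>n. ennreal (L ^ k) * hausdorff_gauge k (C n))"
      proof (intro suminf_le)
        fix n
        have "(diameter (f ` (C n \<inter> E)) / 2) ^ k \<le> (L * diameter (C n) / 2) ^ k"
          using diam[of n] by (intro power_mono divide_right_mono) (auto intro: diameter_ge_0)
        then have "unit_ball_vol (real k) * (diameter (f ` (C n \<inter> E)) / 2) ^ k \<le>
            L ^ k * (unit_ball_vol (real k) * (diameter (C n) / 2) ^ k)"
        proof -
          assume "(diameter (f ` (C n \<inter> E)) / 2) ^ k \<le> (L * diameter (C n) / 2) ^ k"
          then have "unit_ball_vol (real k) * (diameter (f ` (C n \<inter> E)) / 2) ^ k \<le>
              unit_ball_vol (real k) * (L * diameter (C n) / 2) ^ k"
            by (intro mult_left_mono) auto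
          also have "\<dots> = L ^ k * (unit_ball_vol (real k) * (diameter (C n) / 2) ^ k)"
            by (simp add: power_mult_distrib power_divide)
          finally show ?thesis .
        qed
        then show "hausdorff_gauge k (f ` (C n \<inter> E)) \<le> ennreal (L ^ k) * hausdorff_gauge k (C n)"
          unfolding hausdorff_gauge_def using L by (subst ennreal_mult'[symmetric]) (auto intro: ennreal_leI)
      qed auto
      finally show ?thesis by (simp add: ennreal_suminf_cmult)
    qed
    have inv: "ennreal ((1 / L) ^ k) * ennreal (L ^ k) = 1"
      using L by (simp add: ennreal_mult'[symmetric] power_mult_distrib[symmetric])
    have "ennreal ((1 / L) ^ k) * hausdorff_premeasure k \<delta> (f ` E) \<le> (\<Sum>n. hausdorff_gauge k (C n))"
      if "C \<in> covers (\<delta> / L) E" for C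
    proof -
      have "ennreal ((1 / L) ^ k) * hausdorff_premeasure k \<delta> (f ` E) \<le>
          ennreal ((1 / L) ^ k) * (ennreal (L ^ k) * (\<Sum>n. hausdorff_gauge k (C n)))"
        using bound[OF that] by (rule mult_left_mono) simp
      then show ?thesis using inv by (simp add: mult.assoc[symmetric])
    qed
    then have "ennreal ((1 / L) ^ k) * hausdorff_premeasure k \<delta> (f ` E) \<le> hausdorff_premeasure k (\<delta> / L) E"
      unfolding hausdorff_premeasure_alt[of k "\<delta> / L"] by (rule INF_greatest)
    also have "\<dots> \<le> hausdorff_outer_measure k E"
      using \<delta> L by (intro hausdorff_premeasure_le_outer) auto
    finally have "ennreal (L ^ k) * (ennreal ((1 / L) ^ k) * hausdorff_premeasure k \<delta> (f ` E))
        \<le> ennreal (L ^ k) * hausdorff_outer_measure k E"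
      by (rule mult_left_mono) simp
    then show ?thesis
      using inv by (simp only: mult.assoc[symmetric] mult.commute[of "ennreal (L ^ k)"] mult_1_left)
  qed
  then show ?thesis unfolding hausdorff_outer_measure_def[of k "f ` E"] by (intro SUP_least) simp
qed

section \<open>Polar coordinates\<close>

text \<open>The cone measure: a set of directions has \<open>d\<close> times the volume of the cone over it in the unit ball.
  With this normalisation \<open>dx = r\<^sup>d\<^sup>-\<^sup>1 dr d\<sigma>(\<theta>)\<close>.\<close>

definition sphere_measure :: "'a::euclidean_space measure" where
  "sphere_measure = distr (density lborel (\<lambda>x. ennreal (real DIM('a)) * indicator (ball 0 1) x)) borel sgn"

definition radial_measure :: "'a::euclidean_space itself \<Rightarrow> real measure" where
  "radial_measure _ = density lborel (\<lambda>r. ennreal (r ^ (DIM('a) - 1)) * indicator {0<..} r)"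

lemma sets_sphere_measure [simp, measurable_cong]: "sets sphere_measure = sets borel"
  and space_sphere_measure [simp]: "space sphere_measure = UNIV"
  and sets_radial_measure [simp, measurable_cong]: "sets (radial_measure TYPE('a::euclidean_space)) = sets borel"
  and space_radial_measure [simp]: "space (radial_measure TYPE('a::euclidean_space)) = UNIV"
  by (auto simp: sphere_measure_def radial_measure_def)

lemma borel_measurable_ball_density [measurable, simp]:
  "(\<lambda>x::'a::euclidean_space. ennreal (real DIM('a)) * indicator (ball 0 1) x) \<in> borel_measurable borel"
  by (intro borel_measurable_times_ennreal borel_measurable_const borel_measurable_indicator) simp

lemma emeasure_sphere_measure:
  assumes "B \<in> sets borel"
  shows "emeasure (sphere_measure :: 'a::euclidean_space measure) B =
    ennreal (real DIM('a)) * emeasure lborel (ball 0 1 \<inter> sgn -` B)"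
proof -
  have [measurable, simp]: "(sgn -` B :: 'a set) \<in> sets borel"
    using measurable_sets_borel[OF borel_measurable_sgn assms] by simp
  have "emeasure (sphere_measure :: 'a measure) B =
      (\<integral>\<^sup>+x. ennreal (real DIM('a)) * indicator (ball 0 1) x * indicator (sgn -` B) x \<partial>lborel)"
    using assms unfolding sphere_measure_def
    by (subst emeasure_distr) (auto simp: emeasure_density)
  also have "\<dots> = (\<integral>\<^sup>+x. ennreal (real DIM('a)) * indicator (ball 0 1 \<inter> sgn -` B) x \<partial>lborel)"
    by (intro nn_integral_cong) (auto split: split_indicator)
  also have "\<dots> = ennreal (real DIM('a)) * emeasure lborel (ball 0 1 \<inter> sgn -` B)"
    by (subst nn_integral_cmult_indicator) auto
  finally show ?thesis .
qed

lemma finite_measure_sphere_measure: "finite_measure (sphere_measure :: 'a::euclidean_space measure)"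
proof
  have "emeasure lborel (ball (0::'a) 1) < \<infinity>" by (rule emeasure_lborel_ball_finite)
  then show "emeasure (sphere_measure :: 'a measure) (space sphere_measure) \<noteq> \<infinity>"
    by (simp add: emeasure_sphere_measure ennreal_mult_eq_top_iff less_top)
qed

lemma sphere_measure_pos: "0 < emeasure (sphere_measure :: 'a::euclidean_space measure) UNIV"
proof -
  have "0 < emeasure lborel (ball (0::'a) 1)"
    by (simp add: emeasure_ball zero_less_measure_iff unit_ball_vol_pos)
  then show ?thesis by (simp add: emeasure_sphere_measure ennreal_zero_less_mult_iff)
qed

lemma AE_sphere_measure: "AE x in (sphere_measure :: 'a::euclidean_space measure). norm x = 1"
proof -
  have "AE x in density lborel (\<lambda>x::'a. ennreal (real DIM('a)) * indicator (ball 0 1) x). x \<noteq> 0"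
    using AE_lborel_singleton[of "0::'a"] by (subst AE_density) (auto elim!: eventually_mono)
  then have "AE x in density lborel (\<lambda>x::'a. ennreal (real DIM('a)) * indicator (ball 0 1) x). norm (sgn x) = 1"
    by eventually_elim (simp add: norm_sgn)
  then show ?thesis
    unfolding sphere_measure_def by (subst AE_distr_iff) auto
qed

text \<open>The cone is invariant under dilations, which multiply volume by \<open>t\<^sup>d\<close>.\<close>

lemma emeasure_lborel_cone:
  assumes B [measurable]: "B \<in> sets borel" and t: "t > 0"
  shows "emeasure lborel (ball 0 t \<inter> sgn -` B :: 'a::euclidean_space set) =
    ennreal (t ^ DIM('a)) * emeasure lborel (ball 0 1 \<inter> sgn -` B :: 'a set)"
proof -
  have [measurable, simp]: "(sgn -` B :: 'a set) \<in> sets borel"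
    using measurable_sets_borel[OF borel_measurable_sgn B] by simp
  have pre: "(\<lambda>x. 0 + t *\<^sub>R x) -` (ball 0 t \<inter> sgn -` B) = (ball 0 1 \<inter> sgn -` B :: 'a set)"
    using t by (auto simp: sgn_scaleR)
  have "emeasure lborel (ball 0 t \<inter> sgn -` B :: 'a set) =
     emeasure (density (distr lborel borel (\<lambda>x. 0 + t *\<^sub>R x)) (\<lambda>_. ennreal (\<bar>t\<bar> ^ DIM('a)))) (ball 0 t \<inter> sgn -` B :: 'a set)"
    using t by (subst lborel_affine[of t 0]) auto
  also have "\<dots> = ennreal (t ^ DIM('a)) * emeasure lborel ((\<lambda>x. 0 + t *\<^sub>R x) -` (ball 0 t \<inter> sgn -` B) :: 'a set)"
    using t by (simp add: emeasure_density nn_integral_cmult_indicator emeasure_distr)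
  finally show ?thesis unfolding pre .
qed

lemma emeasure_radial_measure_Icc:
  assumes "0 \<le> a" "a \<le> b"
  shows "emeasure (radial_measure TYPE('a::euclidean_space)) {a..b} = ennreal ((b ^ DIM('a) - a ^ DIM('a)) / DIM('a))"
proof -
  have "emeasure (radial_measure TYPE('a)) {a..b} =
     (\<integral>\<^sup>+r. ennreal (r ^ (DIM('a) - 1)) * indicator {0<..} r * indicator {a..b} r \<partial>lborel)"
    unfolding radial_measure_def by (subst emeasure_density) auto
  also have "\<dots> = (\<integral>\<^sup>+r. ennreal (r ^ (DIM('a) - 1)) * indicator {a..b} r \<partial>lborel)"
    using assms AE_lborel_singleton[of "0::real"]
    by (intro nn_integral_cong_AE) (auto split: split_indicator elim!: eventually_mono)
  also have "\<dots> = ennreal (b ^ DIM('a) / DIM('a) - a ^ DIM('a) / DIM('a))"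
    using assms by (intro nn_integral_FTC_Icc) (auto intro!: derivative_eq_intros)
  finally show ?thesis by (simp add: diff_divide_distrib)
qed

lemma AE_radial_measure: "AE r in radial_measure TYPE('a::euclidean_space). 0 < r"
  unfolding radial_measure_def by (subst AE_density) (auto simp: indicator_def intro!: AE_I2)

lemma radial_measure_singleton: "emeasure (radial_measure TYPE('a::euclidean_space)) {r} = 0"
proof -
  have "{r} \<in> null_sets (radial_measure TYPE('a))"
  proof -
    have "AE x in lborel. x \<in> {r} \<longrightarrow> ennreal (x ^ (DIM('a) - 1)) * indicator {0<..} x = 0"
      using AE_lborel_singleton[of r] by eventually_elim simp
    then show ?thesis unfolding radial_measure_def by (subst null_sets_density_iff) auto
  qed
  then show ?thesis by auto
qed

lemma emeasure_radial_measure_lessThan: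
  "emeasure (radial_measure TYPE('a::euclidean_space)) {..<t} = ennreal (if 0 < t then t ^ DIM('a) / DIM('a) else 0)"
proof (cases "0 < t")
  case True
  have "emeasure (radial_measure TYPE('a)) {..<t} = emeasure (radial_measure TYPE('a)) {0..t}"
  proof (rule emeasure_eq_AE)
    have "AE r in radial_measure TYPE('a). r \<notin> {t}"
      by (rule AE_not_in) (simp add: null_sets_def radial_measure_singleton)
    with AE_radial_measure show "AE r in radial_measure TYPE('a). r \<in> {..<t} \<longleftrightarrow> r \<in> {0..t}"
      by eventually_elim auto
  qed auto
  then show ?thesis using True by (simp add: emeasure_radial_measure_Icc)
next
  case False
  have "emeasure (radial_measure TYPE('a)) {..<t} = emeasure (radial_measure TYPE('a)) {}"
  proof (rule emeasure_eq_AE)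
    show "AE r in radial_measure TYPE('a). r \<in> {..<t} \<longleftrightarrow> r \<in> {}"
      using AE_radial_measure by eventually_elim (use False in auto)
  qed auto
  then show ?thesis using False by simp
qed

lemma sigma_finite_radial_measure: "sigma_finite_measure (radial_measure TYPE('a::euclidean_space))"
proof (rule sigma_finite_measure.intro, intro exI conjI ballI)
  show "countable (range (\<lambda>n::nat. {..<real n}))" by simp
  show "\<Union> (range (\<lambda>n::nat. {..<real n})) = space (radial_measure TYPE('a))"
    by (auto intro: reals_Archimedean2)
qed (auto simp: emeasure_radial_measure_lessThan)

text \<open>On a fixed cone both sides are measures in the radial set, and on \<open>{..<t}\<close> they agree by the
  homogeneity of Lebesgue measure.\<close>

lemma emeasure_lborel_polar:
  assumes A: "A \<in> sets borel" and B [measurable]: "B \<in> sets borel"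
  shows "emeasure lborel {x::'a::euclidean_space. norm x \<in> A \<and> sgn x \<in> B} =
    emeasure (radial_measure TYPE('a)) A * emeasure (sphere_measure :: 'a measure) B"
proof -
  have mB [measurable, simp]: "(sgn -` B :: 'a set) \<in> sets borel"
    using measurable_sets_borel[OF borel_measurable_sgn B] by simp
  define M where "M = distr (density lborel (indicator (sgn -` B :: 'a set))) borel norm"
  define N where "N = density (radial_measure TYPE('a)) (\<lambda>_. emeasure (sphere_measure :: 'a measure) B)"
  have M: "emeasure M A = emeasure lborel {x::'a. norm x \<in> A \<and> sgn x \<in> B}" if [measurable]: "A \<in> sets borel" for A
  proof -
    have "emeasure M A = emeasure (density lborel (indicator (sgn -` B :: 'a set))) (norm -` A)"
      unfolding M_def by (subst emeasure_distr) auto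
    also have "\<dots> = (\<integral>\<^sup>+x. indicator (sgn -` B) x * indicator (norm -` A) x \<partial>lborel)"
    proof -
      have "(norm :: 'a \<Rightarrow> real) \<in> borel_measurable borel" by measurable
      then have "(norm -` A :: 'a set) \<in> sets borel" using that by (rule measurable_sets_borel)
      then show ?thesis by (intro emeasure_density) auto
    qed
    also have "\<dots> = (\<integral>\<^sup>+x. indicator {x::'a. norm x \<in> A \<and> sgn x \<in> B} x \<partial>lborel)"
      by (intro nn_integral_cong) (auto split: split_indicator)
    also have "\<dots> = emeasure lborel {x::'a. norm x \<in> A \<and> sgn x \<in> B}"
      by (intro nn_integral_indicator) measurable
    finally show ?thesis .
  qed
  have N: "emeasure N A = emeasure (sphere_measure :: 'a measure) B * emeasure (radial_measure TYPE('a)) A"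
    if "A \<in> sets borel" for A
    using that unfolding N_def by (subst emeasure_density) (auto simp: nn_integral_cmult_indicator)
  have "M = N"
  proof (rule measure_eqI_generator_eq[where E="range lessThan" and \<Omega>=UNIV and A="\<lambda>n. {..<real n}"])
    show "Int_stable (range lessThan :: real set set)"
    proof (rule Int_stableI)
      fix X Y :: "real set" assume "X \<in> range lessThan" "Y \<in> range lessThan"
      then obtain a b where "X = {..<a}" "Y = {..<b}" by blast
      then have "X \<inter> Y = {..<min a b}" by auto
      then show "X \<inter> Y \<in> range lessThan" by blast
    qed
    have s: "sets borel = sigma_sets UNIV (range lessThan :: real set set)"
      by (subst borel_Iio) (simp add: sets_measure_of)
    show "sets M = sigma_sets UNIV (range lessThan)" "sets N = sigma_sets UNIV (range lessThan)"
      by (simp_all add: M_def N_def s)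
    have eq: "emeasure M {..<t} = emeasure N {..<t}" for t
    proof (cases "0 < t")
      case True
      have "emeasure M {..<t} = emeasure lborel (ball 0 t \<inter> sgn -` B :: 'a set)"
        by (subst M) (auto intro!: arg_cong[where f="emeasure lborel"])
      also have "\<dots> = ennreal (t ^ DIM('a)) * emeasure lborel (ball 0 1 \<inter> sgn -` B :: 'a set)"
        by (rule emeasure_lborel_cone[OF B True])
      also have "\<dots> = ennreal (t ^ DIM('a) / DIM('a)) * (ennreal (real DIM('a)) * emeasure lborel (ball 0 1 \<inter> sgn -` B :: 'a set))"
        using True by (simp add: mult.assoc[symmetric] ennreal_mult'[symmetric])
      also have "\<dots> = emeasure N {..<t}"
        using True by (subst N) (simp_all add: emeasure_radial_measure_lessThan emeasure_sphere_measure mult.commute)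
      finally show ?thesis .
    next
      case False
      have "{x::'a. norm x \<in> {..<t} \<and> sgn x \<in> B} = {}"
      proof -
        have "\<not> norm x < t" for x :: 'a using norm_ge_zero[of x] False by linarith
        then show ?thesis by auto
      qed
      moreover have "emeasure M {..<t} = emeasure lborel {x::'a. norm x \<in> {..<t} \<and> sgn x \<in> B}"
        by (rule M) simp
      ultimately have "emeasure M {..<t} = 0" by (simp only: emeasure_empty)
      then show ?thesis using False by (simp add: N emeasure_radial_measure_lessThan)
    qed
    then show "emeasure M X = emeasure N X" if "X \<in> range lessThan" for X using that by auto
    show "emeasure M {..<real n} \<noteq> \<infinity>" for n
    proof -
      interpret finite_measure "sphere_measure :: 'a measure" by (rule finite_measure_sphere_measure)
      show ?thesis
        unfolding eq by (subst N) (auto simp: emeasure_radial_measure_lessThan ennreal_mult_eq_top_iff)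
    qed
  qed (auto intro: reals_Archimedean2)
  then show ?thesis using M[OF A] N[OF A] by (simp add: mult.commute)
qed

text \<open>Integration in polar coordinates: \<open>dx = r\<^sup>d\<^sup>-\<^sup>1 dr d\<sigma>(\<theta>)\<close>, with \<open>\<sigma>\<close> the cone measure.\<close>

lemma lborel_polar:
  "distr (radial_measure TYPE('a) \<Otimes>\<^sub>M sphere_measure) borel (\<lambda>(r, \<theta>). r *\<^sub>R \<theta>) =
    (lborel :: 'a::euclidean_space measure)"
proof -
  let ?P = "radial_measure TYPE('a)" and ?S = "sphere_measure :: 'a measure"
  let ?D = "distr (lborel :: 'a measure) (borel \<Otimes>\<^sub>M borel) (\<lambda>x. (norm x, sgn x))"
  have "?P \<Otimes>\<^sub>M ?S = ?D"
  proof (rule pair_measure_eqI)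
    show "sigma_finite_measure ?P" by (rule sigma_finite_radial_measure)
    show "sigma_finite_measure ?S"
      by (intro finite_measure.axioms(1) finite_measure_sphere_measure)
    show "sets (?P \<Otimes>\<^sub>M ?S) = sets ?D"
      by (simp cong: sets_pair_measure_cong)
    fix A B assume "A \<in> sets ?P" "B \<in> sets ?S"
    then have AB [measurable]: "A \<in> sets borel" "B \<in> sets borel" by auto
    have "emeasure ?D (A \<times> B) = emeasure lborel {x::'a. norm x \<in> A \<and> sgn x \<in> B}"
      by (subst emeasure_distr) (auto intro!: arg_cong[where f="emeasure lborel"])
    then show "emeasure ?P A * emeasure ?S B = emeasure ?D (A \<times> B)"
      using emeasure_lborel_polar[OF AB] by simp
  qed
  then have "distr (?P \<Otimes>\<^sub>M ?S) borel (\<lambda>(r, \<theta>). r *\<^sub>R \<theta>) = distr ?D borel (\<lambda>(r, \<theta>). r *\<^sub>R \<theta>)"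
    by simp
  also have "\<dots> = distr lborel borel ((\<lambda>(r, \<theta>). r *\<^sub>R \<theta>) \<circ> (\<lambda>x. (norm x, sgn x)))"
    by (rule distr_distr) measurable
  also have "(\<lambda>(r, \<theta>). r *\<^sub>R \<theta>) \<circ> (\<lambda>x::'a. (norm x, sgn x)) = (\<lambda>x. x)"
  proof
    show "((\<lambda>(r, \<theta>). r *\<^sub>R \<theta>) \<circ> (\<lambda>x. (norm x, sgn x))) x = x" for x :: 'a
      by (cases "x = 0") (auto simp: sgn_div_norm)
  qed
  also have "distr lborel borel (\<lambda>x::'a. x) = lborel"
    by (simp add: distr_id2)
  finally show ?thesis .
qed

lemma integrable_annulus:
  fixes c :: "'a::euclidean_space" and f :: "'a \<Rightarrow> real"
  assumes f: "continuous_on {x. a \<le> dist c x \<and> dist c x \<le> b} f"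
  shows "integrable lborel (\<lambda>x. indicator {x. a < dist c x \<and> dist c x < b} x * f x)"
proof -
  let ?A = "{x. a < dist c x \<and> dist c x < b}" and ?C = "{x. a \<le> dist c x \<and> dist c x \<le> b}"
  have oA: "open ?A" by (intro open_Collect_conj open_Collect_less continuous_intros)
  have "closed ?C" by (intro closed_Collect_conj closed_Collect_le continuous_intros)
  moreover have "bounded ?C" by (rule bounded_subset[OF bounded_cball[of c b]]) auto
  ultimately have "compact ?C" by (simp add: compact_eq_bounded_closed)
  from borel_integrable_compact[OF this f] have "integrable lborel (\<lambda>x. indicator ?C x *\<^sub>R f x)"
    by (simp add: indicator_scaleR_eq_if)
  moreover have "(\<lambda>x. indicator ?A x *\<^sub>R f x) \<in> borel_measurable borel"
    using oA by (intro borel_measurable_continuous_on_indicator continuous_on_subset[OF f]) auto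
  ultimately show ?thesis
    by (rule_tac Bochner_Integration.integrable_bound[where f="\<lambda>x. indicator ?C x *\<^sub>R f x"])
      (auto split: split_indicator)
qed

text \<open>Radial form of the divergence theorem: the fundamental theorem of calculus along every ray
  from \<open>c\<close>, integrated over the directions.\<close>

lemma integral_annulus_by_rays:
  fixes c :: "'a::euclidean_space" and f :: "'a \<Rightarrow> real"
  assumes ab: "0 \<le> a" "a \<le> b" and f: "continuous_on {x. a \<le> dist c x \<and> dist c x \<le> b} f"
    and Jm: "J a \<in> borel_measurable borel" "J b \<in> borel_measurable borel"
    and J: "\<And>\<theta> r. norm \<theta> = 1 \<Longrightarrow> a \<le> r \<Longrightarrow> r \<le> b \<Longrightarrow>
      ((\<lambda>r. J r \<theta>) has_real_derivative r ^ (DIM('a) - 1) * f (c + r *\<^sub>R \<theta>)) (at r)"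
  shows "(\<integral>x. indicator {x. a < dist c x \<and> dist c x < b} x * f x \<partial>lborel) =
    (\<integral>\<theta>. J b \<theta> - J a \<theta> \<partial>sphere_measure)"
proof -
  let ?P = "radial_measure TYPE('a)" and ?S = "sphere_measure :: 'a measure"
  define g where "g x = indicator {x. a < dist c x \<and> dist c x < b} x * f x" for x
  have gi: "integrable lborel g" unfolding g_def by (rule integrable_annulus[OF f])
  have gm [measurable]: "g \<in> borel_measurable borel" using borel_measurable_integrable[OF gi] by simp
  have shift: "(\<integral>x. g (c + x) \<partial>lborel) = (\<integral>x. g x \<partial>lborel)" "integrable lborel (\<lambda>x. g (c + x))"
  proof -
    have eq: "distr lborel borel ((+) c) = lborel" by (rule lborel_distr_plus)
    show "(\<integral>x. g (c + x) \<partial>lborel) = (\<integral>x. g x \<partial>lborel)"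
      by (subst (2) eq[symmetric]) (simp add: integral_distr)
    have "integrable (distr lborel borel ((+) c)) g" using gi eq by simp
    then show "integrable lborel (\<lambda>x. g (c + x))" by (simp add: integrable_distr_eq)
  qed
  interpret S: finite_measure ?S by (rule finite_measure_sphere_measure)
  interpret P: sigma_finite_measure ?P by (rule sigma_finite_radial_measure)
  interpret PS: pair_sigma_finite ?P ?S ..
  have ipol: "integrable (?P \<Otimes>\<^sub>M ?S) (\<lambda>(r, \<theta>). g (c + r *\<^sub>R \<theta>))"
  proof -
    have "integrable (distr (?P \<Otimes>\<^sub>M ?S) borel (\<lambda>(r, \<theta>). r *\<^sub>R \<theta>)) (\<lambda>x. g (c + x))"
      unfolding lborel_polar by (rule shift)
    then show ?thesis by (subst (asm) integrable_distr_eq) (auto simp: split_def)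
  qed
  have "(\<integral>x. g x \<partial>lborel) = (\<integral>x. g (c + x) \<partial>distr (?P \<Otimes>\<^sub>M ?S) borel (\<lambda>(r, \<theta>). r *\<^sub>R \<theta>))"
    unfolding lborel_polar by (rule shift(1)[symmetric])
  also have "\<dots> = (\<integral>(r, \<theta>). g (c + r *\<^sub>R \<theta>) \<partial>(?P \<Otimes>\<^sub>M ?S))"
    by (subst integral_distr) (auto simp: split_def)
  also have "\<dots> = (\<integral>\<theta>. (\<integral>r. g (c + r *\<^sub>R \<theta>) \<partial>?P) \<partial>?S)"
    using PS.integral_snd[of "\<lambda>r \<theta>. g (c + r *\<^sub>R \<theta>)"] ipol by simp
  also have "\<dots> = (\<integral>\<theta>. J b \<theta> - J a \<theta> \<partial>?S)"
  proof (rule integral_cong_AE)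
    show "(\<lambda>\<theta>. J b \<theta> - J a \<theta>) \<in> borel_measurable ?S"
      using Jm by simp
    show "AE \<theta> in ?S. (\<integral>r. g (c + r *\<^sub>R \<theta>) \<partial>?P) = J b \<theta> - J a \<theta>"
      using AE_sphere_measure
    proof eventually_elim
      case (elim \<theta>)
      let ?k = "\<lambda>r. r ^ (DIM('a) - 1) * f (c + r *\<^sub>R \<theta>)"
      have d: "dist c (c + r *\<^sub>R \<theta>) = \<bar>r\<bar>" for r using elim by (simp add: dist_norm)
      have "(\<integral>r. g (c + r *\<^sub>R \<theta>) \<partial>?P) = (\<integral>r. r ^ (DIM('a) - 1) * indicator {0<..} r * g (c + r *\<^sub>R \<theta>) \<partial>lborel)"
      proof -
        have "?P = density lborel (\<lambda>r. ennreal (r ^ (DIM('a) - 1) * indicator {0<..} r))"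
          unfolding radial_measure_def by (intro arg_cong[where f="density lborel"] ext) (auto split: split_indicator)
        then show ?thesis
          by (simp, subst integral_density) (auto split: split_indicator)
      qed
      also have "\<dots> = (\<integral>r. indicator {a..b} r *\<^sub>R ?k r \<partial>lborel)"
      proof (rule integral_cong_AE)
        have k: "continuous_on {a..b} ?k"
          using ab d by (intro continuous_intros continuous_on_compose2[OF f]) auto
        then show "(\<lambda>r. indicator {a..b} r *\<^sub>R ?k r) \<in> borel_measurable lborel"
          using borel_measurable_continuous_on_indicator[OF _ k] by simp
        show "AE r in lborel. r ^ (DIM('a) - 1) * indicator {0<..} r * g (c + r *\<^sub>R \<theta>) = indicator {a..b} r *\<^sub>R ?k r"
          using AE_lborel_singleton[of a] AE_lborel_singleton[of b]
          by eventually_elim (use ab d in \<open>auto simp: g_def split: split_indicator\<close>)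
      qed measurable
      also have "\<dots> = J b \<theta> - J a \<theta>"
      proof (rule integral_FTC_Icc)
        show "a \<le> b" by fact
        show "((\<lambda>r. J r \<theta>) has_vector_derivative ?k r) (at r within {a..b})" if "a \<le> r" "r \<le> b" for r
          using J[OF elim that] by (rule_tac has_vector_derivative_at_within) (simp add: has_real_derivative_iff_has_vector_derivative)
        show "continuous_on {a..b} ?k"
          using ab d by (intro continuous_intros continuous_on_compose2[OF f]) auto
      qed
      finally show ?case .
    qed
  qed measurable
  finally show ?thesis by (simp add: g_def)
qed

text \<open>The ball and the punctured ball differ by the null set \<open>{c}\<close>.\<close>

lemma integral_ball_by_rays:
  fixes c :: "'a::euclidean_space" and f :: "'a \<Rightarrow> real"
  assumes R: "0 \<le> R" and f: "continuous_on UNIV f"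
    and Jm: "J 0 \<in> borel_measurable borel" "J R \<in> borel_measurable borel"
    and J: "\<And>\<theta> r. norm \<theta> = 1 \<Longrightarrow> 0 \<le> r \<Longrightarrow> r \<le> R \<Longrightarrow>
      ((\<lambda>r. J r \<theta>) has_real_derivative r ^ (DIM('a) - 1) * f (c + r *\<^sub>R \<theta>)) (at r)"
  shows "(\<integral>x. indicator (ball c R) x * f x \<partial>lborel) = (\<integral>\<theta>. J R \<theta> - J 0 \<theta> \<partial>sphere_measure)"
proof -
  let ?A = "{x. 0 < dist c x \<and> dist c x < R}"
  have "(\<integral>x. indicator (ball c R) x * f x \<partial>lborel) = (\<integral>x. indicator ?A x * f x \<partial>lborel)"
  proof (rule integral_cong_AE)
    have [measurable]: "f \<in> borel_measurable borel" by (rule borel_measurable_continuous_onI[OF f])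
    have [measurable]: "ball c R \<in> sets borel" by simp
    have "open ?A" by (intro open_Collect_conj open_Collect_less continuous_intros)
    then have [measurable]: "?A \<in> sets borel" by simp
    show "(\<lambda>x. indicator (ball c R) x * f x) \<in> borel_measurable lborel"
      "(\<lambda>x. indicator ?A x * f x) \<in> borel_measurable lborel" by measurable
    show "AE x in lborel. indicator (ball c R) x * f x = indicator ?A x * f x"
      using AE_lborel_singleton[of c] by eventually_elim (auto split: split_indicator)
  qed
  also have "\<dots> = (\<integral>\<theta>. J R \<theta> - J 0 \<theta> \<partial>sphere_measure)"
    by (rule integral_annulus_by_rays[OF _ R continuous_on_subset[OF f] Jm J]) auto
  finally show ?thesis .
qed

section \<open>Uniformly distributed measures\<close>

text \<open>Christensen's argument. The density of \<open>N\<close> on small balls around a point of the open set \<open>U\<close>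
  tends to \<open>1\<close>, so Fatou's lemma bounds \<open>M U\<close> by averages that Tonelli's theorem turns into
  integrals over \<open>U\<close> of the \<open>M\<close>-measures of balls.\<close>

lemma uniformly_distributed_open_le:
  fixes M N :: "'a::euclidean_space measure"
  assumes sets [measurable_cong, simp]: "sets M = sets borel" "sets N = sets borel"
    and sf: "sigma_finite_measure M" "sigma_finite_measure N"
    and X: "AE x in M. x \<in> X" "AE x in N. x \<in> X"
    and N: "\<And>x r. x \<in> X \<Longrightarrow> 0 < r \<Longrightarrow> emeasure N (ball x r) = g r" and g: "\<And>r. 0 < r \<Longrightarrow> 0 < g r \<and> g r < top"
    and M: "\<And>x r. x \<in> X \<Longrightarrow> 0 < r \<Longrightarrow> emeasure M (ball x r) = c * g r"
    and U: "open U"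
  shows "emeasure M U \<le> c * emeasure N U"
proof -
  interpret M: sigma_finite_measure M by fact
  interpret N: sigma_finite_measure N by fact
  interpret MN: pair_sigma_finite M N ..
  have Um [measurable]: "U \<in> sets borel" using U by simp
  define r where "r n = inverse (real (Suc n))" for n
  have r: "0 < r n" for n by (simp add: r_def)
  define F where "F n x = emeasure N (U \<inter> ball x (r n)) / g (r n)" for n x
  have gr: "g (r n) \<noteq> 0" "g (r n) \<noteq> top" for n using g[OF r[of n]] by auto
  have K [measurable]: "(\<lambda>(x, y). indicator U y * indicator {p::'a \<times> 'a. dist (fst p) (snd p) < r n} (x, y) :: ennreal)
      \<in> borel_measurable (borel \<Otimes>\<^sub>M borel)" for n
  proof -
    have "open {p::'a \<times> 'a. dist (fst p) (snd p) < r n}"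
      by (intro open_Collect_less continuous_intros)
    then have [measurable]: "{p::'a \<times> 'a. dist (fst p) (snd p) < r n} \<in> sets (borel \<Otimes>\<^sub>M borel)"
      unfolding borel_prod by (rule borel_open)
    show ?thesis by measurable
  qed
  have Feq: "emeasure N (U \<inter> ball x (r n)) =
      (\<integral>\<^sup>+y. indicator U y * indicator {p. dist (fst p) (snd p) < r n} (x, y) \<partial>N)" for n x
  proof -
    have "(\<integral>\<^sup>+y. indicator U y * indicator {p. dist (fst p) (snd p) < r n} (x, y) \<partial>N) =
        (\<integral>\<^sup>+y. indicator (U \<inter> ball x (r n)) y \<partial>N)"
      by (intro nn_integral_cong) (auto split: split_indicator)
    then show ?thesis by (simp add: nn_integral_indicator)
  qed
  have Fm: "F n \<in> borel_measurable M" for n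
    unfolding F_def Feq
    using N.borel_measurable_nn_integral_fst[of "\<lambda>(x, y). indicator U y * indicator {p::'a \<times> 'a. dist (fst p) (snd p) < r n} (x, y)" M] K[of n]
    by (intro borel_measurable_divide_ennreal) (auto simp: split_def cong: measurable_cong_sets)
  have "emeasure M U = (\<integral>\<^sup>+x. indicator U x \<partial>M)" by simp
  also have "\<dots> \<le> (\<integral>\<^sup>+x. liminf (\<lambda>n. F n x) \<partial>M)"
  proof (rule nn_integral_mono_AE)
    show "AE x in M. indicator U x \<le> liminf (\<lambda>n. F n x)"
      using X(1)
    proof eventually_elim
      case (elim x)
      show ?case
      proof (cases "x \<in> U")
        case True
        then obtain e where e: "e > 0" "ball x e \<subseteq> U" using U open_contains_ball by blast
        have "\<forall>\<^sub>F n in sequentially. r n < e"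
          using LIMSEQ_inverse_real_of_nat e(1) unfolding r_def by (rule order_tendstoD(2))
        then have "\<forall>\<^sub>F n in sequentially. 1 \<le> F n x"
        proof eventually_elim
          case (elim n)
          then have "U \<inter> ball x (r n) = ball x (r n)" using e(2) by auto
          then have "F n x = 1"
            using N[OF \<open>x \<in> X\<close> r[of n]] gr[of n] by (simp add: F_def ennreal_divide_self less_top)
          then show ?case by simp
        qed
        then show ?thesis using True by (auto intro: Liminf_bounded)
      qed simp
    qed
  qed
  also have "\<dots> \<le> liminf (\<lambda>n. \<integral>\<^sup>+x. F n x \<partial>M)"
    by (rule nn_integral_liminf) (rule Fm)
  also have "(\<lambda>n. \<integral>\<^sup>+x. F n x \<partial>M) = (\<lambda>n. c * emeasure N U)"
  proof
    fix n
    have "(\<integral>\<^sup>+x. F n x \<partial>M) =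
        (\<integral>\<^sup>+x. (\<integral>\<^sup>+y. indicator U y * indicator {p. dist (fst p) (snd p) < r n} (x, y) \<partial>N) \<partial>M) / g (r n)"
      unfolding F_def Feq
      using N.borel_measurable_nn_integral_fst[of "\<lambda>(x, y). indicator U y * indicator {p::'a \<times> 'a. dist (fst p) (snd p) < r n} (x, y)" M] K[of n]
      by (intro nn_integral_divide) (auto simp: split_def cong: measurable_cong_sets)
    also have "(\<integral>\<^sup>+x. (\<integral>\<^sup>+y. indicator U y * indicator {p. dist (fst p) (snd p) < r n} (x, y) \<partial>N) \<partial>M) =
        (\<integral>\<^sup>+y. (\<integral>\<^sup>+x. indicator U y * indicator {p. dist (fst p) (snd p) < r n} (x, y) \<partial>M) \<partial>N)"
      using K[of n]
      by (intro MN.Fubini'[of "\<lambda>x y. indicator U y * indicator {p. dist (fst p) (snd p) < r n} (x, y)", symmetric])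
        (auto cong: measurable_cong_sets)
    also have "\<dots> = (\<integral>\<^sup>+y. c * g (r n) * indicator U y \<partial>N)"
    proof (rule nn_integral_cong_AE)
      show "AE y in N. (\<integral>\<^sup>+x. indicator U y * indicator {p. dist (fst p) (snd p) < r n} (x, y) \<partial>M) =
          c * g (r n) * indicator U y"
        using X(2)
      proof eventually_elim
        case (elim y)
        have "(\<integral>\<^sup>+x. indicator U y * indicator {p. dist (fst p) (snd p) < r n} (x, y) \<partial>M) =
            (\<integral>\<^sup>+x. indicator U y * indicator (ball y (r n)) x \<partial>M)"
          by (intro nn_integral_cong) (auto simp: dist_commute split: split_indicator)
        also have "\<dots> = indicator U y * emeasure M (ball y (r n))"
          by (intro nn_integral_cmult_indicator) simp
        finally show ?case using M[OF elim r[of n]] by (simp add: mult.commute)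
      qed
    qed
    also have "\<dots> = c * g (r n) * emeasure N U"
      by (simp add: nn_integral_cmult_indicator)
    also have "c * g (r n) * emeasure N U / g (r n) = c * emeasure N U"
    proof -
      have "c * g (r n) * emeasure N U = c * emeasure N U * g (r n)" by (simp add: mult_ac)
      then show ?thesis using ennreal_mult_divide_eq[OF gr(1,2)] by simp
    qed
    finally show "(\<integral>\<^sup>+x. F n x \<partial>M) = c * emeasure N U" .
  qed
  finally show ?thesis by (simp add: Liminf_const)
qed

text \<open>Applying the inequality twice, with \<open>M\<close> and \<open>N\<close> exchanged, gives equality on open sets, and these
  generate the Borel sets.\<close>

lemma uniformly_distributed_eq:
  fixes M N :: "'a::euclidean_space measure"
  assumes sets: "sets M = sets borel" "sets N = sets borel"
    and sf: "sigma_finite_measure M" "sigma_finite_measure N"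
    and fin: "\<And>n::nat. emeasure M (ball 0 (real n)) < top"
    and X: "AE x in M. x \<in> X" "AE x in N. x \<in> X"
    and N: "\<And>x r. x \<in> X \<Longrightarrow> 0 < r \<Longrightarrow> emeasure N (ball x r) = g r" and g: "\<And>r. 0 < r \<Longrightarrow> 0 < g r \<and> g r < top"
    and M: "\<And>x r. x \<in> X \<Longrightarrow> 0 < r \<Longrightarrow> emeasure M (ball x r) = ennreal c * g r"
    and c: "0 < c"
  shows "E \<in> sets borel \<Longrightarrow> emeasure M E = ennreal c * emeasure N E"
proof -
  have inv: "ennreal (1 / c) * (ennreal c * a) = a" "ennreal c * (ennreal (1 / c) * a) = a" for a
    using c by (simp_all add: mult.assoc[symmetric] ennreal_mult'[symmetric])
  have eq: "emeasure M U = ennreal c * emeasure N U" if "open U" for U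
  proof (rule antisym)
    show "emeasure M U \<le> ennreal c * emeasure N U"
      by (rule uniformly_distributed_open_le[OF sets sf X N g M that])
    have "emeasure N U \<le> ennreal (1 / c) * emeasure M U"
    proof (rule uniformly_distributed_open_le[OF sets(2,1) sf(2,1) X(2,1), where g="\<lambda>r. ennreal c * g r"])
      show "0 < ennreal c * g r \<and> ennreal c * g r < top" if "0 < r" for r
        using g[OF that] c by (simp add: ennreal_zero_less_mult_iff ennreal_mult_less_top)
    qed (use M N inv that in auto)
    then have "ennreal c * emeasure N U \<le> ennreal c * (ennreal (1 / c) * emeasure M U)"
      by (rule mult_left_mono) simp
    then show "ennreal c * emeasure N U \<le> emeasure M U" by (simp add: inv)
  qed
  define N' where "N' = density N (\<lambda>_. ennreal c)"
  have N': "emeasure N' E = ennreal c * emeasure N E" if "E \<in> sets borel" for E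
    using that sets unfolding N'_def by (subst emeasure_density) (auto simp: nn_integral_cmult_indicator)
  have "M = N'"
  proof (rule measure_eqI_generator_eq[where E="{U. open U}" and \<Omega>=UNIV and A="\<lambda>n. ball 0 (real n)"])
    show "Int_stable {U::'a set. open U}" by (auto simp: Int_stable_def)
    have s: "sets borel = sigma_sets UNIV {U::'a set. open U}" by (simp add: borel_def)
    show "sets M = sigma_sets UNIV {U. open U}" "sets N' = sigma_sets UNIV {U. open U}"
      using sets s by (simp_all add: N'_def)
    show "emeasure M U = emeasure N' U" if "U \<in> {U. open U}" for U
      using that eq N' by simp
    show "emeasure M (ball 0 (real n)) \<noteq> \<infinity>" for n using fin[of n] by auto
    show "(\<Union>n. ball 0 (real n)) = (UNIV :: 'a set)"
      using reals_Archimedean2 by auto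
  qed auto
  then show "E \<in> sets borel \<Longrightarrow> emeasure M E = ennreal c * emeasure N E" using N' by simp
qed

lemma emeasure_lborel_ball:
  "0 \<le> r \<Longrightarrow> emeasure lborel (ball (x::'a::euclidean_space) r) = ennreal (unit_ball_vol (real DIM('a)) * r ^ DIM('a))"
  by (rule emeasure_ball)

lemma orthogonal_transformation_dist:
  assumes "orthogonal_transformation f" shows "dist (f x) (f y) = dist x y"
  using assms orthogonal_transformation_norm[OF assms, of "x - y"]
  by (simp add: dist_norm orthogonal_transformation_def linear_diff)

text \<open>The image of Lebesgue measure gives every ball its volume, so it is uniformly distributed and
  coincides with Lebesgue measure.\<close>

lemma emeasure_lborel_orthogonal:
  fixes f :: "'a::euclidean_space \<Rightarrow> 'a"
  assumes f: "orthogonal_transformation f" and E: "E \<in> sets borel"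
  shows "emeasure lborel (f -` E) = emeasure lborel E"
proof -
  have lf: "linear f" using f by (simp add: orthogonal_transformation_def)
  have fm [measurable]: "f \<in> borel_measurable borel"
    using linear_continuous_on[OF lf[unfolded linear_conv_bounded_linear]] by (rule borel_measurable_continuous_onI)
  have ball: "emeasure (distr lborel borel f) (ball x r) = emeasure lborel (ball (0::'a) r)" for x r
  proof -
    obtain y where y: "x = f y" using orthogonal_transformation_surj[OF f] by (metis surjD)
    have "f -` ball x r = ball y r"
      unfolding y by (auto simp: orthogonal_transformation_dist[OF f])
    then have "emeasure (distr lborel borel f) (ball x r) = emeasure lborel (ball y r)"
      by (subst emeasure_distr) auto
    also have "\<dots> = emeasure lborel (ball (0::'a) r)"
      by (cases "0 \<le> r") (simp_all add: emeasure_lborel_ball ball_empty)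
    finally show ?thesis .
  qed
  have "emeasure (distr lborel borel f) E = ennreal 1 * emeasure lborel E"
  proof (rule uniformly_distributed_eq[where X=UNIV and g="\<lambda>r. emeasure lborel (ball (0::'a) r)"])
    show "sigma_finite_measure (lborel :: 'a measure)" by unfold_locales
    show "sigma_finite_measure (distr lborel borel f)"
    proof (rule sigma_finite_measure.intro, intro exI conjI ballI)
      show "countable (range (\<lambda>n::nat. ball (0::'a) (real n)))" by simp
      show "\<Union> (range (\<lambda>n::nat. ball 0 (real n))) = space (distr lborel borel f)"
        using reals_Archimedean2 by auto
    qed (use ball emeasure_lborel_ball_finite[of "0::'a"] in \<open>auto simp: less_top\<close>)
    show "emeasure (distr lborel borel f) (ball 0 (real n)) < top" for n
      using ball emeasure_lborel_ball_finite[of "0::'a" n] by simp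
    show "emeasure lborel (ball x r) = emeasure lborel (ball (0::'a) r)" if "0 < r" for x :: 'a and r
      using that by (simp add: emeasure_lborel_ball)
    show "0 < emeasure lborel (ball (0::'a) r) \<and> emeasure lborel (ball (0::'a) r) < top" if "0 < r" for r
    proof -
      have "0 < unit_ball_vol (real DIM('a)) * r ^ DIM('a)"
        using that by (intro mult_pos_pos unit_ball_vol_pos zero_less_power) auto
      then show ?thesis
        using that emeasure_lborel_ball_finite[of "0::'a" r] by (simp add: emeasure_lborel_ball[of r "0::'a"])
    qed
  qed (use ball E in auto)
  then show ?thesis using E by (simp add: emeasure_distr)
qed

lemma emeasure_sphere_measure_orthogonal:
  fixes f :: "'a::euclidean_space \<Rightarrow> 'a"
  assumes f: "orthogonal_transformation f" and E: "E \<in> sets borel"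
  shows "emeasure sphere_measure (f -` E) = emeasure sphere_measure E"
proof -
  have lf: "linear f" using f by (simp add: orthogonal_transformation_def)
  have fm: "f \<in> borel_measurable borel"
    using linear_continuous_on[OF lf[unfolded linear_conv_bounded_linear]] by (rule borel_measurable_continuous_onI)
  have fE: "f -` E \<in> sets borel" by (rule measurable_sets_borel[OF fm E])
  have sE: "(sgn -` E :: 'a set) \<in> sets borel"
    using measurable_sets_borel[OF borel_measurable_sgn E] by simp
  have "sgn (f x) = f (sgn x)" for x
    using orthogonal_transformation_norm[OF f] by (simp add: sgn_div_norm linear_scale[OF lf])
  then have "ball 0 1 \<inter> sgn -` (f -` E) = f -` (ball 0 1 \<inter> sgn -` E)"
    using orthogonal_transformation_norm[OF f] by auto
  then show ?thesis
    using emeasure_lborel_orthogonal[OF f, of "ball 0 1 \<inter> sgn -` E"] sE E fE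
    by (simp add: emeasure_sphere_measure)
qed

text \<open>The reflection in the hyperplane orthogonal to \<open>x - y\<close> exchanges \<open>x\<close> and \<open>y\<close>.\<close>

lemma orthogonal_transformation_exists_sphere:
  fixes x y :: "'a::euclidean_space"
  assumes "norm x = norm y"
  obtains f where "orthogonal_transformation f" "f x = y"
proof -
  define v where "v = x - y"
  define f where "f z = z - (2 * (z \<bullet> v) / (v \<bullet> v)) *\<^sub>R v" for z
  have "linear f" unfolding f_def
    by (intro linearI) (auto simp: algebra_simps inner_add_left add_divide_distrib)
  moreover have "f z \<bullet> f w = z \<bullet> w" for z w
    by (cases "v = 0") (simp_all add: f_def inner_diff_left inner_diff_right inner_commute field_simps)
  moreover have "f x = y"
  proof (cases "v = 0")
    case False
    have "v \<bullet> v = 2 * (x \<bullet> v)"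
      using assms by (simp add: v_def inner_diff_left inner_diff_right inner_commute norm_eq)
    then have "2 * (x \<bullet> v) / (v \<bullet> v) = 1" using False by (metis divide_self inner_eq_zero_iff)
    then have "f x = x - 1 *\<^sub>R v" by (simp only: f_def)
    then show ?thesis by (simp add: v_def)
  qed (simp add: f_def v_def)
  ultimately show thesis using that by (auto simp: orthogonal_transformation_def)
qed

section \<open>Hausdorff measure on spheres\<close>

lemma emeasure_sphere_measure_ball:
  fixes x y :: "'a::euclidean_space"
  assumes "norm x = 1" "norm y = 1"
  shows "emeasure sphere_measure (ball x r) = emeasure sphere_measure (ball y r)"
proof -
  obtain f where f: "orthogonal_transformation f" "f x = y"
    using orthogonal_transformation_exists_sphere[of x y] assms by auto
  have "f -` ball y r = ball x r"
    using orthogonal_transformation_dist[OF f(1)] f(2) by auto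
  then show ?thesis using emeasure_sphere_measure_orthogonal[OF f(1), of "ball y r"] by simp
qed

lemma norm_diff_sgn:
  fixes y :: "'a::real_normed_vector"
  assumes "y \<noteq> 0"
  shows "norm (y - sgn y) = \<bar>norm y - 1\<bar>"
proof -
  have "y - sgn y = (1 - inverse (norm y)) *\<^sub>R y" by (simp add: sgn_div_norm scaleR_diff_left)
  then have "norm (y - sgn y) = \<bar>1 - inverse (norm y)\<bar> * \<bar>norm y\<bar>" by simp
  also have "\<dots> = \<bar>norm y - 1\<bar>" unfolding abs_mult[symmetric] using assms by (simp add: left_diff_distrib)
  finally show ?thesis .
qed

lemma radial_measure_Icc_bounds:
  fixes d :: nat
  assumes "0 \<le> a" "a \<le> b" and d: "d = DIM('a::euclidean_space)"
  shows "ennreal ((b - a) * a ^ (d - 1)) \<le> emeasure (radial_measure TYPE('a)) {a..b}"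
    and "emeasure (radial_measure TYPE('a)) {a..b} \<le> ennreal ((b - a) * b ^ (d - 1))"
proof -
  have e: "emeasure (radial_measure TYPE('a)) {a..b} =
      (\<integral>\<^sup>+r. ennreal (r ^ (d - 1)) * indicator {0<..} r * indicator {a..b} r \<partial>lborel)"
    unfolding radial_measure_def d by (subst emeasure_density) auto
  have c: "(\<integral>\<^sup>+r. ennreal k * indicator {a..b} r \<partial>lborel) = ennreal ((b - a) * k)" if "k \<ge> 0" for k
    using assms(2) that by (subst nn_integral_cmult_indicator) (auto simp: ennreal_mult'[symmetric] mult.commute)
  have "ennreal ((b - a) * a ^ (d - 1)) = (\<integral>\<^sup>+r. ennreal (a ^ (d - 1)) * indicator {a..b} r \<partial>lborel)"
    using assms by (simp add: c)
  also have "\<dots> \<le> emeasure (radial_measure TYPE('a)) {a..b}"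
    unfolding e using AE_lborel_singleton[of "0::real"] assms(1)
    by (intro nn_integral_mono_AE) (auto elim!: eventually_mono split: split_indicator intro!: ennreal_leI power_mono)
  finally show "ennreal ((b - a) * a ^ (d - 1)) \<le> emeasure (radial_measure TYPE('a)) {a..b}" .
  have "emeasure (radial_measure TYPE('a)) {a..b} \<le> (\<integral>\<^sup>+r. ennreal (b ^ (d - 1)) * indicator {a..b} r \<partial>lborel)"
    unfolding e using assms(1) by (intro nn_integral_mono) (auto split: split_indicator intro!: ennreal_leI power_mono)
  also have "\<dots> = ennreal ((b - a) * b ^ (d - 1))" using assms by (simp add: c)
  finally show "emeasure (radial_measure TYPE('a)) {a..b} \<le> ennreal ((b - a) * b ^ (d - 1))" .
qed

text \<open>The part of the sphere within distance \<open>r\<close> of \<open>x\<close> spans a conical piece of thickness \<open>r\<close>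
  that lies inside a ball of radius \<open>2r\<close>, and another one that contains a ball of radius \<open>r/2\<close>. So
  its cone measure is comparable with \<open>r\<^sup>d\<^sup>-\<^sup>1\<close>.\<close>

lemma sphere_measure_cball_le:
  assumes x: "norm (x::'a::euclidean_space) = 1" and d: "DIM('a) \<ge> 2" and r: "0 \<le> r"
  shows "emeasure sphere_measure (cball x r) \<le> ennreal (unit_ball_vol (real DIM('a)) * 2 ^ DIM('a) * r ^ (DIM('a) - 1))"
proof -
  let ?d = "DIM('a)" and ?v = "unit_ball_vol (real DIM('a))"
  have v: "?v \<ge> 0" by simp
  have pos: "emeasure sphere_measure (cball x r) \<le> ennreal (?v * 2 ^ ?d * r ^ (?d - 1))" if r: "0 < r" for r
  proof -
    have "ennreal r * emeasure sphere_measure (cball x r) \<le>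
        emeasure (radial_measure TYPE('a)) {1..1 + r} * emeasure sphere_measure (cball x r)"
      using radial_measure_Icc_bounds(1)[of 1 "1 + r", OF _ _ refl, where 'a='a] r
      by (intro mult_right_mono) auto
    also have "\<dots> = emeasure lborel {y::'a. norm y \<in> {1..1 + r} \<and> sgn y \<in> cball x r}"
      by (rule emeasure_lborel_polar[symmetric]) auto
    also have "\<dots> \<le> emeasure lborel (cball x (2 * r))"
    proof (rule emeasure_mono)
      show "{y::'a. norm y \<in> {1..1 + r} \<and> sgn y \<in> cball x r} \<subseteq> cball x (2 * r)"
      proof safe
        fix y :: 'a assume y: "norm y \<in> {1..1 + r}" "sgn y \<in> cball x r"
        then have "y \<noteq> 0" by auto
        then have "norm (y - sgn y) \<le> r" using y by (simp add: norm_diff_sgn)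
        then show "y \<in> cball x (2 * r)"
          using y dist_triangle[of x y "sgn y"] by (simp add: dist_norm norm_minus_commute)
      qed
    qed auto
    also have "\<dots> = ennreal (?v * (2 * r) ^ ?d)"
      using r by (subst emeasure_cball) auto
    also have "\<dots> = ennreal r * ennreal (?v * 2 ^ ?d * r ^ (?d - 1))"
    proof -
      have "(2 * r) ^ ?d = 2 ^ ?d * (r * r ^ (?d - 1))"
        using d by (simp add: power_mult_distrib power_Suc[symmetric] del: power_Suc)
      then show ?thesis using r v by (simp add: ennreal_mult'[symmetric] mult_ac)
    qed
    finally show ?thesis using r by (subst (asm) ennreal_mult_le_mult_iff) auto
  qed
  show ?thesis
  proof (cases "r = 0")
    case True
    \<comment> \<open>The radius \<open>0\<close> is reached as a limit, by monotonicity.\<close>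
    have "((\<lambda>t. ennreal (?v * 2 ^ ?d * t ^ (?d - 1))) \<longlongrightarrow> ennreal (?v * 2 ^ ?d * 0 ^ (?d - 1))) (at_right 0)"
      by (intro tendsto_ennrealI tendsto_intros)
    moreover have "\<forall>\<^sub>F t in at_right 0. emeasure sphere_measure (cball x 0) \<le> ennreal (?v * 2 ^ ?d * t ^ (?d - 1))"
    proof (rule eventually_at_rightI)
      fix t :: real assume "t \<in> {0<..<1}"
      then have "emeasure sphere_measure (cball x 0) \<le> emeasure sphere_measure (cball x t)"
        by (intro emeasure_mono) auto
      also have "\<dots> \<le> ennreal (?v * 2 ^ ?d * t ^ (?d - 1))" using \<open>t \<in> _\<close> by (intro pos) auto
      finally show "emeasure sphere_measure (cball x 0) \<le> ennreal (?v * 2 ^ ?d * t ^ (?d - 1))" .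
    qed simp
    ultimately show ?thesis unfolding True by (rule tendsto_lowerbound) simp
  qed (use pos r in auto)
qed

lemma sphere_measure_ball_ge:
  assumes x: "norm (x::'a::euclidean_space) = 1" and r: "0 < r" "r \<le> 1"
  shows "ennreal (unit_ball_vol (real DIM('a)) / 4 ^ DIM('a) * r ^ (DIM('a) - 1)) \<le> emeasure sphere_measure (ball x r)"
proof -
  let ?d = "DIM('a)" and ?v = "unit_ball_vol (real DIM('a))"
  have v: "?v \<ge> 0" by simp
  have [measurable]: "ball x r \<in> sets borel" by simp
  have "ennreal (?v * (r / 2) ^ ?d) = emeasure lborel (ball x (r / 2))"
    using r by (subst emeasure_lborel_ball) auto
  also have "\<dots> \<le> emeasure lborel {y::'a. norm y \<in> {1 - r / 2..1 + r / 2} \<and> sgn y \<in> ball x r}"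
  proof (rule emeasure_mono)
    show "ball x (r / 2) \<subseteq> {y::'a. norm y \<in> {1 - r / 2..1 + r / 2} \<and> sgn y \<in> ball x r}"
    proof safe
      fix y assume y: "y \<in> ball x (r / 2)"
      have n: "\<bar>norm y - 1\<bar> < r / 2"
        using y x norm_triangle_ineq3[of y x] by (simp add: dist_norm norm_minus_commute)
      then show "norm y \<in> {1 - r / 2..1 + r / 2}" unfolding abs_less_iff atLeastAtMost_iff by linarith
      have "y \<noteq> 0" using n r by auto
      then have "norm (y - sgn y) = \<bar>norm y - 1\<bar>" by (rule norm_diff_sgn)
      then show "sgn y \<in> ball x r"
        using y n dist_triangle[of x "sgn y" y] by (simp add: dist_norm norm_minus_commute)
    qed
  qed measurable
  also have "\<dots> = emeasure (radial_measure TYPE('a)) {1 - r / 2..1 + r / 2} * emeasure sphere_measure (ball x r)"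
    by (rule emeasure_lborel_polar) auto
  also have "\<dots> \<le> ennreal (r * 2 ^ (?d - 1)) * emeasure sphere_measure (ball x r)"
  proof (rule mult_right_mono)
    have "emeasure (radial_measure TYPE('a)) {1 - r / 2..1 + r / 2} \<le> ennreal (r * (1 + r / 2) ^ (?d - 1))"
      using radial_measure_Icc_bounds(2)[of "1 - r / 2" "1 + r / 2", OF _ _ refl, where 'a='a] r by simp
    also have "\<dots> \<le> ennreal (r * 2 ^ (?d - 1))"
      using r by (intro ennreal_leI mult_left_mono power_mono) auto
    finally show "emeasure (radial_measure TYPE('a)) {1 - r / 2..1 + r / 2} \<le> ennreal (r * 2 ^ (?d - 1))" .
  qed simp
  finally have le: "ennreal (?v * (r / 2) ^ ?d) \<le> ennreal (r * 2 ^ (?d - 1)) * emeasure sphere_measure (ball x r)" .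
  have "?v * (r / 2) ^ ?d = (r * 2 ^ (?d - 1)) * (?v * 2 / 4 ^ ?d * r ^ (?d - 1))"
  proof -
    obtain k where k: "?d = Suc k" using DIM_positive[where 'a='a] not0_implies_Suc by blast
    have "(4::real) ^ k = (2 * 2) ^ k" by simp
    then have "(4::real) ^ k = 2 ^ k * 2 ^ k" by (simp only: power_mult_distrib)
    then show ?thesis unfolding k by (simp add: field_simps power_divide)
  qed
  then have "ennreal (r * 2 ^ (?d - 1)) * ennreal (?v * 2 / 4 ^ ?d * r ^ (?d - 1)) \<le>
      ennreal (r * 2 ^ (?d - 1)) * emeasure sphere_measure (ball x r)"
    using le r v by (simp add: ennreal_mult'[symmetric])
  then have "ennreal (?v * 2 / 4 ^ ?d * r ^ (?d - 1)) \<le> emeasure sphere_measure (ball x r)"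
    using r by (subst (asm) ennreal_mult_le_mult_iff) auto
  moreover have "ennreal (?v / 4 ^ ?d * r ^ (?d - 1)) \<le> ennreal (?v * 2 / 4 ^ ?d * r ^ (?d - 1))"
    using r v by (intro ennreal_leI mult_right_mono divide_right_mono) auto
  ultimately show ?thesis by (rule order_trans[rotated])
qed

text \<open>Mass distribution principle: a set \<open>C\<close> of diameter \<open>D\<close> that meets the sphere lies in a ball of
  radius \<open>D\<close> around one of its points on the sphere, so its cone measure is \<open>O(D\<^sup>d\<^sup>-\<^sup>1)\<close>, and every cover has
  total size at least a multiple of the cone measure of the sphere.\<close>

lemma hausdorff_sphere_pos:
  assumes d: "DIM('a::euclidean_space) \<ge> 2"
  shows "0 < hausdorff_outer_measure (DIM('a) - 1) (sphere (0::'a) 1)"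
proof -
  let ?d = "DIM('a)" and ?S = "sphere (0::'a) 1" and ?\<sigma> = "sphere_measure :: 'a measure"
  define K where "K = unit_ball_vol (real ?d) * 2 ^ ?d"
  define w where "w = unit_ball_vol (real (?d - 1)) / 2 ^ (?d - 1)"
  have K: "0 < K" and w: "0 < w" by (auto simp: K_def w_def unit_ball_vol_pos)
  have S: "emeasure ?\<sigma> UNIV = emeasure ?\<sigma> ?S"
    using AE_sphere_measure[where 'a='a] by (intro emeasure_eq_AE) auto
  have "ennreal (w / K) * emeasure ?\<sigma> UNIV \<le> hausdorff_premeasure (?d - 1) 1 ?S"
    unfolding hausdorff_premeasure_alt
  proof (rule INF_greatest)
    fix C assume C: "C \<in> covers 1 ?S"
    define B where "B n = (if C n \<inter> ?S = {} then {} else cball (SOME x. x \<in> C n \<inter> ?S) (diameter (C n)))" for n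
    have some: "(SOME x. x \<in> C n \<inter> ?S) \<in> C n \<inter> ?S" if "C n \<inter> ?S \<noteq> {}" for n
      using that by (rule_tac someI_ex) blast
    have bC: "bounded (C n)" for n using C by (auto simp: covers_def)
    have Bm: "B n \<in> sets borel" for n by (simp add: B_def)
    have "?S \<subseteq> (\<Union>n. B n)"
    proof
      fix x assume x: "x \<in> ?S"
      then obtain n where n: "x \<in> C n" using C by (auto simp: covers_def)
      then have ne: "C n \<inter> ?S \<noteq> {}" using x by blast
      then have "x \<in> B n"
        using some[OF ne] n diameter_bounded_bound[OF bC[of n]] by (auto simp: B_def)
      then show "x \<in> (\<Union>n. B n)" by blast
    qed
    then have "emeasure ?\<sigma> UNIV \<le> emeasure ?\<sigma> (\<Union>n. B n)"
      unfolding S using Bm by (intro emeasure_mono) auto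
    also have "\<dots> \<le> (\<Sum>n. emeasure ?\<sigma> (B n))"
      using Bm by (intro emeasure_subadditive_countably) auto
    finally have "ennreal (w / K) * emeasure ?\<sigma> UNIV \<le> (\<Sum>n. ennreal (w / K) * emeasure ?\<sigma> (B n))"
      unfolding ennreal_suminf_cmult by (rule mult_left_mono) simp
    also have "\<dots> \<le> (\<Sum>n. hausdorff_gauge (?d - 1) (C n))"
    proof (intro suminf_le)
      fix n
      show "ennreal (w / K) * emeasure ?\<sigma> (B n) \<le> hausdorff_gauge (?d - 1) (C n)"
      proof (cases "C n \<inter> ?S = {}")
        case False
        let ?D = "diameter (C n)"
        have D: "0 \<le> ?D" using bC by (rule diameter_ge_0)
        have "emeasure ?\<sigma> (B n) \<le> ennreal (K * ?D ^ (?d - 1))"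
          using sphere_measure_cball_le[OF _ d D, of "SOME x. x \<in> C n \<inter> ?S"] some[OF False] False
          by (simp add: B_def K_def)
        then have "ennreal (w / K) * emeasure ?\<sigma> (B n) \<le> ennreal (w / K) * ennreal (K * ?D ^ (?d - 1))"
          by (rule mult_left_mono) simp
        also have "\<dots> = hausdorff_gauge (?d - 1) (C n)"
          using K w D by (simp add: hausdorff_gauge_def w_def ennreal_mult'[symmetric] power_divide)
        finally show ?thesis .
      qed (simp add: B_def)
    qed auto
    finally show "ennreal (w / K) * emeasure ?\<sigma> UNIV \<le> (\<Sum>n. hausdorff_gauge (?d - 1) (C n))" .
  qed
  also have "\<dots> \<le> hausdorff_outer_measure (?d - 1) ?S" by (rule hausdorff_premeasure_le_outer) simp
  finally have le: "ennreal (w / K) * emeasure ?\<sigma> UNIV \<le> hausdorff_outer_measure (?d - 1) ?S" .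
  have "0 < ennreal (w / K) * emeasure ?\<sigma> UNIV"
    using K w sphere_measure_pos[where 'a='a] by (simp add: ennreal_zero_less_mult_iff)
  then show ?thesis using le by (rule less_le_trans)
qed

text \<open>A maximal \<open>e\<close>-separated set on the sphere has at most \<open>O(e\<^sup>1\<^sup>-\<^sup>d)\<close> points, because the caps of
  radius \<open>e/2\<close> around them are disjoint, and its caps of radius \<open>e\<close> cover the sphere.\<close>

lemma hausdorff_sphere_finite:
  assumes d: "DIM('a::euclidean_space) \<ge> 2"
  shows "hausdorff_outer_measure (DIM('a) - 1) (sphere (0::'a) 1) < top"
proof -
  let ?d = "DIM('a)" and ?S = "sphere (0::'a) 1" and ?\<sigma> = "sphere_measure :: 'a measure"
  interpret finite_measure ?\<sigma> by (rule finite_measure_sphere_measure)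
  define k where "k = unit_ball_vol (real ?d) / 4 ^ ?d"
  define w where "w = unit_ball_vol (real (?d - 1))"
  have k: "0 < k" and w: "0 < w" by (auto simp: k_def w_def unit_ball_vol_pos)
  define L where "L = w * (measure ?\<sigma> UNIV * 2 ^ (?d - 1) / k)"
  have pre: "hausdorff_premeasure (?d - 1) \<delta> ?S \<le> ennreal L" if \<delta>: "\<delta> > 0" for \<delta>
  proof -
    define e where "e = min 1 (\<delta> / 2)"
    have e: "0 < e" "e \<le> 1" "2 * e \<le> \<delta>" using \<delta> by (auto simp: e_def)
    define sep where "sep F \<longleftrightarrow> finite F \<and> F \<subseteq> ?S \<and> (\<forall>x\<in>F. \<forall>y\<in>F. x \<noteq> y \<longrightarrow> e \<le> dist x y)" for F :: "'a set"
    have bound: "real (card F) * (k * (e / 2) ^ (?d - 1)) \<le> measure ?\<sigma> UNIV" if "sep F" for F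
    proof -
      have fin: "finite F" and FS: "F \<subseteq> ?S" using that by (auto simp: sep_def)
      have disj: "disjoint_family_on (\<lambda>x. ball x (e / 2)) F"
        unfolding disjoint_family_on_def
      proof (intro ballI impI)
        fix x y assume xy: "x \<in> F" "y \<in> F" "x \<noteq> y"
        then have "e \<le> dist x y" using that by (auto simp: sep_def)
        then show "ball x (e / 2) \<inter> ball y (e / 2) = {}"
          using disjoint_ballI[of "e / 2" "e / 2" x y] by simp
      qed
      have "real (card F) * (k * (e / 2) ^ (?d - 1)) = (\<Sum>x\<in>F. k * (e / 2) ^ (?d - 1))" by simp
      also have "\<dots> \<le> (\<Sum>x\<in>F. measure ?\<sigma> (ball x (e / 2)))"
      proof (rule sum_mono)
        fix x assume "x \<in> F"
        then have "norm x = 1" using FS by auto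
        then have "ennreal (k * (e / 2) ^ (?d - 1)) \<le> emeasure ?\<sigma> (ball x (e / 2))"
          using sphere_measure_ball_ge[of x "e / 2"] e by (simp add: k_def)
        then show "k * (e / 2) ^ (?d - 1) \<le> measure ?\<sigma> (ball x (e / 2))"
          by (simp add: emeasure_eq_measure ennreal_le_iff)
      qed
      also have "\<dots> = measure ?\<sigma> (\<Union>x\<in>F. ball x (e / 2))"
        using fin disj by (intro finite_measure_finite_Union[symmetric]) auto
      also have "\<dots> \<le> measure ?\<sigma> UNIV" by (intro finite_measure_mono) auto
      finally show ?thesis .
    qed
    define N where "N = nat \<lfloor>measure ?\<sigma> UNIV / (k * (e / 2) ^ (?d - 1))\<rfloor>"
    have "card F \<le> N" if "sep F" for F
      using bound[OF that] k e by (simp add: N_def le_nat_floor pos_le_divide_eq)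
    moreover have "sep {}" by (simp add: sep_def)
    ultimately obtain F where F: "sep F" and max: "\<And>G. sep G \<Longrightarrow> card G \<le> card F"
      using ex_has_greatest_nat[of sep "{}" card "Suc N"] by (auto simp: less_Suc_eq_le)
    have fin: "finite F" using F by (simp add: sep_def)
    have cov: "?S \<subseteq> (\<Union>x\<in>F. cball x e)"
    proof (rule ccontr)
      assume "\<not> ?S \<subseteq> (\<Union>x\<in>F. cball x e)"
      then obtain y where y: "y \<in> ?S" "y \<notin> (\<Union>x\<in>F. cball x e)" by blast
      then have far: "e < dist x y" if "x \<in> F" for x using that by (auto simp: not_le)
      then have "y \<notin> F" using e by force
      moreover have "sep (insert y F)"
        unfolding sep_def
      proof (intro conjI ballI impI)
        fix u v assume uv: "u \<in> insert y F" "v \<in> insert y F" "u \<noteq> v"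
        then consider "u \<in> F" "v \<in> F" | "u = y" "v \<in> F" | "u \<in> F" "v = y" by blast
        then show "e \<le> dist u v"
          by cases (use F uv far in \<open>auto simp: sep_def dist_commute intro: less_imp_le\<close>)
      qed (use F y in \<open>auto simp: sep_def\<close>)
      ultimately show False using max[of "insert y F"] fin by simp
    qed
    obtain h where h: "bij_betw h {..<card F} F" using fin by (metis bij_betw_from_nat_into_finite)
    define C where "C n = (if n < card F then cball (h n) e else {})" for n
    have diam: "diameter (C n) \<le> 2 * e" for n
      using e by (auto simp: C_def intro!: diameter_le dist_triangle_le)
    have "C \<in> covers \<delta> ?S"
    proof -
      have "?S \<subseteq> (\<Union>n. C n)"
      proof
        fix x assume "x \<in> ?S"
        then obtain y where y: "y \<in> F" "x \<in> cball y e" using cov by blast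
        have "h ` {..<card F} = F" using h by (simp add: bij_betw_def)
        then have "y \<in> h ` {..<card F}" using y(1) by simp
        then obtain n where "n < card F" "h n = y" by blast
        then have "x \<in> C n" using y by (simp add: C_def)
        then show "x \<in> (\<Union>n. C n)" by blast
      qed
      moreover have "diameter (C n) \<le> \<delta>" for n using diam[of n] e by linarith
      moreover have "bounded (C n)" for n by (simp add: C_def)
      ultimately show ?thesis by (simp add: covers_def)
    qed
    then have "hausdorff_premeasure (?d - 1) \<delta> ?S \<le> (\<Sum>n. hausdorff_gauge (?d - 1) (C n))"
      by (rule hausdorff_premeasure_le)
    also have "\<dots> = (\<Sum>n<card F. hausdorff_gauge (?d - 1) (C n))"
      using d by (intro suminf_finite) (auto simp: C_def hausdorff_gauge_empty)
    also have "\<dots> \<le> (\<Sum>n<card F. ennreal (w * e ^ (?d - 1)))"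
    proof (rule sum_mono)
      fix n
      have "0 \<le> diameter (C n)" by (rule diameter_ge_0) (simp add: C_def)
      then show "hausdorff_gauge (?d - 1) (C n) \<le> ennreal (w * e ^ (?d - 1))"
        unfolding hausdorff_gauge_def w_def using diam[of n]
        by (intro ennreal_leI mult_left_mono power_mono) auto
    qed
    also have "\<dots> = ennreal (real (card F) * (w * e ^ (?d - 1)))"
      using w e by (simp add: ennreal_mult' ennreal_of_nat_eq_real_of_nat)
    also have "\<dots> \<le> ennreal L"
    proof (rule ennreal_leI)
      have "real (card F) * e ^ (?d - 1) \<le> measure ?\<sigma> UNIV * 2 ^ (?d - 1) / k"
        using bound[OF F] k by (simp add: field_simps power_divide)
      then have "w * (real (card F) * e ^ (?d - 1)) \<le> L"
        unfolding L_def using w by (intro mult_left_mono) auto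
      then show "real (card F) * (w * e ^ (?d - 1)) \<le> L" by (simp only: mult.left_commute)
    qed
    finally show ?thesis .
  qed
  then have "hausdorff_outer_measure (?d - 1) ?S \<le> ennreal L"
    unfolding hausdorff_outer_measure_def by (intro SUP_least) auto
  then show ?thesis by (rule le_less_trans) simp
qed

text \<open>On the unit sphere, Hausdorff and cone measure are both invariant under rotations, hence
  proportional. The proportionality factor (which is \<open>1\<close>) is the same on all spheres by scaling, and
  its value only rescales the parameter of the Robin problem.\<close>

lemma hausdorff_unit_sphere:
  assumes d: "DIM('a::euclidean_space) \<ge> 2"
  shows "\<exists>\<kappa>>0. \<forall>E\<in>sets borel. hausdorff_outer_measure (DIM('a) - 1) (E \<inter> sphere (0::'a) 1) =
    ennreal \<kappa> * emeasure sphere_measure E"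
proof -
  let ?k = "DIM('a) - 1" and ?S = "sphere (0::'a) 1" and ?\<sigma> = "sphere_measure :: 'a measure"
  let ?H = "hausdorff_outer_measure ?k :: 'a set \<Rightarrow> ennreal"
  have k: "?k \<ge> 1" using d by simp
  define M where "M = density (hausdorff_measure ?k) (indicator ?S)"
  have sM [simp, measurable_cong]: "sets M = sets borel" and spM [simp]: "space M = UNIV" by (simp_all add: M_def)
  have Sm: "?S \<in> sets borel" by simp
  have M: "emeasure M E = ?H (E \<inter> ?S)" if E: "E \<in> sets borel" for E
  proof -
    have "emeasure M E = (\<integral>\<^sup>+x. indicator ?S x * indicator E x \<partial>hausdorff_measure ?k)"
      unfolding M_def using E by (intro emeasure_density borel_measurable_indicator) auto
    also have "\<dots> = (\<integral>\<^sup>+x. indicator (E \<inter> ?S) x \<partial>hausdorff_measure ?k)"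
      by (intro nn_integral_cong) (auto split: split_indicator)
    also have "\<dots> = ?H (E \<inter> ?S)"
      using E emeasure_hausdorff_measure[OF k, of "E \<inter> ?S"] by simp
    finally show ?thesis .
  qed
  interpret S: finite_measure ?\<sigma> by (rule finite_measure_sphere_measure)
  interpret M: finite_measure M
  proof
    have "emeasure M UNIV < top" using hausdorff_sphere_finite[OF d] M[of UNIV] by simp
    then show "emeasure M (space M) \<noteq> \<infinity>" by simp
  qed
  interpret MS: pair_sigma_finite M ?\<sigma> ..
  obtain x0 :: 'a where x0: "norm x0 = 1" using vector_choose_size[of 1] by auto
  define g where "g r = emeasure ?\<sigma> (ball x0 r)" for r
  define h where "h r = emeasure M (ball x0 r)" for r
  have g: "emeasure ?\<sigma> (ball x r) = g r" if "norm x = 1" for x r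
    unfolding g_def by (rule emeasure_sphere_measure_ball[OF that x0])
  have Hle: "?H (ball y r \<inter> ?S) \<le> ?H (ball x r \<inter> ?S)" if xy: "norm x = 1" "norm y = 1" for x y :: 'a and r
  proof -
    obtain f where f: "orthogonal_transformation f" "f x = y"
      using orthogonal_transformation_exists_sphere[of x y] xy by auto
    note fd = orthogonal_transformation_dist[OF f(1)]
    have "ball y r \<inter> ?S \<subseteq> f ` (ball x r \<inter> ?S)"
    proof
      fix z assume z: "z \<in> ball y r \<inter> ?S"
      obtain w where w: "z = f w" using orthogonal_transformation_surj[OF f(1)] by (metis surjD)
      then have "w \<in> ball x r \<inter> ?S"
        using z fd[of x w] f(2) orthogonal_transformation_norm[OF f(1), of w] by simp
      then show "z \<in> f ` (ball x r \<inter> ?S)" using w by blast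
    qed
    then have "?H (ball y r \<inter> ?S) \<le> ?H (f ` (ball x r \<inter> ?S))" by (rule hausdorff_outer_measure_mono)
    also have "\<dots> \<le> ennreal (1 ^ ?k) * ?H (ball x r \<inter> ?S)"
      by (rule hausdorff_outer_measure_Lipschitz_image) (simp_all add: fd)
    finally show ?thesis by simp
  qed
  have h: "emeasure M (ball x r) = h r" if "norm x = 1" for x r
    unfolding h_def using Hle[OF that x0, of r] Hle[OF x0 that, of r] by (simp add: M)
  have XM: "AE x in M. x \<in> ?S"
  proof -
    have "indicator ?S \<in> borel_measurable (hausdorff_measure ?k)"
      by (intro borel_measurable_indicator) simp
    then show ?thesis unfolding M_def by (subst AE_density) (auto split: split_indicator)
  qed
  have X\<sigma>: "AE x in ?\<sigma>. x \<in> ?S" using AE_sphere_measure by simp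
  define \<kappa> where "\<kappa> = measure M UNIV / measure ?\<sigma> UNIV"
  have mpos: "0 < measure ?\<sigma> UNIV" "0 < measure M UNIV"
  proof -
    have "0 < emeasure M UNIV" using hausdorff_sphere_pos[OF d] M[of UNIV] by simp
    then show "0 < measure ?\<sigma> UNIV" "0 < measure M UNIV"
      using sphere_measure_pos[where 'a='a]
      by (simp_all add: S.emeasure_eq_measure M.emeasure_eq_measure ennreal_less_zero_iff)
  qed
  \<comment> \<open>Integrating the measures of \<open>r\<close>-balls in either order identifies the ratio of the two ball functions.\<close>
  have hg: "h r = ennreal \<kappa> * g r" for r
  proof -
    have "open {p::'a \<times> 'a. dist (fst p) (snd p) < r}"
      by (intro open_Collect_less continuous_intros)
    then have "{p::'a \<times> 'a. dist (fst p) (snd p) < r} \<in> sets (borel \<Otimes>\<^sub>M borel)"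
      unfolding borel_prod by (rule borel_open)
    then have K: "(\<lambda>(x, y). indicator {p::'a \<times> 'a. dist (fst p) (snd p) < r} (x, y) :: ennreal)
        \<in> borel_measurable (M \<Otimes>\<^sub>M ?\<sigma>)"
      by (simp add: split_def cong: sets_pair_measure_cong measurable_cong_sets)
    have 1: "(\<integral>\<^sup>+y. indicator {p. dist (fst p) (snd p) < r} (x, y) \<partial>?\<sigma>) = emeasure ?\<sigma> (ball x r)" for x
    proof -
      have "(\<integral>\<^sup>+y. indicator {p. dist (fst p) (snd p) < r} (x, y) \<partial>?\<sigma>) = (\<integral>\<^sup>+y. indicator (ball x r) y \<partial>?\<sigma>)"
        by (intro nn_integral_cong) (auto split: split_indicator)
      then show ?thesis by simp
    qed
    have 2: "(\<integral>\<^sup>+x. indicator {p. dist (fst p) (snd p) < r} (x, y) \<partial>M) = emeasure M (ball y r)" for y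
    proof -
      have "(\<integral>\<^sup>+x. indicator {p. dist (fst p) (snd p) < r} (x, y) \<partial>M) = (\<integral>\<^sup>+x. indicator (ball y r) x \<partial>M)"
        by (intro nn_integral_cong) (auto simp: dist_commute split: split_indicator)
      then show ?thesis by simp
    qed
    have "(\<integral>\<^sup>+y. emeasure M (ball y r) \<partial>?\<sigma>) = (\<integral>\<^sup>+x. emeasure ?\<sigma> (ball x r) \<partial>M)"
      using MS.Fubini'[OF K] unfolding 1 2 .
    moreover have "(\<integral>\<^sup>+y. emeasure M (ball y r) \<partial>?\<sigma>) = (\<integral>\<^sup>+y. h r \<partial>?\<sigma>)"
      using X\<sigma> by (intro nn_integral_cong_AE) (auto elim!: eventually_mono simp: h)
    moreover have "(\<integral>\<^sup>+x. emeasure ?\<sigma> (ball x r) \<partial>M) = (\<integral>\<^sup>+x. g r \<partial>M)"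
      using XM by (intro nn_integral_cong_AE) (auto elim!: eventually_mono simp: g)
    ultimately have "h r * emeasure ?\<sigma> UNIV = g r * emeasure M UNIV" by simp
    then have "measure M (ball x0 r) * measure ?\<sigma> UNIV = measure ?\<sigma> (ball x0 r) * measure M UNIV"
      by (simp add: h_def g_def S.emeasure_eq_measure M.emeasure_eq_measure ennreal_mult'[symmetric])
    then have "measure M (ball x0 r) = \<kappa> * measure ?\<sigma> (ball x0 r)"
      using mpos by (simp add: \<kappa>_def field_simps)
    then show ?thesis
      using mpos by (simp add: h_def g_def S.emeasure_eq_measure M.emeasure_eq_measure ennreal_mult'[symmetric] \<kappa>_def)
  qed
  have gpos: "0 < g r \<and> g r < top" if "0 < r" for r
  proof
    define s where "s = min r 1"
    have s: "0 < s" "s \<le> 1" "s \<le> r" using that by (auto simp: s_def)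
    have "0 < unit_ball_vol (real DIM('a)) / 4 ^ DIM('a) * s ^ (DIM('a) - 1)"
      using s by (intro mult_pos_pos divide_pos_pos unit_ball_vol_pos zero_less_power) auto
    then have "0 < ennreal (unit_ball_vol (real DIM('a)) / 4 ^ DIM('a) * s ^ (DIM('a) - 1))"
      by (simp only: ennreal_less_zero_iff)
    also have "\<dots> \<le> emeasure ?\<sigma> (ball x0 s)" by (rule sphere_measure_ball_ge[OF x0 s(1,2)])
    also have "\<dots> \<le> g r" unfolding g_def using s by (intro emeasure_mono) auto
    finally show "0 < g r" .
    show "g r < top" by (simp add: g_def S.emeasure_eq_measure)
  qed
  have \<kappa>: "0 < \<kappa>" using mpos by (simp add: \<kappa>_def)
  have "emeasure M E = ennreal \<kappa> * emeasure ?\<sigma> E" if "E \<in> sets borel" for E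
  proof (rule uniformly_distributed_eq[where X="?S" and g=g])
    show "sigma_finite_measure M" "sigma_finite_measure ?\<sigma>" by unfold_locales
    show "emeasure M (ball 0 (real n)) < top" for n by (simp add: M.emeasure_eq_measure)
  qed (use that XM X\<sigma> g h hg gpos \<kappa> in auto)
  then show ?thesis using \<kappa> M by auto
qed

text \<open>The dilation from the unit sphere is Lipschitz with constant \<open>r\<close>, and its inverse with constant
  \<open>1 / r\<close>, so the two inequalities for Lipschitz images combine to an equality.\<close>

lemma hausdorff_sphere:
  assumes d: "DIM('a::euclidean_space) \<ge> 2"
  shows "\<exists>\<kappa>>0. \<forall>(c::'a) r E. 0 < r \<longrightarrow> E \<in> sets borel \<longrightarrow>
    hausdorff_outer_measure (DIM('a) - 1) (E \<inter> sphere c r) =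
    ennreal (\<kappa> * r ^ (DIM('a) - 1)) * emeasure sphere_measure ((\<lambda>\<theta>. c + r *\<^sub>R \<theta>) -` E)"
proof -
  let ?k = "DIM('a) - 1" and ?S = "sphere (0::'a) 1" and ?\<sigma> = "sphere_measure :: 'a measure"
  let ?H = "hausdorff_outer_measure ?k :: 'a set \<Rightarrow> ennreal"
  obtain \<kappa> where \<kappa>: "\<kappa> > 0" and eq: "\<And>E. E \<in> sets borel \<Longrightarrow> ?H (E \<inter> ?S) = ennreal \<kappa> * emeasure ?\<sigma> E"
    using hausdorff_unit_sphere[OF d] by blast
  have "?H (E \<inter> sphere c r) = ennreal (\<kappa> * r ^ ?k) * emeasure ?\<sigma> ((\<lambda>\<theta>. c + r *\<^sub>R \<theta>) -` E)"
    if r: "0 < r" and E: "E \<in> sets borel" for c r E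
  proof -
    let ?f = "\<lambda>\<theta>. c + r *\<^sub>R \<theta>" and ?g = "\<lambda>x. (1 / r) *\<^sub>R (x - c)"
    have fE: "?f -` E \<in> sets borel"
      by (rule measurable_sets_borel[OF _ E]) (intro borel_measurable_continuous_onI continuous_intros)
    have sub1: "E \<inter> sphere c r = ?f ` (?f -` E \<inter> ?S)"
    proof (intro set_eqI iffI)
      fix x assume x: "x \<in> E \<inter> sphere c r"
      have "?f (?g x) = x" using r by simp
      moreover have "norm (?g x) = 1" using x r by (simp add: dist_norm norm_minus_commute)
      ultimately show "x \<in> ?f ` (?f -` E \<inter> ?S)" using x by (intro image_eqI[of _ _ "?g x"]) auto
    qed (use r in \<open>auto simp: dist_norm\<close>)
    have sub2: "?f -` E \<inter> ?S = ?g ` (E \<inter> sphere c r)"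
      unfolding sub1 image_image using r by simp
    have le1: "?H (E \<inter> sphere c r) \<le> ennreal (r ^ ?k) * ?H (?f -` E \<inter> ?S)"
      unfolding sub1 using r
      by (intro hausdorff_outer_measure_Lipschitz_image) (auto simp: dist_norm simp flip: scaleR_diff_right)
    have "?H (?f -` E \<inter> ?S) \<le> ennreal ((1 / r) ^ ?k) * ?H (E \<inter> sphere c r)"
      unfolding sub2 using r
      by (intro hausdorff_outer_measure_Lipschitz_image) (auto simp: dist_norm simp flip: scaleR_diff_right)
    then have "ennreal (r ^ ?k) * ?H (?f -` E \<inter> ?S) \<le> ennreal (r ^ ?k) * (ennreal ((1 / r) ^ ?k) * ?H (E \<inter> sphere c r))"
      by (rule mult_left_mono) simp
    also have "\<dots> = ?H (E \<inter> sphere c r)"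
      using r by (simp add: mult.assoc[symmetric] ennreal_mult'[symmetric] power_mult_distrib[symmetric])
    finally have "?H (E \<inter> sphere c r) = ennreal (r ^ ?k) * ?H (?f -` E \<inter> ?S)"
      using le1 by (rule antisym[rotated])
    also have "\<dots> = ennreal (\<kappa> * r ^ ?k) * emeasure ?\<sigma> (?f -` E)"
      unfolding eq[OF fE] using \<kappa> r by (simp add: mult.assoc[symmetric] ennreal_mult'[symmetric] mult.commute)
    finally show ?thesis .
  qed
  then show ?thesis using \<kappa> by (intro exI[of _ \<kappa>]) auto
qed

section \<open>Square-integrable functions\<close>

lemma square_integrable_bound:
  assumes "f \<in> borel_measurable M" "square_integrable M g" "AE x in M. norm (f x) \<le> c * norm (g x)"
  shows "square_integrable M f"
proof -
  have "integrable M (\<lambda>x. c\<^sup>2 * (norm (g x))\<^sup>2)" using assms(2) by (simp add: square_integrable_def)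
  then have "integrable M (\<lambda>x. (norm (f x))\<^sup>2)"
  proof (rule Bochner_Integration.integrable_bound)
    show "AE x in M. norm ((norm (f x))\<^sup>2) \<le> norm (c\<^sup>2 * (norm (g x))\<^sup>2)"
      using assms(3)
    proof eventually_elim
      case (elim x)
      have "(norm (f x))\<^sup>2 \<le> (c * norm (g x))\<^sup>2" using elim by (intro power_mono) auto
      then show ?case by (simp add: power_mult_distrib abs_mult)
    qed
  qed (use assms(1) in measurable)
  then show ?thesis using assms(1) by (simp add: square_integrable_def)
qed

lemma norm_add_sq_le: "(norm (a + b))\<^sup>2 \<le> 2 * (norm a)\<^sup>2 + 2 * (norm (b::'b::real_normed_vector))\<^sup>2"
proof -
  have "(norm (a + b))\<^sup>2 \<le> (norm a + norm b)\<^sup>2" by (intro power_mono norm_triangle_ineq) simp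
  also have "\<dots> \<le> 2 * (norm a)\<^sup>2 + 2 * (norm b)\<^sup>2"
    using sum_squares_ge_zero[of "norm a - norm b" 0] by (simp add: power2_eq_square algebra_simps)
  finally show ?thesis .
qed

lemma square_integrable_add:
  assumes "square_integrable M f" "square_integrable M g"
  shows "square_integrable M (\<lambda>x. f x + g x)"
    and "L2_norm_sq M (\<lambda>x. f x + g x) \<le> 2 * L2_norm_sq M f + 2 * L2_norm_sq M g"
proof -
  have m [measurable]: "f \<in> borel_measurable M" "g \<in> borel_measurable M"
    using assms by (auto simp: square_integrable_def)
  have i: "integrable M (\<lambda>x. 2 * (norm (f x))\<^sup>2 + 2 * (norm (g x))\<^sup>2)"
    using assms by (auto simp: square_integrable_def)
  have ii: "integrable M (\<lambda>x. (norm (f x + g x))\<^sup>2)"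
    by (rule Bochner_Integration.integrable_bound[OF i]) (use norm_add_sq_le in auto)
  then show "square_integrable M (\<lambda>x. f x + g x)" by (simp add: square_integrable_def)
  have "L2_norm_sq M (\<lambda>x. f x + g x) \<le> (\<integral>x. 2 * (norm (f x))\<^sup>2 + 2 * (norm (g x))\<^sup>2 \<partial>M)"
    unfolding L2_norm_sq_def by (rule integral_mono[OF ii i]) (rule norm_add_sq_le)
  then show "L2_norm_sq M (\<lambda>x. f x + g x) \<le> 2 * L2_norm_sq M f + 2 * L2_norm_sq M g"
    using assms by (simp add: L2_norm_sq_def square_integrable_def)
qed

lemma square_integrable_diff:
  assumes "square_integrable M f" "square_integrable M g"
  shows "square_integrable M (\<lambda>x. f x - g x)"
    and "L2_norm_sq M (\<lambda>x. f x - g x) \<le> 2 * L2_norm_sq M f + 2 * L2_norm_sq M g"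
proof -
  have "square_integrable M (\<lambda>x. - g x)" using assms(2) by (simp add: square_integrable_def)
  from square_integrable_add[OF assms(1) this]
  show "square_integrable M (\<lambda>x. f x - g x)"
    "L2_norm_sq M (\<lambda>x. f x - g x) \<le> 2 * L2_norm_sq M f + 2 * L2_norm_sq M g"
    by (simp_all add: L2_norm_sq_def)
qed

lemma L2_norm_sq_nonneg: "0 \<le> L2_norm_sq M f"
  by (simp add: L2_norm_sq_def)

lemma square_integrable_mult_integrable:
  fixes f g :: "'a \<Rightarrow> real"
  assumes "square_integrable M f" "square_integrable M g"
  shows "integrable M (\<lambda>x. f x * g x)"
proof -
  have i: "integrable M (\<lambda>x. (norm (f x))\<^sup>2 + (norm (g x))\<^sup>2)"
    using assms by (auto simp: square_integrable_def)
  show ?thesis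
  proof (rule Bochner_Integration.integrable_bound[OF i])
    have "\<bar>a * b\<bar> \<le> a\<^sup>2 + b\<^sup>2" for a b :: real
    proof -
      have "0 \<le> (\<bar>a\<bar> - \<bar>b\<bar>)\<^sup>2" by simp
      then have "2 * (\<bar>a\<bar> * \<bar>b\<bar>) \<le> a\<^sup>2 + b\<^sup>2" by (simp add: power2_diff)
      moreover have "0 \<le> \<bar>a\<bar> * \<bar>b\<bar>" by simp
      ultimately show ?thesis unfolding abs_mult by linarith
    qed
    then show "AE x in M. norm (f x * g x) \<le> norm ((norm (f x))\<^sup>2 + (norm (g x))\<^sup>2)"
      by (intro AE_I2) simp
  qed (use assms in \<open>auto simp: square_integrable_def\<close>)
qed

text \<open>Young's inequality; a small \<open>t\<close> makes the first term negligible while the second one is controlled by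
  the distance.\<close>

lemma norm_sq_diff_le:
  fixes a b :: "'b::real_normed_vector"
  assumes t: "t > 0"
  shows "\<bar>(norm a)\<^sup>2 - (norm b)\<^sup>2\<bar> \<le> t * (norm b)\<^sup>2 + (1 + 1 / t) * (norm (a - b))\<^sup>2"
proof -
  have "\<bar>norm a - norm b\<bar> \<le> norm (a - b)" by (rule norm_triangle_ineq3)
  moreover have "norm a + norm b \<le> 2 * norm b + norm (a - b)"
    using norm_triangle_ineq2[of a b] by simp
  ultimately have "\<bar>norm a - norm b\<bar> * (norm a + norm b) \<le> norm (a - b) * (2 * norm b + norm (a - b))"
    by (intro mult_mono) auto
  moreover have "\<bar>(norm a)\<^sup>2 - (norm b)\<^sup>2\<bar> = \<bar>norm a - norm b\<bar> * (norm a + norm b)"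
    by (simp add: power2_eq_square square_diff_square_factored abs_mult)
  moreover have "2 * (norm b * norm (a - b)) \<le> t * (norm b)\<^sup>2 + (1 / t) * (norm (a - b))\<^sup>2"
  proof -
    have "0 \<le> (t * norm b - norm (a - b))\<^sup>2 / t" using t by simp
    also have "\<dots> = t * (norm b)\<^sup>2 + (1 / t) * (norm (a - b))\<^sup>2 - 2 * (norm b * norm (a - b))"
      using t by (simp add: field_simps power2_eq_square)
    finally show ?thesis by simp
  qed
  ultimately show ?thesis by (simp add: algebra_simps power2_eq_square)
qed

lemma L2_norm_sq_tendsto:
  assumes f: "\<And>n. square_integrable M (f n)" "square_integrable M g"
    and lim: "(\<lambda>n. L2_norm_sq M (\<lambda>x. f n x - g x)) \<longlonglongrightarrow> 0"
  shows "(\<lambda>n. L2_norm_sq M (f n)) \<longlonglongrightarrow> L2_norm_sq M g"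
proof -
  have bound: "\<bar>L2_norm_sq M (f n) - L2_norm_sq M g\<bar> \<le>
      t * L2_norm_sq M g + (1 + 1 / t) * L2_norm_sq M (\<lambda>x. f n x - g x)" if "t > 0" for n t
  proof -
    have d: "square_integrable M (\<lambda>x. f n x - g x)" by (rule square_integrable_diff[OF f])
    have i: "integrable M (\<lambda>x. (norm (f n x))\<^sup>2)" "integrable M (\<lambda>x. (norm (g x))\<^sup>2)"
      "integrable M (\<lambda>x. (norm (f n x - g x))\<^sup>2)"
      using f d by (auto simp: square_integrable_def)
    have "\<bar>L2_norm_sq M (f n) - L2_norm_sq M g\<bar> = \<bar>\<integral>x. (norm (f n x))\<^sup>2 - (norm (g x))\<^sup>2 \<partial>M\<bar>"
      using i by (simp add: L2_norm_sq_def)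
    also have "\<dots> \<le> (\<integral>x. \<bar>(norm (f n x))\<^sup>2 - (norm (g x))\<^sup>2\<bar> \<partial>M)" by (rule integral_abs_bound)
    also have "\<dots> \<le> (\<integral>x. t * (norm (g x))\<^sup>2 + (1 + 1 / t) * (norm (f n x - g x))\<^sup>2 \<partial>M)"
      using i norm_sq_diff_le[OF that] by (intro integral_mono) auto
    also have "\<dots> = t * L2_norm_sq M g + (1 + 1 / t) * L2_norm_sq M (\<lambda>x. f n x - g x)"
      using i by (simp add: L2_norm_sq_def)
    finally show ?thesis .
  qed
  show ?thesis
  proof (rule tendstoI)
    fix e :: real assume e: "e > 0"
    define N where "N = L2_norm_sq M g + 1"
    have N: "N \<ge> 1" "L2_norm_sq M g \<le> N" using L2_norm_sq_nonneg[of M g] by (auto simp: N_def)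
    define t where "t = e / (2 * N)"
    have t: "t > 0" using e N by (simp add: t_def)
    have "(\<lambda>n. (1 + 1 / t) * L2_norm_sq M (\<lambda>x. f n x - g x)) \<longlonglongrightarrow> (1 + 1 / t) * 0"
      by (intro tendsto_intros lim)
    then have "\<forall>\<^sub>F n in sequentially. (1 + 1 / t) * L2_norm_sq M (\<lambda>x. f n x - g x) < e / 2"
      using e by (intro order_tendstoD(2)) auto
    then show "\<forall>\<^sub>F n in sequentially. dist (L2_norm_sq M (f n)) (L2_norm_sq M g) < e"
    proof eventually_elim
      case (elim n)
      have "t * L2_norm_sq M g \<le> t * N" using t N by (intro mult_left_mono) auto
      also have "\<dots> = e / 2" using N by (simp add: t_def)
      finally show ?case using bound[OF t, of n] elim unfolding dist_real_def by linarith
    qed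
  qed
qed

text \<open>Completeness. Weighting the squared increments by \<open>4\<^sup>n\<close> keeps their sum \<open>S\<close> integrable, and
  where \<open>S\<close> is finite the increments are at most \<open>2\<^sup>-\<^sup>n \<surd>S\<close>, so the limit exists and stays within
  \<open>2 \<cdot> 2\<^sup>-\<^sup>n \<surd>S\<close> of the \<open>n\<close>-th function.\<close>

lemma L2_complete:
  fixes v :: "nat \<Rightarrow> 'a \<Rightarrow> real"
  assumes v: "\<And>n. square_integrable M (v n)"
    and C: "\<And>n. L2_norm_sq M (\<lambda>x. v (Suc n) x - v n x) \<le> C * (1 / 8) ^ n"
  obtains g where "square_integrable M g" "(\<lambda>n. L2_norm_sq M (\<lambda>x. v n x - g x)) \<longlonglongrightarrow> 0"
proof -
  define D where "D n x = 4 ^ n * (v (Suc n) x - v n x)\<^sup>2" for n x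
  have vm [measurable]: "v n \<in> borel_measurable M" for n using v by (simp add: square_integrable_def)
  have D0: "0 \<le> D n x" for n x by (simp add: D_def)
  have Di: "integrable M (D n)" for n
    using square_integrable_diff(1)[OF v v, of "Suc n" n] unfolding D_def square_integrable_def by simp
  have DL: "(\<integral>x. D n x \<partial>M) \<le> C * (1 / 2) ^ n" for n
  proof -
    have "(\<integral>x. D n x \<partial>M) = 4 ^ n * L2_norm_sq M (\<lambda>x. v (Suc n) x - v n x)"
      by (simp add: D_def L2_norm_sq_def)
    also have "\<dots> \<le> 4 ^ n * (C * (1 / 8) ^ n)" by (intro mult_left_mono C) simp
    also have "\<dots> = C * (1 / 2) ^ n" by (simp add: power_divide field_simps flip: power_mult_distrib)
    finally show ?thesis .
  qed
  define S where "S x = (\<Sum>n. D n x)" for x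
  have sI: "summable (\<lambda>n. \<integral>x. norm (D n x) \<partial>M)"
  proof (rule summable_comparison_test')
    show "summable (\<lambda>n. C * (1 / 2) ^ n)" by (intro summable_mult summable_geometric) simp
    show "norm (\<integral>x. norm (D n x) \<partial>M) \<le> C * (1 / 2) ^ n" if "n \<ge> 0" for n
      using DL[of n] D0 by simp
  qed
  have nn: "(\<integral>\<^sup>+x. (\<Sum>n. ennreal (D n x)) \<partial>M) < top"
  proof -
    have "(\<integral>\<^sup>+x. (\<Sum>n. ennreal (D n x)) \<partial>M) = (\<Sum>n. \<integral>\<^sup>+x. ennreal (D n x) \<partial>M)"
      by (rule nn_integral_suminf) (simp add: D_def)
    also have "\<dots> = (\<Sum>n. ennreal (\<integral>x. D n x \<partial>M))"
      using Di D0 by (simp add: nn_integral_eq_integral)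
    also have "\<dots> = ennreal (\<Sum>n. \<integral>x. D n x \<partial>M)"
      using sI D0 by (intro suminf_ennreal2) auto
    finally show ?thesis by simp
  qed
  have sumD: "AE x in M. summable (\<lambda>n. D n x)"
  proof -
    have "AE x in M. (\<Sum>n. ennreal (D n x)) \<noteq> \<infinity>"
      using nn by (intro nn_integral_noteq_infinite) (auto simp: D_def)
    then show ?thesis
      by eventually_elim (rule summable_suminf_not_top, auto simp: D0)
  qed
  have Si: "integrable M S"
    unfolding S_def by (rule integrable_suminf[OF Di]) (use sumD sI D0 in auto)
  define g where "g x = lim (\<lambda>n. v n x)" for x
  have gm [measurable]: "g \<in> borel_measurable M" unfolding g_def by measurable
  have est: "AE x in M. \<forall>n. (v n x - g x)\<^sup>2 \<le> 4 * (1 / 4) ^ n * S x"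
    using sumD
  proof eventually_elim
    case (elim x)
    have S0: "0 \<le> S x" unfolding S_def by (rule suminf_nonneg[OF elim D0])
    have inc: "\<bar>v (Suc n) x - v n x\<bar> \<le> sqrt (S x) * (1 / 2) ^ n" for n
    proof -
      have "D n x \<le> S x" unfolding S_def
        using sum_le_suminf[OF elim, of "{n}"] D0 by simp
      have "(v (Suc n) x - v n x)\<^sup>2 \<le> (sqrt (S x) * (1 / 2) ^ n)\<^sup>2"
      proof -
        have "((1 / 2 :: real) ^ n)\<^sup>2 = (1 / 4) ^ n"
          by (simp add: power2_eq_square flip: power_mult_distrib)
        moreover have "(v (Suc n) x - v n x)\<^sup>2 = (1 / 4) ^ n * D n x"
          by (simp add: D_def power_divide)
        moreover have "(1 / 4) ^ n * D n x \<le> (1 / 4) ^ n * S x"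
          using \<open>D n x \<le> S x\<close> by (intro mult_left_mono) auto
        ultimately show ?thesis using S0 by (simp add: power_mult_distrib mult.commute)
      qed
      then show ?thesis using S0 by (subst (asm) abs_le_square_iff[symmetric]) simp
    qed
    have sd: "summable (\<lambda>n. v (Suc n) x - v n x)"
    proof (rule summable_comparison_test')
      show "summable (\<lambda>n. sqrt (S x) * (1 / 2) ^ n)" by (intro summable_mult summable_geometric) simp
    qed (use inc in auto)
    have "(\<lambda>n. \<Sum>i<n. v (Suc i) x - v i x) \<longlonglongrightarrow> (\<Sum>i. v (Suc i) x - v i x)"
      using summable_LIMSEQ[OF sd] .
    then have "(\<lambda>n. v n x - v 0 x) \<longlonglongrightarrow> (\<Sum>i. v (Suc i) x - v i x)"
      by (simp add: sum_lessThan_telescope[of "\<lambda>n. v n x"])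
    then have "(\<lambda>n. v n x - v 0 x + v 0 x) \<longlonglongrightarrow> (\<Sum>i. v (Suc i) x - v i x) + v 0 x"
      by (intro tendsto_intros)
    then have lim: "(\<lambda>n. v n x) \<longlonglongrightarrow> g x"
      unfolding g_def by (simp add: convergentI convergent_LIMSEQ_iff[symmetric])
    show ?case
    proof
      fix n
      have fin: "\<bar>v (n + m) x - v n x\<bar> \<le> sqrt (S x) * (1 / 2) ^ n * (2 - 2 * (1 / 2) ^ m)" for m
      proof (induction m)
        case (Suc m)
        have "\<bar>v (n + Suc m) x - v n x\<bar> \<le> \<bar>v (n + m) x - v n x\<bar> + \<bar>v (Suc (n + m)) x - v (n + m) x\<bar>" by simp
        also have "\<dots> \<le> sqrt (S x) * (1 / 2) ^ n * (2 - 2 * (1 / 2) ^ m) + sqrt (S x) * (1 / 2) ^ (n + m)"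
          using Suc inc by (intro add_mono) auto
        also have "\<dots> = sqrt (S x) * (1 / 2) ^ n * (2 - 2 * (1 / 2) ^ Suc m)"
          by (simp add: power_add algebra_simps)
        finally show ?case .
      qed simp
      have "\<bar>v (n + m) x - v n x\<bar> \<le> sqrt (S x) * (1 / 2) ^ n * 2" for m
      proof -
        have "sqrt (S x) * (1 / 2) ^ n * (2 - 2 * (1 / 2) ^ m) \<le> sqrt (S x) * (1 / 2) ^ n * 2"
          using S0 by (intro mult_left_mono) auto
        then show ?thesis using fin[of m] by linarith
      qed
      moreover have "(\<lambda>m. \<bar>v (n + m) x - v n x\<bar>) \<longlonglongrightarrow> \<bar>g x - v n x\<bar>"
        using LIMSEQ_ignore_initial_segment[OF lim, of n] by (intro tendsto_intros) (simp add: add.commute)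
      ultimately have "\<bar>g x - v n x\<bar> \<le> sqrt (S x) * (1 / 2) ^ n * 2"
        by (intro LIMSEQ_le_const2) auto
      then have "\<bar>g x - v n x\<bar>\<^sup>2 \<le> (sqrt (S x) * (1 / 2) ^ n * 2)\<^sup>2" by (intro power_mono) auto
      also have "\<dots> = 4 * (1 / 4) ^ n * S x"
      proof -
        have "((1 / 2 :: real) ^ n)\<^sup>2 = (1 / 4) ^ n"
          by (simp add: power2_eq_square flip: power_mult_distrib)
        then show ?thesis using S0 by (simp add: power_mult_distrib)
      qed
      finally show "(v n x - g x)\<^sup>2 \<le> 4 * (1 / 4) ^ n * S x" by (simp add: power2_commute)
    qed
  qed
  have dI: "square_integrable M (\<lambda>x. v n x - g x)" and
    dL: "L2_norm_sq M (\<lambda>x. v n x - g x) \<le> 4 * (1 / 4) ^ n * (\<integral>x. S x \<partial>M)" for n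
  proof -
    have i: "integrable M (\<lambda>x. 4 * (1 / 4) ^ n * S x)" using Si by simp
    have est': "AE x in M. (v n x - g x)\<^sup>2 \<le> 4 * (1 / 4) ^ n * S x" using est by eventually_elim simp
    have ii: "integrable M (\<lambda>x. (v n x - g x)\<^sup>2)"
      by (rule Bochner_Integration.integrable_bound[OF i]) (use est' in \<open>auto elim!: eventually_mono\<close>)
    then show "square_integrable M (\<lambda>x. v n x - g x)" by (simp add: square_integrable_def)
    have "(\<integral>x. (v n x - g x)\<^sup>2 \<partial>M) \<le> (\<integral>x. 4 * (1 / 4) ^ n * S x \<partial>M)"
      by (rule integral_mono_AE[OF ii i est'])
    then show "L2_norm_sq M (\<lambda>x. v n x - g x) \<le> 4 * (1 / 4) ^ n * (\<integral>x. S x \<partial>M)"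
      by (simp add: L2_norm_sq_def)
  qed
  show thesis
  proof
    show "square_integrable M g"
      using square_integrable_diff(1)[OF v dI, of 0 0] by simp
    have "(\<lambda>n. 4 * (1 / 4) ^ n * (\<integral>x. S x \<partial>M)) \<longlonglongrightarrow> 4 * 0 * (\<integral>x. S x \<partial>M)"
      by (intro tendsto_intros LIMSEQ_power_zero) simp
    then have lim0: "(\<lambda>n. 4 * (1 / 4) ^ n * (\<integral>x. S x \<partial>M)) \<longlonglongrightarrow> 0" by simp
    show "(\<lambda>n. L2_norm_sq M (\<lambda>x. v n x - g x)) \<longlonglongrightarrow> 0"
    proof (rule Lim_null_comparison[OF always_eventually lim0], rule allI)
      show "norm (L2_norm_sq M (\<lambda>x. v n x - g x)) \<le> 4 * (1 / 4) ^ n * (\<integral>x. S x \<partial>M)" for n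
        using dL[of n] L2_norm_sq_nonneg[of M "\<lambda>x. v n x - g x"] by simp
    qed
  qed
qed

section \<open>Mollification\<close>

lemma uniformly_continuous_compact_support:
  fixes f :: "'a::euclidean_space \<Rightarrow> 'b::metric_space"
  assumes c: "continuous_on UNIV f" and s: "\<And>x. r \<le> norm x \<Longrightarrow> f x = a" and e: "e > 0"
  obtains d where "d > 0" "\<And>x y. dist x y < d \<Longrightarrow> dist (f x) (f y) < e"
proof -
  have "uniformly_continuous_on (cball 0 (r + 1)) f"
    by (rule compact_uniformly_continuous[OF continuous_on_subset[OF c]]) auto
  then obtain d where d: "d > 0"
    "\<And>x y. x \<in> cball 0 (r + 1) \<Longrightarrow> y \<in> cball 0 (r + 1) \<Longrightarrow> dist x y < d \<Longrightarrow> dist (f x) (f y) < e"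
    using e unfolding uniformly_continuous_on_def by (metis dist_commute)
  show thesis
  proof
    show "min d 1 > 0" using d by simp
    fix x y :: 'a assume xy: "dist x y < min d 1"
    have n: "\<bar>norm x - norm y\<bar> < 1" using xy norm_triangle_ineq3[of x y] by (simp add: dist_norm)
    show "dist (f x) (f y) < e"
    proof (cases "norm x \<le> r + 1 \<and> norm y \<le> r + 1")
      case True
      then show ?thesis using xy by (intro d(2)) auto
    next
      case False
      then have "r \<le> norm x" "r \<le> norm y" using n by linarith+
      then show ?thesis using s e by simp
    qed
  qed
qed

definition clamp_real :: "real \<Rightarrow> real \<Rightarrow> real" where
  "clamp_real k a = max (- k) (min k a)"

lemma clamp_real_tendsto: "(\<lambda>n. clamp_real (real n) a) \<longlonglongrightarrow> a"
proof (rule tendsto_eventually)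
  obtain N where N: "\<bar>a\<bar> < real N" using reals_Archimedean2 by blast
  have "clamp_real (real n) a = a" if "n \<ge> N" for n
  proof -
    have "real N \<le> real n" using that by simp
    then have "- real n \<le> a" "a \<le> real n" using N by linarith+
    then show ?thesis by (simp add: clamp_real_def)
  qed
  then show "\<forall>\<^sub>F n in sequentially. clamp_real (real n) a = a"
    by (auto simp: eventually_sequentially)
qed

text \<open>Truncation makes \<open>h\<close> bounded. A measurable function is almost everywhere a limit of continuous
  ones, and the truncated, cut off approximants are dominated by a multiple of the indicator of a
  ball, so the convergence holds in \<open>L\<^sup>2\<close>.\<close>

lemma L2_dense_continuous:
  fixes h :: "'a::euclidean_space \<Rightarrow> real"
  assumes hm [measurable]: "h \<in> borel_measurable borel" and hi: "integrable lborel (\<lambda>x. (h x)\<^sup>2)"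
    and supp: "\<And>x. B \<le> norm x \<Longrightarrow> h x = 0" and e: "e > 0"
  obtains g where "continuous_on UNIV g" "\<And>x. B + 1 \<le> norm x \<Longrightarrow> g x = 0"
    "integrable lborel (\<lambda>x. (h x - g x)\<^sup>2)" "(\<integral>x. (h x - g x)\<^sup>2 \<partial>lborel) < e"
proof -
  define c where "c k x = clamp_real k (h x)" for k x
  have cm [measurable]: "c k \<in> borel_measurable borel" for k unfolding c_def clamp_real_def by measurable
  have c_le: "(h x - c (real n) x)\<^sup>2 \<le> (h x)\<^sup>2" for n x
  proof -
    have "\<bar>h x - c (real n) x\<bar> \<le> \<bar>h x\<bar>" unfolding c_def clamp_real_def by (auto simp: min_def max_def)
    then show ?thesis by (simp add: abs_le_square_iff)
  qed
  have "(\<lambda>n. \<integral>x. (h x - c (real n) x)\<^sup>2 \<partial>lborel) \<longlonglongrightarrow> (\<integral>x. 0 \<partial>(lborel :: 'a measure))"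
  proof (rule integral_dominated_convergence[where w="\<lambda>x. (h x)\<^sup>2"])
    have "(\<lambda>n. (h x - c (real n) x)\<^sup>2) \<longlonglongrightarrow> (h x - h x)\<^sup>2" for x
      unfolding c_def by (intro tendsto_intros clamp_real_tendsto)
    then show "AE x in lborel. (\<lambda>n. (h x - c (real n) x)\<^sup>2) \<longlonglongrightarrow> 0" by simp
  qed (use hi c_le in auto)
  then have "\<forall>\<^sub>F n in sequentially. (\<integral>x. (h x - c (real n) x)\<^sup>2 \<partial>lborel) < e / 4"
    using e by (intro order_tendstoD(2)) auto
  then obtain n where n: "(\<integral>x. (h x - c (real n) x)\<^sup>2 \<partial>lborel) < e / 4"
    by (auto simp: eventually_sequentially)
  have hci: "integrable lborel (\<lambda>x. (h x - c (real n) x)\<^sup>2)"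
    by (rule Bochner_Integration.integrable_bound[OF hi]) (use c_le in auto)
  have "h \<in> borel_measurable lebesgue" using hm by (simp add: measurable_completion)
  then have "h measurable_on UNIV" by (intro lebesgue_measurable_imp_measurable_on_real) auto
  then obtain Z s where Z: "negligible Z" and s: "\<And>j. continuous_on UNIV (s j)"
    and lim: "\<And>x. x \<notin> Z \<Longrightarrow> (\<lambda>j. s j x) \<longlonglongrightarrow> h x"
    unfolding measurable_on_def by auto
  define cut :: "'a \<Rightarrow> real" where "cut x = max 0 (min 1 (B + 1 - norm x))" for x
  define G where "G j x = cut x * clamp_real (real n) (s j x)" for j x
  have Gc: "continuous_on UNIV (G j)" for j
    unfolding G_def cut_def clamp_real_def by (intro continuous_intros s)
  then have Gm [measurable]: "G j \<in> borel_measurable borel" for j by (rule borel_measurable_continuous_onI)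
  have G0: "G j x = 0" if "B + 1 \<le> norm x" for j x using that by (simp add: G_def cut_def)
  have c0: "c (real n) x = 0" if "B \<le> norm x" for x using supp[OF that] by (simp add: c_def clamp_real_def)
  have Gb: "(c (real n) x - G j x)\<^sup>2 \<le> (2 * real n)\<^sup>2 * indicator (cball 0 (B + 1)) x" for j x
  proof (cases "norm x \<le> B + 1")
    case True
    have 1: "\<bar>c (real n) x\<bar> \<le> real n" "\<bar>clamp_real (real n) (s j x)\<bar> \<le> real n"
      unfolding c_def clamp_real_def by auto
    have "\<bar>cut x\<bar> \<le> 1" by (auto simp: cut_def)
    then have "\<bar>G j x\<bar> \<le> 1 * real n" unfolding G_def abs_mult using 1 by (intro mult_mono) auto
    then have "\<bar>c (real n) x - G j x\<bar> \<le> \<bar>2 * real n\<bar>" using 1 by linarith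
    then have "(c (real n) x - G j x)\<^sup>2 \<le> (2 * real n)\<^sup>2" by (simp only: abs_le_square_iff)
    then show ?thesis using True by simp
  qed (use G0 c0 in auto)
  have bi: "integrable lborel (\<lambda>x::'a. (2 * real n)\<^sup>2 * indicator (cball 0 (B + 1)) x)"
    using emeasure_bounded_finite[OF bounded_cball[of "0::'a" "B + 1"]]
    by (intro integrable_mult_right integrable_real_indicator) auto
  have "(\<lambda>j. \<integral>x. (c (real n) x - G j x)\<^sup>2 \<partial>lborel) \<longlonglongrightarrow> (\<integral>x. 0 \<partial>(lborel :: 'a measure))"
  proof (rule integral_dominated_convergence[OF _ _ bi])
    have "Z \<in> null_sets lebesgue" using Z by (simp add: negligible_iff_null_sets)
    then have "AE x in lebesgue. x \<notin> Z" by (rule AE_not_in)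
    then have "AE x in lborel. x \<notin> Z" by (simp add: AE_completion_iff)
    then show "AE x in lborel. (\<lambda>j. (c (real n) x - G j x)\<^sup>2) \<longlonglongrightarrow> 0"
    proof eventually_elim
      case (elim x)
      have "(\<lambda>j. (c (real n) x - G j x)\<^sup>2) \<longlonglongrightarrow> (c (real n) x - cut x * c (real n) x)\<^sup>2"
        unfolding G_def c_def clamp_real_def by (intro tendsto_intros lim elim)
      moreover have "cut x * c (real n) x = c (real n) x"
        using c0[of x] by (cases "B \<le> norm x") (auto simp: cut_def)
      ultimately show ?case by simp
    qed
  qed (use Gb in auto)
  then have "\<forall>\<^sub>F j in sequentially. (\<integral>x. (c (real n) x - G j x)\<^sup>2 \<partial>lborel) < e / 4"
    using e by (intro order_tendstoD(2)) auto
  then obtain j where j: "(\<integral>x. (c (real n) x - G j x)\<^sup>2 \<partial>lborel) < e / 4"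
    by (auto simp: eventually_sequentially)
  have cGi: "integrable lborel (\<lambda>x. (c (real n) x - G j x)\<^sup>2)"
    by (rule Bochner_Integration.integrable_bound[OF bi]) (use Gb in auto)
  have sq1: "square_integrable lborel (\<lambda>x. h x - c (real n) x)" and sq2: "square_integrable lborel (\<lambda>x. c (real n) x - G j x)"
    using hci cGi by (auto simp: square_integrable_def)
  show thesis
  proof
    show "integrable lborel (\<lambda>x. (h x - G j x)\<^sup>2)"
      using square_integrable_add(1)[OF sq1 sq2] by (simp add: square_integrable_def)
    show "(\<integral>x. (h x - G j x)\<^sup>2 \<partial>lborel) < e"
      using square_integrable_add(2)[OF sq1 sq2] n j by (simp add: L2_norm_sq_def)
  qed (use Gc G0 in auto)
qed

lemma nn_integral_translation:
  assumes "f \<in> borel_measurable borel"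
  shows "(\<integral>\<^sup>+x. f (x + z) \<partial>lborel) = (\<integral>\<^sup>+x. f x \<partial>(lborel :: 'a::euclidean_space measure))"
proof -
  have "(\<integral>\<^sup>+x. f x \<partial>lborel) = (\<integral>\<^sup>+x. f x \<partial>distr lborel borel ((+) z))"
    by (simp add: lborel_distr_plus)
  also have "\<dots> = (\<integral>\<^sup>+x. f (z + x) \<partial>lborel)" using assms by (subst nn_integral_distr) auto
  finally show ?thesis by (simp add: add.commute)
qed

lemma integral_translation:
  fixes f :: "'a::euclidean_space \<Rightarrow> real"
  assumes "f \<in> borel_measurable borel"
  shows "(\<integral>x. f (x + z) \<partial>lborel) = (\<integral>x. f x \<partial>lborel)"
    and "integrable lborel (\<lambda>x. f (x + z)) \<longleftrightarrow> integrable lborel f"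
proof -
  have e: "distr lborel borel ((+) z) = (lborel :: 'a measure)" by (rule lborel_distr_plus)
  show "(\<integral>x. f (x + z) \<partial>lborel) = (\<integral>x. f x \<partial>lborel)"
    using assms by (subst (2) e[symmetric]) (simp add: integral_distr add.commute)
  show "integrable lborel (\<lambda>x. f (x + z)) \<longleftrightarrow> integrable lborel f"
    using assms by (subst (2) e[symmetric]) (simp add: integrable_distr_eq add.commute)
qed

text \<open>Translation is an isometry of \<open>L\<^sup>2\<close>, and it is uniformly continuous on the approximating continuous
  functions of compact support.\<close>

lemma L2_translation_continuous:
  fixes h :: "'a::euclidean_space \<Rightarrow> real"
  assumes hm [measurable]: "h \<in> borel_measurable borel" and hi: "integrable lborel (\<lambda>x. (h x)\<^sup>2)"
    and supp: "\<And>x. B \<le> norm x \<Longrightarrow> h x = 0" and e: "e > 0"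
  obtains d where "d > 0" "\<And>z. norm z < d \<Longrightarrow> (\<integral>\<^sup>+x. ennreal ((h (x + z) - h x)\<^sup>2) \<partial>lborel) \<le> ennreal e"
proof -
  have e9: "e / 9 > 0" using e by simp
  obtain g where gc: "continuous_on UNIV g" and g0: "\<And>x. B + 1 \<le> norm x \<Longrightarrow> g x = 0"
    and gi: "integrable lborel (\<lambda>x. (h x - g x)\<^sup>2)" and gl: "(\<integral>x. (h x - g x)\<^sup>2 \<partial>lborel) < e / 9"
    using L2_dense_continuous[OF hm hi supp e9] by blast
  have gm [measurable]: "g \<in> borel_measurable borel" by (rule borel_measurable_continuous_onI[OF gc])
  let ?C = "cball (0::'a) (B + 2)"
  have Cm [measurable]: "?C \<in> sets borel" by simp
  have Im [measurable]: "(\<lambda>x. ennreal k * indicator ?C x) \<in> borel_measurable borel" for k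
    by (intro borel_measurable_times_ennreal borel_measurable_const borel_measurable_indicator Cm)
  define V where "V = measure lborel ?C + 1"
  have V: "V \<ge> 1" by (simp add: V_def)
  define a where "a = sqrt (e / (9 * V))"
  have a: "a > 0" using e V by (simp add: a_def)
  obtain d where d: "d > 0" "\<And>x y. dist x y < d \<Longrightarrow> dist (g x) (g y) < a"
    using uniformly_continuous_compact_support[OF gc g0 a] by blast
  have finC: "emeasure lborel ?C = ennreal (measure lborel ?C)"
    using emeasure_bounded_finite[OF bounded_cball[of "0::'a" "B + 2"]]
    by (intro emeasure_eq_ennreal_measure) auto
  show thesis
  proof
    show "min d 1 > 0" using d by simp
    fix z :: 'a assume z: "norm z < min d 1"
    have g2: "(g (x + z) - g x)\<^sup>2 \<le> a\<^sup>2 * indicator ?C x" for x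
    proof (cases "norm x \<le> B + 2")
      case True
      have "dist (x + z) x < d" using z by (simp add: dist_norm)
      then have "\<bar>g (x + z) - g x\<bar> \<le> \<bar>a\<bar>" using d(2)[of "x + z" x] by (simp add: dist_real_def)
      then have "(g (x + z) - g x)\<^sup>2 \<le> a\<^sup>2" by (simp only: abs_le_square_iff)
      then show ?thesis using True by simp
    next
      case False
      then have "B + 1 \<le> norm (x + z)" using z norm_triangle_ineq2[of x "- z"] by simp
      then show ?thesis using False g0 by simp
    qed
    \<comment> \<open>Translating, approximating and undoing both: three errors, hence the factor \<open>3\<close> and the tolerance \<open>e / 9\<close>.\<close>
    have split: "(h (x + z) - h x)\<^sup>2 \<le> 3 * (h (x + z) - g (x + z))\<^sup>2 + 3 * (h x - g x)\<^sup>2 + 3 * (a\<^sup>2 * indicator ?C x)" for x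
    proof -
      have t: "(p + q + r)\<^sup>2 \<le> 3 * p\<^sup>2 + 3 * q\<^sup>2 + 3 * r\<^sup>2" for p q r :: real
        using sum_squares_ge_zero[of "p - q" "q - r"] sum_squares_ge_zero[of "p - r" 0]
        by (simp add: power2_eq_square algebra_simps)
      have "(h (x + z) - h x)\<^sup>2 = ((h (x + z) - g (x + z)) + (- (h x - g x)) + (g (x + z) - g x))\<^sup>2"
        by (simp add: algebra_simps)
      also have "\<dots> \<le> 3 * (h (x + z) - g (x + z))\<^sup>2 + 3 * (- (h x - g x))\<^sup>2 + 3 * (g (x + z) - g x)\<^sup>2" by (rule t)
      finally show ?thesis using g2[of x] unfolding power2_minus by linarith
    qed
    have "(\<integral>\<^sup>+x. ennreal ((h (x + z) - h x)\<^sup>2) \<partial>lborel) \<le>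
        (\<integral>\<^sup>+x. 3 * ennreal ((h (x + z) - g (x + z))\<^sup>2) + 3 * ennreal ((h x - g x)\<^sup>2) + 3 * (ennreal (a\<^sup>2) * indicator ?C x) \<partial>lborel)"
    proof (rule nn_integral_mono)
      fix x
      have "ennreal ((h (x + z) - h x)\<^sup>2) \<le> ennreal (3 * (h (x + z) - g (x + z))\<^sup>2 + 3 * (h x - g x)\<^sup>2 + 3 * (a\<^sup>2 * indicator ?C x))"
        by (rule ennreal_leI[OF split])
      also have "\<dots> = 3 * ennreal ((h (x + z) - g (x + z))\<^sup>2) + 3 * ennreal ((h x - g x)\<^sup>2) + 3 * (ennreal (a\<^sup>2) * indicator ?C x)"
        by (simp add: ennreal_mult' ennreal_indicator)
      finally show "ennreal ((h (x + z) - h x)\<^sup>2) \<le> \<dots>" .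
    qed
    also have "\<dots> = 3 * (\<integral>\<^sup>+x. ennreal ((h (x + z) - g (x + z))\<^sup>2) \<partial>lborel) + 3 * (\<integral>\<^sup>+x. ennreal ((h x - g x)\<^sup>2) \<partial>lborel)
        + 3 * (ennreal (a\<^sup>2) * emeasure lborel ?C)"
      by (simp add: nn_integral_add nn_integral_cmult nn_integral_cmult_indicator)
    also have "(\<integral>\<^sup>+x. ennreal ((h (x + z) - g (x + z))\<^sup>2) \<partial>lborel) = (\<integral>\<^sup>+x. ennreal ((h x - g x)\<^sup>2) \<partial>lborel)"
      by (rule nn_integral_translation[of "\<lambda>x. ennreal ((h x - g x)\<^sup>2)"]) measurable
    also have "(\<integral>\<^sup>+x. ennreal ((h x - g x)\<^sup>2) \<partial>lborel) = ennreal (\<integral>x. (h x - g x)\<^sup>2 \<partial>lborel)"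
      using gi by (intro nn_integral_eq_integral) auto
    also have "3 * \<dots> + 3 * \<dots> + 3 * (ennreal (a\<^sup>2) * emeasure lborel ?C) =
        ennreal (3 * (\<integral>x. (h x - g x)\<^sup>2 \<partial>lborel) + 3 * (\<integral>x. (h x - g x)\<^sup>2 \<partial>lborel) + 3 * (a\<^sup>2 * measure lborel ?C))"
    proof -
      have "3 * ennreal p + 3 * ennreal q + 3 * (ennreal r * ennreal s) = ennreal (3 * p + 3 * q + 3 * (r * s))"
        if "0 \<le> p" "0 \<le> q" "0 \<le> r" "0 \<le> s" for p q r s :: real
        using that by (simp add: ennreal_mult')
      from this[of "\<integral>x. (h x - g x)\<^sup>2 \<partial>lborel" "\<integral>x. (h x - g x)\<^sup>2 \<partial>lborel" "a\<^sup>2" "measure lborel ?C"]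
      show ?thesis unfolding finC by fastforce
    qed
    also have "\<dots> \<le> ennreal e"
    proof (rule ennreal_leI)
      have "a\<^sup>2 * measure lborel ?C \<le> a\<^sup>2 * V" by (intro mult_left_mono) (auto simp: V_def)
      also have "\<dots> = e / 9" using e V by (simp add: a_def)
      finally show "3 * (\<integral>x. (h x - g x)\<^sup>2 \<partial>lborel) + 3 * (\<integral>x. (h x - g x)\<^sup>2 \<partial>lborel) + 3 * (a\<^sup>2 * measure lborel ?C) \<le> e"
        using gl by linarith
    qed
    finally show "(\<integral>\<^sup>+x. ennreal ((h (x + z) - h x)\<^sup>2) \<partial>lborel) \<le> ennreal e" .
  qed
qed

definition mollifier :: "real \<Rightarrow> 'a::euclidean_space \<Rightarrow> real" where
  "mollifier \<delta> x = bump ((1 / \<delta>) *\<^sub>R x) / (\<delta> ^ DIM('a) * (\<integral>y. bump y \<partial>(lborel :: 'a measure)))"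

lemma bump_le_1: "bump x \<le> 1"
  by (simp add: bump_def flat_deriv_def)

lemma borel_measurable_bump [measurable]: "bump \<in> borel_measurable borel"
  by (rule borel_measurable_continuous_onI[OF smooth_on_continuous[OF smooth_bump]])

lemma integrable_bump: "integrable lborel (bump :: 'a::euclidean_space \<Rightarrow> real)"
proof (rule Bochner_Integration.integrable_bound)
  show "integrable lborel (indicator (cball (0::'a) 1) :: 'a \<Rightarrow> real)"
    using emeasure_bounded_finite[OF bounded_cball[of "0::'a" 1]] by (intro integrable_real_indicator) auto
  show "AE x in lborel. norm (bump x) \<le> norm (indicator (cball (0::'a) 1) x :: real)"
  proof (rule AE_I2)
    fix x :: 'a
    show "norm (bump x) \<le> norm (indicator (cball (0::'a) 1) x :: real)"
      using bump_le_1[of x] bump_nonneg[of x] bump_eq_0[of x] by (cases "norm x \<le> 1") auto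
  qed
qed measurable

lemma integral_bump_pos: "0 < (\<integral>y. bump y \<partial>(lborel :: 'a::euclidean_space measure))"
proof (rule ccontr)
  assume "\<not> ?thesis"
  moreover have "0 \<le> (\<integral>y. bump y \<partial>(lborel :: 'a measure))" by (simp add: bump_nonneg)
  ultimately have "(\<integral>y. bump y \<partial>(lborel :: 'a measure)) = 0" by simp
  then have "AE x in lborel. bump (x::'a) = 0"
    using integral_nonneg_eq_0_iff_AE[OF integrable_bump[where 'a='a]] by (simp add: bump_nonneg)
  then have "AE x in lborel. x \<notin> ball (0::'a) 1"
    by eventually_elim (metis bump_pos less_irrefl mem_ball_0)
  then have "ball (0::'a) 1 \<in> null_sets lborel" by (subst AE_iff_null_sets) auto
  moreover have "0 < unit_ball_vol (real DIM('a)) * 1 ^ DIM('a)" by (simp add: unit_ball_vol_pos)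
  ultimately show False using emeasure_ball[of 1 "0::'a"] by (simp add: null_sets_def)
qed

lemma mollifier_nonneg: "0 < \<delta> \<Longrightarrow> 0 \<le> mollifier \<delta> x"
  using integral_bump_pos[where 'a='a] by (simp add: mollifier_def bump_nonneg)

lemma mollifier_eq_0: "0 < \<delta> \<Longrightarrow> \<delta> \<le> norm x \<Longrightarrow> mollifier \<delta> x = 0"
  by (simp add: mollifier_def bump_eq_0)

lemma mollifier_le:
  "0 < \<delta> \<Longrightarrow> mollifier \<delta> (x::'a::euclidean_space) \<le> 1 / (\<delta> ^ DIM('a) * (\<integral>y. bump y \<partial>(lborel :: 'a measure)))"
  using integral_bump_pos[where 'a='a] unfolding mollifier_def by (intro divide_right_mono bump_le_1) auto

lemma smooth_mollifier: "smooth_on UNIV (mollifier \<delta> :: 'a::euclidean_space \<Rightarrow> real)"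
proof -
  define c where "c = inverse (\<delta> ^ DIM('a) * (\<integral>y. bump y \<partial>(lborel :: 'a measure)))"
  have "smooth_on UNIV (\<lambda>x::'a. bump ((1 / \<delta>) *\<^sub>R x))"
  proof (rule smooth_on_compose[where T=UNIV and f=bump and \<Psi>="\<lambda>x. (1 / \<delta>) *\<^sub>R x"])
    show "smooth_on UNIV (\<lambda>x::'a. ((1 / \<delta>) *\<^sub>R x) \<bullet> b)" for b
      using smooth_on_inner[of UNIV "(1 / \<delta>) *\<^sub>R b"] by simp
  qed (auto simp: smooth_bump)
  then have "smooth_on UNIV (\<lambda>x::'a. bump ((1 / \<delta>) *\<^sub>R x) * c)"
    by (intro smooth_on_mult smooth_on_const) auto
  moreover have "mollifier \<delta> = (\<lambda>x::'a. bump ((1 / \<delta>) *\<^sub>R x) * c)"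
    by (simp add: fun_eq_iff mollifier_def c_def divide_inverse)
  ultimately show ?thesis by simp
qed

lemma borel_measurable_mollifier [measurable]: "mollifier \<delta> \<in> borel_measurable borel"
  by (rule borel_measurable_continuous_onI[OF smooth_on_continuous[OF smooth_mollifier]])

lemma integral_scaling:
  fixes f :: "'a::euclidean_space \<Rightarrow> real"
  assumes d: "0 < \<delta>" and f [measurable]: "f \<in> borel_measurable borel"
  shows "(\<integral>x. f x \<partial>lborel) = \<delta> ^ DIM('a) * (\<integral>x. f (\<delta> *\<^sub>R x) \<partial>lborel)"
    and "integrable lborel f \<longleftrightarrow> integrable lborel (\<lambda>x. f (\<delta> *\<^sub>R x))"
proof -
  have e: "density (distr lborel borel (\<lambda>x. 0 + \<delta> *\<^sub>R x)) (\<lambda>_. ennreal (\<bar>\<delta>\<bar> ^ DIM('a))) = (lborel :: 'a measure)"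
    using d by (intro lborel_affine[symmetric]) simp
  have "(\<integral>x. f x \<partial>lborel) = (\<integral>x. f x \<partial>density (distr lborel borel (\<lambda>x. 0 + \<delta> *\<^sub>R x)) (\<lambda>_. ennreal (\<bar>\<delta>\<bar> ^ DIM('a))))"
    unfolding e ..
  also have "\<dots> = \<delta> ^ DIM('a) * (\<integral>x. f (\<delta> *\<^sub>R x) \<partial>lborel)"
    using d by (subst integral_density) (auto simp: integral_distr)
  finally show "(\<integral>x. f x \<partial>lborel) = \<delta> ^ DIM('a) * (\<integral>x. f (\<delta> *\<^sub>R x) \<partial>lborel)" .
  have "integrable lborel f \<longleftrightarrow> integrable (density (distr lborel borel (\<lambda>x. 0 + \<delta> *\<^sub>R x)) (\<lambda>_. ennreal (\<bar>\<delta>\<bar> ^ DIM('a)))) f"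
    unfolding e ..
  also have "\<dots> \<longleftrightarrow> integrable lborel (\<lambda>x. f (\<delta> *\<^sub>R x))"
    using d by (subst integrable_density) (auto simp: integrable_distr_eq)
  finally show "integrable lborel f \<longleftrightarrow> integrable lborel (\<lambda>x. f (\<delta> *\<^sub>R x))" .
qed

lemma integral_reflect:
  fixes f :: "'a::euclidean_space \<Rightarrow> real"
  assumes f [measurable]: "f \<in> borel_measurable borel"
  shows "(\<integral>y. f (z - y) \<partial>lborel) = (\<integral>y. f y \<partial>lborel)"
    and "integrable lborel (\<lambda>y. f (z - y)) \<longleftrightarrow> integrable lborel f"
proof -
  have e: "density (distr lborel borel (\<lambda>x. z + (-1) *\<^sub>R x)) (\<lambda>_. ennreal (\<bar>-1\<bar> ^ DIM('a))) = (lborel :: 'a measure)"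
    by (intro lborel_affine[symmetric]) simp
  then have e: "distr lborel borel (\<lambda>x. z - x) = (lborel :: 'a measure)" by (simp add: density_1)
  show "(\<integral>y. f (z - y) \<partial>lborel) = (\<integral>y. f y \<partial>lborel)"
    by (subst (2) e[symmetric]) (simp add: integral_distr)
  show "integrable lborel (\<lambda>y. f (z - y)) \<longleftrightarrow> integrable lborel f"
    by (subst (2) e[symmetric]) (simp add: integrable_distr_eq)
qed

lemma mollifier_integral:
  assumes "0 < \<delta>"
  shows "integrable lborel (mollifier \<delta> :: 'a::euclidean_space \<Rightarrow> real)"
    and "(\<integral>x. mollifier \<delta> x \<partial>(lborel :: 'a measure)) = 1"
proof -
  let ?c = "\<integral>y. bump y \<partial>(lborel :: 'a measure)"
  have c: "0 < ?c" by (rule integral_bump_pos)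
  have s: "mollifier \<delta> (\<delta> *\<^sub>R x) = bump x / (\<delta> ^ DIM('a) * ?c)" for x :: 'a
    using assms by (simp add: mollifier_def)
  show "integrable lborel (mollifier \<delta> :: 'a \<Rightarrow> real)"
    by (subst integral_scaling(2)[OF assms]) (auto simp: s integrable_bump)
  have "(\<integral>x. mollifier \<delta> x \<partial>(lborel :: 'a measure)) = \<delta> ^ DIM('a) * (\<integral>x. bump x / (\<delta> ^ DIM('a) * ?c) \<partial>(lborel :: 'a measure))"
    by (subst integral_scaling(1)[OF assms]) (auto simp: s)
  also have "\<dots> = 1" using assms c by simp
  finally show "(\<integral>x. mollifier \<delta> x \<partial>(lborel :: 'a measure)) = 1" .
qed

definition convolution :: "('a::euclidean_space \<Rightarrow> real) \<Rightarrow> ('a \<Rightarrow> real) \<Rightarrow> 'a \<Rightarrow> real" where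
  "convolution h \<phi> z = (\<integral>y. h y * \<phi> (z - y) \<partial>lborel)"

lemma smooth_compact_support_bounded:
  fixes \<phi> :: "'a::euclidean_space \<Rightarrow> real"
  assumes "continuous_on UNIV \<phi>" "\<And>x. r \<le> norm x \<Longrightarrow> \<phi> x = 0"
  obtains K where "\<And>x. \<bar>\<phi> x\<bar> \<le> K"
proof -
  have "compact (\<phi> ` cball 0 r)"
    by (intro compact_continuous_image continuous_on_subset[OF assms(1)]) auto
  then have "bounded (\<phi> ` cball 0 r)" by (rule compact_imp_bounded)
  then obtain K where K: "\<And>x. x \<in> cball 0 r \<Longrightarrow> norm (\<phi> x) \<le> K"
    unfolding bounded_iff by blast
  have "\<bar>\<phi> x\<bar> \<le> max K 0" for x
    using K[of x] assms(2)[of x] by (cases "norm x \<le> r") auto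
  then show thesis by (rule that)
qed

lemma frechet_derivative_zero_outside:
  fixes \<phi> :: "'a::euclidean_space \<Rightarrow> real"
  assumes s: "smooth_on UNIV \<phi>" and z: "\<And>x. r \<le> norm x \<Longrightarrow> \<phi> x = 0" and x: "r < norm x"
  shows "frechet_derivative \<phi> (at x) v = 0"
proof -
  have "open {x::'a. r < norm x}" by (intro open_Collect_less continuous_intros)
  then have "(\<phi> has_derivative (\<lambda>v. 0)) (at x)"
    using z x by (rule_tac has_derivative_transform_within_open[where f="\<lambda>_. 0" and s="{x. r < norm x}"]) auto
  then show ?thesis using smooth_on_has_derivative[OF s, of x] has_derivative_unique by (metis UNIV_I)
qed

lemma convolution_integrable:
  fixes h \<phi> :: "'a::euclidean_space \<Rightarrow> real"
  assumes h: "integrable lborel h" and c: "continuous_on UNIV \<phi>" and z: "\<And>x. r \<le> norm x \<Longrightarrow> \<phi> x = 0"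
  shows "integrable lborel (\<lambda>y. h y * \<phi> (x - y))"
proof -
  obtain K where K: "\<And>x. \<bar>\<phi> x\<bar> \<le> K" using smooth_compact_support_bounded[OF c z] by blast
  have [measurable]: "\<phi> \<in> borel_measurable borel" by (rule borel_measurable_continuous_onI[OF c])
  have [measurable]: "h \<in> borel_measurable borel" using borel_measurable_integrable[OF h] by simp
  show ?thesis
  proof (rule Bochner_Integration.integrable_bound)
    show "integrable lborel (\<lambda>y. K * h y)" using h by simp
    have "\<bar>h y * \<phi> (x - y)\<bar> \<le> \<bar>K * h y\<bar>" for y
      using mult_left_mono[OF K[of "x - y"], of "\<bar>h y\<bar>"] K[of 0] by (simp add: abs_mult mult.commute)
    then show "AE y in lborel. norm (h y * \<phi> (x - y)) \<le> norm (K * h y)" by (intro AE_I2) simp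
  qed measurable
qed

text \<open>The first-order Taylor remainder of \<open>\<phi>\<close> is uniformly small relative to the increment because
  its derivative is uniformly continuous, so differentiation passes under the integral.\<close>

lemma convolution_has_derivative:
  fixes h \<phi> :: "'a::euclidean_space \<Rightarrow> real"
  assumes h: "integrable lborel h" and s: "smooth_on UNIV \<phi>" and z: "\<And>x. r \<le> norm x \<Longrightarrow> \<phi> x = 0"
  shows "(convolution h \<phi> has_derivative (\<lambda>v. convolution h (\<lambda>x. frechet_derivative \<phi> (at x) v) x)) (at x)"
proof -
  define D where "D x v = frechet_derivative \<phi> (at x) v" for x v
  have dD: "(\<phi> has_derivative D x) (at x)" for x
    using smooth_on_has_derivative[OF s] unfolding D_def by (metis UNIV_I eta_contract_eq)
  have linD: "linear (D x)" for x using dD by (rule has_derivative_linear)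
  have Dc: "continuous_on UNIV (\<lambda>x. D x v)" for v
    unfolding D_def by (intro smooth_on_continuous smooth_on_frechet_derivative s)
  have D0: "D x v = 0" if "r + 1 \<le> norm x" for x v
    unfolding D_def using that by (intro frechet_derivative_zero_outside[OF s z]) auto
  have Dexp: "D x v = (\<Sum>b\<in>Basis. D x b * (v \<bullet> b))" for x v
  proof -
    have "D x v = D x (\<Sum>b\<in>Basis. (v \<bullet> b) *\<^sub>R b)" by (simp add: euclidean_representation)
    also have "\<dots> = (\<Sum>b\<in>Basis. D x b * (v \<bullet> b))"
      using linD[of x] by (simp add: linear_sum linear_scale mult.commute)
    finally show ?thesis .
  qed
  have cont: "continuous_on UNIV \<phi>" by (rule smooth_on_continuous[OF s])
  have i0: "integrable lborel (\<lambda>y. h y * \<phi> (x - y))" for x by (rule convolution_integrable[OF h cont z])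
  have iD: "integrable lborel (\<lambda>y. h y * D (x - y) v)" for x v
    by (rule convolution_integrable[OF h Dc, where r="r + 1"]) (use D0 in auto)
  define L where "L v = (\<integral>y. h y * D (x - y) v \<partial>lborel)" for v
  have Lexp: "L v = (\<Sum>b\<in>Basis. L b * (v \<bullet> b))" for v
  proof -
    have "L v = (\<integral>y. (\<Sum>b\<in>Basis. h y * D (x - y) b * (v \<bullet> b)) \<partial>lborel)"
      unfolding L_def by (subst Dexp) (simp add: sum_distrib_left mult.assoc)
    also have "\<dots> = (\<Sum>b\<in>Basis. L b * (v \<bullet> b))"
      unfolding L_def using iD by (subst Bochner_Integration.integral_sum) auto
    finally show ?thesis .
  qed
  have bl: "bounded_linear L"
  proof -
    have "bounded_linear (\<lambda>v. \<Sum>b\<in>Basis. L b * (v \<bullet> b))"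
      by (intro bounded_linear_sum bounded_linear_mult_right[THEN bounded_linear_compose] bounded_linear_inner_left)
    then show ?thesis using Lexp by (metis (no_types, lifting) ext)
  qed
  have "(convolution h \<phi> has_derivative L) (at x)"
    unfolding has_derivative_at_alt
  proof (intro conjI bl allI impI)
    fix e :: real assume e: "e > 0"
    define H where "H = (\<integral>y. \<bar>h y\<bar> \<partial>lborel) + 1"
    have H: "H \<ge> 1" by (simp add: H_def)
    define a where "a = e / (H * real DIM('a))"
    have a: "a > 0" using e H by (simp add: a_def)
    have "\<exists>d>0. \<forall>w x. dist w x < d \<longrightarrow> dist (D w b) (D x b) < a" for b
      using uniformly_continuous_compact_support[OF Dc[of b] D0[of _ b] a] by metis
    then obtain d where d: "\<And>b. d b > 0" "\<And>b w x. dist w x < d b \<Longrightarrow> dist (D w b) (D x b) < a" by metis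
    define dm where "dm = Min (d ` Basis)"
    have dm: "dm > 0" "\<And>b. b \<in> Basis \<Longrightarrow> dm \<le> d b" using d(1) by (auto simp: dm_def)
    have taylor: "\<bar>\<phi> (w + v) - \<phi> w - D w v\<bar> \<le> e / H * norm v" if v: "norm v < dm" for w v
    proof -
      define \<psi> where "\<psi> u = \<phi> u - D w u" for u
      have d\<psi>: "(\<psi> has_derivative (\<lambda>v. D u v - D w v)) (at u within ball w dm)" for u
      proof -
        have "bounded_linear (D w)" using linD linear_conv_bounded_linear by blast
        then have "(\<psi> has_derivative (\<lambda>v. D u v - D w v)) (at u)"
          unfolding \<psi>_def by (intro has_derivative_diff dD bounded_linear_imp_has_derivative)
        then show ?thesis by (rule has_derivative_at_withinI)
      qed
      have on: "onorm (\<lambda>v. D u v - D w v) \<le> e / H" if u: "u \<in> ball w dm" for u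
      proof (rule onorm_le)
        fix v
        have "\<bar>D u v - D w v\<bar> = \<bar>\<Sum>b\<in>Basis. (D u b - D w b) * (v \<bullet> b)\<bar>"
          by (subst (1 2) Dexp) (simp add: sum_subtractf left_diff_distrib)
        also have "\<dots> \<le> (\<Sum>b\<in>Basis. \<bar>(D u b - D w b) * (v \<bullet> b)\<bar>)" by (rule sum_abs)
        also have "\<dots> \<le> (\<Sum>b\<in>(Basis::'a set). a * norm v)"
        proof (rule sum_mono)
          fix b :: 'a assume b: "b \<in> Basis"
          have "dist u w < d b" using u dm(2)[OF b] by (simp add: dist_commute)
          then have "\<bar>D u b - D w b\<bar> \<le> a" using d(2) by (force simp: dist_real_def)
          then show "\<bar>(D u b - D w b) * (v \<bullet> b)\<bar> \<le> a * norm v"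
            unfolding abs_mult using Basis_le_norm[OF b, of v] a by (intro mult_mono) auto
        qed
        also have "\<dots> = e / H * norm v" by (simp add: a_def)
        finally show "norm (D u v - D w v) \<le> e / H * norm v" by simp
      qed
      have "norm (\<psi> (w + v) - \<psi> w) \<le> e / H * norm (w + v - w)"
        by (rule differentiable_bound[OF convex_ball d\<psi> on]) (use v dm in \<open>auto simp: dist_norm\<close>)
      moreover have "\<psi> (w + v) - \<psi> w = \<phi> (w + v) - \<phi> w - D w v"
        using linD[of w] by (simp add: \<psi>_def linear_add)
      ultimately show ?thesis by simp
    qed
    show "\<exists>d>0. \<forall>y. norm (y - x) < d \<longrightarrow>
        norm (convolution h \<phi> y - convolution h \<phi> x - L (y - x)) \<le> e * norm (y - x)"
    proof (intro exI conjI allI impI)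
      show "dm > 0" by (rule dm(1))
      fix y assume y: "norm (y - x) < dm"
      define v where "v = y - x"
      have yv: "y - u = (x - u) + v" for u by (simp add: v_def)
      have "convolution h \<phi> y - convolution h \<phi> x - L v =
          (\<integral>u. h u * \<phi> (y - u) - h u * \<phi> (x - u) - h u * D (x - u) v \<partial>lborel)"
        unfolding convolution_def L_def using i0 iD by simp
      also have "\<dots> = (\<integral>u. h u * (\<phi> ((x - u) + v) - \<phi> (x - u) - D (x - u) v) \<partial>lborel)"
        by (simp add: yv right_diff_distrib)
      finally have eq: "convolution h \<phi> y - convolution h \<phi> x - L v = \<dots>" .
      have "\<bar>\<integral>u. h u * (\<phi> ((x - u) + v) - \<phi> (x - u) - D (x - u) v) \<partial>lborel\<bar> \<le>
          (\<integral>u. \<bar>h u\<bar> * (e / H * norm v) \<partial>lborel)"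
      proof (rule integral_abs_bound[THEN order_trans], rule integral_mono)
        have "integrable lborel (\<lambda>u. h u * \<phi> (y - u) - h u * \<phi> (x - u) - h u * D (x - u) v)"
          using i0 iD by auto
        then have "integrable lborel (\<lambda>u. h u * (\<phi> ((x - u) + v) - \<phi> (x - u) - D (x - u) v))"
          by (simp add: yv right_diff_distrib)
        then show "integrable lborel (\<lambda>u. \<bar>h u * (\<phi> ((x - u) + v) - \<phi> (x - u) - D (x - u) v)\<bar>)" by simp
        show "integrable lborel (\<lambda>u. \<bar>h u\<bar> * (e / H * norm v))" using h by simp
        show "\<bar>h u * (\<phi> ((x - u) + v) - \<phi> (x - u) - D (x - u) v)\<bar> \<le> \<bar>h u\<bar> * (e / H * norm v)" for u
          unfolding abs_mult using y by (intro mult_left_mono taylor) (auto simp: v_def)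
      qed
      also have "\<dots> = (\<integral>u. \<bar>h u\<bar> \<partial>lborel) * (e / H * norm v)" by simp
      also have "\<dots> \<le> H * (e / H * norm v)" using e H by (intro mult_right_mono) (auto simp: H_def)
      also have "\<dots> = e * norm v" using H by simp
      finally show "norm (convolution h \<phi> y - convolution h \<phi> x - L (y - x)) \<le> e * norm (y - x)"
        using eq by (simp add: v_def)
    qed
  qed
  then show ?thesis unfolding L_def D_def convolution_def .
qed

text \<open>A derivative of a convolution is again a convolution with a smooth kernel of compact support, so
  smoothness follows by induction on the order.\<close>

lemma smooth_convolution:
  fixes h \<phi> :: "'a::euclidean_space \<Rightarrow> real"
  assumes h: "integrable lborel h" and s: "smooth_on UNIV \<phi>" and z: "\<And>x. r \<le> norm x \<Longrightarrow> \<phi> x = 0"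
  shows "smooth_on UNIV (convolution h \<phi>)"
proof -
  have "Ck_on k UNIV (convolution h \<phi>)" for k
    using s z
  proof (induction k arbitrary: \<phi> r)
    case 0
    then show ?case
      using convolution_has_derivative[OF h 0]
      by (auto intro!: continuous_at_imp_continuous_on has_derivative_continuous)
  next
    case (Suc k)
    show ?case
    proof (rule Ck_on_SucI)
      show "(convolution h \<phi> has_derivative (\<lambda>v. convolution h (\<lambda>x. frechet_derivative \<phi> (at x) v) x)) (at x)" for x
        by (rule convolution_has_derivative[OF h Suc.prems])
      show "Ck_on k UNIV (\<lambda>x. convolution h (\<lambda>x. frechet_derivative \<phi> (at x) v) x)" for v
      proof (rule Suc.IH)
        show "smooth_on UNIV (\<lambda>x. frechet_derivative \<phi> (at x) v)" by (intro smooth_on_frechet_derivative Suc.prems)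
        show "frechet_derivative \<phi> (at x) v = 0" if "r + 1 \<le> norm x" for x
          using that by (intro frechet_derivative_zero_outside[OF Suc.prems]) auto
      qed
    qed simp
  qed
  then show ?thesis by (simp add: smooth_on_def)
qed

lemma mollifier_mult_integrable:
  fixes f :: "'a::euclidean_space \<Rightarrow> real"
  assumes d: "0 < \<delta>" and f: "integrable lborel f"
  shows "integrable lborel (\<lambda>y. mollifier \<delta> (z - y) * f y)"
  using convolution_integrable[OF f smooth_on_continuous[OF smooth_mollifier] mollifier_eq_0[OF d], where x=z]
  by (simp add: mult.commute)

text \<open>Jensen's inequality for the probability density \<open>y \<mapsto> mollifier \<delta> (z - y)\<close>.\<close>

lemma convolution_mollifier_diff_sq_le:
  fixes h :: "'a::euclidean_space \<Rightarrow> real"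
  assumes d: "0 < \<delta>" and h: "integrable lborel h" and hi: "integrable lborel (\<lambda>x. (h x)\<^sup>2)"
  shows "integrable lborel (\<lambda>y. mollifier \<delta> (z - y) * (h y - a)\<^sup>2)"
    and "(convolution h (mollifier \<delta>) z - a)\<^sup>2 \<le> (\<integral>y. mollifier \<delta> (z - y) * (h y - a)\<^sup>2 \<partial>lborel)"
proof -
  let ?K = "\<lambda>y. mollifier \<delta> (z - y)"
  have K: "integrable lborel ?K" "(\<integral>y. ?K y \<partial>lborel) = 1"
    using mollifier_integral[OF d, where 'a='a] integral_reflect[of "mollifier \<delta>" z] by simp_all
  have K1: "integrable lborel (\<lambda>y. ?K y * h y)" and K2: "integrable lborel (\<lambda>y. ?K y * (h y)\<^sup>2)"
    using mollifier_mult_integrable[OF d] h hi by auto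
  have c: "(\<integral>y. ?K y * h y \<partial>lborel) = convolution h (mollifier \<delta>) z"
    by (simp add: convolution_def mult.commute)
  have ex: "?K y * (h y - t)\<^sup>2 = ?K y * (h y)\<^sup>2 - 2 * t * (?K y * h y) + t\<^sup>2 * ?K y" for y t
    by (simp add: power2_diff algebra_simps)
  show "integrable lborel (\<lambda>y. ?K y * (h y - a)\<^sup>2)"
    unfolding ex using K K1 K2 by auto
  define m where "m = convolution h (mollifier \<delta>) z"
  have val: "(\<integral>y. ?K y * (h y - t)\<^sup>2 \<partial>lborel) = (\<integral>y. ?K y * (h y)\<^sup>2 \<partial>lborel) - 2 * t * m + t\<^sup>2" for t
    unfolding ex using K K1 K2 c by (simp add: m_def)
  have "0 \<le> (\<integral>y. ?K y * (h y - m)\<^sup>2 \<partial>lborel)"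
    by (intro Bochner_Integration.integral_nonneg) (simp add: mollifier_nonneg[OF d])
  then show "(convolution h (mollifier \<delta>) z - a)\<^sup>2 \<le> (\<integral>y. ?K y * (h y - a)\<^sup>2 \<partial>lborel)"
    unfolding val m_def[symmetric] by (simp add: power2_eq_square algebra_simps)
qed

lemma integrable_of_square_integrable_bounded_support:
  fixes h :: "'a::euclidean_space \<Rightarrow> real"
  assumes [measurable]: "h \<in> borel_measurable borel" and hi: "integrable lborel (\<lambda>x. (h x)\<^sup>2)"
    and supp: "\<And>x. B \<le> norm x \<Longrightarrow> h x = 0"
  shows "integrable lborel h"
proof (rule Bochner_Integration.integrable_bound)
  have "integrable lborel (indicator (cball (0::'a) B) :: 'a \<Rightarrow> real)"
    using emeasure_bounded_finite[OF bounded_cball[of "0::'a" B]] by (intro integrable_real_indicator) auto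
  then show "integrable lborel (\<lambda>x. indicator (cball (0::'a) B) x + (h x)\<^sup>2)" using hi by simp
  have "\<bar>h x\<bar> \<le> indicator (cball (0::'a) B) x + (h x)\<^sup>2" for x
  proof (cases "norm x \<le> B")
    case True
    have "0 \<le> (\<bar>h x\<bar> - 1 / 2)\<^sup>2" by simp
    then have "\<bar>h x\<bar> \<le> (h x)\<^sup>2 + 1 / 4" by (simp add: power2_diff power_divide)
    then show ?thesis using True by simp
  qed (use supp in auto)
  then show "AE x in lborel. norm (h x) \<le> norm (indicator (cball (0::'a) B) x + (h x)\<^sup>2)"
    by (intro AE_I2) (auto simp: abs_of_nonneg)
qed measurable

text \<open>The mollification may be evaluated at a point displaced by at most \<open>L \<delta>\<^sub>n\<close>: the kernel is
  then still bounded by \<open>O(\<delta>\<^sub>n\<^sup>-\<^sup>d)\<close> and supported in the ball of radius \<open>(L + 1) \<delta>\<^sub>n\<close> around \<open>x\<close>,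
  so the error is an average of \<open>L\<^sup>2\<close> distances between \<open>h\<close> and its small translates.\<close>

lemma mollify_tendsto:
  fixes h :: "'a::euclidean_space \<Rightarrow> real" and \<Psi> :: "nat \<Rightarrow> 'a \<Rightarrow> 'a"
  assumes hm [measurable]: "h \<in> borel_measurable borel" and hi: "integrable lborel (\<lambda>x. (h x)\<^sup>2)"
    and supp: "\<And>x. B \<le> norm x \<Longrightarrow> h x = 0" and A [measurable]: "A \<in> sets borel"
    and \<delta>: "\<And>n. 0 < \<delta> n" "\<delta> \<longlonglongrightarrow> 0" and L: "0 \<le> L"
    and near: "\<And>n x. x \<in> A \<Longrightarrow> norm (\<Psi> n x - x) \<le> L * \<delta> n"
  shows "(\<lambda>n. \<integral>\<^sup>+x. indicator A x * ennreal ((convolution h (mollifier (\<delta> n)) (\<Psi> n x) - h x)\<^sup>2) \<partial>lborel) \<longlonglongrightarrow> 0"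
proof -
  let ?d = "DIM('a)" and ?c = "\<integral>y. bump y \<partial>(lborel :: 'a measure)"
  have c: "0 < ?c" by (rule integral_bump_pos)
  have h: "integrable lborel h" by (rule integrable_of_square_integrable_bounded_support[OF hm hi supp])
  define Q where "Q = unit_ball_vol (real ?d) * (L + 1) ^ ?d / ?c"
  have Q: "0 < Q" using c L by (simp add: Q_def unit_ball_vol_pos)
  have main: "(\<integral>\<^sup>+x. indicator A x * ennreal ((convolution h (mollifier (\<delta> n)) (\<Psi> n x) - h x)\<^sup>2) \<partial>lborel) \<le> ennreal (Q * e)"
    if e: "0 \<le> e" and d: "(L + 1) * \<delta> n \<le> d"
      and tr: "\<And>z. norm z < d \<Longrightarrow> (\<integral>\<^sup>+x. ennreal ((h (x + z) - h x)\<^sup>2) \<partial>lborel) \<le> ennreal e" for n e d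
  proof -
    define r where "r = (L + 1) * \<delta> n"
    define C where "C = 1 / (\<delta> n ^ ?d * ?c)"
    have r: "0 < r" using L \<delta> by (simp add: r_def)
    have C: "0 < C" using c \<delta> by (simp add: C_def)
    have Bm [measurable]: "ball (0::'a) r \<in> sets borel" by simp
    have Im [measurable]: "(\<lambda>z::'a. ennreal C * indicator (ball 0 r) z) \<in> borel_measurable borel"
      by (intro borel_measurable_times_ennreal borel_measurable_const borel_measurable_indicator Bm)
    have pt: "indicator A x * ennreal ((convolution h (mollifier (\<delta> n)) (\<Psi> n x) - h x)\<^sup>2) \<le>
        (\<integral>\<^sup>+z. (ennreal C * indicator (ball 0 r) z) * ennreal ((h (x + z) - h x)\<^sup>2) \<partial>lborel)" for x
    proof (cases "x \<in> A")
      case True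
      let ?K = "\<lambda>y. mollifier (\<delta> n) (\<Psi> n x - y)"
      have "ennreal ((convolution h (mollifier (\<delta> n)) (\<Psi> n x) - h x)\<^sup>2) \<le>
          ennreal (\<integral>y. ?K y * (h y - h x)\<^sup>2 \<partial>lborel)"
        by (intro ennreal_leI convolution_mollifier_diff_sq_le \<delta> h hi)
      also have "\<dots> = (\<integral>\<^sup>+y. ennreal (?K y * (h y - h x)\<^sup>2) \<partial>lborel)"
        by (intro nn_integral_eq_integral[symmetric] convolution_mollifier_diff_sq_le \<delta> h hi)
          (simp add: mollifier_nonneg[OF \<delta>(1)])
      also have "\<dots> \<le> (\<integral>\<^sup>+y. ennreal C * indicator (ball 0 r) (y - x) * ennreal ((h (x + (y - x)) - h x)\<^sup>2) \<partial>lborel)"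
      proof (rule nn_integral_mono)
        fix y
        have k: "?K y \<le> C * indicator (ball 0 r) (y - x)"
        proof (cases "norm (y - x) < r")
          case True
          then show ?thesis using mollifier_le[OF \<delta>(1)] by (simp add: C_def)
        next
          case False
          have "norm (\<Psi> n x - y) \<ge> norm (y - x) - norm (\<Psi> n x - x)"
            using norm_triangle_ineq2[of "y - x" "\<Psi> n x - x"] by (simp add: norm_minus_commute)
          then have "\<delta> n \<le> norm (\<Psi> n x - y)"
            using False near[OF \<open>x \<in> A\<close>, of n] by (simp add: r_def algebra_simps)
          then show ?thesis using mollifier_eq_0[OF \<delta>(1), of n "\<Psi> n x - y"] False by simp
        qed
        have "ennreal (?K y * (h y - h x)\<^sup>2) \<le> ennreal (C * indicator (ball 0 r) (y - x) * (h y - h x)\<^sup>2)"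
          by (intro ennreal_leI mult_right_mono k) simp
        also have "\<dots> = ennreal C * indicator (ball 0 r) (y - x) * ennreal ((h (x + (y - x)) - h x)\<^sup>2)"
          using C by (simp add: ennreal_mult' ennreal_indicator)
        finally show "ennreal (?K y * (h y - h x)\<^sup>2) \<le> \<dots>" .
      qed
      also have "\<dots> = (\<integral>\<^sup>+z. (ennreal C * indicator (ball 0 r) z) * ennreal ((h (x + z) - h x)\<^sup>2) \<partial>lborel)"
        using nn_integral_translation[of "\<lambda>z. ennreal C * indicator (ball 0 r) z * ennreal ((h (x + z) - h x)\<^sup>2)" "- x"]
        by simp
      finally show ?thesis using True by simp
    qed simp
    have meas: "(\<lambda>(x, z). (ennreal C * indicator (ball 0 r) z) * ennreal ((h (x + z) - h x)\<^sup>2)) \<in> borel_measurable (lborel \<Otimes>\<^sub>M (lborel :: 'a measure))"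
      by measurable
    have "(\<integral>\<^sup>+x. indicator A x * ennreal ((convolution h (mollifier (\<delta> n)) (\<Psi> n x) - h x)\<^sup>2) \<partial>lborel) \<le>
        (\<integral>\<^sup>+x. (\<integral>\<^sup>+z. (ennreal C * indicator (ball 0 r) z) * ennreal ((h (x + z) - h x)\<^sup>2) \<partial>lborel) \<partial>lborel)"
      by (intro nn_integral_mono pt)
    also have "\<dots> = (\<integral>\<^sup>+z. (\<integral>\<^sup>+x. (ennreal C * indicator (ball 0 r) z) * ennreal ((h (x + z) - h x)\<^sup>2) \<partial>lborel) \<partial>lborel)"
      by (rule lborel_pair.Fubini'[OF meas, symmetric])
    also have "\<dots> = (\<integral>\<^sup>+z. (ennreal C * indicator (ball 0 r) z) * (\<integral>\<^sup>+x. ennreal ((h (x + z) - h x)\<^sup>2) \<partial>lborel) \<partial>lborel)"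
      by (intro nn_integral_cong nn_integral_cmult) measurable
    also have "\<dots> \<le> (\<integral>\<^sup>+z. (ennreal C * ennreal e) * indicator (ball (0::'a) r) z \<partial>lborel)"
    proof (rule nn_integral_mono)
      fix z :: 'a
      show "(ennreal C * indicator (ball 0 r) z) * (\<integral>\<^sup>+x. ennreal ((h (x + z) - h x)\<^sup>2) \<partial>lborel) \<le>
          (ennreal C * ennreal e) * indicator (ball 0 r) z"
        using tr[of z] d by (cases "norm z < r") (auto simp: r_def intro!: mult_left_mono)
    qed
    also have "\<dots> = (ennreal C * ennreal e) * emeasure lborel (ball (0::'a) r)"
      by (rule nn_integral_cmult_indicator) simp
    also have "\<dots> = ennreal (C * e * (unit_ball_vol (real ?d) * r ^ ?d))"
      using r C e by (simp add: emeasure_ball ennreal_mult')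
    also have "C * e * (unit_ball_vol (real ?d) * r ^ ?d) = Q * e"
      using \<delta>(1)[of n] c by (simp add: C_def Q_def r_def power_mult_distrib)
    finally show ?thesis .
  qed
  show ?thesis
  proof (rule order_tendstoI)
    fix a :: ennreal assume a: "0 < a"
    obtain t where t: "0 < t" "ennreal t < a"
    proof -
      obtain b where b: "0 < b" "b < a" using dense[OF a] by blast
      then have "b < top" using less_top_ennreal by (meson less_le_trans top_greatest)
      then have "b = ennreal (enn2real b)" by simp
      then show thesis using b that[of "enn2real b"] by (metis ennreal_less_zero_iff)
    qed
    have e: "0 < t / Q" using t Q by simp
    obtain d where d: "d > 0" "\<And>z. norm z < d \<Longrightarrow> (\<integral>\<^sup>+x. ennreal ((h (x + z) - h x)\<^sup>2) \<partial>lborel) \<le> ennreal (t / Q)"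
      using L2_translation_continuous[OF hm hi supp e] by blast
    have "(\<lambda>n. (L + 1) * \<delta> n) \<longlonglongrightarrow> (L + 1) * 0" by (intro tendsto_intros \<delta>)
    then have "\<forall>\<^sub>F n in sequentially. (L + 1) * \<delta> n < d" using d(1) by (intro order_tendstoD(2)) auto
    then show "\<forall>\<^sub>F n in sequentially.
        (\<integral>\<^sup>+x. indicator A x * ennreal ((convolution h (mollifier (\<delta> n)) (\<Psi> n x) - h x)\<^sup>2) \<partial>lborel) < a"
    proof eventually_elim
      case (elim n)
      have "(\<integral>\<^sup>+x. indicator A x * ennreal ((convolution h (mollifier (\<delta> n)) (\<Psi> n x) - h x)\<^sup>2) \<partial>lborel) \<le> ennreal (Q * (t / Q))"
        using e elim d(2) by (intro main[of "t / Q" n d]) auto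
      then show ?case using t Q by simp
    qed
  qed simp
qed

section \<open>Weak gradients\<close>

text \<open>Replacing functions on \<open>\<Omega>\<close> by Borel functions that vanish outside turns integrals over \<open>\<Omega>\<close> into
  integrals for \<^const>\<open>lborel\<close>, to which Tonelli's theorem and translation invariance apply.\<close>

lemma square_integrable_borel_representative:
  fixes f :: "'a::euclidean_space \<Rightarrow> real"
  assumes \<Omega>: "open \<Omega>" and f: "square_integrable (lebesgue_on \<Omega>) f"
  obtains g where "g \<in> borel_measurable borel" "\<And>x. x \<notin> \<Omega> \<Longrightarrow> g x = 0"
    "AE x in lebesgue_on \<Omega>. g x = f x" "integrable lborel (\<lambda>x. (g x)\<^sup>2)"
proof -
  have \<Omega>b: "\<Omega> \<in> sets borel" using \<Omega> by simp
  then have \<Omega>l: "\<Omega> \<inter> space lebesgue \<in> sets lebesgue" by (simp add: lmeasurable_iff_integrable)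
  have "(\<lambda>x. indicator \<Omega> x *\<^sub>R f x) \<in> borel_measurable lebesgue"
    using f borel_measurable_restrict_space_iff[OF \<Omega>l, of f] unfolding square_integrable_def by blast
  then obtain g0 where g0 [measurable]: "g0 \<in> borel_measurable lborel"
    and ae: "AE x in lborel. indicator \<Omega> x *\<^sub>R f x = g0 x"
    using completion_ex_borel_measurable_real by blast
  define g where "g x = indicator \<Omega> x * g0 x" for x
  have gm [measurable]: "g \<in> borel_measurable borel"
    unfolding g_def using g0 \<Omega>b by (intro borel_measurable_times borel_measurable_indicator) auto
  have "AE x in lebesgue. indicator \<Omega> x *\<^sub>R f x = g0 x" using ae by (simp add: AE_completion_iff)
  then have ael: "AE x in lebesgue. x \<in> \<Omega> \<longrightarrow> g x = f x" by eventually_elim (auto simp: g_def)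
  have aeon: "AE x in lebesgue_on \<Omega>. g x = f x" using ael by (subst AE_restrict_space_iff[OF \<Omega>l])
  have I: "integrable lebesgue (\<lambda>x. indicator \<Omega> x *\<^sub>R (norm (f x))\<^sup>2)"
    using f integrable_restrict_space[OF \<Omega>l, of "\<lambda>x. (norm (f x))\<^sup>2"] unfolding square_integrable_def by blast
  have E: "AE x in lebesgue. indicator \<Omega> x *\<^sub>R (norm (f x))\<^sup>2 = (g x)\<^sup>2"
    using ael by eventually_elim (auto simp: g_def split: split_indicator)
  have gl: "(\<lambda>x. (g x)\<^sup>2) \<in> borel_measurable lebesgue"
    by (intro measurable_completion) measurable
  have "integrable lebesgue (\<lambda>x. (g x)\<^sup>2)"
    by (rule integrable_cong_AE_imp[OF I gl E])
  then have "integrable lborel (\<lambda>x. (g x)\<^sup>2)" by (subst (asm) integrable_completion) auto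
  moreover have "g x = 0" if "x \<notin> \<Omega>" for x using that by (simp add: g_def)
  ultimately show thesis using that[OF gm _ aeon] by blast
qed

lemma lebesgue_on_borel:
  fixes f :: "'a::euclidean_space \<Rightarrow> real"
  assumes \<Omega>: "open \<Omega>" and f: "f \<in> borel_measurable borel" "\<And>x. x \<notin> \<Omega> \<Longrightarrow> f x = 0"
  shows "(\<integral>x. f x \<partial>lebesgue_on \<Omega>) = (\<integral>x. f x \<partial>lborel)"
    and "integrable (lebesgue_on \<Omega>) f \<longleftrightarrow> integrable lborel f"
proof -
  have \<Omega>l: "\<Omega> \<inter> space lebesgue \<in> sets lebesgue" using \<Omega> by auto
  have e: "(\<lambda>x. indicator \<Omega> x *\<^sub>R f x) = f" using f(2) by (auto split: split_indicator)
  show "(\<integral>x. f x \<partial>lebesgue_on \<Omega>) = (\<integral>x. f x \<partial>lborel)"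
    using f(1) unfolding integral_restrict_space[OF \<Omega>l] e by (simp add: integral_completion)
  show "integrable (lebesgue_on \<Omega>) f \<longleftrightarrow> integrable lborel f"
    using f(1) unfolding integrable_restrict_space[OF \<Omega>l] e by (simp add: integrable_completion)
qed

text \<open>With this test function, the definition of the weak gradient says that the gradient of a
  mollification at \<open>z\<close> is the mollified weak gradient.\<close>

lemma test_function_mollifier:
  assumes d: "0 < \<delta>" and sub: "cball z \<delta> \<subseteq> \<Omega>"
  shows "test_function \<Omega> (\<lambda>y. mollifier \<delta> (z - y))"
    and "frechet_derivative (\<lambda>y. mollifier \<delta> (z - y)) (at y) v = - frechet_derivative (mollifier \<delta>) (at (z - y)) v"
proof -
  have supp: "closure {y. mollifier \<delta> (z - y) \<noteq> 0} \<subseteq> cball z \<delta>"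
    using mollifier_eq_0[OF d] by (intro closure_minimal) (force simp: dist_norm)+
  have "smooth_on UNIV (\<lambda>y. mollifier \<delta> (z - y))"
  proof (rule smooth_on_compose[where T=UNIV and f="mollifier \<delta>" and \<Psi>="\<lambda>y. z - y"])
    show "smooth_on UNIV (\<lambda>y. (z - y) \<bullet> b)" for b
      unfolding inner_diff_left by (intro smooth_on_diff smooth_on_const smooth_on_inner) auto
  qed (auto intro: smooth_mollifier)
  moreover have "compact (closure {y. mollifier \<delta> (z - y) \<noteq> 0})"
    using supp by (meson bounded_cball bounded_subset closed_closure compact_eq_bounded_closed)
  ultimately show "test_function \<Omega> (\<lambda>y. mollifier \<delta> (z - y))"
    using supp sub by (auto simp: test_function_def)
  have "((\<lambda>y. mollifier \<delta> (z - y)) has_derivative (\<lambda>v. frechet_derivative (mollifier \<delta>) (at (z - y)) (- v))) (at y)"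
  proof (rule has_derivative_compose[where f="\<lambda>y. z - y" and f'=uminus])
    show "((\<lambda>y. z - y) has_derivative uminus) (at y)" by (auto intro!: derivative_eq_intros)
    show "(mollifier \<delta> has_derivative frechet_derivative (mollifier \<delta>) (at (z - y))) (at (z - y))"
      using smooth_on_has_derivative[OF smooth_mollifier] by blast
  qed
  then have "frechet_derivative (\<lambda>y. mollifier \<delta> (z - y)) (at y) = (\<lambda>v. frechet_derivative (mollifier \<delta>) (at (z - y)) (- v))"
    by (metis frechet_derivative_at)
  moreover have "linear (frechet_derivative (mollifier \<delta>) (at (z - y)))"
    using smooth_on_has_derivative[OF smooth_mollifier] has_derivative_linear by blast
  ultimately show "frechet_derivative (\<lambda>y. mollifier \<delta> (z - y)) (at y) v = - frechet_derivative (mollifier \<delta>) (at (z - y)) v"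
    by (simp add: linear_neg)
qed

lemma smooth_on_borel_measurable: "smooth_on UNIV f \<Longrightarrow> f \<in> borel_measurable borel"
  by (intro borel_measurable_continuous_onI smooth_on_continuous)

lemma bounded_norm_bound:
  fixes \<Omega> :: "'a::real_normed_vector set"
  assumes "bounded \<Omega>" obtains B where "\<And>x. B \<le> norm x \<Longrightarrow> x \<notin> \<Omega>"
proof -
  obtain B where B: "\<And>x. x \<in> \<Omega> \<Longrightarrow> norm x \<le> B" using assms by (auto simp: bounded_iff)
  then have "x \<notin> \<Omega>" if "B + 1 \<le> norm x" for x using that B[of x] by force
  then show thesis by (rule that)
qed

text \<open>Fundamental lemma of the calculus of variations, by mollification in the interior.\<close>

lemma fundamental_lemma:
  fixes g :: "'a::euclidean_space \<Rightarrow> real"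
  assumes \<Omega>: "open \<Omega>" "bounded \<Omega>" and gm [measurable]: "g \<in> borel_measurable borel"
    and gi: "integrable lborel (\<lambda>x. (g x)\<^sup>2)" and g0: "\<And>x. x \<notin> \<Omega> \<Longrightarrow> g x = 0"
    and test: "\<And>\<phi>. test_function \<Omega> \<phi> \<Longrightarrow> (\<integral>x. g x * \<phi> x \<partial>lborel) = 0"
  shows "AE x in lborel. g x = 0"
proof -
  obtain B where B: "\<And>x. B \<le> norm x \<Longrightarrow> x \<notin> \<Omega>" using bounded_norm_bound[OF \<Omega>(2)] by blast
  have ne: "- \<Omega> \<noteq> {}"
  proof
    assume "- \<Omega> = {}"
    then have "\<Omega> = UNIV" by auto
    then show False using \<Omega>(2) not_bounded_UNIV[where 'a='a] by simp
  qed
  define A where "A k = {x. inverse (real (Suc k)) \<le> infdist x (- \<Omega>)}" for k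
  have Ab [measurable]: "A k \<in> sets borel" for k
    unfolding A_def by (intro borel_closed closed_Collect_le continuous_intros)
  have ball: "cball x \<delta> \<subseteq> \<Omega>" if "x \<in> A k" "\<delta> < inverse (real (Suc k))" for x k \<delta>
  proof
    fix y assume "y \<in> cball x \<delta>"
    moreover have "inverse (real (Suc k)) \<le> dist x y" if "y \<in> - \<Omega>"
      using \<open>x \<in> A k\<close> infdist_le[OF that, of x] by (simp add: A_def)
    ultimately show "y \<in> \<Omega>" using that by force
  qed
  have "AE x in lborel. x \<in> A k \<longrightarrow> g x = 0" for k
  proof -
    define \<delta> where "\<delta> n = inverse (real (Suc (n + Suc k)))" for n
    have \<delta>: "0 < \<delta> n" "\<delta> n < inverse (real (Suc k))" for n
      by (auto simp: \<delta>_def intro!: less_imp_inverse_less)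
    have \<delta>lim: "\<delta> \<longlonglongrightarrow> 0"
      unfolding \<delta>_def using LIMSEQ_ignore_initial_segment[OF LIMSEQ_inverse_real_of_nat, of "Suc k"] by simp
    \<comment> \<open>The mollification of \<open>g\<close> at \<open>x\<close> is the integral of \<open>g\<close> against a test function supported near \<open>x\<close>.\<close>
    have conv0: "convolution g (mollifier (\<delta> n)) x = 0" if "x \<in> A k" for x n
      unfolding convolution_def using test[OF test_function_mollifier(1)[OF \<delta>(1) ball[OF that \<delta>(2)]]] .
    have "(\<lambda>n. \<integral>\<^sup>+x. indicator (A k) x * ennreal ((convolution g (mollifier (\<delta> n)) x - g x)\<^sup>2) \<partial>lborel) \<longlonglongrightarrow> 0"
      using B g0 by (intro mollify_tendsto[where L=0 and B=B] gm gi Ab \<delta> \<delta>lim) auto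
    moreover have "(\<integral>\<^sup>+x. indicator (A k) x * ennreal ((convolution g (mollifier (\<delta> n)) x - g x)\<^sup>2) \<partial>lborel) =
        (\<integral>\<^sup>+x. indicator (A k) x * ennreal ((g x)\<^sup>2) \<partial>lborel)" for n
      by (intro nn_integral_cong) (auto simp: conv0 split: split_indicator)
    ultimately have "(\<integral>\<^sup>+x. indicator (A k) x * ennreal ((g x)\<^sup>2) \<partial>lborel) = 0"
      using LIMSEQ_unique[OF tendsto_const] by simp
    then have "AE x in lborel. indicator (A k) x * ennreal ((g x)\<^sup>2) = 0"
      by (subst (asm) nn_integral_0_iff_AE) measurable
    then show ?thesis by eventually_elim (auto split: split_indicator_asm simp: ennreal_eq_0_iff)
  qed
  then have "AE x in lborel. \<forall>k. x \<in> A k \<longrightarrow> g x = 0" by (subst AE_all_countable) blast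
  then show ?thesis
  proof eventually_elim
    case (elim x)
    show ?case
    proof (cases "x \<in> \<Omega>")
      case True
      then have "0 < infdist x (- \<Omega>)"
        using in_closed_iff_infdist_zero[of "- \<Omega>" x] \<Omega>(1) ne infdist_nonneg[of x "- \<Omega>"]
        by (auto simp: less_le)
      then obtain k where "inverse (real (Suc k)) < infdist x (- \<Omega>)" using reals_Archimedean by blast
      then have "x \<in> A k" unfolding A_def by (simp only: mem_Collect_eq less_imp_le)
      then show ?thesis using elim by blast
    qed (rule g0)
  qed
qed

lemma test_function_props:
  assumes t: "test_function \<Omega> \<phi>"
  shows "smooth_on UNIV \<phi>" and "x \<notin> \<Omega> \<Longrightarrow> \<phi> x = 0" and "x \<notin> \<Omega> \<Longrightarrow> frechet_derivative \<phi> (at x) v = 0"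
    and "\<exists>r. \<forall>x. r \<le> norm x \<longrightarrow> \<phi> x = 0"
proof -
  let ?S = "closure {x. \<phi> x \<noteq> 0}"
  show s: "smooth_on UNIV \<phi>" using t by (simp add: test_function_def)
  have sub: "?S \<subseteq> \<Omega>" and comp: "compact ?S" using t by (auto simp: test_function_def)
  have out: "\<phi> x = 0" if "x \<notin> ?S" for x using that closure_subset[of "{x. \<phi> x \<noteq> 0}"] by blast
  then show "x \<notin> \<Omega> \<Longrightarrow> \<phi> x = 0" using sub by blast
  show "frechet_derivative \<phi> (at x) v = 0" if "x \<notin> \<Omega>"
  proof -
    have "(\<phi> has_derivative (\<lambda>v. 0)) (at x)"
    proof (rule has_derivative_transform_within_open[where f="\<lambda>_. 0" and s="- ?S"])
      show "x \<in> - ?S" using that sub by blast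
      show "0 = \<phi> y" if "y \<in> - ?S" for y using out[of y] that by simp
    qed (simp_all add: open_Compl)
    then show ?thesis using smooth_on_has_derivative[OF s, of x] has_derivative_unique by (metis UNIV_I)
  qed
  obtain r where r: "\<And>x. x \<in> ?S \<Longrightarrow> norm x \<le> r"
    using compact_imp_bounded[OF comp] unfolding bounded_iff by blast
  have "\<phi> x = 0" if "r + 1 \<le> norm x" for x
    using r[of x] that by (intro out) linarith
  then show "\<exists>r. \<forall>x. r \<le> norm x \<longrightarrow> \<phi> x = 0" by blast
qed

lemma continuous_on_bounded_on:
  fixes f :: "'a::euclidean_space \<Rightarrow> 'b::real_normed_vector"
  assumes "bounded \<Omega>" "continuous_on UNIV f"
  obtains K where "0 \<le> K" "\<And>x. x \<in> \<Omega> \<Longrightarrow> norm (f x) \<le> K"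
proof -
  have "compact (f ` closure \<Omega>)"
    using assms by (intro compact_continuous_image continuous_on_subset[OF assms(2)]) (auto simp: compact_closure)
  then have "bounded (f ` closure \<Omega>)" by (rule compact_imp_bounded)
  then obtain K where "\<And>x. x \<in> closure \<Omega> \<Longrightarrow> norm (f x) \<le> K" unfolding bounded_iff by blast
  then have "norm (f x) \<le> max K 0" if "x \<in> \<Omega>" for x using that closure_subset by fastforce
  then show thesis by (intro that[of "max K 0"]) auto
qed

lemma square_integrable_continuous:
  fixes f :: "'a::euclidean_space \<Rightarrow> 'b::euclidean_space"
  assumes \<Omega>: "open \<Omega>" "bounded \<Omega>" and c: "continuous_on UNIV f"
  shows "square_integrable (lebesgue_on \<Omega>) f"
proof -
  have fm: "f \<in> borel_measurable (lebesgue_on \<Omega>)"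
    using borel_measurable_continuous_onI[OF c] by (intro measurable_restrict_space1 measurable_completion) simp
  obtain K where K: "\<And>x. x \<in> \<Omega> \<Longrightarrow> norm (f x) \<le> K"
    using continuous_on_bounded_on[OF \<Omega>(2) c] by blast
  have "finite_measure (lebesgue_on \<Omega>)"
    using \<Omega> by (intro finite_measure_lebesgue_on bounded_set_imp_lmeasurable) auto
  then interpret finite_measure "lebesgue_on \<Omega>" .
  have "integrable (lebesgue_on \<Omega>) (\<lambda>x. (norm (f x))\<^sup>2)"
  proof (rule integrable_const_bound[of _ "K\<^sup>2"])
    show "AE x in lebesgue_on \<Omega>. norm ((norm (f x))\<^sup>2) \<le> K\<^sup>2"
    proof (rule AE_I2)
      fix x assume "x \<in> space (lebesgue_on \<Omega>)"
      then have "x \<in> \<Omega>" by simp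
      then show "norm ((norm (f x))\<^sup>2) \<le> K\<^sup>2" using K[of x] by (simp add: power_mono)
    qed
  qed (use fm in measurable)
  then show ?thesis using fm by (simp add: square_integrable_def)
qed

lemma integrable_mult_continuous:
  fixes f c :: "'a::euclidean_space \<Rightarrow> real"
  assumes "square_integrable (lebesgue_on \<Omega>) f" "open \<Omega>" "bounded \<Omega>" "continuous_on UNIV c"
  shows "integrable (lebesgue_on \<Omega>) (\<lambda>x. f x * c x)"
  using square_integrable_mult_integrable[OF assms(1) square_integrable_continuous[OF assms(2-4)]] .

text \<open>Componentwise, the difference of two weak gradients annihilates all test functions.\<close>

lemma weak_gradient_unique:
  fixes G H :: "'a::euclidean_space \<Rightarrow> 'a"
  assumes \<Omega>: "open \<Omega>" "bounded \<Omega>"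
    and G: "square_integrable (lebesgue_on \<Omega>) G" "has_weak_gradient \<Omega> u G"
    and H: "square_integrable (lebesgue_on \<Omega>) H" "has_weak_gradient \<Omega> u H"
  shows "AE x in lebesgue_on \<Omega>. G x = H x"
proof -
  have \<Omega>l: "\<Omega> \<inter> space lebesgue \<in> sets lebesgue" using \<Omega> by auto
  have comp: "AE x in lebesgue_on \<Omega>. G x \<bullet> b = H x \<bullet> b" if b: "b \<in> Basis" for b
  proof -
    have sq: "square_integrable (lebesgue_on \<Omega>) (\<lambda>x. F x \<bullet> b)"
      if "square_integrable (lebesgue_on \<Omega>) F" for F :: "'a \<Rightarrow> 'a"
      using that Basis_le_norm[OF b]
      by (intro square_integrable_bound[OF _ that, of _ 1]) (auto simp: square_integrable_def)
    have d: "square_integrable (lebesgue_on \<Omega>) (\<lambda>x. G x \<bullet> b - H x \<bullet> b)"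
      by (intro square_integrable_diff sq G H)
    obtain g where g: "g \<in> borel_measurable borel" "\<And>x. x \<notin> \<Omega> \<Longrightarrow> g x = 0"
      "AE x in lebesgue_on \<Omega>. g x = G x \<bullet> b - H x \<bullet> b" "integrable lborel (\<lambda>x. (g x)\<^sup>2)"
      using square_integrable_borel_representative[OF \<Omega>(1) d] by blast
    have "AE x in lborel. g x = 0"
    proof (rule fundamental_lemma[OF \<Omega> g(1,4,2)])
      fix \<phi> assume t: "test_function \<Omega> \<phi>"
      note p = test_function_props[OF t]
      have c: "continuous_on UNIV \<phi>" by (rule smooth_on_continuous[OF p(1)])
      have [measurable]: "\<phi> \<in> borel_measurable borel" by (rule smooth_on_borel_measurable[OF p(1)])
      have "(\<integral>x. g x * \<phi> x \<partial>lborel) = (\<integral>x. g x * \<phi> x \<partial>lebesgue_on \<Omega>)"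
        using g(1,2) by (intro lebesgue_on_borel(1)[symmetric] \<Omega>) auto
      also have "\<dots> = (\<integral>x. (G x \<bullet> b - H x \<bullet> b) * \<phi> x \<partial>lebesgue_on \<Omega>)"
      proof (rule integral_cong_AE)
        have m: "f \<in> borel_measurable (lebesgue_on \<Omega>)" if "f \<in> borel_measurable borel" for f :: "'a \<Rightarrow> real"
          using that by (intro measurable_restrict_space1 measurable_completion) simp
        show "(\<lambda>x. g x * \<phi> x) \<in> borel_measurable (lebesgue_on \<Omega>)"
          using g(1) by (intro m) auto
        have "\<phi> \<in> borel_measurable (lebesgue_on \<Omega>)" by (intro m) auto
        then show "(\<lambda>x. (G x \<bullet> b - H x \<bullet> b) * \<phi> x) \<in> borel_measurable (lebesgue_on \<Omega>)"
          using d by (auto simp: square_integrable_def)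
        show "AE x in lebesgue_on \<Omega>. g x * \<phi> x = (G x \<bullet> b - H x \<bullet> b) * \<phi> x"
          using g(3) by eventually_elim simp
      qed
      also have "\<dots> = (\<integral>x. (G x \<bullet> b) * \<phi> x \<partial>lebesgue_on \<Omega>) - (\<integral>x. (H x \<bullet> b) * \<phi> x \<partial>lebesgue_on \<Omega>)"
        using integrable_mult_continuous[OF sq[OF G(1)] \<Omega> c] integrable_mult_continuous[OF sq[OF H(1)] \<Omega> c]
        by (simp add: left_diff_distrib)
      also have "\<dots> = 0"
      proof -
        have "(\<integral>x. u x * frechet_derivative \<phi> (at x) b \<partial>lebesgue_on \<Omega>) = - (\<integral>x. (G x \<bullet> b) * \<phi> x \<partial>lebesgue_on \<Omega>)"
          using G(2) t b unfolding has_weak_gradient_def by blast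
        moreover have "(\<integral>x. u x * frechet_derivative \<phi> (at x) b \<partial>lebesgue_on \<Omega>) = - (\<integral>x. (H x \<bullet> b) * \<phi> x \<partial>lebesgue_on \<Omega>)"
          using H(2) t b unfolding has_weak_gradient_def by blast
        ultimately show ?thesis by linarith
      qed
      finally show "(\<integral>x. g x * \<phi> x \<partial>lborel) = 0" .
    qed
    then have "AE x in lebesgue_on \<Omega>. g x = 0"
      unfolding AE_restrict_space_iff[OF \<Omega>l] AE_completion_iff by eventually_elim simp
    with g(3) show ?thesis by eventually_elim simp
  qed
  have "AE x in lebesgue_on \<Omega>. \<forall>b\<in>Basis. G x \<bullet> b = H x \<bullet> b"
    by (rule AE_finite_allI) (auto intro: comp)
  then show ?thesis by eventually_elim (auto intro: euclidean_eqI)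
qed

definition gradient :: "('a::euclidean_space \<Rightarrow> real) \<Rightarrow> 'a \<Rightarrow> 'a" where
  "gradient v x = (\<Sum>b\<in>Basis. frechet_derivative v (at x) b *\<^sub>R b)"

lemma gradient_inner_Basis: "b \<in> Basis \<Longrightarrow> gradient v x \<bullet> b = frechet_derivative v (at x) b"
  by (simp add: gradient_def inner_sum_left inner_Basis if_distrib cong: if_cong)

lemma smooth_frechet_derivative_gradient:
  assumes "smooth_on UNIV v"
  shows "frechet_derivative v (at x) h = gradient v x \<bullet> h"
proof -
  interpret linear "frechet_derivative v (at x)"
    using smooth_on_has_derivative[OF assms] has_derivative_linear by blast
  have "frechet_derivative v (at x) h = frechet_derivative v (at x) (\<Sum>b\<in>Basis. (h \<bullet> b) *\<^sub>R b)"
    by (simp add: euclidean_representation)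
  also have "\<dots> = (\<Sum>b\<in>Basis. (h \<bullet> b) * frechet_derivative v (at x) b)" by (simp add: sum scaleR)
  also have "\<dots> = gradient v x \<bullet> h" unfolding gradient_def inner_sum_left
    by (intro sum.cong) (simp_all add: inner_commute)
  finally show ?thesis .
qed

lemma continuous_on_gradient: "smooth_on UNIV v \<Longrightarrow> continuous_on UNIV (gradient v)"
  unfolding gradient_def by (intro continuous_intros smooth_on_continuous smooth_on_frechet_derivative)

text \<open>The integral of a partial derivative of a compactly supported function vanishes: all
  difference quotients integrate to \<open>0\<close> by translation invariance.\<close>

lemma integral_derivative_compact_support:
  fixes F :: "'a::euclidean_space \<Rightarrow> real"
  assumes s: "smooth_on UNIV F" and z: "\<And>x. r \<le> norm x \<Longrightarrow> F x = 0"
  shows "(\<integral>x. frechet_derivative F (at x) b \<partial>lborel) = 0"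
proof -
  define D where "D x = frechet_derivative F (at x)" for x
  have dF: "(F has_derivative D x) (at x)" for x
    using smooth_on_has_derivative[OF s] unfolding D_def by blast
  have Fm [measurable]: "F \<in> borel_measurable borel" by (rule smooth_on_borel_measurable[OF s])
  have Dc: "continuous_on UNIV (\<lambda>x. D x b)" unfolding D_def by (intro smooth_on_continuous smooth_on_frechet_derivative s)
  have D0: "D x b = 0" if "r + 1 \<le> norm x" for x
    unfolding D_def using that by (intro frechet_derivative_zero_outside[OF s z]) auto
  obtain K where K: "\<And>x. \<bar>D x b\<bar> \<le> K" using smooth_compact_support_bounded[OF Dc D0] by blast
  have ray: "((\<lambda>t. F (x + t *\<^sub>R b)) has_real_derivative D (x + t *\<^sub>R b) b) (at t)" for x t
  proof -
    have "((\<lambda>t. F (x + t *\<^sub>R b)) has_derivative (\<lambda>h. D (x + t *\<^sub>R b) (h *\<^sub>R b))) (at t)"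
      by (rule has_derivative_compose[OF _ dF]) (auto intro!: derivative_eq_intros)
    moreover have "D y (h *\<^sub>R b) = D y b * h" for y h
      using has_derivative_linear[OF dF] by (simp add: linear_scale mult.commute)
    ultimately show ?thesis by (simp add: has_field_derivative_def)
  qed
  define t where "t n = inverse (real (Suc n))" for n
  have t: "0 < t n" "t n \<le> 1" for n
    by (auto simp: t_def inverse_le_1_iff)
  have tlim: "t \<longlonglongrightarrow> 0" unfolding t_def by (rule LIMSEQ_inverse_real_of_nat)
  define q where "q n x = (F (x + t n *\<^sub>R b) - F x) / t n" for n x
  define R where "R = \<bar>r\<bar> + norm b"
  have "(\<lambda>n. \<integral>x. q n x \<partial>lborel) \<longlonglongrightarrow> (\<integral>x. D x b \<partial>lborel)"
  proof (rule integral_dominated_convergence[where w="\<lambda>x. K * indicator (cball 0 R) x"])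
    show "(\<lambda>x. D x b) \<in> borel_measurable lborel" using borel_measurable_continuous_onI[OF Dc] by simp
    show "q n \<in> borel_measurable lborel" for n unfolding q_def by measurable
    show "integrable lborel (\<lambda>x::'a. K * indicator (cball 0 R) x)"
      using emeasure_bounded_finite[OF bounded_cball[of "0::'a" R]]
      by (intro integrable_mult_right integrable_real_indicator) auto
    have "(\<lambda>n. q n x) \<longlonglongrightarrow> D x b" for x
    proof -
      have "((\<lambda>h. (F (x + h *\<^sub>R b) - F x) / h) \<longlongrightarrow> D x b) (at 0)"
        using ray[of x 0] by (simp add: DERIV_def)
      moreover have "filterlim t (at 0) sequentially"
        using t tlim by (auto simp: filterlim_at less_imp_neq[symmetric] intro!: always_eventually)
      ultimately show ?thesis unfolding q_def by (rule filterlim_compose)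
    qed
    then show "AE x in lborel. (\<lambda>n. q n x) \<longlonglongrightarrow> D x b" by simp
    have "\<bar>q n x\<bar> \<le> K * indicator (cball 0 R) x" for n x
    proof (cases "norm x \<le> R")
      case True
      have "\<exists>s. 0 < s \<and> s < t n \<and> F (x + t n *\<^sub>R b) - F (x + 0 *\<^sub>R b) = (t n - 0) * D (x + s *\<^sub>R b) b"
        using ray by (intro MVT2 t)
      then obtain s where "F (x + t n *\<^sub>R b) - F x = t n * D (x + s *\<^sub>R b) b" by auto
      then have "q n x = D (x + s *\<^sub>R b) b" using t(1)[of n] by (simp add: q_def)
      then show ?thesis using K True by simp
    next
      case False
      have "norm (t n *\<^sub>R b) \<le> norm b" using t[of n] by (simp add: mult_left_le_one_le)
      moreover have "norm x - norm (t n *\<^sub>R b) \<le> norm (x + t n *\<^sub>R b)"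
        using norm_triangle_ineq2[of x "- (t n *\<^sub>R b)"] by simp
      ultimately have "r \<le> norm (x + t n *\<^sub>R b)" "r \<le> norm x"
        using False norm_ge_zero[of b] abs_ge_self[of r] unfolding R_def by linarith+
      then show ?thesis using z False by (simp add: q_def)
    qed
    then show "AE x in lborel. norm (q n x) \<le> K * indicator (cball 0 R) x" for n by simp
  qed
  moreover have "(\<integral>x. q n x \<partial>lborel) = 0" for n
  proof -
    have Fi: "integrable lborel F"
    proof (rule integrable_of_square_integrable_bounded_support[OF Fm _ z])
      obtain M where M: "\<And>x. \<bar>F x\<bar> \<le> M" using smooth_compact_support_bounded[OF smooth_on_continuous[OF s] z] by blast
      show "integrable lborel (\<lambda>x. (F x)\<^sup>2)"
      proof (rule Bochner_Integration.integrable_bound)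
        show "integrable lborel (\<lambda>x::'a. M\<^sup>2 * indicator (cball 0 r) x)"
          using emeasure_bounded_finite[OF bounded_cball[of "0::'a" r]]
          by (intro integrable_mult_right integrable_real_indicator) auto
        have "(F x)\<^sup>2 \<le> M\<^sup>2 * indicator (cball 0 r) x" for x
        proof (cases "norm x \<le> r")
          case True
          have "\<bar>F x\<bar> \<le> \<bar>M\<bar>" using M[of x] by linarith
          then show ?thesis using True by (simp add: abs_le_square_iff)
        qed (use z in auto)
        then show "AE x in lborel. norm ((F x)\<^sup>2) \<le> norm (M\<^sup>2 * indicator (cball 0 r) x)" by (intro AE_I2) simp
      qed measurable
    qed
    then show ?thesis
      using integral_translation[OF Fm, of "t n *\<^sub>R b"] by (simp add: q_def)
  qed
  ultimately show ?thesis by (simp add: D_def LIMSEQ_const_iff)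
qed

text \<open>Integration by parts: the product of \<open>v\<close> with a test function has compact support, so its partial
  derivatives have integral \<open>0\<close>.\<close>

lemma smooth_W12:
  fixes v :: "'a::euclidean_space \<Rightarrow> real"
  assumes \<Omega>: "open \<Omega>" "bounded \<Omega>" and v: "smooth_on UNIV v"
  shows "square_integrable (lebesgue_on \<Omega>) v" "square_integrable (lebesgue_on \<Omega>) (gradient v)"
    "has_weak_gradient \<Omega> v (gradient v)" "v \<in> W12 \<Omega>"
proof -
  show 1: "square_integrable (lebesgue_on \<Omega>) v" "square_integrable (lebesgue_on \<Omega>) (gradient v)"
    by (intro square_integrable_continuous \<Omega> smooth_on_continuous continuous_on_gradient v)+
  show 2: "has_weak_gradient \<Omega> v (gradient v)"
    unfolding has_weak_gradient_def
  proof (intro allI impI ballI)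
    fix \<phi> and b :: 'a assume t: "test_function \<Omega> \<phi>" and b: "b \<in> Basis"
    note p = test_function_props[OF t]
    obtain r where r: "\<And>x. r \<le> norm x \<Longrightarrow> \<phi> x = 0" using p(4) by blast
    let ?D = "\<lambda>f x. frechet_derivative f (at x) b"
    have cs: "continuous_on UNIV \<phi>" "continuous_on UNIV (?D \<phi>)" "continuous_on UNIV v" "continuous_on UNIV (?D v)"
      by (intro smooth_on_continuous smooth_on_frechet_derivative p(1) v)+
    have m [measurable]: "\<phi> \<in> borel_measurable borel" "?D \<phi> \<in> borel_measurable borel"
      "v \<in> borel_measurable borel" "?D v \<in> borel_measurable borel"
      using cs by (auto intro: borel_measurable_continuous_onI)
    have prod: "?D (\<lambda>x. v x * \<phi> x) x = v x * ?D \<phi> x + ?D v x * \<phi> x" for x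
    proof -
      have "((\<lambda>x. v x * \<phi> x) has_derivative (\<lambda>h. v x * frechet_derivative \<phi> (at x) h + frechet_derivative v (at x) h * \<phi> x)) (at x)"
        using smooth_on_has_derivative[OF v] smooth_on_has_derivative[OF p(1)] by (intro has_derivative_mult) auto
      then show ?thesis by (simp only: frechet_derivative_at[symmetric])
    qed
    have i1: "integrable lborel (\<lambda>x. v x * ?D \<phi> x)"
      using integrable_mult_continuous[OF 1(1) \<Omega> cs(2)] lebesgue_on_borel(2)[OF \<Omega>(1), of "\<lambda>x. v x * ?D \<phi> x"] p(3) m
      by simp
    have "square_integrable (lebesgue_on \<Omega>) (?D v)" by (rule square_integrable_continuous[OF \<Omega> cs(4)])
    then have i2: "integrable lborel (\<lambda>x. ?D v x * \<phi> x)"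
      using integrable_mult_continuous[OF _ \<Omega> cs(1)] lebesgue_on_borel(2)[OF \<Omega>(1), of "\<lambda>x. ?D v x * \<phi> x"] p(2) m
      by simp
    have "(\<integral>x. ?D (\<lambda>x. v x * \<phi> x) x \<partial>lborel) = 0"
      using r by (intro integral_derivative_compact_support smooth_on_mult v p(1)) auto
    then have "(\<integral>x. v x * ?D \<phi> x \<partial>lborel) = - (\<integral>x. ?D v x * \<phi> x \<partial>lborel)"
      unfolding prod using i1 i2 by simp
    moreover have "(\<integral>x. v x * ?D \<phi> x \<partial>lebesgue_on \<Omega>) = (\<integral>x. v x * ?D \<phi> x \<partial>lborel)"
      using p(3) by (intro lebesgue_on_borel \<Omega>) auto
    moreover have "(\<integral>x. ?D v x * \<phi> x \<partial>lebesgue_on \<Omega>) = (\<integral>x. ?D v x * \<phi> x \<partial>lborel)"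
      using p(2) by (intro lebesgue_on_borel \<Omega>) auto
    ultimately show "(\<integral>x. v x * ?D \<phi> x \<partial>lebesgue_on \<Omega>) = - (\<integral>x. (gradient v x \<bullet> b) * \<phi> x \<partial>lebesgue_on \<Omega>)"
      by (simp add: gradient_inner_Basis[OF b])
  qed
  show "v \<in> W12 \<Omega>" using 1 2 unfolding W12_def by blast
qed

lemma borel_measurable_lebesgue_on_borel: "f \<in> borel_measurable borel \<Longrightarrow> f \<in> borel_measurable (lebesgue_on \<Omega>)"
  by (intro measurable_restrict_space1 measurable_completion) simp

lemma L2_norm_sq_cong_AE:
  assumes "square_integrable M f" "square_integrable M g" "AE x in M. f x = g x"
  shows "L2_norm_sq M f = L2_norm_sq M g"
  unfolding L2_norm_sq_def
proof (rule integral_cong_AE)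
  show "AE x in M. (norm (f x))\<^sup>2 = (norm (g x))\<^sup>2" using assms(3) by eventually_elim simp
qed (use assms in \<open>auto simp: square_integrable_def\<close>)

lemma square_integrable_component:
  fixes F :: "'a \<Rightarrow> 'b::euclidean_space"
  assumes "square_integrable M F" "b \<in> Basis"
  shows "square_integrable M (\<lambda>x. F x \<bullet> b)"
  using assms Basis_le_norm[OF assms(2)]
  by (intro square_integrable_bound[OF _ assms(1), of _ 1]) (auto simp: square_integrable_def)

lemma L2_norm_sq_components:
  fixes F :: "'a \<Rightarrow> 'b::euclidean_space"
  assumes "square_integrable M F"
  shows "L2_norm_sq M F = (\<Sum>b\<in>Basis. L2_norm_sq M (\<lambda>x. F x \<bullet> b))"
proof -
  have "(norm y)\<^sup>2 = (\<Sum>b\<in>Basis. (norm (y \<bullet> b))\<^sup>2)" for y :: 'b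
    unfolding power2_norm_eq_inner by (subst euclidean_inner) (simp add: power2_eq_square)
  moreover have "integrable M (\<lambda>x. (norm (F x \<bullet> b))\<^sup>2)" if "b \<in> Basis" for b
    using square_integrable_component[OF assms that] by (simp add: square_integrable_def)
  ultimately show ?thesis
    unfolding L2_norm_sq_def by (simp add: Bochner_Integration.integral_sum)
qed

lemma square_integrable_cmult:
  fixes f :: "'a \<Rightarrow> real"
  assumes "square_integrable M f"
  shows "square_integrable M (\<lambda>x. c * f x)" "L2_norm_sq M (\<lambda>x. c * f x) = c\<^sup>2 * L2_norm_sq M f"
  using assms by (auto simp: square_integrable_def L2_norm_sq_def power_mult_distrib)

text \<open>The function is extended by \<open>0\<close> outside \<open>\<Omega>\<close>, so that it can be mollified on the whole space.\<close>

lemma mollify_L2_tendsto: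
  fixes h :: "'a::euclidean_space \<Rightarrow> real" and \<Psi> :: "nat \<Rightarrow> 'a \<Rightarrow> 'a"
  assumes \<Omega>: "open \<Omega>" "bounded \<Omega>" and hm [measurable]: "h \<in> borel_measurable borel"
    and hi: "integrable lborel (\<lambda>x. (h x)\<^sup>2)" and h0: "\<And>x. x \<notin> \<Omega> \<Longrightarrow> h x = 0"
    and \<delta>: "\<And>n. 0 < \<delta> n" "\<delta> \<longlonglongrightarrow> 0" and L: "0 \<le> L"
    and near: "\<And>n x. x \<in> \<Omega> \<Longrightarrow> norm (\<Psi> n x - x) \<le> L * \<delta> n" and \<Psi>: "\<And>n. continuous_on UNIV (\<Psi> n)"
  shows "square_integrable (lebesgue_on \<Omega>) h"
    and "square_integrable (lebesgue_on \<Omega>) (\<lambda>x. convolution h (mollifier (\<delta> n)) (\<Psi> n x))"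
    and "(\<lambda>n. L2_norm_sq (lebesgue_on \<Omega>) (\<lambda>x. convolution h (mollifier (\<delta> n)) (\<Psi> n x) - h x)) \<longlonglongrightarrow> 0"
proof -
  let ?w = "\<lambda>n x. convolution h (mollifier (\<delta> n)) (\<Psi> n x)"
  obtain B where B: "\<And>x. B \<le> norm x \<Longrightarrow> x \<notin> \<Omega>" using bounded_norm_bound[OF \<Omega>(2)] by blast
  have hB: "h x = 0" if "B \<le> norm x" for x using h0 B that by blast
  have h1: "integrable lborel h" by (rule integrable_of_square_integrable_bounded_support[OF hm hi hB])
  have wc: "continuous_on UNIV (?w n)" for n
  proof -
    have "continuous_on UNIV (convolution h (mollifier (\<delta> n)))"
      using mollifier_eq_0[OF \<delta>(1)]
      by (intro smooth_on_continuous smooth_convolution[OF h1 smooth_mollifier]) auto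
    then show ?thesis using \<Psi> by (rule continuous_on_compose2) auto
  qed
  then have wm [measurable]: "?w n \<in> borel_measurable borel" for n by (rule borel_measurable_continuous_onI)
  have "integrable (lebesgue_on \<Omega>) (\<lambda>x. (h x)\<^sup>2)"
    using hi h0 by (subst lebesgue_on_borel(2)[OF \<Omega>(1)]) auto
  then show "square_integrable (lebesgue_on \<Omega>) h"
    using hm by (auto simp: square_integrable_def intro: borel_measurable_lebesgue_on_borel)
  show "square_integrable (lebesgue_on \<Omega>) (?w n)" by (rule square_integrable_continuous[OF \<Omega> wc])
  have \<Omega>b [measurable]: "\<Omega> \<in> sets borel" using \<Omega> by simp
  have "L2_norm_sq (lebesgue_on \<Omega>) (\<lambda>x. ?w n x - h x) =
      enn2real (\<integral>\<^sup>+x. indicator \<Omega> x * ennreal ((?w n x - h x)\<^sup>2) \<partial>lborel)" for n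
  proof -
    have "L2_norm_sq (lebesgue_on \<Omega>) (\<lambda>x. ?w n x - h x) = (\<integral>x. indicator \<Omega> x * (?w n x - h x)\<^sup>2 \<partial>lebesgue_on \<Omega>)"
      unfolding L2_norm_sq_def by (rule Bochner_Integration.integral_cong) auto
    also have "\<dots> = (\<integral>x. indicator \<Omega> x * (?w n x - h x)\<^sup>2 \<partial>lborel)"
      by (intro lebesgue_on_borel \<Omega>) auto
    also have "\<dots> = enn2real (\<integral>\<^sup>+x. ennreal (indicator \<Omega> x * (?w n x - h x)\<^sup>2) \<partial>lborel)"
      by (rule integral_eq_nn_integral) auto
    finally show ?thesis by (simp add: ennreal_mult' ennreal_indicator)
  qed
  moreover have "(\<lambda>n. enn2real (\<integral>\<^sup>+x. indicator \<Omega> x * ennreal ((?w n x - h x)\<^sup>2) \<partial>lborel)) \<longlonglongrightarrow> enn2real 0"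
    using mollify_tendsto[OF hm hi hB \<Omega>b \<delta> L near] by (intro tendsto_enn2real) auto
  ultimately show "(\<lambda>n. L2_norm_sq (lebesgue_on \<Omega>) (\<lambda>x. ?w n x - h x)) \<longlonglongrightarrow> 0" by simp
qed

section \<open>Density of smooth functions\<close>

text \<open>Sampling the mollification of \<open>u\<close> at \<open>\<Psi>\<^sub>n x = x + \<delta>\<^sub>n \<psi> x\<close>, with a smooth field \<open>\<psi>\<close> that pushes
  \<open>\<Omega>\<close> into itself, only uses values of \<open>u\<close> inside \<open>\<Omega>\<close>, and yields a function that is smooth on the
  whole space. Its gradient is the likewise mollified weak gradient, up to a factor that tends to
  the identity.\<close>

lemma smooth_dense_W12:
  fixes u :: "'a::euclidean_space \<Rightarrow> real" and \<psi> G :: "'a \<Rightarrow> 'a"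
  assumes \<Omega>: "open \<Omega>" "bounded \<Omega>"
    and \<psi>: "\<And>b. b \<in> Basis \<Longrightarrow> smooth_on UNIV (\<lambda>x. \<psi> x \<bullet> b)"
    and \<epsilon>0: "0 < \<epsilon>0" and inward: "\<And>\<epsilon> x. 0 < \<epsilon> \<Longrightarrow> \<epsilon> < \<epsilon>0 \<Longrightarrow> x \<in> \<Omega> \<Longrightarrow> cball (x + \<epsilon> *\<^sub>R \<psi> x) \<epsilon> \<subseteq> \<Omega>"
    and u: "square_integrable (lebesgue_on \<Omega>) u"
    and G: "square_integrable (lebesgue_on \<Omega>) G" "has_weak_gradient \<Omega> u G"
  obtains v :: "nat \<Rightarrow> 'a \<Rightarrow> real" where "\<And>n. smooth_on UNIV (v n)"
    "(\<lambda>n. L2_norm_sq (lebesgue_on \<Omega>) (\<lambda>x. v n x - u x)) \<longlonglongrightarrow> 0"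
    "(\<lambda>n. L2_norm_sq (lebesgue_on \<Omega>) (\<lambda>x. gradient (v n) x - G x)) \<longlonglongrightarrow> 0"
proof -
  let ?M = "lebesgue_on \<Omega>"
  obtain ur where ur: "ur \<in> borel_measurable borel" "\<And>x. x \<notin> \<Omega> \<Longrightarrow> ur x = 0"
    "AE x in ?M. ur x = u x" "integrable lborel (\<lambda>x. (ur x)\<^sup>2)"
    using square_integrable_borel_representative[OF \<Omega>(1) u] by blast
  have "\<forall>b\<in>Basis. \<exists>g. g \<in> borel_measurable borel \<and> (\<forall>x. x \<notin> \<Omega> \<longrightarrow> g x = 0) \<and>
      (AE x in ?M. g x = G x \<bullet> b) \<and> integrable lborel (\<lambda>x. (g x)\<^sup>2)"
  proof
    fix b :: 'a assume b: "b \<in> Basis"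
    show "\<exists>g. g \<in> borel_measurable borel \<and> (\<forall>x. x \<notin> \<Omega> \<longrightarrow> g x = 0) \<and>
        (AE x in ?M. g x = G x \<bullet> b) \<and> integrable lborel (\<lambda>x. (g x)\<^sup>2)"
      by (rule square_integrable_borel_representative[OF \<Omega>(1) square_integrable_component[OF G(1) b]]) blast
  qed
  from bchoice[OF this] obtain gr where gr0: "\<forall>b\<in>Basis. gr b \<in> borel_measurable borel \<and>
      (\<forall>x. x \<notin> \<Omega> \<longrightarrow> gr b x = 0) \<and> (AE x in ?M. gr b x = G x \<bullet> b) \<and> integrable lborel (\<lambda>x. (gr b x)\<^sup>2)"
    by blast
  have gr: "gr b \<in> borel_measurable borel" "\<And>x. x \<notin> \<Omega> \<Longrightarrow> gr b x = 0"
    "AE x in ?M. gr b x = G x \<bullet> b" "integrable lborel (\<lambda>x. (gr b x)\<^sup>2)" if "b \<in> Basis" for b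
    using bspec[OF gr0 that] by simp_all
  obtain B where B: "\<And>x. B \<le> norm x \<Longrightarrow> x \<notin> \<Omega>" using bounded_norm_bound[OF \<Omega>(2)] by blast
  have ur1: "integrable lborel ur"
    using ur(2) B by (intro integrable_of_square_integrable_bounded_support[OF ur(1,4), of B]) blast
  have weak: "(\<integral>x. ur x * frechet_derivative \<phi> (at x) b \<partial>lborel) = - (\<integral>x. gr b x * \<phi> x \<partial>lborel)"
    if t: "test_function \<Omega> \<phi>" and b: "b \<in> Basis" for \<phi> b
  proof -
    note p = test_function_props[OF t]
    have m: "\<phi> \<in> borel_measurable borel" "(\<lambda>x. frechet_derivative \<phi> (at x) b) \<in> borel_measurable borel"
      by (intro smooth_on_borel_measurable smooth_on_frechet_derivative p(1))+
    have um: "u \<in> borel_measurable ?M" and Gm: "(\<lambda>x. G x \<bullet> b) \<in> borel_measurable ?M"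
      using u square_integrable_component[OF G(1) b] by (auto simp: square_integrable_def)
    note mM = m[THEN borel_measurable_lebesgue_on_borel, of \<Omega>]
    note rM = ur(1)[THEN borel_measurable_lebesgue_on_borel, of \<Omega>] gr(1)[OF b, THEN borel_measurable_lebesgue_on_borel, of \<Omega>]
    have "(\<integral>x. ur x * frechet_derivative \<phi> (at x) b \<partial>lborel) = (\<integral>x. ur x * frechet_derivative \<phi> (at x) b \<partial>?M)"
      using ur(1,2) m by (intro lebesgue_on_borel(1)[symmetric] \<Omega>) auto
    also have "\<dots> = (\<integral>x. u x * frechet_derivative \<phi> (at x) b \<partial>?M)"
      using ur(3) rM mM um by (intro integral_cong_AE) (auto elim!: eventually_mono)
    also have "\<dots> = - (\<integral>x. (G x \<bullet> b) * \<phi> x \<partial>?M)"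
      using G(2) t b unfolding has_weak_gradient_def by blast
    also have "(\<integral>x. (G x \<bullet> b) * \<phi> x \<partial>?M) = (\<integral>x. gr b x * \<phi> x \<partial>?M)"
      using gr(3)[OF b] rM mM Gm by (intro integral_cong_AE) (auto elim!: eventually_mono)
    also have "\<dots> = (\<integral>x. gr b x * \<phi> x \<partial>lborel)"
      using gr(1,2)[OF b] m by (intro lebesgue_on_borel \<Omega>) auto
    finally show ?thesis .
  qed
  have \<psi>c: "continuous_on UNIV \<psi>"
    by (subst continuous_on_componentwise) (use \<psi> smooth_on_continuous in blast)
  obtain L where L: "0 \<le> L" "\<And>x. x \<in> \<Omega> \<Longrightarrow> norm (\<psi> x) \<le> L"
    using continuous_on_bounded_on[OF \<Omega>(2) \<psi>c] by blast
  define p where "p b' b x = frechet_derivative (\<lambda>x. \<psi> x \<bullet> b') (at x) b" for b' b x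
  have pc: "continuous_on UNIV (p b' b)" if "b' \<in> Basis" for b' b
    unfolding p_def by (intro smooth_on_continuous smooth_on_frechet_derivative \<psi> that)
  have "continuous_on UNIV (\<lambda>x. \<Sum>b\<in>Basis. \<Sum>b'\<in>Basis. (p b' b x)\<^sup>2)"
    by (intro continuous_intros pc)
  then obtain K where K: "0 \<le> K" "\<And>x. x \<in> \<Omega> \<Longrightarrow> norm (\<Sum>b\<in>Basis. \<Sum>b'\<in>Basis. (p b' b x)\<^sup>2) \<le> K"
    using continuous_on_bounded_on[OF \<Omega>(2)] by blast
  have pK: "(p b' b x)\<^sup>2 \<le> K" if "x \<in> \<Omega>" "b \<in> Basis" "b' \<in> Basis" for b b' x
  proof -
    have "(p b' b x)\<^sup>2 \<le> (\<Sum>b'\<in>Basis. (p b' b x)\<^sup>2)" using that(3) by (intro member_le_sum) auto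
    also have "\<dots> \<le> (\<Sum>b\<in>Basis. \<Sum>b'\<in>Basis. (p b' b x)\<^sup>2)"
      using that(2) member_le_sum[of b Basis "\<lambda>b. \<Sum>b'\<in>Basis. (p b' b x)\<^sup>2"] by (simp add: sum_nonneg)
    also have "\<dots> \<le> K" using K(2)[OF that(1)] by (auto simp: abs_le_iff)
    finally show ?thesis .
  qed
  define \<delta> where "\<delta> n = \<epsilon>0 * inverse (real (Suc (Suc n)))" for n
  have \<delta>: "0 < \<delta> n" "\<delta> n < \<epsilon>0" for n
  proof -
    show "0 < \<delta> n" using \<epsilon>0 by (simp add: \<delta>_def)
    have "inverse (real (Suc (Suc n))) < inverse 1" by (rule less_imp_inverse_less) auto
    then show "\<delta> n < \<epsilon>0" using \<epsilon>0 mult_strict_left_mono[of _ 1 \<epsilon>0] by (simp add: \<delta>_def)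
  qed
  have \<delta>lim: "\<delta> \<longlonglongrightarrow> 0"
  proof -
    have "(\<lambda>n. \<epsilon>0 * inverse (real (Suc (Suc n)))) \<longlonglongrightarrow> \<epsilon>0 * 0"
      by (intro tendsto_intros LIMSEQ_Suc[OF LIMSEQ_inverse_real_of_nat])
    then show ?thesis by (simp add: \<delta>_def[abs_def])
  qed
  define \<Psi> where "\<Psi> n x = x + \<delta> n *\<^sub>R \<psi> x" for n x
  have \<Psi>c: "continuous_on UNIV (\<Psi> n)" for n unfolding \<Psi>_def by (intro continuous_intros \<psi>c)
  have near: "norm (\<Psi> n x - x) \<le> L * \<delta> n" if "x \<in> \<Omega>" for n x
    using L(2)[OF that] \<delta>(1)[of n] by (simp add: \<Psi>_def mult.commute mult_left_mono)
  have \<Psi>\<Omega>: "cball (\<Psi> n x) (\<delta> n) \<subseteq> \<Omega>" if "x \<in> \<Omega>" for n x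
    unfolding \<Psi>_def by (intro inward \<delta> that)
  define w where "w n = convolution ur (mollifier (\<delta> n))" for n
  define v where "v n x = w n (\<Psi> n x)" for n x
  define W where "W n b x = convolution (gr b) (mollifier (\<delta> n)) (\<Psi> n x)" for n b x
  have ws: "smooth_on UNIV (w n)" for n
    unfolding w_def using mollifier_eq_0[OF \<delta>(1)[of n]] by (intro smooth_convolution[OF ur1 smooth_mollifier]) blast
  have vs: "smooth_on UNIV (v n)" for n
    unfolding v_def
  proof (rule smooth_on_compose[where T=UNIV and f="w n" and \<Psi>="\<Psi> n"])
    fix b :: 'a assume b: "b \<in> Basis"
    have "smooth_on UNIV (\<lambda>x. x \<bullet> b + \<delta> n * (\<psi> x \<bullet> b))"
      by (intro smooth_on_add smooth_on_mult smooth_on_inner smooth_on_const \<psi> b) auto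
    then show "smooth_on UNIV (\<lambda>x. \<Psi> n x \<bullet> b)" by (simp add: \<Psi>_def inner_add_left)
  qed (auto intro: ws)
  \<comment> \<open>The kernel centred at \<open>\<Psi> n x\<close> is a test function on \<open>\<Omega>\<close>, because its support is the inward displaced ball.\<close>
  have dw: "frechet_derivative (w n) (at (\<Psi> n x)) b = W n b x" if x: "x \<in> \<Omega>" and b: "b \<in> Basis" for n x b
  proof -
    let ?z = "\<Psi> n x"
    note tf = test_function_mollifier[OF \<delta>(1) \<Psi>\<Omega>[OF x], of n]
    have "(w n has_derivative (\<lambda>v. convolution ur (\<lambda>x. frechet_derivative (mollifier (\<delta> n)) (at x) v) ?z)) (at ?z)"
      unfolding w_def using mollifier_eq_0[OF \<delta>(1)[of n]]
      by (intro convolution_has_derivative[OF ur1 smooth_mollifier]) blast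
    then have "frechet_derivative (w n) (at ?z) b = convolution ur (\<lambda>x. frechet_derivative (mollifier (\<delta> n)) (at x) b) ?z"
      by (simp only: frechet_derivative_at[symmetric])
    also have "\<dots> = - (\<integral>y. ur y * frechet_derivative (\<lambda>y. mollifier (\<delta> n) (?z - y)) (at y) b \<partial>lborel)"
      unfolding convolution_def tf(2) by simp
    also have "\<dots> = (\<integral>y. gr b y * mollifier (\<delta> n) (?z - y) \<partial>lborel)"
      using weak[OF tf(1) b] by simp
    finally show ?thesis by (simp add: W_def convolution_def)
  qed
  \<comment> \<open>Chain rule: the derivative of \<open>\<Psi> n\<close> is the identity plus \<open>\<delta> n\<close> times that of \<open>\<psi>\<close>.\<close>
  have dv: "frechet_derivative (v n) (at x) b = W n b x + \<delta> n * (\<Sum>b'\<in>Basis. p b' b x * W n b' x)"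
    if x: "x \<in> \<Omega>" and b: "b \<in> Basis" for n x b
  proof -
    define P where "P h = (\<Sum>b'\<in>Basis. frechet_derivative (\<lambda>x. \<psi> x \<bullet> b') (at x) h *\<^sub>R b')" for h
    have dP: "(\<psi> has_derivative P) (at x)"
    proof (subst has_derivative_componentwise_within, intro ballI)
      fix b' :: 'a assume b': "b' \<in> Basis"
      have "P h \<bullet> b' = frechet_derivative (\<lambda>x. \<psi> x \<bullet> b') (at x) h" for h
        using b' by (simp add: P_def inner_sum_left inner_Basis if_distrib cong: if_cong)
      then show "((\<lambda>x. \<psi> x \<bullet> b') has_derivative (\<lambda>h. P h \<bullet> b')) (at x)"
        using smooth_on_has_derivative[OF \<psi>[OF b'], of x] by (simp add: eta_contract_eq)
    qed
    have d\<Psi>: "(\<Psi> n has_derivative (\<lambda>h. h + \<delta> n *\<^sub>R P h)) (at x)"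
      unfolding \<Psi>_def by (intro derivative_intros dP)
    have dwz: "(w n has_derivative frechet_derivative (w n) (at (\<Psi> n x))) (at (\<Psi> n x))"
      using smooth_on_has_derivative[OF ws] by blast
    have "(v n has_derivative (\<lambda>h. frechet_derivative (w n) (at (\<Psi> n x)) (h + \<delta> n *\<^sub>R P h))) (at x)"
      unfolding v_def using has_derivative_compose[OF d\<Psi> dwz] .
    then have "frechet_derivative (v n) (at x) b = frechet_derivative (w n) (at (\<Psi> n x)) (b + \<delta> n *\<^sub>R P b)"
      by (simp only: frechet_derivative_at[symmetric])
    also have "\<dots> = W n b x + \<delta> n * (\<Sum>b'\<in>Basis. p b' b x * W n b' x)"
    proof -
      interpret linear "frechet_derivative (w n) (at (\<Psi> n x))" using dwz by (rule has_derivative_linear)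
      show ?thesis by (simp add: add scaleR P_def sum dw[OF x] b p_def)
    qed
    finally show ?thesis .
  qed
  have Wsq: "square_integrable ?M (W n b)" and gsq: "square_integrable ?M (gr b)"
    and Wlim: "(\<lambda>n. L2_norm_sq ?M (\<lambda>x. W n b x - gr b x)) \<longlonglongrightarrow> 0" if b: "b \<in> Basis" for n b
    unfolding W_def using mollify_L2_tendsto[OF \<Omega> gr(1,4,2)[OF b] \<delta>(1) \<delta>lim L(1) near \<Psi>c] b by auto
  have usq: "square_integrable ?M ur" and vlim: "(\<lambda>n. L2_norm_sq ?M (\<lambda>x. v n x - ur x)) \<longlonglongrightarrow> 0"
    unfolding v_def w_def using mollify_L2_tendsto[OF \<Omega> ur(1,4,2) \<delta>(1) \<delta>lim L(1) near \<Psi>c] by auto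
  have vsq: "square_integrable ?M (v n)" for n by (rule smooth_W12(1)[OF \<Omega> vs])
  define Q where "Q n b x = (\<Sum>b'\<in>Basis. p b' b x * W n b' x)" for n b x
  define C where "C n = 2 * real DIM('a) * K * (\<Sum>b'\<in>Basis. L2_norm_sq ?M (\<lambda>x. W n b' x - gr b' x) + L2_norm_sq ?M (gr b'))" for n
  have Qsq: "square_integrable ?M (Q n b)" and QC: "L2_norm_sq ?M (Q n b) \<le> C n" if b: "b \<in> Basis" for n b
  proof -
    have i: "integrable ?M (\<lambda>x. real DIM('a) * K * (\<Sum>b'\<in>Basis. (W n b' x)\<^sup>2))"
      using Wsq by (auto simp: square_integrable_def)
    have qb: "(Q n b x)\<^sup>2 \<le> real DIM('a) * K * (\<Sum>b'\<in>Basis. (W n b' x)\<^sup>2)" if "x \<in> \<Omega>" for x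
    proof -
      have "(Q n b x)\<^sup>2 \<le> (\<Sum>b'\<in>Basis. (p b' b x * W n b' x)\<^sup>2) * real DIM('a)"
        unfolding Q_def by (rule sum_squared_le_sum_of_squares)
      also have "(\<Sum>b'\<in>Basis. (p b' b x * W n b' x)\<^sup>2) \<le> (\<Sum>b'\<in>Basis. K * (W n b' x)\<^sup>2)"
        unfolding power_mult_distrib using pK[OF that b] by (intro sum_mono mult_right_mono) auto
      also have "\<dots> = K * (\<Sum>b'\<in>Basis. (W n b' x)\<^sup>2)" by (simp add: sum_distrib_left)
      finally show ?thesis by (simp add: mult_ac)
    qed
    have qae: "AE x in ?M. norm ((norm (Q n b x))\<^sup>2) \<le> real DIM('a) * K * (\<Sum>b'\<in>Basis. (W n b' x)\<^sup>2)"
      using qb by (intro AE_I2) auto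
    have Qm: "Q n b \<in> borel_measurable ?M"
      unfolding Q_def
    proof (intro borel_measurable_sum borel_measurable_times)
      fix b' :: 'a assume b': "b' \<in> Basis"
      show "p b' b \<in> borel_measurable ?M"
        by (intro borel_measurable_lebesgue_on_borel borel_measurable_continuous_onI pc b')
      show "W n b' \<in> borel_measurable ?M" using Wsq[OF b'] by (simp add: square_integrable_def)
    qed
    have Qi: "integrable ?M (\<lambda>x. (norm (Q n b x))\<^sup>2)"
      by (rule Bochner_Integration.integrable_bound[OF i]) (use Qm qae in \<open>auto elim!: eventually_mono\<close>)
    then show "square_integrable ?M (Q n b)" using Qm by (simp add: square_integrable_def)
    have "L2_norm_sq ?M (Q n b) \<le> (\<integral>x. real DIM('a) * K * (\<Sum>b'\<in>Basis. (W n b' x)\<^sup>2) \<partial>?M)"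
      unfolding L2_norm_sq_def using qae by (intro integral_mono_AE Qi i) auto
    also have "\<dots> = real DIM('a) * K * (\<Sum>b'\<in>Basis. L2_norm_sq ?M (W n b'))"
      using Wsq by (simp add: L2_norm_sq_def square_integrable_def Bochner_Integration.integral_sum)
    also have "\<dots> \<le> real DIM('a) * K * (\<Sum>b'\<in>Basis. 2 * L2_norm_sq ?M (\<lambda>x. W n b' x - gr b' x) + 2 * L2_norm_sq ?M (gr b'))"
    proof (intro mult_left_mono sum_mono)
      fix b' :: 'a assume b': "b' \<in> Basis"
      show "L2_norm_sq ?M (W n b') \<le> 2 * L2_norm_sq ?M (\<lambda>x. W n b' x - gr b' x) + 2 * L2_norm_sq ?M (gr b')"
        using square_integrable_add(2)[OF square_integrable_diff(1)[OF Wsq[OF b'] gsq[OF b']] gsq[OF b'], of n] by simp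
    qed (use K in auto)
    also have "\<dots> = C n" by (simp add: C_def sum_distrib_left algebra_simps)
    finally show "L2_norm_sq ?M (Q n b) \<le> C n" .
  qed
  have Clim: "C \<longlonglongrightarrow> 2 * real DIM('a) * K * (\<Sum>b'\<in>Basis. 0 + L2_norm_sq ?M (gr b'))"
    unfolding C_def by (intro tendsto_intros Wlim)
  have comp: "(\<lambda>n. L2_norm_sq ?M (\<lambda>x. (gradient (v n) x - G x) \<bullet> b)) \<longlonglongrightarrow> 0" if b: "b \<in> Basis" for b
  proof (rule Lim_null_comparison[OF always_eventually], rule allI)
    fix n
    note sW = square_integrable_diff(1)[OF Wsq[OF b] gsq[OF b], of n] and sQ = square_integrable_cmult[OF Qsq[OF b], of "\<delta> n" n]
    have gsq': "square_integrable ?M (\<lambda>x. (gradient (v n) x - G x) \<bullet> b)"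
      by (intro square_integrable_component[OF _ b] square_integrable_diff smooth_W12(2) \<Omega> vs G)
    have ae: "AE x in ?M. (gradient (v n) x - G x) \<bullet> b = (W n b x - gr b x) + \<delta> n * Q n b x"
      using gr(3)[OF b] AE_space
    proof eventually_elim
      case (elim x)
      then show ?case using dv[of x b n] b by (simp add: inner_diff_left gradient_inner_Basis Q_def)
    qed
    have "L2_norm_sq ?M (\<lambda>x. (gradient (v n) x - G x) \<bullet> b) = L2_norm_sq ?M (\<lambda>x. (W n b x - gr b x) + \<delta> n * Q n b x)"
      by (rule L2_norm_sq_cong_AE[OF gsq' square_integrable_add(1)[OF sW sQ(1)] ae])
    also have "\<dots> \<le> 2 * L2_norm_sq ?M (\<lambda>x. W n b x - gr b x) + 2 * ((\<delta> n)\<^sup>2 * L2_norm_sq ?M (Q n b))"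
      using square_integrable_add(2)[OF sW sQ(1)] sQ(2) by simp
    also have "\<dots> \<le> 2 * L2_norm_sq ?M (\<lambda>x. W n b x - gr b x) + 2 * ((\<delta> n)\<^sup>2 * C n)"
      using QC[OF b] by (intro add_left_mono mult_left_mono) auto
    finally show "norm (L2_norm_sq ?M (\<lambda>x. (gradient (v n) x - G x) \<bullet> b)) \<le>
        2 * L2_norm_sq ?M (\<lambda>x. W n b x - gr b x) + 2 * ((\<delta> n)\<^sup>2 * C n)"
      using L2_norm_sq_nonneg[of ?M "\<lambda>x. (gradient (v n) x - G x) \<bullet> b"] by simp
  next
    have "(\<lambda>n. 2 * L2_norm_sq ?M (\<lambda>x. W n b x - gr b x) + 2 * ((\<delta> n)\<^sup>2 * C n)) \<longlonglongrightarrow>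
        2 * 0 + 2 * (0\<^sup>2 * (2 * real DIM('a) * K * (\<Sum>b'\<in>Basis. 0 + L2_norm_sq ?M (gr b'))))"
      by (intro tendsto_intros Wlim b \<delta>lim Clim)
    then show "(\<lambda>n. 2 * L2_norm_sq ?M (\<lambda>x. W n b x - gr b x) + 2 * ((\<delta> n)\<^sup>2 * C n)) \<longlonglongrightarrow> 0" by simp
  qed
  show thesis
  proof
    show "smooth_on UNIV (v n)" for n by (rule vs)
    have "L2_norm_sq ?M (\<lambda>x. v n x - u x) = L2_norm_sq ?M (\<lambda>x. v n x - ur x)" for n
      using ur(3) by (intro L2_norm_sq_cong_AE square_integrable_diff vsq u usq) (auto elim!: eventually_mono)
    then show "(\<lambda>n. L2_norm_sq ?M (\<lambda>x. v n x - u x)) \<longlonglongrightarrow> 0" using vlim by simp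
    have "L2_norm_sq ?M (\<lambda>x. gradient (v n) x - G x) = (\<Sum>b\<in>Basis. L2_norm_sq ?M (\<lambda>x. (gradient (v n) x - G x) \<bullet> b))" for n
      by (intro L2_norm_sq_components square_integrable_diff smooth_W12(2) \<Omega> vs G)
    moreover have "(\<lambda>n. \<Sum>b\<in>Basis. L2_norm_sq ?M (\<lambda>x. (gradient (v n) x - G x) \<bullet> b)) \<longlonglongrightarrow> (\<Sum>b\<in>(Basis::'a set). 0)"
      by (intro tendsto_sum comp)
    ultimately show "(\<lambda>n. L2_norm_sq ?M (\<lambda>x. gradient (v n) x - G x)) \<longlonglongrightarrow> 0" by simp
  qed
qed

section \<open>Traces\<close>

text \<open>The choice made in \<^const>\<open>weak_gradient\<close> does not affect norms.\<close>

lemma L2_norm_sq_weak_gradient: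
  assumes \<Omega>: "open \<Omega>" "bounded \<Omega>"
    and H: "square_integrable (lebesgue_on \<Omega>) H" "has_weak_gradient \<Omega> w H"
  shows "L2_norm_sq (lebesgue_on \<Omega>) (weak_gradient \<Omega> w) = L2_norm_sq (lebesgue_on \<Omega>) H"
proof -
  have W: "square_integrable (lebesgue_on \<Omega>) (weak_gradient \<Omega> w)" "has_weak_gradient \<Omega> w (weak_gradient \<Omega> w)"
    using someI[of "\<lambda>G. square_integrable (lebesgue_on \<Omega>) G \<and> has_weak_gradient \<Omega> w G" H] H
    unfolding weak_gradient_def by blast+
  show ?thesis by (rule L2_norm_sq_cong_AE[OF W(1) H(1) weak_gradient_unique[OF \<Omega> W H]])
qed

lemma W12_weak_gradient:
  assumes "u \<in> W12 \<Omega>"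
  shows "square_integrable (lebesgue_on \<Omega>) u" "square_integrable (lebesgue_on \<Omega>) (weak_gradient \<Omega> u)"
    "has_weak_gradient \<Omega> u (weak_gradient \<Omega> u)"
  using assms someI_ex[of "\<lambda>G. square_integrable (lebesgue_on \<Omega>) G \<and> has_weak_gradient \<Omega> u G"]
  unfolding weak_gradient_def W12_def by blast+

lemma has_weak_gradient_diff:
  assumes \<Omega>: "open \<Omega>" "bounded \<Omega>"
    and u: "square_integrable (lebesgue_on \<Omega>) u" "square_integrable (lebesgue_on \<Omega>) G" "has_weak_gradient \<Omega> u G"
    and v: "square_integrable (lebesgue_on \<Omega>) v" "square_integrable (lebesgue_on \<Omega>) H" "has_weak_gradient \<Omega> v H"
  shows "has_weak_gradient \<Omega> (\<lambda>x. v x - u x) (\<lambda>x. H x - G x)"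
  unfolding has_weak_gradient_def
proof (intro allI impI ballI)
  fix \<phi> and b :: 'a assume t: "test_function \<Omega> \<phi>" and b: "b \<in> Basis"
  note p = test_function_props[OF t]
  let ?D = "\<lambda>x. frechet_derivative \<phi> (at x) b"
  have c: "continuous_on UNIV \<phi>" "continuous_on UNIV ?D"
    by (intro smooth_on_continuous smooth_on_frechet_derivative p(1))+
  note i = integrable_mult_continuous[OF _ \<Omega> c(2)] integrable_mult_continuous[OF _ \<Omega> c(1)]
  have "(\<integral>x. (v x - u x) * ?D x \<partial>lebesgue_on \<Omega>) = (\<integral>x. v x * ?D x \<partial>lebesgue_on \<Omega>) - (\<integral>x. u x * ?D x \<partial>lebesgue_on \<Omega>)"
    using i(1)[OF v(1)] i(1)[OF u(1)] by (simp add: left_diff_distrib)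
  also have "\<dots> = - (\<integral>x. (H x \<bullet> b) * \<phi> x \<partial>lebesgue_on \<Omega>) - - (\<integral>x. (G x \<bullet> b) * \<phi> x \<partial>lebesgue_on \<Omega>)"
  proof -
    have "(\<integral>x. v x * ?D x \<partial>lebesgue_on \<Omega>) = - (\<integral>x. (H x \<bullet> b) * \<phi> x \<partial>lebesgue_on \<Omega>)"
      using v(3) t b unfolding has_weak_gradient_def by blast
    moreover have "(\<integral>x. u x * ?D x \<partial>lebesgue_on \<Omega>) = - (\<integral>x. (G x \<bullet> b) * \<phi> x \<partial>lebesgue_on \<Omega>)"
      using u(3) t b unfolding has_weak_gradient_def by blast
    ultimately show ?thesis by simp
  qed
  also have "\<dots> = - (\<integral>x. ((H x - G x) \<bullet> b) * \<phi> x \<partial>lebesgue_on \<Omega>)"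
    using i(2)[OF square_integrable_component[OF v(2) b]] i(2)[OF square_integrable_component[OF u(2) b]]
    by (simp add: inner_diff_left left_diff_distrib)
  finally show "(\<integral>x. (v x - u x) * ?D x \<partial>lebesgue_on \<Omega>) = - (\<integral>x. ((H x - G x) \<bullet> b) * \<phi> x \<partial>lebesgue_on \<Omega>)" .
qed

lemma W12_norm_sq_smooth_diff:
  assumes \<Omega>: "open \<Omega>" "bounded \<Omega>" and u: "u \<in> W12 \<Omega>" and v: "smooth_on UNIV v"
  shows "W12_norm_sq \<Omega> (\<lambda>x. v x - u x) = L2_norm_sq (lebesgue_on \<Omega>) (\<lambda>x. v x - u x)
    + L2_norm_sq (lebesgue_on \<Omega>) (\<lambda>x. gradient v x - weak_gradient \<Omega> u x)"
  unfolding W12_norm_sq_def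
  using L2_norm_sq_weak_gradient[OF \<Omega> square_integrable_diff(1)
      has_weak_gradient_diff[OF \<Omega> W12_weak_gradient[OF u] smooth_W12(1-3)[OF \<Omega> v]]]
    smooth_W12(2)[OF \<Omega> v] W12_weak_gradient(2)[OF u] by simp

lemma gradient_diff:
  assumes "smooth_on UNIV v" "smooth_on UNIV w"
  shows "gradient (\<lambda>x. v x - w x) x = gradient v x - gradient w x"
proof -
  have "((\<lambda>x. v x - w x) has_derivative (\<lambda>h. frechet_derivative v (at x) h - frechet_derivative w (at x) h)) (at x)"
    using assms by (intro has_derivative_diff) (auto intro: smooth_on_has_derivative)
  then have "frechet_derivative (\<lambda>x. v x - w x) (at x) = (\<lambda>h. frechet_derivative v (at x) h - frechet_derivative w (at x) h)"
    by (simp only: frechet_derivative_at[symmetric])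
  then show ?thesis by (simp add: gradient_def scaleR_diff_left sum_subtractf)
qed

text \<open>Whichever trace \<open>g\<close> has been chosen, all norms in the Robin quotient of \<open>u\<close> are limits of those of the
  same smooth functions.\<close>

lemma has_trace_approximation:
  assumes \<Omega>: "open \<Omega>" "bounded \<Omega>" and u: "u \<in> W12 \<Omega>" and tr: "has_trace \<Omega> u g"
    and bd: "\<And>v. smooth_on UNIV v \<Longrightarrow> square_integrable (boundary_measure \<Omega>) v"
  obtains v where "\<And>n::nat. smooth_on UNIV (v n)" "(\<lambda>n. W12_norm_sq \<Omega> (\<lambda>x. v n x - u x)) \<longlonglongrightarrow> 0"
    "(\<lambda>n. L2_norm_sq (lebesgue_on \<Omega>) (v n)) \<longlonglongrightarrow> L2_norm_sq (lebesgue_on \<Omega>) u"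
    "(\<lambda>n. L2_norm_sq (lebesgue_on \<Omega>) (gradient (v n))) \<longlonglongrightarrow> L2_norm_sq (lebesgue_on \<Omega>) (weak_gradient \<Omega> u)"
    "(\<lambda>n. L2_norm_sq (boundary_measure \<Omega>) (v n)) \<longlonglongrightarrow> L2_norm_sq (boundary_measure \<Omega>) g"
proof -
  obtain v where v: "\<And>n::nat. smooth_on UNIV (v n)" and lim: "(\<lambda>n. W12_norm_sq \<Omega> (\<lambda>x. v n x - u x)) \<longlonglongrightarrow> 0"
    and limg: "(\<lambda>n. L2_norm_sq (boundary_measure \<Omega>) (\<lambda>x. v n x - g x)) \<longlonglongrightarrow> 0"
    and g: "square_integrable (boundary_measure \<Omega>) g"
    using tr unfolding has_trace_def by blast
  let ?M = "lebesgue_on \<Omega>"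
  note eq = W12_norm_sq_smooth_diff[OF \<Omega> u v]
  have l1: "(\<lambda>n. L2_norm_sq ?M (\<lambda>x. v n x - u x)) \<longlonglongrightarrow> 0"
    using lim by (rule Lim_null_comparison[rotated]) (auto simp: eq L2_norm_sq_nonneg intro!: always_eventually)
  have l2: "(\<lambda>n. L2_norm_sq ?M (\<lambda>x. gradient (v n) x - weak_gradient \<Omega> u x)) \<longlonglongrightarrow> 0"
    using lim by (rule Lim_null_comparison[rotated]) (auto simp: eq L2_norm_sq_nonneg intro!: always_eventually)
  show thesis
    using that[OF v lim L2_norm_sq_tendsto[OF smooth_W12(1)[OF \<Omega> v] W12_weak_gradient(1)[OF u] l1]
      L2_norm_sq_tendsto[OF smooth_W12(2)[OF \<Omega> v] W12_weak_gradient(2)[OF u] l2]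
      L2_norm_sq_tendsto[OF bd[OF v] g limg]] .
qed

lemma trace_inequality_limit:
  assumes \<Omega>: "open \<Omega>" "bounded \<Omega>" and u: "u \<in> W12 \<Omega>" and tr: "has_trace \<Omega> u g"
    and bd: "\<And>v. smooth_on UNIV v \<Longrightarrow> square_integrable (boundary_measure \<Omega>) v"
    and ineq: "\<And>v. smooth_on UNIV v \<Longrightarrow> \<beta> * L2_norm_sq (boundary_measure \<Omega>) v \<le>
      L2_norm_sq (lebesgue_on \<Omega>) (gradient v) + \<mu> * L2_norm_sq (lebesgue_on \<Omega>) v"
  shows "\<beta> * L2_norm_sq (boundary_measure \<Omega>) g \<le>
    L2_norm_sq (lebesgue_on \<Omega>) (weak_gradient \<Omega> u) + \<mu> * L2_norm_sq (lebesgue_on \<Omega>) u"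
proof -
  obtain v where v: "\<And>n::nat. smooth_on UNIV (v n)"
    and l: "(\<lambda>n. L2_norm_sq (lebesgue_on \<Omega>) (v n)) \<longlonglongrightarrow> L2_norm_sq (lebesgue_on \<Omega>) u"
    "(\<lambda>n. L2_norm_sq (lebesgue_on \<Omega>) (gradient (v n))) \<longlonglongrightarrow> L2_norm_sq (lebesgue_on \<Omega>) (weak_gradient \<Omega> u)"
    "(\<lambda>n. L2_norm_sq (boundary_measure \<Omega>) (v n)) \<longlonglongrightarrow> L2_norm_sq (boundary_measure \<Omega>) g"
    using has_trace_approximation[OF \<Omega> u tr bd] by blast
  show ?thesis
    by (rule LIMSEQ_le[OF tendsto_mult[OF tendsto_const l(3)] tendsto_add[OF l(2) tendsto_mult[OF tendsto_const l(1)]]])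
      (use ineq[OF v] in auto)
qed

text \<open>The trace inequality makes the trace unique, so for a smooth function it has the norm of the
  restriction.\<close>

lemma L2_norm_sq_trace_smooth:
  assumes \<Omega>: "open \<Omega>" "bounded \<Omega>" and u: "smooth_on UNIV u" and tr: "has_trace \<Omega> u g"
    and bd: "\<And>v. smooth_on UNIV v \<Longrightarrow> square_integrable (boundary_measure \<Omega>) v"
    and ineq: "\<And>v. smooth_on UNIV v \<Longrightarrow> L2_norm_sq (boundary_measure \<Omega>) v \<le>
      C * (L2_norm_sq (lebesgue_on \<Omega>) v + L2_norm_sq (lebesgue_on \<Omega>) (gradient v))"
  shows "L2_norm_sq (boundary_measure \<Omega>) g = L2_norm_sq (boundary_measure \<Omega>) u"
proof -
  note uW = smooth_W12(4)[OF \<Omega> u]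
  obtain v where v: "\<And>n::nat. smooth_on UNIV (v n)" and lim: "(\<lambda>n. W12_norm_sq \<Omega> (\<lambda>x. v n x - u x)) \<longlonglongrightarrow> 0"
    and l: "(\<lambda>n. L2_norm_sq (boundary_measure \<Omega>) (v n)) \<longlonglongrightarrow> L2_norm_sq (boundary_measure \<Omega>) g"
    using has_trace_approximation[OF \<Omega> uW tr bd] by blast
  have s: "smooth_on UNIV (\<lambda>x. v n x - u x)" for n by (intro smooth_on_diff v u) simp
  have eq: "W12_norm_sq \<Omega> (\<lambda>x. v n x - u x) = L2_norm_sq (lebesgue_on \<Omega>) (\<lambda>x. v n x - u x)
      + L2_norm_sq (lebesgue_on \<Omega>) (gradient (\<lambda>x. v n x - u x))" for n
    unfolding W12_norm_sq_def using L2_norm_sq_weak_gradient[OF \<Omega> smooth_W12(2,3)[OF \<Omega> s]] by simp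
  have "(\<lambda>n. L2_norm_sq (boundary_measure \<Omega>) (\<lambda>x. v n x - u x)) \<longlonglongrightarrow> 0"
  proof (rule Lim_null_comparison[OF always_eventually], rule allI)
    show "norm (L2_norm_sq (boundary_measure \<Omega>) (\<lambda>x. v n x - u x)) \<le> C * W12_norm_sq \<Omega> (\<lambda>x. v n x - u x)" for n
      using ineq[OF s] eq L2_norm_sq_nonneg[of "boundary_measure \<Omega>" "\<lambda>x. v n x - u x"] by simp
    show "(\<lambda>n. C * W12_norm_sq \<Omega> (\<lambda>x. v n x - u x)) \<longlonglongrightarrow> 0"
      using tendsto_mult[OF tendsto_const lim, of C] by simp
  qed
  then have "(\<lambda>n. L2_norm_sq (boundary_measure \<Omega>) (v n)) \<longlonglongrightarrow> L2_norm_sq (boundary_measure \<Omega>) u"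
    by (rule L2_norm_sq_tendsto[OF bd[OF v] bd[OF u]])
  then show ?thesis by (rule LIMSEQ_unique[OF l])
qed

lemma has_trace_smooth:
  assumes \<Omega>: "open \<Omega>" "bounded \<Omega>" and u: "smooth_on UNIV u"
    and bd: "square_integrable (boundary_measure \<Omega>) u"
  shows "has_trace \<Omega> u u"
proof -
  have "gradient (\<lambda>x. 0) = (\<lambda>x. 0 :: 'a)" by (simp add: gradient_def fun_eq_iff frechet_derivative_const)
  then have "W12_norm_sq \<Omega> (\<lambda>x. u x - u x) = 0"
    unfolding W12_norm_sq_def
    using L2_norm_sq_weak_gradient[OF \<Omega> smooth_W12(2,3)[OF \<Omega> smooth_on_const[of UNIV 0]]]
    by (simp add: L2_norm_sq_def)
  then show ?thesis
    unfolding has_trace_def using bd u smooth_W12(4)[OF \<Omega> u]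
    by (intro conjI exI[of _ "\<lambda>n. u"]) (auto simp: L2_norm_sq_def)
qed

text \<open>By the trace inequality, the boundary values of smooth functions approximating \<open>u\<close> form a Cauchy
  sequence in \<open>L\<^sup>2(\<partial>\<Omega>)\<close>. Its limit is a trace.\<close>

lemma has_trace_exists:
  fixes u :: "'a::euclidean_space \<Rightarrow> real" and \<psi> :: "'a \<Rightarrow> 'a"
  assumes \<Omega>: "open \<Omega>" "bounded \<Omega>"
    and \<psi>: "\<And>b. b \<in> Basis \<Longrightarrow> smooth_on UNIV (\<lambda>x. \<psi> x \<bullet> b)"
    and \<epsilon>0: "0 < \<epsilon>0" and inward: "\<And>\<epsilon> x. 0 < \<epsilon> \<Longrightarrow> \<epsilon> < \<epsilon>0 \<Longrightarrow> x \<in> \<Omega> \<Longrightarrow> cball (x + \<epsilon> *\<^sub>R \<psi> x) \<epsilon> \<subseteq> \<Omega>"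
    and bd: "\<And>v. smooth_on UNIV v \<Longrightarrow> square_integrable (boundary_measure \<Omega>) v" and C: "0 \<le> C"
    and ineq: "\<And>v. smooth_on UNIV v \<Longrightarrow> L2_norm_sq (boundary_measure \<Omega>) v \<le>
      C * (L2_norm_sq (lebesgue_on \<Omega>) v + L2_norm_sq (lebesgue_on \<Omega>) (gradient v))"
    and u: "u \<in> W12 \<Omega>"
  shows "\<exists>g. has_trace \<Omega> u g"
proof -
  let ?M = "lebesgue_on \<Omega>" and ?G = "weak_gradient \<Omega> u"
  note W = W12_weak_gradient[OF u]
  obtain w where w: "\<And>n::nat. smooth_on UNIV (w n)"
    and w1: "(\<lambda>n. L2_norm_sq ?M (\<lambda>x. w n x - u x)) \<longlonglongrightarrow> 0"
    and w2: "(\<lambda>n. L2_norm_sq ?M (\<lambda>x. gradient (w n) x - ?G x)) \<longlonglongrightarrow> 0"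
    using smooth_dense_W12[OF \<Omega> \<psi> \<epsilon>0 inward W] by blast
  define E where "E v = L2_norm_sq ?M (\<lambda>x. v x - u x) + L2_norm_sq ?M (\<lambda>x. gradient v x - ?G x)" for v
  have "(\<lambda>n. E (w n)) \<longlonglongrightarrow> 0" unfolding E_def using tendsto_add[OF w1 w2] by simp
  \<comment> \<open>Thinning out the sequence produces the geometric rate under which \<open>L2_complete\<close> applies.\<close>
  then have "\<exists>n. E (w n) < (1 / 8) ^ k" for k :: nat
  proof -
    have "\<forall>\<^sub>F n in sequentially. E (w n) < (1 / 8) ^ k"
      using \<open>(\<lambda>n. E (w n)) \<longlonglongrightarrow> 0\<close> by (rule order_tendstoD(2)) simp
    then show ?thesis by (auto simp: eventually_sequentially)
  qed
  then obtain s where s: "\<And>k. E (w (s k)) < (1 / 8) ^ k" by metis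
  define v where "v k = w (s k)" for k
  have v: "smooth_on UNIV (v k)" and Ev: "E (v k) < (1 / 8) ^ k" for k using w s by (auto simp: v_def)
  have inc: "L2_norm_sq (boundary_measure \<Omega>) (\<lambda>x. v (Suc n) x - v n x) \<le> (4 * C) * (1 / 8) ^ n" for n
  proof -
    have sm: "smooth_on UNIV (\<lambda>x. v (Suc n) x - v n x)" by (intro smooth_on_diff v) simp
    have a: "L2_norm_sq ?M (\<lambda>x. v (Suc n) x - v n x) \<le>
        2 * L2_norm_sq ?M (\<lambda>x. v (Suc n) x - u x) + 2 * L2_norm_sq ?M (\<lambda>x. v n x - u x)"
      using square_integrable_diff(2)[OF square_integrable_diff(1)[OF smooth_W12(1)[OF \<Omega> v[of "Suc n"]] W(1)]
        square_integrable_diff(1)[OF smooth_W12(1)[OF \<Omega> v[of n]] W(1)]] by simp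
    have b: "L2_norm_sq ?M (gradient (\<lambda>x. v (Suc n) x - v n x)) \<le>
        2 * L2_norm_sq ?M (\<lambda>x. gradient (v (Suc n)) x - ?G x) + 2 * L2_norm_sq ?M (\<lambda>x. gradient (v n) x - ?G x)"
      using square_integrable_diff(2)[OF square_integrable_diff(1)[OF smooth_W12(2)[OF \<Omega> v[of "Suc n"]] W(2)]
        square_integrable_diff(1)[OF smooth_W12(2)[OF \<Omega> v[of n]] W(2)]]
        gradient_diff[OF v v, of "Suc n" n] by (simp add: L2_norm_sq_def)
    have "L2_norm_sq ?M (\<lambda>x. v (Suc n) x - v n x) + L2_norm_sq ?M (gradient (\<lambda>x. v (Suc n) x - v n x)) \<le>
        2 * E (v (Suc n)) + 2 * E (v n)" using add_mono[OF a b] unfolding E_def by (simp add: algebra_simps)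
    also have "\<dots> \<le> 2 * (1 / 8) ^ n + 2 * (1 / 8) ^ n"
    proof -
      have "(1 / 8 :: real) ^ Suc n \<le> (1 / 8) ^ n" by (intro power_decreasing) auto
      then show ?thesis using Ev[of "Suc n"] Ev[of n] by linarith
    qed
    finally have "C * (L2_norm_sq ?M (\<lambda>x. v (Suc n) x - v n x) + L2_norm_sq ?M (gradient (\<lambda>x. v (Suc n) x - v n x))) \<le>
        C * (4 * (1 / 8) ^ n)" using C by (intro mult_left_mono) auto
    then show ?thesis using ineq[OF sm] by simp
  qed
  obtain g where g: "square_integrable (boundary_measure \<Omega>) g"
    "(\<lambda>n. L2_norm_sq (boundary_measure \<Omega>) (\<lambda>x. v n x - g x)) \<longlonglongrightarrow> 0"
    by (rule L2_complete[OF bd[OF v] inc])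
  have "(\<lambda>n. W12_norm_sq \<Omega> (\<lambda>x. v n x - u x)) \<longlonglongrightarrow> 0"
  proof (rule Lim_null_comparison[OF always_eventually], rule allI)
    fix n
    have "W12_norm_sq \<Omega> (\<lambda>x. v n x - u x) = E (v n)"
      unfolding E_def by (rule W12_norm_sq_smooth_diff[OF \<Omega> u v])
    moreover have "0 \<le> E (v n)" by (simp add: E_def L2_norm_sq_nonneg)
    ultimately show "norm (W12_norm_sq \<Omega> (\<lambda>x. v n x - u x)) \<le> (1 / 8) ^ n" using Ev[of n] by simp
  next
    show "(\<lambda>n. (1 / 8 :: real) ^ n) \<longlonglongrightarrow> 0" by (rule LIMSEQ_power_zero) simp
  qed
  then show ?thesis
    unfolding has_trace_def using g v smooth_W12(4)[OF \<Omega> v] by blast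
qed

section \<open>Integration over the boundary\<close>

text \<open>The ratio of Hausdorff and cone measure, common to all spheres in the space.\<close>

definition sphere_factor :: "'a::euclidean_space itself \<Rightarrow> real" where
  "sphere_factor _ = (SOME \<kappa>. \<kappa> > 0 \<and> (\<forall>(c::'a) r E. 0 < r \<longrightarrow> E \<in> sets borel \<longrightarrow>
    hausdorff_outer_measure (DIM('a) - 1) (E \<inter> sphere c r) =
    ennreal (\<kappa> * r ^ (DIM('a) - 1)) * emeasure sphere_measure ((\<lambda>\<theta>. c + r *\<^sub>R \<theta>) -` E)))"

lemma sphere_factor:
  assumes "DIM('a::euclidean_space) \<ge> 2"
  shows "0 < sphere_factor TYPE('a)"
    and "\<And>(c::'a) r E. 0 < r \<Longrightarrow> E \<in> sets borel \<Longrightarrow>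
    hausdorff_outer_measure (DIM('a) - 1) (E \<inter> sphere c r) =
    ennreal (sphere_factor TYPE('a) * r ^ (DIM('a) - 1)) * emeasure sphere_measure ((\<lambda>\<theta>. c + r *\<^sub>R \<theta>) -` E)"
  using someI_ex[OF hausdorff_sphere[OF assms]] unfolding sphere_factor_def by blast+

text \<open>Hausdorff measure on the sphere is the image of a multiple of the cone measure.\<close>

lemma integral_hausdorff_sphere:
  fixes f :: "'a::euclidean_space \<Rightarrow> real"
  assumes d: "DIM('a) \<ge> 2" and r: "0 < r" and f: "continuous_on UNIV f"
  shows "integrable (hausdorff_measure (DIM('a) - 1)) (\<lambda>x. indicator (sphere c r) x * f x)"
    and "(\<integral>x. indicator (sphere c r) x * f x \<partial>hausdorff_measure (DIM('a) - 1)) =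
      sphere_factor TYPE('a) * r ^ (DIM('a) - 1) * (\<integral>\<theta>. f (c + r *\<^sub>R \<theta>) \<partial>sphere_measure)"
    and "integrable sphere_measure (\<lambda>\<theta>. f (c + r *\<^sub>R \<theta>))"
proof -
  let ?k = "DIM('a) - 1" and ?H = "hausdorff_measure (DIM('a) - 1) :: 'a measure"
    and ?\<sigma> = "sphere_measure :: 'a measure" and ?F = "\<lambda>\<theta>. c + r *\<^sub>R \<theta>"
  define q where "q = sphere_factor TYPE('a) * r ^ ?k"
  have q: "0 \<le> q" using sphere_factor(1)[OF d] r by (simp add: q_def)
  interpret S: finite_measure ?\<sigma> by (rule finite_measure_sphere_measure)
  have k: "?k \<ge> 1" using d by simp
  have fm [measurable]: "f \<in> borel_measurable borel" by (rule borel_measurable_continuous_onI[OF f])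
  have Fm [measurable]: "?F \<in> borel_measurable borel" by (intro borel_measurable_continuous_onI continuous_intros)
  have Im: "(\<lambda>x. indicator (sphere c r) x :: real) \<in> borel_measurable ?H"
    by (intro borel_measurable_indicator) simp
  have Im': "(indicator (sphere c r) :: 'a \<Rightarrow> ennreal) \<in> borel_measurable ?H"
    by (intro borel_measurable_indicator) simp
  have fH: "f \<in> borel_measurable ?H" using fm by (simp cong: measurable_cong_sets)
  have eq: "density ?H (\<lambda>x. ennreal (indicator (sphere c r) x)) = distr (density ?\<sigma> (\<lambda>_. ennreal q)) borel ?F"
  proof (rule measure_eqI)
    fix E assume "E \<in> sets (density ?H (\<lambda>x. ennreal (indicator (sphere c r) x)))"
    then have E: "E \<in> sets borel" by simp
    have FE: "?F -` E \<in> sets borel" by (rule measurable_sets_borel[OF Fm E])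
    have "emeasure (density ?H (\<lambda>x. ennreal (indicator (sphere c r) x))) E =
        (\<integral>\<^sup>+x. ennreal (indicator (sphere c r) x) * indicator E x \<partial>?H)"
      using E Im by (intro emeasure_density) auto
    also have "\<dots> = (\<integral>\<^sup>+x. indicator (E \<inter> sphere c r) x \<partial>?H)"
      by (intro nn_integral_cong) (auto split: split_indicator)
    also have "\<dots> = ennreal q * emeasure ?\<sigma> (?F -` E)"
      using E emeasure_hausdorff_measure[OF k, of "E \<inter> sphere c r"] sphere_factor(2)[OF d r E] by (simp add: q_def)
    also have "\<dots> = emeasure (distr (density ?\<sigma> (\<lambda>_. ennreal q)) borel ?F) E"
      using E FE by (subst emeasure_distr) (auto simp: emeasure_density nn_integral_cmult_indicator)
    finally show "emeasure (density ?H (\<lambda>x. ennreal (indicator (sphere c r) x))) E =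
        emeasure (distr (density ?\<sigma> (\<lambda>_. ennreal q)) borel ?F) E" .
  qed simp
  have "compact (?F ` sphere 0 1)" by (intro compact_continuous_image continuous_intros) auto
  then have "compact (f ` ?F ` sphere 0 1)"
    using continuous_on_subset[OF f] by (rule compact_continuous_image[rotated]) simp
  then have "bounded (f ` ?F ` sphere 0 1)" by (rule compact_imp_bounded)
  then obtain K where K0: "\<forall>y\<in>f ` ?F ` sphere 0 1. norm y \<le> K" unfolding bounded_iff by blast
  have K: "norm (f (?F \<theta>)) \<le> K" if "norm \<theta> = 1" for \<theta>
    using K0 that by (simp add: image_image)
  show i: "integrable ?\<sigma> (\<lambda>\<theta>. f (?F \<theta>))"
  proof (rule S.integrable_const_bound[of _ K])
    show "AE \<theta> in ?\<sigma>. norm (f (?F \<theta>)) \<le> K" using AE_sphere_measure by eventually_elim (rule K)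
  qed measurable
  have i2: "integrable (distr (density ?\<sigma> (\<lambda>_. ennreal q)) borel ?F) f"
    using i q by (subst integrable_distr_eq) (auto simp: integrable_density)
  have v2: "(\<integral>x. f x \<partial>distr (density ?\<sigma> (\<lambda>_. ennreal q)) borel ?F) = q * (\<integral>\<theta>. f (?F \<theta>) \<partial>?\<sigma>)"
    using q by (subst integral_distr) (auto simp: integral_density)
  show "integrable ?H (\<lambda>x. indicator (sphere c r) x * f x)"
    using i2 fH Im unfolding eq[symmetric] by (subst (asm) integrable_density) auto
  show "(\<integral>x. indicator (sphere c r) x * f x \<partial>?H) = sphere_factor TYPE('a) * r ^ ?k * (\<integral>\<theta>. f (?F \<theta>) \<partial>?\<sigma>)"
    using v2 fH Im unfolding eq[symmetric] by (subst (asm) integral_density) (auto simp: q_def)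
qed

section \<open>Integral identities on balls and shells\<close>

lemma L2_norm_sq_lborel:
  fixes f :: "'a::euclidean_space \<Rightarrow> 'b::euclidean_space"
  assumes \<Omega>: "open \<Omega>" "bounded \<Omega>" and f: "continuous_on UNIV f"
  shows "integrable lborel (\<lambda>x. indicator \<Omega> x * (norm (f x))\<^sup>2)"
    and "L2_norm_sq (lebesgue_on \<Omega>) f = (\<integral>x. indicator \<Omega> x * (norm (f x))\<^sup>2 \<partial>lborel)"
proof -
  have [measurable]: "f \<in> borel_measurable borel" by (rule borel_measurable_continuous_onI[OF f])
  have [measurable]: "\<Omega> \<in> sets borel" using \<Omega> by simp
  have m: "(\<lambda>x. indicator \<Omega> x * (norm (f x))\<^sup>2) \<in> borel_measurable borel" by measurable
  have e: "(\<integral>x. (norm (f x))\<^sup>2 \<partial>lebesgue_on \<Omega>) = (\<integral>x. indicator \<Omega> x * (norm (f x))\<^sup>2 \<partial>lebesgue_on \<Omega>)"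
    "integrable (lebesgue_on \<Omega>) (\<lambda>x. (norm (f x))\<^sup>2) \<longleftrightarrow> integrable (lebesgue_on \<Omega>) (\<lambda>x. indicator \<Omega> x * (norm (f x))\<^sup>2)"
    by (auto intro!: Bochner_Integration.integral_cong Bochner_Integration.integrable_cong)
  show "integrable lborel (\<lambda>x. indicator \<Omega> x * (norm (f x))\<^sup>2)"
    using square_integrable_continuous[OF \<Omega> f] lebesgue_on_borel(2)[OF \<Omega>(1) m] e by (simp add: square_integrable_def)
  show "L2_norm_sq (lebesgue_on \<Omega>) f = (\<integral>x. indicator \<Omega> x * (norm (f x))\<^sup>2 \<partial>lborel)"
    unfolding L2_norm_sq_def e by (rule lebesgue_on_borel(1)[OF \<Omega>(1) m]) simp
qed

lemma boundary_L2:
  assumes i: "integrable (hausdorff_measure (DIM('a) - 1)) (\<lambda>x. indicator (frontier \<Omega>) x * (v x)\<^sup>2)"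
    and v: "continuous_on UNIV (v :: 'a::euclidean_space \<Rightarrow> real)"
  shows "square_integrable (boundary_measure \<Omega>) v"
    and "L2_norm_sq (boundary_measure \<Omega>) v = (\<integral>x. indicator (frontier \<Omega>) x * (v x)\<^sup>2 \<partial>hausdorff_measure (DIM('a) - 1))"
proof -
  let ?H = "hausdorff_measure (DIM('a) - 1) :: 'a measure"
  have F: "frontier \<Omega> \<inter> space ?H \<in> sets ?H" by simp
  have "v \<in> borel_measurable ?H" using borel_measurable_continuous_onI[OF v] by (simp cong: measurable_cong_sets)
  then have vm: "v \<in> borel_measurable (boundary_measure \<Omega>)"
    unfolding boundary_measure_def by (rule measurable_restrict_space1)
  have "integrable (boundary_measure \<Omega>) (\<lambda>x. (norm (v x))\<^sup>2)"
    unfolding boundary_measure_def integrable_restrict_space[OF F] using i by simp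
  then show "square_integrable (boundary_measure \<Omega>) v" using vm by (simp add: square_integrable_def)
  show "L2_norm_sq (boundary_measure \<Omega>) v = (\<integral>x. indicator (frontier \<Omega>) x * (v x)\<^sup>2 \<partial>?H)"
    unfolding L2_norm_sq_def boundary_measure_def integral_restrict_space[OF F] by simp
qed

text \<open>The surface integral, up to the factor between Hausdorff and cone measure.\<close>

definition sphere_integral :: "('a::euclidean_space \<Rightarrow> real) \<Rightarrow> 'a \<Rightarrow> real \<Rightarrow> real" where
  "sphere_integral f c r = r ^ (DIM('a) - 1) * (\<integral>\<theta>. f (c + r *\<^sub>R \<theta>) \<partial>sphere_measure)"

lemma boundary_L2_ball:
  fixes c :: "'a::euclidean_space"
  assumes d: "DIM('a) \<ge> 2" and R: "0 < R" and v: "continuous_on UNIV v"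
  shows "square_integrable (boundary_measure (ball c R)) v"
    and "L2_norm_sq (boundary_measure (ball c R)) v = sphere_factor TYPE('a) * sphere_integral (\<lambda>x. (v x)\<^sup>2) c R"
proof -
  have f: "frontier (ball c R) = sphere c R" using R by (rule frontier_ball)
  have v2: "continuous_on UNIV (\<lambda>x. (v x)\<^sup>2)" by (intro continuous_intros v)
  note s = integral_hausdorff_sphere[OF d R v2, of c]
  show "square_integrable (boundary_measure (ball c R)) v"
    by (rule boundary_L2(1)[OF _ v]) (use s(1) f in simp)
  show "L2_norm_sq (boundary_measure (ball c R)) v = sphere_factor TYPE('a) * sphere_integral (\<lambda>x. (v x)\<^sup>2) c R"
    using boundary_L2(2)[OF _ v, of "ball c R"] s f by (simp add: sphere_integral_def)
qed

lemma open_spherical_shell: "open (spherical_shell r1 r2)"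
  unfolding spherical_shell_def by (intro open_Collect_conj open_Collect_less continuous_intros)

lemma bounded_spherical_shell: "bounded (spherical_shell r1 r2)"
  unfolding spherical_shell_def by (rule bounded_subset[OF bounded_ball[of 0 r2]]) auto

text \<open>A point of the closed shell is approached from inside by moving it radially towards the middle
  sphere.\<close>

lemma frontier_spherical_shell:
  assumes "0 < r1" "r1 < r2"
  shows "frontier (spherical_shell r1 r2 :: 'a::euclidean_space set) = sphere 0 r1 \<union> sphere 0 r2"
proof -
  let ?S = "spherical_shell r1 r2 :: 'a set"
  have "closure ?S \<subseteq> {x. r1 \<le> norm x \<and> norm x \<le> r2}"
    by (rule closure_minimal) (auto simp: spherical_shell_def intro!: closed_Collect_conj closed_Collect_le continuous_intros)
  moreover have "x \<in> closure ?S" if x: "r1 \<le> norm x" "norm x \<le> r2" for x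
    unfolding closure_approachable
  proof (intro allI impI)
    fix e :: real assume e: "0 < e"
    define m where "m = (r1 + r2) / 2"
    define s where "s = min 1 (e / (2 * (\<bar>m - norm x\<bar> + 1)))"
    define y where "y = (((1 - s) * norm x + s * m) / norm x) *\<^sub>R x"
    have "0 < 2 * (\<bar>m - norm x\<bar> + 1)" by (intro mult_pos_pos add_nonneg_pos) auto
    then have "0 < e / (2 * (\<bar>m - norm x\<bar> + 1))" using e by (intro divide_pos_pos)
    then have s: "0 < s" "s \<le> 1" by (auto simp: s_def)
    have x0: "0 < norm x" using x assms by linarith
    have m: "r1 < m" "m < r2" using assms by (auto simp: m_def)
    have lo: "r1 < (1 - s) * norm x + s * m"
    proof -
      have "(1 - s) * r1 + s * r1 < (1 - s) * norm x + s * m"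
        using s x m by (intro add_le_less_mono mult_left_mono mult_strict_left_mono) auto
      then show ?thesis by (simp add: algebra_simps)
    qed
    have hi: "(1 - s) * norm x + s * m < r2"
    proof -
      have "(1 - s) * norm x + s * m < (1 - s) * r2 + s * r2"
        using s x m by (intro add_le_less_mono mult_left_mono mult_strict_left_mono) auto
      then show ?thesis by (simp add: algebra_simps)
    qed
    have ny: "norm y = (1 - s) * norm x + s * m"
      using x0 lo assms by (simp add: y_def)
    have "y \<in> ?S" using ny lo hi by (simp add: spherical_shell_def)
    moreover have "dist y x < e"
    proof -
      have "y - x = (s * (m - norm x) / norm x) *\<^sub>R x"
      proof -
        have "((1 - s) * norm x + s * m) / norm x = 1 + s * (m - norm x) / norm x"
          using x0 by (simp add: field_simps)
        then show ?thesis by (simp add: y_def scaleR_left_distrib)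
      qed
      then have "norm (y - x) = s * \<bar>m - norm x\<bar>" using x0 s by (simp add: abs_mult)
      also have "\<dots> \<le> e / (2 * (\<bar>m - norm x\<bar> + 1)) * \<bar>m - norm x\<bar>"
        by (intro mult_right_mono) (auto simp: s_def)
      also have "\<dots> = e * (\<bar>m - norm x\<bar> / (2 * (\<bar>m - norm x\<bar> + 1)))" by simp
      also have "\<dots> < e * 1"
      proof (rule mult_strict_left_mono[OF _ e])
        have T: "t / (2 * (t + 1)) < 1" if "0 \<le> t" for t :: real using that by (simp add: divide_less_eq)
        show "\<bar>m - norm x\<bar> / (2 * (\<bar>m - norm x\<bar> + 1)) < 1" by (rule T) simp
      qed
      finally show ?thesis by (simp add: dist_norm)
    qed
    ultimately show "\<exists>y\<in>?S. dist y x < e" by blast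
  qed
  ultimately have "closure ?S = {x. r1 \<le> norm x \<and> norm x \<le> r2}" by blast
  moreover have "interior ?S = ?S" by (rule interior_open[OF open_spherical_shell])
  moreover have "{x::'a. r1 \<le> norm x \<and> norm x \<le> r2} - ?S = {x. norm x = r1 \<or> norm x = r2}"
    using assms by (fastforce simp: spherical_shell_def)
  ultimately show ?thesis unfolding frontier_def by (auto simp: dist_norm)
qed

lemma boundary_L2_shell:
  assumes d: "DIM('a::euclidean_space) \<ge> 2" and r: "0 < r1" "r1 < r2" and v: "continuous_on UNIV v"
  shows "square_integrable (boundary_measure (spherical_shell r1 r2 :: 'a set)) v"
    and "L2_norm_sq (boundary_measure (spherical_shell r1 r2 :: 'a set)) v =
      sphere_factor TYPE('a) * (sphere_integral (\<lambda>x. (v x)\<^sup>2) 0 r1 + sphere_integral (\<lambda>x. (v x)\<^sup>2) 0 r2)"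
proof -
  let ?H = "hausdorff_measure (DIM('a) - 1) :: 'a measure"
  have r2: "0 < r2" using r by simp
  have v2: "continuous_on UNIV (\<lambda>x. (v x)\<^sup>2)" by (intro continuous_intros v)
  note s1 = integral_hausdorff_sphere[OF d r(1) v2, of 0] and s2 = integral_hausdorff_sphere[OF d r2 v2, of 0]
  have split: "indicator (frontier (spherical_shell r1 r2)) x * (v x)\<^sup>2 =
      indicator (sphere 0 r1) x * (v x)\<^sup>2 + indicator (sphere 0 r2) x * (v x)\<^sup>2" for x
    unfolding frontier_spherical_shell[OF r] using r by (auto split: split_indicator)
  have i: "integrable ?H (\<lambda>x. indicator (frontier (spherical_shell r1 r2)) x * (v x)\<^sup>2)"
    unfolding split using s1(1) s2(1) by (rule Bochner_Integration.integrable_add)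
  show "square_integrable (boundary_measure (spherical_shell r1 r2 :: 'a set)) v" by (rule boundary_L2(1)[OF i v])
  show "L2_norm_sq (boundary_measure (spherical_shell r1 r2 :: 'a set)) v =
      sphere_factor TYPE('a) * (sphere_integral (\<lambda>x. (v x)\<^sup>2) 0 r1 + sphere_integral (\<lambda>x. (v x)\<^sup>2) 0 r2)"
    unfolding boundary_L2(2)[OF i v] split Bochner_Integration.integral_add[OF s1(1) s2(1)] s1(2) s2(2)
    by (simp add: sphere_integral_def distrib_left)
qed

lemma smooth_ray_derivative:
  fixes v :: "'a::euclidean_space \<Rightarrow> real"
  assumes "smooth_on UNIV v"
  shows "((\<lambda>r. v (c + r *\<^sub>R \<theta>)) has_real_derivative gradient v (c + r *\<^sub>R \<theta>) \<bullet> \<theta>) (at r)"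
proof -
  let ?x = "c + r *\<^sub>R \<theta>"
  have "(v has_derivative (\<lambda>h. gradient v ?x \<bullet> h)) (at ?x)"
  proof -
    have "frechet_derivative v (at ?x) = (\<lambda>h. gradient v ?x \<bullet> h)"
      by (rule ext) (rule smooth_frechet_derivative_gradient[OF assms])
    then show ?thesis using smooth_on_has_derivative[OF assms, of ?x] by simp
  qed
  then have "((\<lambda>r. v (c + r *\<^sub>R \<theta>)) has_derivative (\<lambda>h. gradient v ?x \<bullet> (h *\<^sub>R \<theta>))) (at r)"
    by (rule has_derivative_compose[rotated]) (auto intro!: derivative_eq_intros)
  then show ?thesis by (simp add: has_field_derivative_def mult.commute[of _ "gradient v ?x \<bullet> \<theta>"])
qed

lemma two_mult_le: "2 * a * (b * k) \<le> k\<^sup>2 * a\<^sup>2 + (b::real)\<^sup>2"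
  using sum_squares_ge_zero[of "k * a - b" 0] by (simp add: power2_eq_square algebra_simps)

text \<open>The divergence theorem for the field \<open>v\<^sup>2 (x - c) / R\<close>.\<close>

lemma ball_trace_inequality:
  fixes c :: "'a::euclidean_space"
  assumes R: "0 < R" and v: "smooth_on UNIV v"
  shows "sphere_integral (\<lambda>x. (v x)\<^sup>2) c R \<le> (real DIM('a) / R + 1) *
    (L2_norm_sq (lebesgue_on (ball c R)) v + L2_norm_sq (lebesgue_on (ball c R)) (gradient v))"
proof -
  let ?d = "DIM('a)" and ?B = "ball c R"
  obtain k where k: "?d = Suc k" using DIM_positive[where 'a='a] not0_implies_Suc by blast
  \<comment> \<open>\<open>f\<close> is the divergence of the field, and \<open>J\<close> is \<open>r\<^sup>d\<^sup>-\<^sup>1\<close> times its radial component.\<close>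
  define f where "f x = real ?d / R * (v x)\<^sup>2 + 2 * v x * (gradient v x \<bullet> ((x - c) /\<^sub>R R))" for x
  define J where "J r \<theta> = r ^ ?d / R * (v (c + r *\<^sub>R \<theta>))\<^sup>2" for r \<theta>
  have vc: "continuous_on UNIV v" and gc: "continuous_on UNIV (gradient v)"
    by (intro smooth_on_continuous continuous_on_gradient v)+
  have fc: "continuous_on UNIV f" unfolding f_def by (intro continuous_intros vc gc)
  have Jm: "J r \<in> borel_measurable borel" for r
    unfolding J_def by (intro borel_measurable_continuous_onI continuous_intros continuous_on_compose2[OF vc]) auto
  have "(\<integral>x. indicator ?B x * f x \<partial>lborel) = (\<integral>\<theta>. J R \<theta> - J 0 \<theta> \<partial>sphere_measure)"
  proof (rule integral_ball_by_rays[OF _ fc])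
    fix \<theta> :: 'a and r assume "norm \<theta> = 1" "0 \<le> r" "r \<le> R"
    show "((\<lambda>r. J r \<theta>) has_real_derivative r ^ (?d - 1) * f (c + r *\<^sub>R \<theta>)) (at r)"
    proof -
      let ?x = "c + r *\<^sub>R \<theta>"
      have vd: "((\<lambda>r. (v (c + r *\<^sub>R \<theta>))\<^sup>2) has_real_derivative 2 * v ?x * (gradient v ?x \<bullet> \<theta>)) (at r)"
        by (auto intro!: derivative_eq_intros smooth_ray_derivative[OF v])
      have pd: "((\<lambda>r. r ^ Suc k) has_real_derivative real (Suc k) * r ^ k) (at r)"
        using DERIV_pow[of "Suc k" r] by simp
      have "((\<lambda>r. J r \<theta>) has_real_derivative
          (real (Suc k) * r ^ k * (v ?x)\<^sup>2 + (2 * v ?x * (gradient v ?x \<bullet> \<theta>)) * r ^ Suc k) / R) (at r)"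
        using DERIV_cdivide[OF DERIV_mult[OF pd vd], of R] unfolding J_def k by simp
      moreover have "(real (Suc k) * r ^ k * (v ?x)\<^sup>2 + (2 * v ?x * (gradient v ?x \<bullet> \<theta>)) * r ^ Suc k) / R =
          r ^ (?d - 1) * f ?x"
        using R by (simp add: f_def k field_simps)
      ultimately show ?thesis by simp
    qed
  qed (use R Jm in auto)
  also have "\<dots> = sphere_integral (\<lambda>x. (v x)\<^sup>2) c R"
    using R by (simp add: J_def sphere_integral_def k)
  finally have eq: "sphere_integral (\<lambda>x. (v x)\<^sup>2) c R = (\<integral>x. indicator ?B x * f x \<partial>lborel)" by simp
  note Lv = L2_norm_sq_lborel[OF open_ball bounded_ball vc, of c R] and Lg = L2_norm_sq_lborel[OF open_ball bounded_ball gc, of c R]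
  have "(\<integral>x. indicator ?B x * f x \<partial>lborel) \<le>
      (\<integral>x. (real ?d / R + 1) * (indicator ?B x * (norm (v x))\<^sup>2 + indicator ?B x * (norm (gradient v x))\<^sup>2) \<partial>lborel)"
  proof (rule integral_mono')
    show "integrable lborel (\<lambda>x. (real ?d / R + 1) * (indicator ?B x * (norm (v x))\<^sup>2 + indicator ?B x * (norm (gradient v x))\<^sup>2))"
      using Lv(1) Lg(1) by (intro integrable_mult_right Bochner_Integration.integrable_add)
    fix x
    show "indicator ?B x * f x \<le> (real ?d / R + 1) * (indicator ?B x * (norm (v x))\<^sup>2 + indicator ?B x * (norm (gradient v x))\<^sup>2)"
    proof (cases "x \<in> ?B")
      case True
      then have "inverse R * norm (x - c) \<le> inverse R * R"
        using R by (intro mult_left_mono) (auto simp: dist_norm norm_minus_commute)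
      then have n: "norm ((x - c) /\<^sub>R R) \<le> 1" using R by simp
      have "\<bar>gradient v x \<bullet> ((x - c) /\<^sub>R R)\<bar> \<le> norm (gradient v x) * norm ((x - c) /\<^sub>R R)" by (rule Cauchy_Schwarz_ineq2)
      also have "\<dots> \<le> norm (gradient v x) * 1" using n by (intro mult_left_mono) auto
      finally have A: "\<bar>v x\<bar> * \<bar>gradient v x \<bullet> ((x - c) /\<^sub>R R)\<bar> \<le> \<bar>v x\<bar> * norm (gradient v x)" by (intro mult_left_mono) auto
      have "v x * (gradient v x \<bullet> ((x - c) /\<^sub>R R)) \<le> \<bar>v x * (gradient v x \<bullet> ((x - c) /\<^sub>R R))\<bar>"
        by (rule abs_ge_self)
      also have "\<dots> \<le> \<bar>v x\<bar> * norm (gradient v x)" unfolding abs_mult by (rule A)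
      finally have "v x * (gradient v x \<bullet> ((x - c) /\<^sub>R R)) \<le> \<bar>v x\<bar> * norm (gradient v x)" .
      moreover have "2 * (\<bar>v x\<bar> * norm (gradient v x)) \<le> (v x)\<^sup>2 + (norm (gradient v x))\<^sup>2"
        using two_mult_le[of "\<bar>v x\<bar>" "norm (gradient v x)" 1] by simp
      moreover have "0 \<le> real ?d / R * (norm (gradient v x))\<^sup>2" using R by simp
      ultimately have "f x \<le> (real ?d / R + 1) * ((v x)\<^sup>2 + (norm (gradient v x))\<^sup>2)"
        unfolding f_def by (simp add: algebra_simps)
      then show ?thesis using True by simp
    qed simp
    show "0 \<le> (real ?d / R + 1) * (indicator ?B x * (norm (v x))\<^sup>2 + indicator ?B x * (norm (gradient v x))\<^sup>2)"
      using R by simp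
  qed
  also have "\<dots> = (real ?d / R + 1) * (L2_norm_sq (lebesgue_on ?B) v + L2_norm_sq (lebesgue_on ?B) (gradient v))"
    using Lv Lg by simp
  finally show ?thesis unfolding eq .
qed

section \<open>Lower bound for the shell\<close>

text \<open>The cubic \<open>3 s\<^sup>2 - 2 s\<^sup>3\<close> increases from \<open>0\<close> to \<open>1\<close> on the unit interval with derivative \<open>6 s (1 - s)\<close>, which
  vanishes at both ends.\<close>

definition step_profile :: "real \<Rightarrow> real \<Rightarrow> real \<Rightarrow> real" where
  "step_profile r1 r2 r = (let s = (r2 - r) / (r2 - r1) in 1 - 2 * (3 * s\<^sup>2 - 2 * s ^ 3))"

lemma step_profile_ends:
  assumes "r1 < r2"
  shows "step_profile r1 r2 r1 = -1" "step_profile r1 r2 r2 = 1"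
  using assms by (simp_all add: step_profile_def)

lemma step_profile_derivative:
  assumes "r1 < r2"
  shows "(step_profile r1 r2 has_real_derivative
    12 * ((r2 - r) / (r2 - r1) * (1 - (r2 - r) / (r2 - r1))) / (r2 - r1)) (at r)"
proof -
  define w where "w = r2 - r1"
  have w: "w \<noteq> 0" using assms by (simp add: w_def)
  have "((\<lambda>r. 1 - 2 * (3 * ((r2 - r) / w)\<^sup>2 - 2 * ((r2 - r) / w) ^ 3)) has_real_derivative
      12 * ((r2 - r) / w * (1 - (r2 - r) / w)) / w) (at r)"
    using w by (auto intro!: derivative_eq_intros simp: field_simps power2_eq_square power3_eq_cube)
  then show ?thesis by (simp add: step_profile_def[abs_def] Let_def w_def)
qed

text \<open>With \<open>y = s (1 - s)\<close>, where \<open>s\<close> runs from \<open>0\<close> at the outer to \<open>1\<close> at the inner sphere, both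
  \<open>p'\<close> and the loss in \<open>p/r \<le> 1/r2\<close> are \<open>O(y)\<close>, while \<open>1 - p\<^sup>2\<close> is at least \<open>12 y\<^sup>2\<close>. So the terms linear
  in \<open>b y\<close> are absorbed by \<open>-12 (b y)\<^sup>2\<close> up to a constant.\<close>

lemma step_profile_riccati:
  assumes r: "0 < r1" "r1 < r2" "r1 \<le> r" "r \<le> r2" and b: "0 \<le> b" and d: "1 \<le> d"
  defines "p \<equiv> step_profile r1 r2" and "w \<equiv> r2 - r1"
  shows "b * (12 * ((r2 - r) / w * (1 - (r2 - r) / w)) / w) + (d - 1) * (b * p r / r) + (b * p r)\<^sup>2
    \<le> b\<^sup>2 + (d - 1) * b / r2 + (12 / w + (d - 1) * (2 * w / (r1 * r2)))\<^sup>2 / 48"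
proof -
  define s where "s = (r2 - r) / w"
  define y where "y = s * (1 - s)"
  have w: "0 < w" using r by (simp add: w_def)
  have s: "0 \<le> s" "s \<le> 1" using r w by (auto simp: s_def w_def)
  have y: "0 \<le> y" using s by (simp add: y_def)
  have p: "p r = 1 - 2 * (3 * s\<^sup>2 - 2 * s ^ 3)" by (simp add: p_def step_profile_def Let_def s_def w_def)
  have rp: "0 < r" "0 < r2" using r by auto
  have psq: "(p r)\<^sup>2 \<le> 1 - 12 * y\<^sup>2"
  proof -
    have "1 - (p r)\<^sup>2 - 12 * y\<^sup>2 = 16 * (y * y * y)"
      unfolding p y_def by (simp add: power2_eq_square power3_eq_cube algebra_simps)
    moreover have "0 \<le> y * y * y" using y by simp
    ultimately show ?thesis by linarith
  qed
  have ple: "p r / r \<le> 1 / r2 + 2 * w / (r1 * r2) * y"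
  proof (cases "s \<le> 1 / 2")
    case True
    have "p r \<le> 1"
    proof -
      have "0 \<le> s\<^sup>2 * (3 - 2 * s)" using s by simp
      then show ?thesis unfolding p by (simp add: algebra_simps power2_eq_square power3_eq_cube)
    qed
    then have "p r / r \<le> 1 / r" using rp by (intro divide_right_mono) auto
    also have "\<dots> = 1 / r2 + w * s / (r * r2)" using rp w by (simp add: s_def field_simps)
    also have "w * s / (r * r2) \<le> w * s / (r1 * r2)"
      using r rp w s by (intro divide_left_mono mult_right_mono mult_nonneg_nonneg) auto
    also have "w * s / (r1 * r2) \<le> w * (2 * y) / (r1 * r2)"
    proof -
      have "s * 1 \<le> s * (2 * (1 - s))" using True s by (intro mult_left_mono) auto
      then have "s \<le> 2 * y" by (simp add: y_def algebra_simps)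
      then show ?thesis using r rp w by (intro divide_right_mono mult_left_mono) auto
    qed
    finally show ?thesis by (simp add: mult_ac)
  next
    case False
    have "p r = (1 - 2 * s) * (1 + 2 * y)"
      unfolding p y_def by (simp add: power2_eq_square power3_eq_cube algebra_simps)
    moreover have "(1 - 2 * s) * (1 + 2 * y) \<le> 0" using False y by (intro mult_nonpos_nonneg) auto
    ultimately have "p r / r \<le> 0" using rp by (simp add: divide_nonpos_pos)
    also have "0 \<le> 1 / r2 + 2 * w / (r1 * r2) * y" using r rp w y by simp
    finally show ?thesis .
  qed
  define K where "K = 12 / w + (d - 1) * (2 * w / (r1 * r2))"
  have "(d - 1) * (b * p r / r) \<le> (d - 1) * b * (1 / r2 + 2 * w / (r1 * r2) * y)"
    using mult_left_mono[OF ple, of "(d - 1) * b"] b d by (simp add: mult.assoc)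
  moreover have "(b * p r)\<^sup>2 \<le> b\<^sup>2 - 12 * (b * y)\<^sup>2"
    using mult_left_mono[OF psq, of "b\<^sup>2"] by (simp add: power_mult_distrib algebra_simps)
  moreover have "K * (b * y) - 12 * (b * y)\<^sup>2 \<le> K\<^sup>2 / 48"
  proof -
    have "0 \<le> 12 * (b * y - K / 24)\<^sup>2" by simp
    then show ?thesis by (simp add: power2_eq_square algebra_simps)
  qed
  moreover have "b * (12 * y / w) + (d - 1) * b * (1 / r2 + 2 * w / (r1 * r2) * y) = (d - 1) * b / r2 + K * (b * y)"
    by (simp add: K_def algebra_simps diff_divide_distrib)
  ultimately have "b * (12 * y / w) + (d - 1) * (b * p r / r) + (b * p r)\<^sup>2 \<le> b\<^sup>2 + (d - 1) * b / r2 + K\<^sup>2 / 48"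
    by linarith
  then show ?thesis unfolding K_def y_def s_def .
qed

text \<open>Integrating the divergence of \<open>v\<^sup>2 V\<close> for \<open>V = b p(r) x/r\<close>, whose normal component on the
  boundary is \<open>b\<close>, and estimating \<open>2 v V \<bullet> \<nabla>v \<le> |V|\<^sup>2 v\<^sup>2 + |\<nabla>v|\<^sup>2\<close>.\<close>

lemma shell_lower_bound:
  fixes v :: "'a::euclidean_space \<Rightarrow> real"
  assumes d: "DIM('a) \<ge> 2" and r: "0 < r1" "r1 < r2" and b: "0 \<le> b" and v: "smooth_on UNIV v"
  defines "w \<equiv> r2 - r1"
  defines "C \<equiv> (12 / w + (real DIM('a) - 1) * (2 * w / (r1 * r2)))\<^sup>2 / 48"
  shows "b * (sphere_integral (\<lambda>x. (v x)\<^sup>2) 0 r1 + sphere_integral (\<lambda>x. (v x)\<^sup>2) 0 r2)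
    \<le> L2_norm_sq (lebesgue_on (spherical_shell r1 r2)) (gradient v)
      + (b\<^sup>2 + (real DIM('a) - 1) * b / r2 + C) * L2_norm_sq (lebesgue_on (spherical_shell r1 r2)) v"
proof -
  let ?d = "DIM('a)" and ?S = "spherical_shell r1 r2 :: 'a set"
  let ?p = "step_profile r1 r2"
  define p' where "p' r = 12 * ((r2 - r) / w * (1 - (r2 - r) / w)) / w" for r
  obtain k where k: "?d = Suc k" using DIM_positive[where 'a='a] not0_implies_Suc by blast
  have vc: "continuous_on UNIV v" and gc: "continuous_on UNIV (gradient v)"
    by (intro smooth_on_continuous continuous_on_gradient v)+
  have dp: "(?p has_real_derivative p' r) (at r)" for r
    unfolding p'_def w_def by (rule step_profile_derivative[OF r(2)])
  have pc: "continuous_on UNIV ?p" using dp by (intro continuous_at_imp_continuous_on) (auto intro: DERIV_isCont)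
  have p'c: "continuous_on UNIV p'" unfolding p'_def using r by (intro continuous_intros) (auto simp: w_def)
  \<comment> \<open>On every ray, \<open>f\<close> is the divergence of \<open>v\<^sup>2 V\<close> and \<open>J\<close> is \<open>r\<^sup>d\<^sup>-\<^sup>1\<close> times the radial component of \<open>v\<^sup>2 V\<close>.\<close>
  define f where "f x = (b * p' (norm x) + real k * (b * ?p (norm x) / norm x)) * (v x)\<^sup>2
      + b * ?p (norm x) * (2 * v x * (gradient v x \<bullet> (x /\<^sub>R norm x)))" for x :: 'a
  define J where "J r \<theta> = r ^ k * (b * ?p r) * (v (0 + r *\<^sub>R \<theta>))\<^sup>2" for r \<theta>
  have A: "{x::'a. r1 < dist 0 x \<and> dist 0 x < r2} = ?S" by (simp add: spherical_shell_def)
  have fc: "continuous_on {x. r1 \<le> dist 0 x \<and> dist 0 x \<le> r2} f"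
    unfolding f_def using r
    by (intro continuous_intros continuous_on_compose2[OF pc] continuous_on_compose2[OF p'c]
        continuous_on_subset[OF vc] continuous_on_subset[OF gc]) auto
  have Jm: "J r \<in> borel_measurable borel" for r
    unfolding J_def by (intro borel_measurable_continuous_onI continuous_intros continuous_on_compose2[OF vc]) auto
  have "(\<integral>x. indicator ?S x * f x \<partial>lborel) = (\<integral>\<theta>. J r2 \<theta> - J r1 \<theta> \<partial>sphere_measure)"
    unfolding A[symmetric]
  proof (rule integral_annulus_by_rays[OF _ _ fc])
    fix \<theta> :: 'a and r assume \<theta>: "norm \<theta> = 1" and rr: "r1 \<le> r" "r \<le> r2"
    let ?x = "0 + r *\<^sub>R \<theta>"
    have r0: "0 < r" using rr r by linarith
    have nx: "norm ?x = r" "?x /\<^sub>R r = \<theta>" using \<theta> r0 by auto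
    have vd: "((\<lambda>r. (v (0 + r *\<^sub>R \<theta>))\<^sup>2) has_real_derivative 2 * v ?x * (gradient v ?x \<bullet> \<theta>)) (at r)"
      using DERIV_power[OF smooth_ray_derivative[OF v, of 0 \<theta> r], of 2] by (simp add: mult_ac)
    have bd: "((\<lambda>r. b * ?p r) has_real_derivative b * p' r) (at r)" by (rule DERIV_cmult[OF dp])
    have "((\<lambda>r. J r \<theta>) has_real_derivative
        (real k * r ^ (k - Suc 0) * (b * ?p r) + b * p' r * r ^ k) * (v ?x)\<^sup>2
          + 2 * v ?x * (gradient v ?x \<bullet> \<theta>) * (r ^ k * (b * ?p r))) (at r)"
      unfolding J_def by (rule DERIV_mult[OF DERIV_mult[OF DERIV_pow bd] vd])
    moreover have "real k * r ^ (k - Suc 0) = r ^ k * (real k / r)"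
      using r0 by (cases k) auto
    ultimately show "((\<lambda>r. J r \<theta>) has_real_derivative r ^ (?d - 1) * f ?x) (at r)"
      unfolding f_def nx by (simp add: k algebra_simps)
  qed (use r Jm in auto)
  also have "\<dots> = b * (sphere_integral (\<lambda>x. (v x)\<^sup>2) 0 r1 + sphere_integral (\<lambda>x. (v x)\<^sup>2) 0 r2)"
  proof -
    have v2: "continuous_on UNIV (\<lambda>x. (v x)\<^sup>2)" by (intro continuous_intros vc)
    have "0 < r2" using r by linarith
    note integral_hausdorff_sphere(3)[OF d r(1) v2, of 0] integral_hausdorff_sphere(3)[OF d this v2, of 0]
    then show ?thesis
      unfolding J_def step_profile_ends[OF r(2)] by (simp add: sphere_integral_def k algebra_simps)
  qed
  finally have eq: "b * (sphere_integral (\<lambda>x. (v x)\<^sup>2) 0 r1 + sphere_integral (\<lambda>x. (v x)\<^sup>2) 0 r2) =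
      (\<integral>x. indicator ?S x * f x \<partial>lborel)" by simp
  define \<mu> where "\<mu> = b\<^sup>2 + (real ?d - 1) * b / r2 + C"
  note Lv = L2_norm_sq_lborel[OF open_spherical_shell bounded_spherical_shell vc, of r1 r2]
    and Lg = L2_norm_sq_lborel[OF open_spherical_shell bounded_spherical_shell gc, of r1 r2]
  have "(\<integral>x. indicator ?S x * f x \<partial>lborel) \<le>
      (\<integral>x. indicator ?S x * (norm (gradient v x))\<^sup>2 + \<mu> * (indicator ?S x * (norm (v x))\<^sup>2) \<partial>lborel)"
  proof (rule integral_mono)
    show "integrable lborel (\<lambda>x. indicator ?S x * f x)" using integrable_annulus[OF fc] unfolding A .
    show "integrable lborel (\<lambda>x. indicator ?S x * (norm (gradient v x))\<^sup>2 + \<mu> * (indicator ?S x * (norm (v x))\<^sup>2))"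
      using Lv(1) Lg(1) by (intro integrable_mult_right Bochner_Integration.integrable_add)
    fix x
    show "indicator ?S x * f x \<le> indicator ?S x * (norm (gradient v x))\<^sup>2 + \<mu> * (indicator ?S x * (norm (v x))\<^sup>2)"
    proof (cases "x \<in> ?S")
      case True
      then have x: "r1 < norm x" "norm x < r2" by (auto simp: spherical_shell_def)
      let ?q = "b * ?p (norm x)" and ?g = "gradient v x \<bullet> (x /\<^sub>R norm x)"
      have "\<bar>?g\<bar> \<le> norm (gradient v x) * norm (x /\<^sub>R norm x)" by (rule Cauchy_Schwarz_ineq2)
      also have "norm (x /\<^sub>R norm x) = 1"
      proof -
        have "x \<noteq> 0" using x r by auto
        then show ?thesis by simp
      qed
      finally have "\<bar>?g\<bar> \<le> \<bar>norm (gradient v x)\<bar>" by simp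
      then have g: "?g\<^sup>2 \<le> (norm (gradient v x))\<^sup>2" by (simp only: abs_le_square_iff)
      have "2 * v x * (?g * ?q) \<le> ?q\<^sup>2 * (v x)\<^sup>2 + ?g\<^sup>2" by (rule two_mult_le)
      then have "?q * (2 * v x * ?g) \<le> ?q\<^sup>2 * (v x)\<^sup>2 + (norm (gradient v x))\<^sup>2" using g by (simp add: mult_ac)
      moreover have "(b * p' (norm x) + real k * (?q / norm x)) * (v x)\<^sup>2 + ?q\<^sup>2 * (v x)\<^sup>2 \<le> \<mu> * (v x)\<^sup>2"
      proof -
        have "b * p' (norm x) + real k * (?q / norm x) + ?q\<^sup>2 \<le> \<mu>"
          using step_profile_riccati[of r1 r2 "norm x" b "real ?d"] r x b
          unfolding p'_def \<mu>_def C_def w_def by (simp add: k)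
        from mult_right_mono[OF this, of "(v x)\<^sup>2"] show ?thesis by (simp add: distrib_right)
      qed
      ultimately have "f x \<le> (norm (gradient v x))\<^sup>2 + \<mu> * (v x)\<^sup>2" unfolding f_def by linarith
      then show ?thesis using True by simp
    qed simp
  qed
  also have "\<dots> = L2_norm_sq (lebesgue_on ?S) (gradient v) + \<mu> * L2_norm_sq (lebesgue_on ?S) v"
    using Lv Lg by simp
  finally show ?thesis unfolding eq \<mu>_def .
qed

section \<open>Upper bound for the ball\<close>

text \<open>The function is \<open>u = exp (b \<rho>)\<close>, and \<open>f\<close> below is \<open>div (u \<nabla>u) = |\<nabla>u|\<^sup>2 + u \<Delta>u\<close>. Its integral is the
  boundary integral of \<open>u \<partial>u/\<partial>n = (b R / \<rho>(R)) u\<^sup>2\<close>, which is at most that of \<open>b u\<^sup>2\<close>, and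
  \<open>\<Delta>u \<ge> m u\<close> pointwise. The shift \<open>1 / b\<^sup>2\<close> is small enough to cost only the term \<open>1 / b\<close> in \<open>m\<close>.\<close>

lemma ball_test_function:
  fixes c :: "'a::euclidean_space"
  assumes d: "DIM('a) \<ge> 2" and R: "0 < R" and b: "1 \<le> b"
  obtains u :: "'a \<Rightarrow> real" where "smooth_on UNIV u" "\<And>x. 0 < u x"
    "L2_norm_sq (lebesgue_on (ball c R)) (gradient u) - b * sphere_integral (\<lambda>x. (u x)\<^sup>2) c R \<le>
      - (b\<^sup>2 + (real DIM('a) - 1 - 1 / b) * b / sqrt (R\<^sup>2 + (1 / b\<^sup>2)\<^sup>2)) * L2_norm_sq (lebesgue_on (ball c R)) u"
proof -
  let ?d = "DIM('a)" and ?B = "ball c R"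
  obtain k where k: "?d = Suc k" using DIM_positive[where 'a='a] not0_implies_Suc by blast
  define e where "e = 1 / b\<^sup>2"
  have e: "0 < e" using b by (simp add: e_def)
  define \<rho> where "\<rho> r = sqrt (r\<^sup>2 + e\<^sup>2)" for r
  have \<rho>2: "(\<rho> r)\<^sup>2 = r\<^sup>2 + e\<^sup>2" for r by (simp add: \<rho>_def)
  have \<rho>e: "e \<le> \<rho> r" for r unfolding \<rho>_def using e by (intro real_le_rsqrt) simp
  have \<rho>0: "0 < \<rho> r" for r using \<rho>e[of r] e by linarith
  have d\<rho>: "(\<rho> has_real_derivative r / \<rho> r) (at r)" for r
  proof -
    have "0 < r\<^sup>2 + e\<^sup>2" using e by (intro add_nonneg_pos) auto
    then show ?thesis
      unfolding \<rho>_def [abs_def] by (auto intro!: derivative_eq_intros simp: field_simps)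
  qed
  have \<rho>c: "continuous_on UNIV \<rho>" using d\<rho> by (intro continuous_at_imp_continuous_on) (auto intro: DERIV_isCont)
  define U where "U r = exp (b * \<rho> r)" for r
  define u where "u x = U (norm (x - c))" for x
  have us: "smooth_on UNIV u"
  proof -
    have q: "smooth_on UNIV (\<lambda>x. (norm (x - c))\<^sup>2 + e\<^sup>2)"
      by (intro smooth_on_add smooth_on_norm_sq smooth_on_const) auto
    have "smooth_on UNIV (\<lambda>x. sqrt ((norm (x - c))\<^sup>2 + e\<^sup>2))"
      using e by (intro smooth_on_compose_real[OF _ _ _ smooth_on_sqrt q]) (auto intro: add_nonneg_pos)
    then have "smooth_on UNIV (\<lambda>x. b * sqrt ((norm (x - c))\<^sup>2 + e\<^sup>2))"
      by (intro smooth_on_mult smooth_on_const) auto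
    then have "smooth_on UNIV (\<lambda>x. exp (b * sqrt ((norm (x - c))\<^sup>2 + e\<^sup>2)))"
      by (intro smooth_on_compose_real[OF _ _ _ smooth_on_exp]) auto
    then show ?thesis by (simp add: u_def[abs_def] U_def \<rho>_def)
  qed
  have gu: "gradient u x = (u x * b / \<rho> (norm (x - c))) *\<^sub>R (x - c)" for x
  proof -
    let ?\<rho> = "\<rho> (norm (x - c))"
    have q0: "0 < (x - c) \<bullet> (x - c) + e\<^sup>2" using e by (intro add_nonneg_pos) auto
    have q: "sqrt ((x - c) \<bullet> (x - c) + e\<^sup>2) = \<rho> (norm (x - c))" for x
      by (simp add: \<rho>_def power2_norm_eq_inner)
    have ue: "u = (\<lambda>x. exp (b * sqrt ((x - c) \<bullet> (x - c) + e\<^sup>2)))" by (simp add: u_def[abs_def] U_def q)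
    have "((\<lambda>x. (x - c) \<bullet> (x - c) + e\<^sup>2) has_derivative (\<lambda>h. 2 * ((x - c) \<bullet> h))) (at x)"
      by (auto intro!: derivative_eq_intros simp: inner_commute)
    from has_derivative_compose[OF this DERIV_real_sqrt[OF q0, THEN has_field_derivative_imp_has_derivative]]
    have "((\<lambda>x. sqrt ((x - c) \<bullet> (x - c) + e\<^sup>2)) has_derivative (\<lambda>h. inverse ?\<rho> / 2 * (2 * ((x - c) \<bullet> h)))) (at x)"
      unfolding q .
    from has_derivative_exp[OF has_derivative_mult_right[OF this, of b]]
    have "(u has_derivative (\<lambda>h. (u x * b / ?\<rho>) * ((x - c) \<bullet> h))) (at x)"
      unfolding ue q[symmetric] by (simp add: field_simps)
    then have "frechet_derivative u (at x) = (\<lambda>h. (u x * b / ?\<rho>) * ((x - c) \<bullet> h))"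
      by (simp only: frechet_derivative_at[symmetric])
    then have "gradient u x = (\<Sum>i\<in>Basis. ((u x * b / ?\<rho>) *\<^sub>R (x - c) \<bullet> i) *\<^sub>R i)" by (simp add: gradient_def)
    then show ?thesis by (simp only: euclidean_representation)
  qed
  define f where "f r = (real ?d * b / \<rho> r - b * r\<^sup>2 / \<rho> r ^ 3 + 2 * b\<^sup>2 * r\<^sup>2 / (\<rho> r)\<^sup>2) * (U r)\<^sup>2" for r
  define J where "J r = r ^ ?d * (b / \<rho> r * (U r)\<^sup>2)" for r
  have Uc: "continuous_on UNIV U" unfolding U_def by (intro continuous_intros \<rho>c)
  have fc: "continuous_on UNIV f"
    unfolding f_def using \<rho>0 by (intro continuous_intros \<rho>c Uc) (auto simp: less_imp_neq[symmetric])
  have fdc: "continuous_on UNIV (\<lambda>x. f (dist c x))" by (intro continuous_on_compose2[OF fc] continuous_intros) auto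
  have dJ: "(J has_real_derivative r ^ k * f r) (at r)" for r
  proof -
    have \<rho>n: "\<rho> r \<noteq> 0" using \<rho>0[of r] by simp
    have dU: "(U has_real_derivative U r * (b * (r / \<rho> r))) (at r)"
      unfolding U_def by (rule DERIV_fun_exp[OF DERIV_cmult[OF d\<rho>]])
    have dU2: "((\<lambda>r. (U r)\<^sup>2) has_real_derivative 2 * U r * (U r * (b * (r / \<rho> r)))) (at r)"
      using DERIV_power[OF dU, of 2] by (simp add: mult_ac)
    have d1: "((\<lambda>r. b / \<rho> r) has_real_derivative - (b * (r / \<rho> r)) / (\<rho> r * \<rho> r)) (at r)"
      using DERIV_divide[OF DERIV_const d\<rho> \<rho>n, of b] by simp
    have dp: "((\<lambda>r. r ^ Suc k) has_real_derivative real (Suc k) * r ^ k) (at r)"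
      using DERIV_pow[of "Suc k" r] by simp
    have "(J has_real_derivative real (Suc k) * r ^ k * (b / \<rho> r * (U r)\<^sup>2) +
        (- (b * (r / \<rho> r)) / (\<rho> r * \<rho> r) * (U r)\<^sup>2 + 2 * U r * (U r * (b * (r / \<rho> r))) * (b / \<rho> r)) * r ^ Suc k) (at r)"
      unfolding J_def k by (rule DERIV_mult[OF dp DERIV_mult[OF d1 dU2]])
    moreover have "real (Suc k) * r ^ k * (b / \<rho> r * (U r)\<^sup>2) +
        (- (b * (r / \<rho> r)) / (\<rho> r * \<rho> r) * (U r)\<^sup>2 + 2 * U r * (U r * (b * (r / \<rho> r))) * (b / \<rho> r)) * r ^ Suc k
        = r ^ k * f r"
      using \<rho>n unfolding f_def k by (simp add: field_simps power2_eq_square power3_eq_cube)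
    ultimately show ?thesis by simp
  qed
  interpret S: finite_measure "sphere_measure :: 'a measure" by (rule finite_measure_sphere_measure)
  define \<sigma> where "\<sigma> = measure (sphere_measure :: 'a measure) UNIV"
  have "(\<integral>x. indicator ?B x * f (dist c x) \<partial>lborel) = (\<integral>\<theta>. J R - J 0 \<partial>(sphere_measure :: 'a measure))"
  proof (rule integral_ball_by_rays[where J="\<lambda>r \<theta>. J r", OF _ fdc])
    fix \<theta> :: 'a and r assume "norm \<theta> = 1" "0 \<le> r" "r \<le> R"
    then show "(J has_real_derivative r ^ (?d - 1) * f (dist c (c + r *\<^sub>R \<theta>))) (at r)"
      using dJ[of r] by (simp add: k dist_norm)
  qed (use R in auto)
  also have "\<dots> = \<sigma> * J R" by (simp add: \<sigma>_def J_def k)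
  finally have eq: "(\<integral>x. indicator ?B x * f (dist c x) \<partial>lborel) = \<sigma> * J R" .
  have \<sigma>0: "0 \<le> \<sigma>" by (simp add: \<sigma>_def)
  have si: "sphere_integral (\<lambda>x. (u x)\<^sup>2) c R = R ^ k * (\<sigma> * (U R)\<^sup>2)"
  proof -
    have "(\<integral>\<theta>. (u (c + R *\<^sub>R \<theta>))\<^sup>2 \<partial>(sphere_measure :: 'a measure)) = (\<integral>\<theta>. (U R)\<^sup>2 \<partial>(sphere_measure :: 'a measure))"
    proof (rule integral_cong_AE)
      have "continuous_on UNIV (\<lambda>\<theta>. (u (c + R *\<^sub>R \<theta>))\<^sup>2)"
        by (intro continuous_intros continuous_on_compose2[OF smooth_on_continuous[OF us]]) auto
      then show "(\<lambda>\<theta>. (u (c + R *\<^sub>R \<theta>))\<^sup>2) \<in> borel_measurable sphere_measure"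
        using borel_measurable_continuous_onI by (simp cong: measurable_cong_sets)
      show "AE \<theta> in sphere_measure. (u (c + R *\<^sub>R \<theta>))\<^sup>2 = (U R)\<^sup>2"
        using AE_sphere_measure by eventually_elim (use R in \<open>simp add: u_def\<close>)
    qed simp
    then show ?thesis by (simp add: sphere_integral_def k \<sigma>_def)
  qed
  have "R \<le> \<rho> R" unfolding \<rho>_def using R by (intro real_le_rsqrt) simp
  then have "\<sigma> * J R \<le> b * sphere_integral (\<lambda>x. (u x)\<^sup>2) c R"
  proof -
    have "R ^ ?d * (b / \<rho> R) \<le> R ^ k * b"
    proof -
      have "R / \<rho> R \<le> 1" using \<open>R \<le> \<rho> R\<close> \<rho>0[of R] by simp
      then have "(R ^ k * b) * (R / \<rho> R) \<le> (R ^ k * b) * 1" using R b by (intro mult_left_mono) auto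
      then show ?thesis by (simp add: k mult_ac)
    qed
    then have "(\<sigma> * (U R)\<^sup>2) * (R ^ ?d * (b / \<rho> R)) \<le> (\<sigma> * (U R)\<^sup>2) * (R ^ k * b)" using \<sigma>0 by (intro mult_left_mono) auto
    then show ?thesis unfolding si J_def by (simp add: mult_ac)
  qed
  then have bd: "(\<integral>x. indicator ?B x * f (dist c x) \<partial>lborel) \<le> b * sphere_integral (\<lambda>x. (u x)\<^sup>2) c R" unfolding eq .
  have uc: "continuous_on UNIV u" and gc: "continuous_on UNIV (gradient u)"
    by (intro smooth_on_continuous continuous_on_gradient us)+
  note Lu = L2_norm_sq_lborel[OF open_ball bounded_ball uc, of c R] and Lg = L2_norm_sq_lborel[OF open_ball bounded_ball gc, of c R]
  define m where "m = b\<^sup>2 + (real ?d - 1 - 1 / b) * b / \<rho> R"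
  have pt: "(norm (gradient u x))\<^sup>2 + m * (u x)\<^sup>2 \<le> f (dist c x)" if x: "x \<in> ?B" for x
  proof -
    define r where "r = norm (x - c)"
    have rd: "dist c x = r" by (simp add: r_def dist_norm norm_minus_commute)
    have r: "0 \<le> r" "r \<le> R" using x rd by (auto simp: r_def)
    have ux: "u x = U r" by (simp add: u_def r_def)
    have ng: "(norm (gradient u x))\<^sup>2 = b\<^sup>2 * r\<^sup>2 / (\<rho> r)\<^sup>2 * (U r)\<^sup>2"
      unfolding gu by (simp add: r_def[symmetric] ux power_mult_distrib power_divide mult_ac)
    have fr: "f r = b\<^sup>2 * r\<^sup>2 / (\<rho> r)\<^sup>2 * (U r)\<^sup>2 + (real ?d * b / \<rho> r - b * r\<^sup>2 / \<rho> r ^ 3 + b\<^sup>2 * r\<^sup>2 / (\<rho> r)\<^sup>2) * (U r)\<^sup>2"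
      unfolding f_def by (simp add: algebra_simps)
    have "m \<le> real ?d * b / \<rho> r - b * r\<^sup>2 / \<rho> r ^ 3 + b\<^sup>2 * r\<^sup>2 / (\<rho> r)\<^sup>2"
    proof -
      define t where "t = \<rho> r"
      have t: "0 < t" "e \<le> t" "t \<le> \<rho> R"
        using \<rho>0 \<rho>e r unfolding t_def by (auto simp: \<rho>_def power_mono)
      have rt: "r\<^sup>2 = t\<^sup>2 - e\<^sup>2" using \<rho>2[of r] by (simp add: t_def)
      have "b * r\<^sup>2 / t ^ 3 = b / t - b * e\<^sup>2 / t ^ 3" "b\<^sup>2 * r\<^sup>2 / t\<^sup>2 = b\<^sup>2 - b\<^sup>2 * e\<^sup>2 / t\<^sup>2"
        unfolding rt using t by (simp_all add: field_simps power2_eq_square power3_eq_cube)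
      moreover have "b\<^sup>2 * e\<^sup>2 / t\<^sup>2 \<le> (1 / b) * b / t"
      proof -
        have "b\<^sup>2 * e\<^sup>2 / t\<^sup>2 = e / t / t" using b by (simp add: e_def power2_eq_square field_simps)
        also have "\<dots> \<le> 1 / t" using t e by (intro divide_right_mono) auto
        finally show ?thesis using b by simp
      qed
      moreover have "0 \<le> b * e\<^sup>2 / t ^ 3" using b t by simp
      moreover have "(real ?d - 1 - 1 / b) * b / \<rho> R \<le> (real ?d - 1 - 1 / b) * b / t"
      proof (rule divide_left_mono)
        have "1 / b \<le> 1" using b by simp
        moreover have "2 \<le> real ?d" using d by simp
          ultimately show "0 \<le> (real ?d - 1 - 1 / b) * b" using b by (intro mult_nonneg_nonneg) linarith+
      qed (use t \<rho>0 in auto)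
      moreover have "(real ?d - 1 - 1 / b) * b / t = real ?d * b / t - b / t - (1 / b) * b / t"
        by (simp add: left_diff_distrib diff_divide_distrib)
      ultimately show ?thesis unfolding m_def t_def[symmetric] by linarith
    qed
    from mult_right_mono[OF this, of "(U r)\<^sup>2"] show ?thesis unfolding ng rd fr ux by simp
  qed
  have fi: "integrable lborel (\<lambda>x. indicator ?B x * f (dist c x))"
  proof -
    have "integrable lborel (\<lambda>x. indicator {x. -1 < dist c x \<and> dist c x < R} x * f (dist c x))"
      by (rule integrable_annulus[OF continuous_on_subset[OF fdc]]) simp
    moreover have "{x. -1 < dist c x \<and> dist c x < R} = ?B" by (auto intro: less_le_trans[OF _ zero_le_dist])
    ultimately show ?thesis by simp
  qed
  have "L2_norm_sq (lebesgue_on ?B) (gradient u) + m * L2_norm_sq (lebesgue_on ?B) u =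
      (\<integral>x. indicator ?B x * (norm (gradient u x))\<^sup>2 + m * (indicator ?B x * (norm (u x))\<^sup>2) \<partial>lborel)"
    using Lu Lg by simp
  also have "\<dots> \<le> (\<integral>x. indicator ?B x * f (dist c x) \<partial>lborel)"
  proof (rule integral_mono[OF _ fi])
    show "integrable lborel (\<lambda>x. indicator ?B x * (norm (gradient u x))\<^sup>2 + m * (indicator ?B x * (norm (u x))\<^sup>2))"
      using Lu(1) Lg(1) by (intro integrable_mult_right Bochner_Integration.integrable_add)
    show "indicator ?B x * (norm (gradient u x))\<^sup>2 + m * (indicator ?B x * (norm (u x))\<^sup>2) \<le> indicator ?B x * f (dist c x)" for x
      using pt[of x] by (cases "x \<in> ?B") auto
  qed
  finally have "L2_norm_sq (lebesgue_on ?B) (gradient u) - b * sphere_integral (\<lambda>x. (u x)\<^sup>2) c R \<le> - m * L2_norm_sq (lebesgue_on ?B) u"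
    using bd by simp
  then show thesis
    using that[OF us] by (simp add: u_def U_def m_def \<rho>_def e_def)
qed

section \<open>The spherical shell as a domain\<close>

text \<open>In the orthogonal coordinates with axis \<open>e\<close> through \<open>x\<close>, points close to \<open>x\<close> have positive height
  \<open>t = y \<bullet> e\<close>, and then comparing \<open>t\<close> with the square root amounts to comparing
  \<open>|y|\<^sup>2 = |y - t e|\<^sup>2 + t\<^sup>2\<close> with \<open>\<rho>\<^sup>2\<close>.\<close>

lemma half_sphere_graph:
  fixes x y :: "'a::euclidean_space"
  assumes \<rho>: "0 < \<rho>" "norm x = \<rho>" and y: "y \<in> ball x \<rho>"
  defines "e \<equiv> x /\<^sub>R \<rho>"
  shows "sqrt (\<rho>\<^sup>2 - (norm (y - (y \<bullet> e) *\<^sub>R e))\<^sup>2) < y \<bullet> e \<longleftrightarrow> \<rho> < norm y"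
    and "y \<bullet> e < sqrt (\<rho>\<^sup>2 - (norm (y - (y \<bullet> e) *\<^sub>R e))\<^sup>2) \<longleftrightarrow> norm y < \<rho>"
proof -
  define t where "t = y \<bullet> e"
  define z where "z = y - t *\<^sub>R e"
  have e: "norm e = 1" using \<rho> by (simp add: e_def)
  have xe: "x \<bullet> e = \<rho>" using \<rho> by (simp add: e_def power2_norm_eq_inner[symmetric] power2_eq_square)
  have "\<rho> - t = (x - y) \<bullet> e" by (simp add: inner_diff_left xe t_def)
  also have "\<dots> \<le> norm (x - y) * norm e" by (rule norm_cauchy_schwarz)
  also have "\<dots> < \<rho>" using y e by (simp add: dist_norm)
  finally have t: "0 < t" by simp
  have ee: "e \<bullet> e = 1" using e by (simp add: norm_eq_sqrt_inner)
  have "(norm z)\<^sup>2 = (norm y)\<^sup>2 - t\<^sup>2"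
    unfolding power2_norm_eq_inner z_def
    by (simp add: inner_diff_left inner_diff_right ee t_def[symmetric] inner_commute[of e y] power2_eq_square)
  then have q: "\<rho>\<^sup>2 - (norm z)\<^sup>2 < t\<^sup>2 \<longleftrightarrow> \<rho>\<^sup>2 < (norm y)\<^sup>2" "t\<^sup>2 < \<rho>\<^sup>2 - (norm z)\<^sup>2 \<longleftrightarrow> (norm y)\<^sup>2 < \<rho>\<^sup>2" by auto
  have sq: "a\<^sup>2 < b\<^sup>2 \<longleftrightarrow> a < b" if "0 \<le> a" "0 \<le> b" for a b :: real
    using that by (metis power2_less_imp_less power_strict_mono pos2)
  have st: "sqrt (t\<^sup>2) = t" using t by simp
  show "sqrt (\<rho>\<^sup>2 - (norm (y - (y \<bullet> e) *\<^sub>R e))\<^sup>2) < y \<bullet> e \<longleftrightarrow> \<rho> < norm y"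
    unfolding t_def[symmetric] z_def[symmetric]
    using q(1) sq[of \<rho> "norm y"] \<rho>(1) real_sqrt_less_iff[of "\<rho>\<^sup>2 - (norm z)\<^sup>2" "t\<^sup>2"] st by simp
  show "y \<bullet> e < sqrt (\<rho>\<^sup>2 - (norm (y - (y \<bullet> e) *\<^sub>R e))\<^sup>2) \<longleftrightarrow> norm y < \<rho>"
    unfolding t_def[symmetric] z_def[symmetric]
    using q(2) sq[of "norm y" \<rho>] \<rho>(1) real_sqrt_less_iff[of "t\<^sup>2" "\<rho>\<^sup>2 - (norm z)\<^sup>2"] st by simp
qed

lemma smooth_on_half_sphere:
  assumes "0 < \<rho>" "\<delta> \<le> \<rho>"
  shows "smooth_on (ball 0 \<delta>) (\<lambda>z::'a::euclidean_space. sqrt (\<rho>\<^sup>2 - (norm z)\<^sup>2))"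
proof (rule smooth_on_compose_real[where T="{0<..}", OF _ _ _ smooth_on_sqrt])
  show "(\<lambda>z. \<rho>\<^sup>2 - (norm z)\<^sup>2) ` ball (0::'a) \<delta> \<subseteq> {0<..}"
  proof (rule image_subsetI)
    fix z :: 'a assume "z \<in> ball 0 \<delta>"
    then have "norm z < \<rho>" using assms by simp
    then have "(norm z)\<^sup>2 < \<rho>\<^sup>2" by (intro power_strict_mono) auto
    then show "\<rho>\<^sup>2 - (norm z)\<^sup>2 \<in> {0<..}" by simp
  qed
  show "smooth_on (ball 0 \<delta>) (\<lambda>z::'a. \<rho>\<^sup>2 - (norm z)\<^sup>2)"
    using smooth_on_norm_sq[of "ball (0::'a) \<delta>" 0] by (intro smooth_on_diff smooth_on_const) auto
qed auto

text \<open>Near the inner sphere the domain lies above the graph of a half sphere in the outward direction. At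
  the outer sphere the axis points inwards and the graph function is the lower half sphere.\<close>

lemma bounded_smooth_domain_spherical_shell:
  assumes d: "DIM('a::euclidean_space) \<ge> 2" and r: "0 < r1" "r1 < r2"
  shows "bounded_smooth_domain (spherical_shell r1 r2 :: 'a set)"
  unfolding bounded_smooth_domain_def
proof (intro conjI ballI)
  let ?S = "spherical_shell r1 r2 :: 'a set"
  show "open ?S" "bounded ?S" by (rule open_spherical_shell bounded_spherical_shell)+
  show "connected ?S" using connected_annulus(1)[OF d, of r1 0 r2] by (simp add: spherical_shell_def)
  obtain b :: 'a where "b \<in> Basis" using nonempty_Basis by blast
  then have "((r1 + r2) / 2) *\<^sub>R b \<in> ?S" using r by (simp add: spherical_shell_def)
  then show "?S \<noteq> {}" by blast
  fix x :: 'a assume x: "x \<in> frontier ?S"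
  have diff: "\<bar>norm y - norm x\<bar> < \<delta>" if "y \<in> ball x \<delta>" for y \<delta>
    using that norm_triangle_ineq3[of y x] by (simp add: dist_norm norm_minus_commute)
  define \<delta> where "\<delta> = min r1 (r2 - r1)"
  have \<delta>: "0 < \<delta>" "\<delta> \<le> r1" "\<delta> \<le> r2" "r1 + \<delta> \<le> r2" using r by (auto simp: \<delta>_def)
  have r2: "0 < r2" using r by linarith
  have centre: "x - (x \<bullet> (x /\<^sub>R \<rho>)) *\<^sub>R (x /\<^sub>R \<rho>) = 0" if "norm x = \<rho>" "0 < \<rho>" for \<rho>
  proof -
    have "x \<bullet> (x /\<^sub>R \<rho>) = \<rho>" using that by (simp add: power2_norm_eq_inner[symmetric] power2_eq_square)
    then show ?thesis using that by simp
  qed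
  consider "norm x = r1" | "norm x = r2" using x unfolding frontier_spherical_shell[OF r] by auto
  then show "\<exists>r>0. \<exists>e \<gamma>. norm e = 1 \<and> smooth_on (ball (x - (x \<bullet> e) *\<^sub>R e) r) \<gamma> \<and>
      ?S \<inter> ball x r = {y \<in> ball x r. \<gamma> (y - (y \<bullet> e) *\<^sub>R e) < y \<bullet> e}"
  proof cases
    case 1
    let ?e = "x /\<^sub>R r1" and ?\<gamma> = "\<lambda>z::'a. sqrt (r1\<^sup>2 - (norm z)\<^sup>2)"
    have "y \<in> ?S \<longleftrightarrow> ?\<gamma> (y - (y \<bullet> ?e) *\<^sub>R ?e) < y \<bullet> ?e" if y: "y \<in> ball x \<delta>" for y
    proof -
      have "y \<in> ball x r1" using y \<delta> by auto
      note half_sphere_graph(1)[OF r(1) 1 this]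
      moreover have "norm y < r2" using diff[OF y] 1 \<delta> by linarith
      ultimately show ?thesis by (simp add: spherical_shell_def)
    qed
    then have "?S \<inter> ball x \<delta> = {y \<in> ball x \<delta>. ?\<gamma> (y - (y \<bullet> ?e) *\<^sub>R ?e) < y \<bullet> ?e}" by blast
    moreover have "smooth_on (ball (x - (x \<bullet> ?e) *\<^sub>R ?e) \<delta>) ?\<gamma>"
      unfolding centre[OF 1 r(1)] by (rule smooth_on_half_sphere[OF r(1) \<delta>(2)])
    moreover have "norm ?e = 1" using 1 r by simp
    ultimately show ?thesis using \<delta>(1) by blast
  next
    case 2
    let ?e = "x /\<^sub>R r2" and ?\<gamma> = "\<lambda>z::'a. - sqrt (r2\<^sup>2 - (norm z)\<^sup>2)"
    have flip: "(y \<bullet> (- ?e)) *\<^sub>R (- ?e) = (y \<bullet> ?e) *\<^sub>R ?e" for y by simp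
    have "y \<in> ?S \<longleftrightarrow> ?\<gamma> (y - (y \<bullet> (- ?e)) *\<^sub>R (- ?e)) < y \<bullet> (- ?e)" if y: "y \<in> ball x \<delta>" for y
    proof -
      have "y \<in> ball x r2" using y \<delta> by auto
      note half_sphere_graph(2)[OF r2 2 this]
      moreover have "r1 < norm y" using diff[OF y] 2 \<delta> by linarith
      ultimately show ?thesis unfolding flip inner_minus_right by (simp add: spherical_shell_def)
    qed
    then have "?S \<inter> ball x \<delta> = {y \<in> ball x \<delta>. ?\<gamma> (y - (y \<bullet> (- ?e)) *\<^sub>R (- ?e)) < y \<bullet> (- ?e)}" by blast
    moreover have "smooth_on (ball (x - (x \<bullet> (- ?e)) *\<^sub>R (- ?e)) \<delta>) ?\<gamma>"
    proof -
      have "smooth_on (ball 0 \<delta>) (\<lambda>z::'a. (-1) * sqrt (r2\<^sup>2 - (norm z)\<^sup>2))"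
        by (intro smooth_on_mult smooth_on_const smooth_on_half_sphere r2 \<delta>) auto
      then show ?thesis unfolding flip centre[OF 2 r2] by simp
    qed
    moreover have "norm (- ?e) = 1" using 2 r by simp
    ultimately show ?thesis using \<delta>(1) by blast
  qed
qed

lemma measure_spherical_shell:
  assumes "0 < r1" "r1 < r2"
  shows "measure lebesgue (spherical_shell r1 r2 :: 'a::euclidean_space set) =
    unit_ball_vol (real DIM('a)) * (r2 ^ DIM('a) - r1 ^ DIM('a))"
proof -
  have "spherical_shell r1 r2 = ball (0::'a) r2 - cball 0 r1" by (auto simp: spherical_shell_def)
  moreover have "measure lebesgue (ball (0::'a) r2 - cball 0 r1) = measure lebesgue (ball (0::'a) r2) - measure lebesgue (cball (0::'a) r1)"
    using assms by (intro measurable_measure_Diff) auto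
  moreover have "measure lebesgue (ball (0::'a) r2) = unit_ball_vol (real DIM('a)) * r2 ^ DIM('a)"
    "measure lebesgue (cball (0::'a) r1) = unit_ball_vol (real DIM('a)) * r1 ^ DIM('a)"
    using assms content_ball[of r2 "0::'a"] content_cball[of r1 "0::'a"] by simp_all
  ultimately show ?thesis by (simp add: algebra_simps)
qed

lemma measure_ball:
  fixes c :: "'a::euclidean_space"
  assumes "0 < R"
  shows "measure lebesgue (ball c R) = unit_ball_vol (real DIM('a)) * R ^ DIM('a)"
  using assms content_ball[of R c] by simp

text \<open>The field points along \<open>x\<close> inside the sphere of radius \<open>sqrt m\<close> and against it outside. Near either
  boundary sphere its radial component has modulus at least \<open>1\<close>, which compensates the radius
  \<open>\<epsilon>\<close> of the ball; elsewhere the distance to the boundary is bounded below.\<close>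

lemma shell_inward_field:
  assumes r: "0 < r1" "r1 < r2"
  obtains \<psi> :: "'a::euclidean_space \<Rightarrow> 'a" and \<epsilon>0 :: real
  where "\<And>b. b \<in> Basis \<Longrightarrow> smooth_on UNIV (\<lambda>x. \<psi> x \<bullet> b)" "0 < \<epsilon>0"
    "\<And>\<epsilon> x. 0 < \<epsilon> \<Longrightarrow> \<epsilon> < \<epsilon>0 \<Longrightarrow> x \<in> spherical_shell r1 r2 \<Longrightarrow>
      cball (x + \<epsilon> *\<^sub>R \<psi> x) \<epsilon> \<subseteq> spherical_shell r1 r2"
proof -
  define m where "m = (r1\<^sup>2 + r2\<^sup>2) / 2"
  define D where "D = (r2\<^sup>2 - r1\<^sup>2) / 4"
  \<comment> \<open>\<open>K\<close> normalises the radial component to at least \<open>1\<close> where \<open>|s\<^sup>2 - m| \<ge> D\<close>; \<open>p1\<close> and \<open>p2\<close> are the radii at which this starts.\<close>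
  define K where "K = 1 / (r1 * D)"
  define p1 where "p1 = sqrt (m - D)"
  define p2 where "p2 = sqrt (m + D)"
  have r12: "r1\<^sup>2 < r2\<^sup>2" using r by (intro power_strict_mono) auto
  have D: "0 < D" using r12 by (simp add: D_def)
  have K: "0 < K" using r D by (simp add: K_def)
  have p1: "r1 < p1" unfolding p1_def by (rule real_less_rsqrt) (use r12 in \<open>simp add: m_def D_def field_simps\<close>)
  have p2: "p2 < r2" unfolding p2_def by (rule real_less_lsqrt) (use r r12 in \<open>auto simp: m_def D_def field_simps\<close>)
  define L where "L = K * (r2 * r2\<^sup>2)"
  have L: "0 \<le> L" using K r by (simp add: L_def)
  define \<epsilon>0 where "\<epsilon>0 = min (r2 - p2) (p1 - r1) / (L + 1)"
  have \<epsilon>0: "0 < \<epsilon>0" using p1 p2 L by (simp add: \<epsilon>0_def)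
  define \<psi> :: "'a \<Rightarrow> 'a" where "\<psi> x = (K * (m - (norm x)\<^sup>2)) *\<^sub>R x" for x
  have radial: "r1 + \<epsilon> < s + \<epsilon> * (K * (s * (m - s\<^sup>2))) \<and> s + \<epsilon> * (K * (s * (m - s\<^sup>2))) < r2 - \<epsilon>"
    if \<epsilon>: "0 < \<epsilon>" "\<epsilon> < \<epsilon>0" and s: "r1 < s" "s < r2" for \<epsilon> s
  proof -
    let ?h = "K * (s * (m - s\<^sup>2))"
    have "\<epsilon> * (L + 1) < \<epsilon>0 * (L + 1)" using \<epsilon> L by (intro mult_strict_right_mono) auto
    also have "\<dots> = min (r2 - p2) (p1 - r1)" using L by (simp add: \<epsilon>0_def)
    finally have small: "\<epsilon> * L + \<epsilon> < r2 - p2" "\<epsilon> * L + \<epsilon> < p1 - r1" by (auto simp: algebra_simps)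
    have s2: "r1\<^sup>2 < s\<^sup>2" "s\<^sup>2 < r2\<^sup>2" using s r by (auto intro!: power_strict_mono)
    have KrD: "K * (r1 * D) = 1" using r D by (simp add: K_def)
    have "\<bar>m - s\<^sup>2\<bar> \<le> r2\<^sup>2"
    proof -
      have "0 \<le> m" "m \<le> r2\<^sup>2" using r12 by (auto simp: m_def)
      then show ?thesis using s2 by (smt (verit) zero_le_power2)
    qed
    then have "\<bar>s * (m - s\<^sup>2)\<bar> \<le> r2 * r2\<^sup>2" unfolding abs_mult using s r by (intro mult_mono) auto
    then have "\<bar>?h\<bar> \<le> L" unfolding L_def using K by (simp add: abs_mult)
    then have "\<epsilon> * \<bar>?h\<bar> \<le> \<epsilon> * L" using \<epsilon> by (intro mult_left_mono) auto
    then have hb: "\<bar>\<epsilon> * ?h\<bar> \<le> \<epsilon> * L" using \<epsilon> by (simp add: abs_mult)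
    have lower: "r1 + \<epsilon> < s + \<epsilon> * ?h"
    proof (cases "s\<^sup>2 \<le> m - D")
      case True
      have "r1 * D \<le> s * (m - s\<^sup>2)" using True D s r by (intro mult_mono) auto
      then have "1 \<le> ?h" using K KrD mult_left_mono[of "r1 * D" "s * (m - s\<^sup>2)" K] by simp
      then have "\<epsilon> \<le> \<epsilon> * ?h" using \<epsilon> mult_left_mono[of 1 ?h \<epsilon>] by simp
      then show ?thesis using s by linarith
    next
      case False
      then have "p1 < s" unfolding p1_def using s r by (intro real_less_lsqrt) auto
      then show ?thesis using small hb by linarith
    qed
    have upper: "s + \<epsilon> * ?h < r2 - \<epsilon>"
    proof (cases "m + D \<le> s\<^sup>2")
      case True
      have "r1 * D \<le> s * (s\<^sup>2 - m)" using True D s r by (intro mult_mono) auto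
      then have "1 \<le> K * (s * (s\<^sup>2 - m))" using K KrD mult_left_mono[of "r1 * D" "s * (s\<^sup>2 - m)" K] by simp
      then have "\<epsilon> \<le> \<epsilon> * (K * (s * (s\<^sup>2 - m)))" using \<epsilon> mult_left_mono[of 1 "K * (s * (s\<^sup>2 - m))" \<epsilon>] by simp
      moreover have "\<epsilon> * (K * (s * (s\<^sup>2 - m))) = - (\<epsilon> * ?h)" by (simp add: algebra_simps)
      ultimately show ?thesis using s by linarith
    next
      case False
      then have "s < p2" unfolding p2_def by (intro real_less_rsqrt) auto
      then show ?thesis using small hb by linarith
    qed
    show ?thesis using lower upper by blast
  qed
  show thesis
  proof (rule that[of \<psi> \<epsilon>0])
    fix b :: 'a assume "b \<in> Basis"
    have "smooth_on UNIV (\<lambda>x::'a. (K * (m - (norm x)\<^sup>2)) * (x \<bullet> b))"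
      using smooth_on_norm_sq[of "UNIV :: 'a set" 0]
      by (intro smooth_on_mult smooth_on_diff smooth_on_const smooth_on_inner) auto
    then show "smooth_on UNIV (\<lambda>x. \<psi> x \<bullet> b)" by (simp add: \<psi>_def)
  next
    fix \<epsilon> and x :: 'a assume \<epsilon>: "0 < \<epsilon>" "\<epsilon> < \<epsilon>0" and "x \<in> spherical_shell r1 r2"
    then have x: "r1 < norm x" "norm x < r2" by (auto simp: spherical_shell_def)
    define y where "y = x + \<epsilon> *\<^sub>R \<psi> x"
    define q where "q = 1 + \<epsilon> * (K * (m - (norm x)\<^sup>2))"
    have "q * norm x = norm x + \<epsilon> * (K * (norm x * (m - (norm x)\<^sup>2)))" by (simp add: q_def algebra_simps)
    then have qx: "r1 + \<epsilon> < q * norm x" "q * norm x < r2 - \<epsilon>" using radial[OF \<epsilon> x] by simp_all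
    then have "0 < q * norm x" using r \<epsilon> by linarith
    then have "0 < q" by (simp add: zero_less_mult_iff)
    moreover have "y = q *\<^sub>R x" by (simp add: y_def \<psi>_def q_def algebra_simps)
    ultimately have ny: "norm y = q * norm x" by simp
    show "cball (x + \<epsilon> *\<^sub>R \<psi> x) \<epsilon> \<subseteq> spherical_shell r1 r2"
    proof
      fix z assume "z \<in> cball (x + \<epsilon> *\<^sub>R \<psi> x) \<epsilon>"
      then have "norm (y - z) \<le> \<epsilon>" by (simp add: y_def[symmetric] dist_norm)
      then have "\<bar>norm y - norm z\<bar> \<le> \<epsilon>" using norm_triangle_ineq3[of y z] by linarith
      then show "z \<in> spherical_shell r1 r2" using qx ny by (simp add: spherical_shell_def abs_le_iff)
    qed
  qed (rule \<epsilon>0)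
qed

section \<open>Eigenvalue bounds and the comparison\<close>

lemma L2_norm_sq_pos:
  assumes "square_integrable M u" "\<not> (AE x in M. u x = 0)"
  shows "0 < L2_norm_sq M u"
proof -
  have i: "integrable M (\<lambda>x. (norm (u x))\<^sup>2)" using assms by (simp add: square_integrable_def)
  have "L2_norm_sq M u \<noteq> 0"
    unfolding L2_norm_sq_def
    using integral_nonneg_eq_0_iff_AE[OF i] assms(2) by simp
  moreover have "0 \<le> L2_norm_sq M u" unfolding L2_norm_sq_def by (simp add: Bochner_Integration.integral_nonneg)
  ultimately show ?thesis by simp
qed

text \<open>Every function in \<open>W\<^sup>1\<^sup>,\<^sup>2\<close> of the shell has a trace, so the arbitrary choice of
  \<^const>\<open>sobolev_trace\<close> is a trace and the inequality for smooth functions passes to the limit.\<close>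

lemma robin_eigenvalue_shell_ge:
  fixes b r1 r2 :: real
  assumes d: "DIM('a::euclidean_space) \<ge> 2" and r: "0 < r1" "r1 < r2" and b: "0 \<le> b"
  defines "C \<equiv> (12 / (r2 - r1) + (real DIM('a) - 1) * (2 * (r2 - r1) / (r1 * r2)))\<^sup>2 / 48"
  shows "ereal (- (b\<^sup>2 + (real DIM('a) - 1) * b / r2 + C)) \<le>
    robin_eigenvalue (- (b / sphere_factor TYPE('a))) (spherical_shell r1 r2 :: 'a set)"
proof -
  let ?S = "spherical_shell r1 r2 :: 'a set" and ?\<kappa> = "sphere_factor TYPE('a)"
  define \<mu> where "\<mu> b = b\<^sup>2 + (real DIM('a) - 1) * b / r2 + C" for b
  have \<kappa>: "0 < ?\<kappa>" by (rule sphere_factor(1)[OF d])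
  note \<Omega> = open_spherical_shell[of r1 r2, where 'a='a] bounded_spherical_shell[of r1 r2, where 'a='a]
  have bd: "square_integrable (boundary_measure ?S) v" if "smooth_on UNIV v" for v
    by (rule boundary_L2_shell(1)[OF d r smooth_on_continuous[OF that]])
  have low: "b / ?\<kappa> * L2_norm_sq (boundary_measure ?S) v \<le>
      L2_norm_sq (lebesgue_on ?S) (gradient v) + \<mu> b * L2_norm_sq (lebesgue_on ?S) v"
    if "0 \<le> b" "smooth_on UNIV v" for b v
    using shell_lower_bound[OF d r that] \<kappa>
    unfolding boundary_L2_shell(2)[OF d r smooth_on_continuous[OF that(2)]] \<mu>_def C_def by simp
  have E: "\<exists>g. has_trace ?S u g" if u: "u \<in> W12 ?S" for u
  proof -
    obtain \<psi> :: "'a \<Rightarrow> 'a" and \<epsilon>0 where \<psi>: "\<And>b. b \<in> Basis \<Longrightarrow> smooth_on UNIV (\<lambda>x. \<psi> x \<bullet> b)" "0 < \<epsilon>0"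
      "\<And>\<epsilon> x. 0 < \<epsilon> \<Longrightarrow> \<epsilon> < \<epsilon>0 \<Longrightarrow> x \<in> ?S \<Longrightarrow> cball (x + \<epsilon> *\<^sub>R \<psi> x) \<epsilon> \<subseteq> ?S"
      using shell_inward_field[OF r] by blast
    have \<mu>1: "0 \<le> \<mu> 1" using r d by (simp add: \<mu>_def C_def)
    \<comment> \<open>The trace inequality is the lower bound for \<open>b = 1\<close>.\<close>
    have ineq: "L2_norm_sq (boundary_measure ?S) v \<le>
        (?\<kappa> * (1 + \<mu> 1)) * (L2_norm_sq (lebesgue_on ?S) v + L2_norm_sq (lebesgue_on ?S) (gradient v))"
      if v: "smooth_on UNIV v" for v
    proof -
      let ?a = "L2_norm_sq (lebesgue_on ?S) v" and ?g = "L2_norm_sq (lebesgue_on ?S) (gradient v)"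
      have nn: "0 \<le> ?a" "0 \<le> ?g" by (simp_all add: L2_norm_sq_def Bochner_Integration.integral_nonneg)
      have "L2_norm_sq (boundary_measure ?S) v = ?\<kappa> * (1 / ?\<kappa> * L2_norm_sq (boundary_measure ?S) v)" using \<kappa> by simp
      also have "\<dots> \<le> ?\<kappa> * (?g + \<mu> 1 * ?a)" using low[of 1 v] v \<kappa> by (intro mult_left_mono) auto
      also have "\<dots> \<le> ?\<kappa> * ((1 + \<mu> 1) * (?a + ?g))"
        using nn \<mu>1 \<kappa> by (intro mult_left_mono) (auto simp: algebra_simps)
      finally show ?thesis by (simp add: mult.assoc)
    qed
    have "0 \<le> ?\<kappa> * (1 + \<mu> 1)" using \<kappa> \<mu>1 by (intro mult_nonneg_nonneg) auto
    from has_trace_exists[OF \<Omega> \<psi> bd this ineq u] show ?thesis by simp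
  qed
  have tr: "has_trace ?S u (sobolev_trace ?S u)" if "u \<in> W12 ?S" for u
    unfolding sobolev_trace_def by (rule someI_ex[OF E[OF that]])
  have "ereal (- \<mu> b) \<le> robin_eigenvalue (- (b / ?\<kappa>)) ?S"
    unfolding robin_eigenvalue_def
  proof (rule INF_greatest)
    fix u assume "u \<in> {u \<in> W12 ?S. \<not> (AE x in lebesgue_on ?S. u x = 0)}"
    then have u: "u \<in> W12 ?S" and nz: "\<not> (AE x in lebesgue_on ?S. u x = 0)" by auto
    have pos: "0 < L2_norm_sq (lebesgue_on ?S) u" by (rule L2_norm_sq_pos[OF W12_weak_gradient(1)[OF u] nz])
    have "b / ?\<kappa> * L2_norm_sq (boundary_measure ?S) (sobolev_trace ?S u) \<le>
        L2_norm_sq (lebesgue_on ?S) (weak_gradient ?S u) + \<mu> b * L2_norm_sq (lebesgue_on ?S) u"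
      by (rule trace_inequality_limit[OF \<Omega> u tr[OF u] bd low[OF b]])
    then have "- \<mu> b * L2_norm_sq (lebesgue_on ?S) u \<le> L2_norm_sq (lebesgue_on ?S) (weak_gradient ?S u)
        + - (b / ?\<kappa>) * L2_norm_sq (boundary_measure ?S) (sobolev_trace ?S u)" by linarith
    then show "ereal (- \<mu> b) \<le> ereal ((L2_norm_sq (lebesgue_on ?S) (weak_gradient ?S u)
        + - (b / ?\<kappa>) * L2_norm_sq (boundary_measure ?S) (sobolev_trace ?S u)) / L2_norm_sq (lebesgue_on ?S) u)"
      unfolding ereal_less_eq by (simp only: pos_le_divide_eq[OF pos])
  qed
  then show ?thesis unfolding \<mu>_def .
qed

text \<open>The trace inequality on the ball ensures that the chosen trace of the test function has the norm of
  its restriction to the sphere.\<close>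

lemma robin_eigenvalue_ball_le:
  fixes c :: "'a::euclidean_space"
  assumes d: "DIM('a) \<ge> 2" and R: "0 < R" and b: "1 \<le> b"
  shows "robin_eigenvalue (- (b / sphere_factor TYPE('a))) (ball c R) \<le>
    ereal (- (b\<^sup>2 + (real DIM('a) - 1 - 1 / b) * b / sqrt (R\<^sup>2 + (1 / b\<^sup>2)\<^sup>2)))"
proof -
  let ?B = "ball c R" and ?\<kappa> = "sphere_factor TYPE('a)"
  define m where "m = b\<^sup>2 + (real DIM('a) - 1 - 1 / b) * b / sqrt (R\<^sup>2 + (1 / b\<^sup>2)\<^sup>2)"
  have \<kappa>: "0 < ?\<kappa>" by (rule sphere_factor(1)[OF d])
  obtain u :: "'a \<Rightarrow> real" where u: "smooth_on UNIV u" and u0: "\<And>x. 0 < u x"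
    and le: "L2_norm_sq (lebesgue_on ?B) (gradient u) - b * sphere_integral (\<lambda>x. (u x)\<^sup>2) c R \<le>
      - m * L2_norm_sq (lebesgue_on ?B) u"
    using ball_test_function[OF d R b, of c] unfolding m_def by blast
  note \<Omega> = open_ball[of c R] bounded_ball[of c R]
  have bd: "square_integrable (boundary_measure ?B) v" if "smooth_on UNIV v" for v
    by (rule boundary_L2_ball(1)[OF d R smooth_on_continuous[OF that]])
  have ineq: "L2_norm_sq (boundary_measure ?B) v \<le>
      (?\<kappa> * (real DIM('a) / R + 1)) * (L2_norm_sq (lebesgue_on ?B) v + L2_norm_sq (lebesgue_on ?B) (gradient v))"
    if "smooth_on UNIV v" for v
    using mult_left_mono[OF ball_trace_inequality[OF R that, of c], of ?\<kappa>] \<kappa>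
    unfolding boundary_L2_ball(2)[OF d R smooth_on_continuous[OF that]] by (simp add: mult.assoc)
  have "has_trace ?B u u" by (rule has_trace_smooth[OF \<Omega> u bd[OF u]])
  then have "has_trace ?B u (sobolev_trace ?B u)" unfolding sobolev_trace_def by (rule someI[where P="has_trace ?B u"])
  then have bu: "L2_norm_sq (boundary_measure ?B) (sobolev_trace ?B u) = ?\<kappa> * sphere_integral (\<lambda>x. (u x)\<^sup>2) c R"
    using L2_norm_sq_trace_smooth[OF \<Omega> u _ bd ineq] boundary_L2_ball(2)[OF d R smooth_on_continuous[OF u]] by simp
  have gu: "L2_norm_sq (lebesgue_on ?B) (weak_gradient ?B u) = L2_norm_sq (lebesgue_on ?B) (gradient u)"
    by (rule L2_norm_sq_weak_gradient[OF \<Omega> smooth_W12(2,3)[OF \<Omega> u]])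
  have nz: "\<not> (AE x in lebesgue_on ?B. u x = 0)"
  proof
    assume "AE x in lebesgue_on ?B. u x = 0"
    then have "AE x in lebesgue. x \<in> ?B \<longrightarrow> u x = 0" by (simp add: AE_restrict_space_iff)
    then have "AE x in lebesgue. x \<notin> ?B" by eventually_elim (use u0 in \<open>auto simp: less_le\<close>)
    then have "?B \<in> null_sets lebesgue" by (subst AE_iff_null_sets) auto
    then have "negligible ?B" by (simp add: negligible_iff_null_sets)
    then show False using open_not_negligible[OF \<Omega>(1)] R by simp
  qed
  have uW: "u \<in> W12 ?B" by (rule smooth_W12(4)[OF \<Omega> u])
  have pos: "0 < L2_norm_sq (lebesgue_on ?B) u" by (rule L2_norm_sq_pos[OF W12_weak_gradient(1)[OF uW] nz])
  have "robin_eigenvalue (- (b / ?\<kappa>)) ?B \<le> ereal (- m)"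
    unfolding robin_eigenvalue_def
  proof (rule INF_lower2)
    show "u \<in> {u \<in> W12 ?B. \<not> (AE x in lebesgue_on ?B. u x = 0)}" using uW nz by simp
    have "L2_norm_sq (lebesgue_on ?B) (gradient u) + - (b / ?\<kappa>) * (?\<kappa> * sphere_integral (\<lambda>x. (u x)\<^sup>2) c R)
        \<le> - m * L2_norm_sq (lebesgue_on ?B) u" using le \<kappa> by simp
    then show "ereal ((L2_norm_sq (lebesgue_on ?B) (weak_gradient ?B u) +
        - (b / ?\<kappa>) * L2_norm_sq (boundary_measure ?B) (sobolev_trace ?B u)) / L2_norm_sq (lebesgue_on ?B) u) \<le> ereal (- m)"
      unfolding gu bu ereal_less_eq by (simp only: pos_divide_le_eq[OF pos])
  qed
  then show ?thesis unfolding m_def .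
qed

text \<open>Divided by \<open>b\<close>, the difference of the two bounds tends to \<open>(d - 1) (1 / R - 1 / r2) > 0\<close>.\<close>

lemma bounds_separate:
  fixes d R r2 C :: real
  assumes "1 < d" "0 < R" "R < r2"
  shows "\<exists>b0\<ge>1. \<forall>b>b0. b\<^sup>2 + (d - 1) * b / r2 + C < b\<^sup>2 + (d - 1 - 1 / b) * b / sqrt (R\<^sup>2 + (1 / b\<^sup>2)\<^sup>2)"
proof -
  define g where "g b = (d - 1 - 1 / b) / sqrt (R\<^sup>2 + (1 / b\<^sup>2)\<^sup>2) - (d - 1) / r2" for b
  have i: "((\<lambda>b::real. 1 / b) \<longlongrightarrow> 0) at_top"
    by (rule tendsto_divide_0[OF tendsto_const filterlim_at_top_imp_at_infinity[OF filterlim_ident]])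
  have "((\<lambda>b. (d - 1 - 1 / b) / sqrt (R\<^sup>2 + ((1 / b)\<^sup>2)\<^sup>2) - (d - 1) / r2) \<longlongrightarrow>
      (d - 1 - 0) / sqrt (R\<^sup>2 + (0\<^sup>2)\<^sup>2) - (d - 1) / r2) at_top"
    by (intro tendsto_intros i) (use assms in auto)
  then have "(g \<longlongrightarrow> (d - 1) / R - (d - 1) / r2) at_top"
    using assms by (simp add: g_def[abs_def] power_one_over)
  moreover have "0 < (d - 1) / R - (d - 1) / r2"
    using assms by (simp add: divide_strict_left_mono)
  ultimately have "filterlim (\<lambda>b. g b * b) at_top at_top"
    by (rule filterlim_tendsto_pos_mult_at_top[OF _ _ filterlim_ident])
  then have "\<forall>\<^sub>F b in at_top. C < g b * b" by (simp add: filterlim_at_top_dense)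
  then obtain N where N: "\<And>b. N \<le> b \<Longrightarrow> C < g b * b" unfolding eventually_at_top_linorder by blast
  have "b\<^sup>2 + (d - 1) * b / r2 + C < b\<^sup>2 + (d - 1 - 1 / b) * b / sqrt (R\<^sup>2 + (1 / b\<^sup>2)\<^sup>2)" if "b > max 1 N" for b
    using N[of b] that by (simp add: g_def left_diff_distrib)
  then show ?thesis by (intro exI[of _ "max 1 N"]) auto
qed

text \<open>The ball of radius \<open>r2\<close> contains the shell and the omitted ball of radius \<open>r1\<close>, hence \<open>R < r2\<close>. Both
  bounds are stated for \<open>b = - \<kappa> \<alpha>\<close> with the same factor \<open>\<kappa>\<close>.\<close>

lemma robin_eigenvalue_shell_gt_ball:
  fixes c :: "'a::euclidean_space"
  assumes d: "DIM('a) \<ge> 2" and r: "0 < r1" "r1 < r2" and R: "0 < R"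
    and vol: "measure lebesgue (ball c R) = measure lebesgue (spherical_shell r1 r2 :: 'a set)"
  shows "\<exists>\<alpha>0<0. \<forall>\<alpha><\<alpha>0. robin_eigenvalue \<alpha> (spherical_shell r1 r2 :: 'a set) > robin_eigenvalue \<alpha> (ball c R)"
proof -
  let ?\<kappa> = "sphere_factor TYPE('a)"
  have \<kappa>: "0 < ?\<kappa>" by (rule sphere_factor(1)[OF d])
  have "unit_ball_vol (real DIM('a)) \<noteq> 0" using unit_ball_vol_pos[of "real DIM('a)"] by linarith
  then have "R ^ DIM('a) = r2 ^ DIM('a) - r1 ^ DIM('a)"
    using vol unfolding measure_ball[OF R] measure_spherical_shell[OF r] by (rule mult_left_cancel[THEN iffD1])
  then have "R ^ DIM('a) < r2 ^ DIM('a)" using r by simp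
  then have Rr: "R < r2" using r by (intro power_less_imp_less_base[of R "DIM('a)" r2]) auto
  have d': "1 < real DIM('a)" using d by simp
  obtain b0 where b0: "1 \<le> b0" and sep: "\<And>b. b0 < b \<Longrightarrow> b\<^sup>2 + (real DIM('a) - 1) * b / r2 +
      (12 / (r2 - r1) + (real DIM('a) - 1) * (2 * (r2 - r1) / (r1 * r2)))\<^sup>2 / 48
      < b\<^sup>2 + (real DIM('a) - 1 - 1 / b) * b / sqrt (R\<^sup>2 + (1 / b\<^sup>2)\<^sup>2)"
    using bounds_separate[OF d' R Rr] by blast
  have "robin_eigenvalue \<alpha> (ball c R) < robin_eigenvalue \<alpha> (spherical_shell r1 r2 :: 'a set)"
    if \<alpha>: "\<alpha> < - (b0 / ?\<kappa>)" for \<alpha>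
  proof -
    define b where "b = - \<alpha> * ?\<kappa>"
    have \<alpha>b: "\<alpha> = - (b / ?\<kappa>)" using \<kappa> by (simp add: b_def)
    have "b0 / ?\<kappa> < b / ?\<kappa>" using \<alpha> \<alpha>b by linarith
    then have bb: "b0 < b" using \<kappa> by (simp add: divide_less_cancel)
    then have b: "1 \<le> b" "0 \<le> b" using b0 by auto
    note robin_eigenvalue_ball_le[OF d R b(1), of c]
    also note less_ereal.simps(1)[THEN iffD2, OF neg_less_iff_less[THEN iffD2, OF sep[OF bb]]]
    also note robin_eigenvalue_shell_ge[OF d r b(2)]
    finally show ?thesis unfolding \<alpha>b .
  qed
  moreover have "- (b0 / ?\<kappa>) < 0" using b0 \<kappa> by simp
  ultimately show ?thesis by blast
qed

theorem theorem1:
  assumes "CARD('n::finite) \<ge> 2"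
  shows
    "(\<forall>r1 r2 R. \<forall>c :: real ^ 'n.
        0 < r1 \<and> r1 < r2 \<and> 0 < R \<and>
        measure lebesgue (ball c R) = measure lebesgue (spherical_shell r1 r2 :: (real ^ 'n) set) \<longrightarrow>
        (\<exists>\<alpha>0<0. \<forall>\<alpha><\<alpha>0.
           robin_eigenvalue \<alpha> (spherical_shell r1 r2 :: (real ^ 'n) set)
             > robin_eigenvalue \<alpha> (ball c R)))
     \<and>
     \<not> (\<forall>\<alpha>\<le>0. \<forall>\<Omega> :: (real ^ 'n) set. bounded_smooth_domain \<Omega> \<longrightarrow>
          (\<forall>(c :: real ^ 'n) R. 0 < R \<and> measure lebesgue (ball c R) = measure lebesgue \<Omega> \<longrightarrow>
             robin_eigenvalue \<alpha> \<Omega> \<le> robin_eigenvalue \<alpha> (ball c R)))"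
proof
  let ?d = "DIM(real ^ 'n)"
  have d: "?d \<ge> 2" using assms by simp
  show *: "\<forall>r1 r2 R. \<forall>c :: real ^ 'n.
        0 < r1 \<and> r1 < r2 \<and> 0 < R \<and>
        measure lebesgue (ball c R) = measure lebesgue (spherical_shell r1 r2 :: (real ^ 'n) set) \<longrightarrow>
        (\<exists>\<alpha>0<0. \<forall>\<alpha><\<alpha>0.
           robin_eigenvalue \<alpha> (spherical_shell r1 r2 :: (real ^ 'n) set)
             > robin_eigenvalue \<alpha> (ball c R))"
    using robin_eigenvalue_shell_gt_ball[OF d] by blast
  let ?S = "spherical_shell 1 2 :: (real ^ 'n) set"
  define R where "R = root ?d (2 ^ ?d - 1)"
  have "(1::real) < 2 ^ ?d" by (rule one_less_power) auto
  then have R: "0 < R" "R ^ ?d = 2 ^ ?d - 1" by (simp_all add: R_def)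
  have vol: "measure lebesgue (ball (0 :: real ^ 'n) R) = measure lebesgue ?S"
    unfolding measure_ball[OF R(1)] R(2) by (simp add: measure_spherical_shell)
  obtain \<alpha>0 where \<alpha>0: "\<alpha>0 < 0" "\<And>\<alpha>. \<alpha> < \<alpha>0 \<Longrightarrow> robin_eigenvalue \<alpha> (ball (0 :: real ^ 'n) R) < robin_eigenvalue \<alpha> ?S"
    using robin_eigenvalue_shell_gt_ball[OF d _ _ R(1) vol] by auto
  have "bounded_smooth_domain ?S" by (rule bounded_smooth_domain_spherical_shell[OF d]) auto
  moreover have "\<not> robin_eigenvalue (\<alpha>0 - 1) ?S \<le> robin_eigenvalue (\<alpha>0 - 1) (ball (0 :: real ^ 'n) R)"
    using \<alpha>0(2)[of "\<alpha>0 - 1"] by (simp add: not_le)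
  moreover have "\<alpha>0 - 1 \<le> 0" using \<alpha>0(1) by simp
  ultimately show "\<not> (\<forall>\<alpha>\<le>0. \<forall>\<Omega> :: (real ^ 'n) set. bounded_smooth_domain \<Omega> \<longrightarrow>
          (\<forall>(c :: real ^ 'n) R. 0 < R \<and> measure lebesgue (ball c R) = measure lebesgue \<Omega> \<longrightarrow>
             robin_eigenvalue \<alpha> \<Omega> \<le> robin_eigenvalue \<alpha> (ball c R)))"
    using vol R(1) by blast
qed

end
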